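(* The algebra $\mathcal{Y}_t$ (defined in the context as a quotient of a subalgebra of formal power series over a Heisenberg algebra) is defined by generators $\tilde Y_{i,l}^{\pm 1}$ ($i\in I$, $l\in\mathbb{Z}$), central elements $t^{\pm 1}$, and relations ($i,j\in I$, $k,l\in\mathbb{Z}$): $$\tilde Y_{i,l}\tilde Y_{j,k}=t^{\gamma(i,l,j,k)}\,\tilde Y_{j,k}\tilde Y_{i,l},$$ where $\gamma:(I\times\mathbb{Z})^2\to\mathbb{Z}$ is given by $$\gamma(i,l,j,k)=\sum_{r\in\mathbb{Z}}\pi_r(\tilde C_{j,i}(z))\bigl(-\delta_{l-k,-r_j-r}-\delta_{l-k,r-r_j}+\delta_{l-k,r_j-r}+\delta_{l-k,r_j+r}\bigr).$$ (Here, as the notation indicates, $\tilde Y_{i,l}^{-1}$ and $t^{-1}$ are the inverses of $\tilde Y_{i,l}$ and $t$.)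
   Context: Let $I=\{1,\dots,n\}$ and let $C=(C_{i,j})_{i,j\in I}$ be a Cartan matrix of finite type, with $r_i\in\mathbb{N}^*$ such that $(r_iC_{i,j})$ is symmetric; if $C$ is indecomposable the $r_i$ are the unique such choice with $\gcd(r_1,\dots,r_n)=1$. Let $q\in\mathbb{C}^*$ be not a root of unity and $z$ an indeterminate. Put $[l]_z=\frac{z^l-z^{-l}}{z-z^{-1}}$, $C(z)_{i,i}=z^{r_i}+z^{-r_i}$, $C(z)_{i,j}=[C_{i,j}]_z$ for $i\ne j$, and $B(z)_{i,j}=[r_i]_zC(z)_{i,j}$. Let $\mathfrak{U}\subset\mathbb{Q}(z)$ be the additive subgroup spanned by the $\frac{P(z)}{Q(z^{-1})}$ with $P\in\mathbb{Z}[z^{\pm1}]$, $Q\in\mathbb{Z}[z]$, all zeros of $Q$ roots of unity, $Q(0)=1$; it is a subring, $R(q^m)\in\mathbb{C}$ makes sense for $R\in\mathfrak{U}$ and $m\in\mathbb{Z}\setminus\{0\}$, and $C(z)$ has an inverse $\tilde C(z)$ with entries in $\mathfrak{U}$. Expanding $1/Q(z^{-1})$ in $\mathbb{Z}[[z^{-1}]]$ embeds $\mathfrak{U}\subset\mathbb{Z}((z^{-1}))$; $\pi_r:\mathfrak{U}\to\mathbb{Z}$ takes the coefficient of $z^r$. $\mathcal{H}$ is the $\mathbb{C}$-algebra with generators $a_i[m]$ ($i\in I$, $m\in\mathbb{Z}\setminus\{0\}$), central elements $c_r$ ($r>0$) and relations $[a_i[m],a_j[r]]=\delta_{m,-r}(q^m-q^{-m})B_{i,j}(q^m)c_{|m|}$.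 Put $y_j[m]=\sum_{i\in I}\tilde C_{i,j}(q^m)a_i[m]$. In $\mathcal{H}_h=\mathcal{H}[[h]]$ put, for $i\in I$, $l\in\mathbb{Z}$, $R\in\mathfrak{U}$: $$\tilde A_{i,l}=\exp\Bigl(\sum_{m>0}h^ma_i[m]q^{lm}\Bigr)\exp\Bigl(\sum_{m>0}h^ma_i[-m]q^{-lm}\Bigr),\quad \tilde Y_{i,l}=\exp\Bigl(\sum_{m>0}h^my_i[m]q^{lm}\Bigr)\exp\Bigl(\sum_{m>0}h^my_i[-m]q^{-lm}\Bigr),$$ $$t_R=\exp\Bigl(\sum_{m>0}h^{2m}R(q^m)c_m\Bigr).$$ $\mathcal{Y}_u$ is the $\mathbb{Z}$-subalgebra of $\mathcal{H}_h$ generated by all $\tilde Y_{i,l}^{\pm1},\tilde A_{i,l}^{\pm1},t_R$. $\mathcal{Y}_t$ is the quotient of $\mathcal{Y}_u$ by the relations $t_R=t_{R'}$ whenever $\pi_0(R)=\pi_0(R')$. The images of $\tilde Y_{i,l}^{\pm1}$ keep their names, and $t$ is the image of $t_1$ (so $t_R\mapsto t^{\pi_0(R)}$).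
   Formalization: The generator t of the presentation is matched with the inverse of the image of t_1, since with t the image of t_1 the printed sign of γ is wrong (type A_1, l-k=2); for decomposable C the r_i are taken with gcd 1 on each indecomposable component. *)

theory Defs
  imports
    "HOL-Analysis.Analysis"
    "HOL-Combinatorics.Permutations"
    "HOL-Computational_Algebra.Fraction_Field"
    "HOL-Computational_Algebra.Formal_Laurent_Series"
    "HOL-Computational_Algebra.Group_Closure"
    "HOL-Library.Poly_Mapping"
    "HOL-Library.Groups_Big_Fun"
    "HOL-Algebra.QuotRing"
    "HOL-Algebra.Generated_Rings"
begin

section \<open>Cartan matrices of finite type\<close>

definition principal_minor :: "int ^ 'n ^ 'n \<Rightarrow> 'n set \<Rightarrow> int" where
  "principal_minor C J =
     (\<Sum>p | p permutes J. sign p * (\<Prod>i\<in>J. C $ i $ p i))"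

definition finite_type_cartan :: "int ^ 'n ^ 'n \<Rightarrow> bool" where
  "finite_type_cartan C \<longleftrightarrow>
     (\<forall>i. C $ i $ i = 2) \<and>
     (\<forall>i j. i \<noteq> j \<longrightarrow> C $ i $ j \<le> 0) \<and>
     (\<forall>i j. C $ i $ j = 0 \<longleftrightarrow> C $ j $ i = 0) \<and>
     (\<forall>J. J \<noteq> {} \<longrightarrow> principal_minor C J > 0)"

definition cartan_component :: "int ^ 'n ^ 'n \<Rightarrow> 'n \<Rightarrow> 'n set" where
  "cartan_component C i = {j. (i, j) \<in> {(a, b). C $ a $ b \<noteq> 0}\<^sup>*}"

text \<open>
  For a decomposable matrix the gcd normalization is imposed on each indecomposable component.
  It cannot be dropped: on a component of type \<open>B\<^sub>2\<close> with symmetrizer \<open>(2, 4)\<close>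
  the matrix \<open>B(z)\<close> below is not symmetric, so that the defining relations of the
  Heisenberg algebra force the central elements to vanish.
\<close>

definition cartan_symmetrizer :: "int ^ 'n ^ 'n \<Rightarrow> ('n \<Rightarrow> nat) \<Rightarrow> bool" where
  "cartan_symmetrizer C r \<longleftrightarrow>
     (\<forall>i. r i > 0) \<and>
     (\<forall>i j. int (r i) * C $ i $ j = int (r j) * C $ j $ i) \<and>
     (\<forall>i. Gcd (r ` cartan_component C i) = 1)"

section \<open>Rational functions in \<open>z\<close>\<close>

type_synonym ratfun = "rat poly fract"

definition zvar :: ratfun where
  "zvar = Fract [:0, 1:] 1"

definition qint :: "'a::field \<Rightarrow> int \<Rightarrow> 'a" where
  "qint x l = (x powi l - x powi (- l)) / (x - inverse x)"

definition Cz :: "int ^ 'n ^ 'n \<Rightarrow> ('n \<Rightarrow> nat) \<Rightarrow> ratfun ^ 'n ^ 'n" where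
  "Cz C r = (\<chi> i j. if i = j then zvar powi int (r i) + zvar powi (- int (r i))
                     else qint zvar (C $ i $ j))"

definition Bz :: "int ^ 'n ^ 'n \<Rightarrow> ('n \<Rightarrow> nat) \<Rightarrow> ratfun ^ 'n ^ 'n" where
  "Bz C r = (\<chi> i j. qint zvar (int (r i)) * Cz C r $ i $ j)"

definition Cz_inv :: "int ^ 'n ^ 'n \<Rightarrow> ('n \<Rightarrow> nat) \<Rightarrow> ratfun ^ 'n ^ 'n" where
  "Cz_inv C r = matrix_inv (Cz C r)"

text \<open>
  Substitution of \<open>x\<close> for \<open>z\<close>, meaningful whenever \<open>R\<close> can be written
  with a denominator that does not vanish at \<open>x\<close>. It is used both for \<open>x = q\<^sup>m\<close>
  and for \<open>x = z\<close> in the field of Laurent series in \<open>z\<^sup>-\<^sup>1\<close>.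
\<close>

definition ratfun_at :: "ratfun \<Rightarrow> 'a::field_char_0 \<Rightarrow> 'a" where
  "ratfun_at R x = (THE v. \<exists>a b. R = Fract a b \<and> poly (map_poly of_rat b) x \<noteq> 0 \<and>
      v = poly (map_poly of_rat a) x / poly (map_poly of_rat b) x)"

text \<open>The Laurent polynomial \<open>P\<close> is written as \<open>z\<^sup>-\<^sup>k p(z)\<close>.\<close>

definition \<UU> :: "ratfun set" where
  "\<UU> = group_closure
     {inverse zvar ^ k * poly (map_poly of_int p) zvar / poly (map_poly of_int Q) (inverse zvar)
      | k p Q. poly Q 0 = 1 \<and>
          (\<forall>\<zeta>::complex. poly (map_poly of_int Q) \<zeta> = 0 \<longrightarrow> (\<exists>N>0. \<zeta> ^ N = 1))}"

text \<open>
  In \<^typ>\<open>rat fls\<close> the series variable plays the role of \<open>z\<^sup>-\<^sup>1\<close>, so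
  that \<open>z\<close> is \<^const>\<open>fls_X_inv\<close> and the coefficient of \<open>z\<^sup>r\<close> sits at index \<open>- r\<close>.
  For elements of \<open>\<UU>\<close> the coefficients are integers and the floor only changes the type.
\<close>

definition zcoeff :: "int \<Rightarrow> ratfun \<Rightarrow> int" where
  "zcoeff r R = \<lfloor>fls_nth (ratfun_at R (fls_X_inv :: rat fls)) (- r)\<rfloor>"

definition \<gamma> :: "int ^ 'n ^ 'n \<Rightarrow> ('n \<Rightarrow> nat) \<Rightarrow> 'n \<Rightarrow> int \<Rightarrow> 'n \<Rightarrow> int \<Rightarrow> int" where
  "\<gamma> C r i l j k = Sum_any (\<lambda>s. zcoeff s (Cz_inv C r $ j $ i) *
     (- of_bool (l - k = - int (r j) - s) - of_bool (l - k = s - int (r j))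
      + of_bool (l - k = int (r j) - s) + of_bool (l - k = int (r j) + s)))"

section \<open>Algebras given by generators and relations\<close>

text \<open>
  The free algebra is the monoid algebra of the free monoid of words, which is written
  additively because \<^type>\<open>poly_mapping\<close> takes its multiplication from addition of exponents.
\<close>

datatype 'g word = Word (letters: "'g list")

instantiation word :: (type) monoid_add
begin
definition zero_word :: "'a word" where "0 = Word []"
definition plus_word :: "'a word \<Rightarrow> 'a word \<Rightarrow> 'a word" where
  "u + v = Word (letters u @ letters v)"
instance by standard (simp_all add: zero_word_def plus_word_def)
end

definition letter :: "'g \<Rightarrow> ('g word \<Rightarrow>\<^sub>0 'c::comm_ring_1)" where
  "letter g = Poly_Mapping.single (Word [g]) 1"

definition scalar :: "'c::comm_ring_1 \<Rightarrow> ('g word \<Rightarrow>\<^sub>0 'c)" where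
  "scalar c = Poly_Mapping.single 0 c"

definition free_algebra :: "'g set \<Rightarrow> ('g word \<Rightarrow>\<^sub>0 'c::comm_ring_1) ring" where
  "free_algebra G =
     \<lparr>carrier = {f. \<forall>w\<in>Poly_Mapping.keys f. set (letters w) \<subseteq> G},
      mult = (*), one = 1, zero = 0, add = (+)\<rparr>"

definition presented_algebra ::
    "'g set \<Rightarrow> ('g word \<Rightarrow>\<^sub>0 'c::comm_ring_1) set \<Rightarrow> ('g word \<Rightarrow>\<^sub>0 'c) set ring" where
  "presented_algebra G S = free_algebra G Quot genideal (free_algebra G) S"

definition presented_class ::
    "'g set \<Rightarrow> ('g word \<Rightarrow>\<^sub>0 'c::comm_ring_1) set \<Rightarrow> ('g word \<Rightarrow>\<^sub>0 'c) \<Rightarrow> ('g word \<Rightarrow>\<^sub>0 'c) set" where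
  "presented_class G S x = genideal (free_algebra G) S +>\<^bsub>free_algebra G\<^esub> x"

section \<open>The Heisenberg algebra\<close>

datatype 'n heis_letter = LA 'n int | LC nat

definition heis_letters :: "'n heis_letter set" where
  "heis_letters = {LA i m | i m. m \<noteq> 0} \<union> {LC s | s. s > 0}"

definition heis_relations ::
    "int ^ 'n ^ 'n \<Rightarrow> ('n \<Rightarrow> nat) \<Rightarrow> complex \<Rightarrow> ('n heis_letter word \<Rightarrow>\<^sub>0 complex) set" where
  "heis_relations C r q =
     {letter (LA i m) * letter (LA j s) - letter (LA j s) * letter (LA i m)
        - scalar (of_bool (m = - s) * (q powi m - q powi (- m)) * ratfun_at (Bz C r $ i $ j) (q powi m))
          * letter (LC (nat \<bar>m\<bar>))
      | i j m s. m \<noteq> 0 \<and> s \<noteq> 0} \<union>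
     {letter (LC s) * letter g - letter g * letter (LC s) | s g. s > 0 \<and> g \<in> heis_letters}"

type_synonym 'n heis = "('n heis_letter word \<Rightarrow>\<^sub>0 complex) set"

definition Heis :: "int ^ 'n ^ 'n \<Rightarrow> ('n \<Rightarrow> nat) \<Rightarrow> complex \<Rightarrow> 'n heis ring" where
  "Heis C r q = presented_algebra heis_letters (heis_relations C r q)"

definition heis_scalar :: "int ^ 'n ^ 'n \<Rightarrow> ('n \<Rightarrow> nat) \<Rightarrow> complex \<Rightarrow> complex \<Rightarrow> 'n heis" where
  "heis_scalar C r q x = presented_class heis_letters (heis_relations C r q) (scalar x)"

definition heis_a :: "int ^ 'n ^ 'n \<Rightarrow> ('n \<Rightarrow> nat) \<Rightarrow> complex \<Rightarrow> 'n \<Rightarrow> int \<Rightarrow> 'n heis" where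
  "heis_a C r q i m = presented_class heis_letters (heis_relations C r q) (letter (LA i m))"

definition heis_c :: "int ^ 'n ^ 'n \<Rightarrow> ('n \<Rightarrow> nat) \<Rightarrow> complex \<Rightarrow> nat \<Rightarrow> 'n heis" where
  "heis_c C r q s = presented_class heis_letters (heis_relations C r q) (letter (LC s))"

definition heis_y :: "int ^ 'n ^ 'n \<Rightarrow> ('n \<Rightarrow> nat) \<Rightarrow> complex \<Rightarrow> 'n \<Rightarrow> int \<Rightarrow> 'n heis" where
  "heis_y C r q j m = (\<Oplus>\<^bsub>Heis C r q\<^esub>i\<in>UNIV.
     heis_scalar C r q (ratfun_at (Cz_inv C r $ i $ j) (q powi m)) \<otimes>\<^bsub>Heis C r q\<^esub> heis_a C r q i m)"

section \<open>Formal power series in \<open>h\<close>\<close>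

definition power_series_ring :: "('a, 'b) ring_scheme \<Rightarrow> (nat \<Rightarrow> 'a) ring" where
  "power_series_ring R =
     \<lparr>carrier = {f. \<forall>k. f k \<in> carrier R},
      mult = (\<lambda>f g k. \<Oplus>\<^bsub>R\<^esub>i\<in>{..k}. f i \<otimes>\<^bsub>R\<^esub> g (k - i)),
      one = (\<lambda>k. if k = 0 then \<one>\<^bsub>R\<^esub> else \<zero>\<^bsub>R\<^esub>),
      zero = (\<lambda>k. \<zero>\<^bsub>R\<^esub>),
      add = (\<lambda>f g k. f k \<oplus>\<^bsub>R\<^esub> g k)\<rparr>"

abbreviation Heis_h :: "int ^ 'n ^ 'n \<Rightarrow> ('n \<Rightarrow> nat) \<Rightarrow> complex \<Rightarrow> (nat \<Rightarrow> 'n heis) ring" where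
  "Heis_h C r q \<equiv> power_series_ring (Heis C r q)"

text \<open>
  The exponential of a series \<open>F\<close> without constant term: as \<open>F\<^sup>n\<close> is divisible by
  \<open>h\<^sup>n\<close>, only the terms with \<open>n \<le> k\<close> contribute to the coefficient of \<open>h\<^sup>k\<close>.
\<close>

definition heis_exp ::
    "int ^ 'n ^ 'n \<Rightarrow> ('n \<Rightarrow> nat) \<Rightarrow> complex \<Rightarrow> (nat \<Rightarrow> 'n heis) \<Rightarrow> (nat \<Rightarrow> 'n heis)" where
  "heis_exp C r q F = (\<lambda>k. \<Oplus>\<^bsub>Heis C r q\<^esub>n\<in>{..k}.
     heis_scalar C r q (1 / fact n) \<otimes>\<^bsub>Heis C r q\<^esub> (F [^]\<^bsub>Heis_h C r q\<^esub> n) k)"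

text \<open>
  \<open>exp (\<Sum>m>0. h^m q^(l m) x[m])\<close> times \<open>exp (\<Sum>m>0. h^m q^(- l m) x[- m])\<close>
\<close>

definition vertex ::
    "int ^ 'n ^ 'n \<Rightarrow> ('n \<Rightarrow> nat) \<Rightarrow> complex \<Rightarrow> (int \<Rightarrow> 'n heis) \<Rightarrow> int \<Rightarrow> (nat \<Rightarrow> 'n heis)" where
  "vertex C r q x l =
     heis_exp C r q (\<lambda>m. if m = 0 then \<zero>\<^bsub>Heis C r q\<^esub>
       else heis_scalar C r q (q powi (l * int m)) \<otimes>\<^bsub>Heis C r q\<^esub> x (int m))
     \<otimes>\<^bsub>Heis_h C r q\<^esub>
     heis_exp C r q (\<lambda>m. if m = 0 then \<zero>\<^bsub>Heis C r q\<^esub>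
       else heis_scalar C r q (q powi (- l * int m)) \<otimes>\<^bsub>Heis C r q\<^esub> x (- int m))"

definition A_tilde ::
    "int ^ 'n ^ 'n \<Rightarrow> ('n \<Rightarrow> nat) \<Rightarrow> complex \<Rightarrow> 'n \<Rightarrow> int \<Rightarrow> (nat \<Rightarrow> 'n heis)" where
  "A_tilde C r q i l = vertex C r q (heis_a C r q i) l"

definition Y_tilde ::
    "int ^ 'n ^ 'n \<Rightarrow> ('n \<Rightarrow> nat) \<Rightarrow> complex \<Rightarrow> 'n \<Rightarrow> int \<Rightarrow> (nat \<Rightarrow> 'n heis)" where
  "Y_tilde C r q i l = vertex C r q (heis_y C r q i) l"

definition t_elem ::
    "int ^ 'n ^ 'n \<Rightarrow> ('n \<Rightarrow> nat) \<Rightarrow> complex \<Rightarrow> ratfun \<Rightarrow> (nat \<Rightarrow> 'n heis)" where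
  "t_elem C r q R = heis_exp C r q (\<lambda>k. if k > 0 \<and> even k
     then heis_scalar C r q (ratfun_at R (q powi int (k div 2))) \<otimes>\<^bsub>Heis C r q\<^esub> heis_c C r q (k div 2)
     else \<zero>\<^bsub>Heis C r q\<^esub>)"

section \<open>The algebras \<open>Y\<^sub>u\<close> and \<open>Y\<^sub>t\<close>\<close>

definition Yu :: "int ^ 'n ^ 'n \<Rightarrow> ('n \<Rightarrow> nat) \<Rightarrow> complex \<Rightarrow> (nat \<Rightarrow> 'n heis) ring" where
  "Yu C r q = (Heis_h C r q) \<lparr>carrier := generate_ring (Heis_h C r q)
     ({Y_tilde C r q i l | i l. True} \<union> {inv\<^bsub>Heis_h C r q\<^esub> Y_tilde C r q i l | i l. True} \<union>
      {A_tilde C r q i l | i l. True} \<union> {inv\<^bsub>Heis_h C r q\<^esub> A_tilde C r q i l | i l. True} \<union>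
      {t_elem C r q R | R. R \<in> \<UU>})\<rparr>"

definition Yt_ideal :: "int ^ 'n ^ 'n \<Rightarrow> ('n \<Rightarrow> nat) \<Rightarrow> complex \<Rightarrow> (nat \<Rightarrow> 'n heis) set" where
  "Yt_ideal C r q = genideal (Yu C r q)
     {t_elem C r q R \<ominus>\<^bsub>Yu C r q\<^esub> t_elem C r q R' | R R'.
        R \<in> \<UU> \<and> R' \<in> \<UU> \<and> zcoeff 0 R = zcoeff 0 R'}"

definition Yt :: "int ^ 'n ^ 'n \<Rightarrow> ('n \<Rightarrow> nat) \<Rightarrow> complex \<Rightarrow> (nat \<Rightarrow> 'n heis) set ring" where
  "Yt C r q = Yu C r q Quot Yt_ideal C r q"

definition Yt_class ::
    "int ^ 'n ^ 'n \<Rightarrow> ('n \<Rightarrow> nat) \<Rightarrow> complex \<Rightarrow> (nat \<Rightarrow> 'n heis) \<Rightarrow> (nat \<Rightarrow> 'n heis) set" where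
  "Yt_class C r q x = Yt_ideal C r q +>\<^bsub>Yu C r q\<^esub> x"

section \<open>The presented algebra\<close>

datatype 'n yt_letter = LY 'n int | LYinv 'n int | LT | LTinv

definition LT_power :: "int \<Rightarrow> ('n yt_letter word \<Rightarrow>\<^sub>0 int)" where
  "LT_power k = (if k \<ge> 0 then letter LT ^ nat k else letter LTinv ^ nat (- k))"

definition yt_relations ::
    "int ^ 'n ^ 'n \<Rightarrow> ('n \<Rightarrow> nat) \<Rightarrow> ('n yt_letter word \<Rightarrow>\<^sub>0 int) set" where
  "yt_relations C r =
     {letter (LY i l) * letter (LYinv i l) - 1 | i l. True} \<union>
     {letter (LYinv i l) * letter (LY i l) - 1 | i l. True} \<union>
     {letter LT * letter LTinv - 1, letter LTinv * letter LT - 1} \<union>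
     {letter LT * letter g - letter g * letter LT | g. True} \<union>
     {letter LTinv * letter g - letter g * letter LTinv | g. True} \<union>
     {letter (LY i l) * letter (LY j k)
        - LT_power (\<gamma> C r i l j k) * letter (LY j k) * letter (LY i l) | i l j k. True}"

definition Yt_presented ::
    "int ^ 'n ^ 'n \<Rightarrow> ('n \<Rightarrow> nat) \<Rightarrow> ('n yt_letter word \<Rightarrow>\<^sub>0 int) set ring" where
  "Yt_presented C r = presented_algebra UNIV (yt_relations C r)"

definition Yt_presented_gen ::
    "int ^ 'n ^ 'n \<Rightarrow> ('n \<Rightarrow> nat) \<Rightarrow> 'n yt_letter \<Rightarrow> ('n yt_letter word \<Rightarrow>\<^sub>0 int) set" where
  "Yt_presented_gen C r g = presented_class UNIV (yt_relations C r) (letter g)"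

text \<open>
  Sign of \<open>\<gamma>\<close>: in \<open>Y\<^sub>u\<close> one has
  \<open>Y\<^sub>i\<^sub>,\<^sub>l Y\<^sub>j\<^sub>,\<^sub>k = t\<^sub>R Y\<^sub>j\<^sub>,\<^sub>k Y\<^sub>i\<^sub>,\<^sub>l\<close>, where \<open>R\<close> is the product of the entry
  \<open>(j, i)\<close> of the inverse of \<open>C(z)\<close>, of \<open>z^(r j) - z^(- r j)\<close> and of
  \<open>z^(l - k) - z^(k - l)\<close>, and the coefficient of \<open>z^0\<close> in \<open>R\<close> is \<open>- \<gamma>(i, l, j, k)\<close>.
  For type \<open>A\<^sub>1\<close> and \<open>l - k = 2\<close> this is \<open>R = (z - z^(-1))^2\<close>, with constant term \<open>-2\<close>,
  while \<open>\<gamma>\<close> has the value \<open>2\<close>. Therefore the central generator \<^const>\<open>LT\<close> of the presented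
  algebra corresponds to the class of \<open>t\<^sub>-\<^sub>1\<close>, the inverse of the class of \<open>t\<^sub>1\<close>.
\<close>

end

theory Submission
  imports Defs
begin

text \<open>
  The entries of the inverse of \<open>C(z)\<close> are found by solving a linear recurrence with integer
  coefficients. The recurrence preserves an energy form that is positive definite because \<open>C\<close> is of
  finite type; so a solution takes finitely many values, it is periodic, and the inverse has entries
  in \<open>\<UU>\<close>.

  Products of exponentials of linear elements of the Heisenberg algebra are again such exponentials up
  to a central factor, so \<open>Y\<^sub>u\<close> is the integral span of monomials labelled by an element \<open>R\<close> of
  \<open>\<UU>\<close> and a finitely supported exponent \<open>e\<close>. Letting the Heisenberg algebra act on Fock modules in
  which \<open>c\<^sub>M\<close> acts by \<open>1\<close> and \<open>a\<^sub>i[2M]\<close> by an arbitrary scalar, one finds functionals that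
  take the monomials to powers of pairwise distinct numbers, and the monomials are linearly independent.
  Hence the images of \<open>(R, e)\<close> and \<open>(R', e')\<close> in \<open>Y\<^sub>t\<close> agree exactly if \<open>e = e'\<close> and the constant
  terms of \<open>R\<close> and \<open>R'\<close> agree, and distinct images are independent. In the presented algebra a word is
  determined by the same data, its exponent and its total power of \<open>t\<close>.
\<close>

text \<open>The difficulty is faithfulness: the stated relations are easily checked in
  \<open>Yt\<close>, but a quotient of a subring of power series could satisfy further ones.
  Injectivity of \<open>Lc\<close> bounds the defining ideal from above by the image of
  \<open>JZ\<close>, and this bound separates the classes. Symmetry of B(z) rests on the gcd
  normalization, which forces the smaller of two unequal symmetrizers on an edge to be 1
  (\<open>multiple_edge\<close>). Instead of a classification of Cartan matrices, one positive
  vector \<open>pvec\<close> with positive image under \<open>C\<close> yields both the definiteness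
  of the Cartan form and the lower bound for the energy. In the Fock modules the mode 2M is chosen
  because c_M carries h^(2M): both contribute to the same coefficient, and the value is a power of a
  sum. As c_(2M) acts by 0, the a_i[2M] may act by arbitrary scalars. In the presented algebra the
  power of t produced by reordering a long word is never computed: words with equal exponent agree
  up to some word in t, whose degree is then found by mapping to \<open>Yt\<close>.\<close>

no_notation fps_nth (infixl "$" 75)

section \<open>Cartan matrices of finite type\<close>

text \<open>Padding with the identity outside \<open>J\<close> keeps the index type fixed, so that
  \<open>det\<close>, \<open>invertible\<close> and Cramer's rule apply to principal
  submatrices.\<close>

definition restr_mat :: "int ^ 'n ^ 'n \<Rightarrow> 'n set \<Rightarrow> real ^ 'n ^ 'n" where
  "restr_mat C J = (\<chi> i j. if i \<in> J \<and> j \<in> J then of_int (C $ i $ j) else of_bool (i = j))"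

lemma det_restr_mat: "det (restr_mat C J) = of_int (principal_minor C J)"
proof -
  let ?f = "\<lambda>p. of_int (sign p) * (\<Prod>i\<in>UNIV. restr_mat C J $ i $ p i) :: real"
  have "det (restr_mat C J) = sum ?f {p. p permutes UNIV}"
    by (simp add: det_def)
  also have "\<dots> = sum ?f {p. p permutes J}"
  proof (rule sum.mono_neutral_right)
    show "finite {p :: 'a \<Rightarrow> 'a. p permutes UNIV}" by (simp add: finite_permutations)
    show "{p. p permutes J} \<subseteq> {p. p permutes UNIV}" by (auto intro: permutes_subset)
    show "\<forall>p\<in>{p. p permutes UNIV} - {p. p permutes J}. ?f p = 0"
    proof
      fix p assume p: "p \<in> {p. p permutes UNIV} - {p. p permutes J}"
      then obtain i where "i \<notin> J" "p i \<noteq> i" by (auto simp: permutes_def)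
      then have "restr_mat C J $ i $ p i = 0" by (simp add: restr_mat_def)
      then show "?f p = 0" by auto
    qed
  qed
  also have "\<dots> = (\<Sum>p | p permutes J. of_int (sign p * (\<Prod>i\<in>J. C $ i $ p i)))"
  proof (rule sum.cong)
    fix p assume "p \<in> {p. p permutes J}"
    then have p: "p permutes J" by simp
    have "(\<Prod>i\<in>UNIV. restr_mat C J $ i $ p i) = (\<Prod>i\<in>J. restr_mat C J $ i $ p i)"
      using p by (intro prod.mono_neutral_right) (auto simp: restr_mat_def permutes_def)
    also have "\<dots> = (\<Prod>i\<in>J. of_int (C $ i $ p i))"
      using p by (intro prod.cong) (auto simp: restr_mat_def permutes_in_image)
    finally show "?f p = of_int (sign p * (\<Prod>i\<in>J. C $ i $ p i))" by simp
  qed simp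
  finally show ?thesis by (simp add: principal_minor_def)
qed

text \<open>
  The Schur complement \<open>s\<close> of \<open>C\<^sub>J\<close> in \<open>C\<^sub>J\<^sub>\<union>\<^sub>k\<close> is the quotient of the two principal minors.
\<close>

lemma det_restr_mat_insert:
  assumes "k \<notin> J"
    and w: "\<And>i. i \<in> J \<Longrightarrow> (\<Sum>j\<in>J. of_int (C $ i $ j) * w j) = - of_int (C $ i $ k)"
  shows "det (restr_mat C (insert k J)) = 
    ((\<Sum>j\<in>J. of_int (C $ k $ j) * w j) + of_int (C $ k $ k)) * det (restr_mat C J)"
proof -
  define s where "s = (\<Sum>j\<in>J. of_int (C $ k $ j) * w j) + of_int (C $ k $ k)"
  let ?M = "restr_mat C (insert k J)"
  define x :: "real ^ 'a" where "x = (\<chi> j. if j \<in> J then w j else of_bool (j = k))"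
  have Mx: "(?M *v x) $ i = of_bool (i = k) * s" for i
  proof (cases "i \<in> insert k J")
    case True
    have "(?M *v x) $ i = (\<Sum>j\<in>insert k J. ?M $ i $ j * x $ j)"
      unfolding matrix_vector_mult_def by (auto simp: x_def intro!: sum.mono_neutral_right)
    also have "\<dots> = of_int (C $ i $ k) + (\<Sum>j\<in>J. of_int (C $ i $ j) * w j)"
      using assms(1) True by (subst sum.insert) (auto simp: x_def restr_mat_def intro!: sum.cong)
    finally show ?thesis using True w[of i] assms(1) by (auto simp: s_def)
  next
    case False
    then have "(?M *v x) $ i = (\<Sum>j\<in>UNIV. of_bool (i = j) * x $ j)"
      unfolding matrix_vector_mult_def by (simp add: restr_mat_def)
    also have "\<dots> = x $ i" by simp
    finally show ?thesis using False by (simp add: x_def)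
  qed
  \<comment> \<open>By Cramer's rule the determinant, times the coordinate \<open>x $ k = 1\<close>,
    is that of the matrix with column \<open>k\<close> replaced by s e_k; only permutations fixing
    \<open>k\<close> survive in its expansion.\<close>
  have "det ?M = x $ k * det ?M" using assms(1) by (simp add: x_def)
  also have "\<dots> = det (\<chi> i j. if j = k then (?M *v x) $ i else ?M $ i $ j)"
    by (simp add: cramer_lemma)
  also have "\<dots> = s * det (restr_mat C J)"
    unfolding det_def sum_distrib_left
  proof (rule sum.cong)
    fix p :: "'a \<Rightarrow> 'a" assume "p \<in> {p. p permutes UNIV}"
    then have p: "p permutes UNIV" by simp
    let ?N = "(\<chi> i j. if j = k then (?M *v x) $ i else ?M $ i $ j) :: real ^ 'a ^ 'a"
    have "(\<Prod>i\<in>UNIV. ?N $ i $ p i) = s * (\<Prod>i\<in>UNIV. restr_mat C J $ i $ p i)"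
    proof (cases "p k = k")
      case True
      have "?N $ i $ p i = restr_mat C J $ i $ p i" if "i \<noteq> k" for i
      proof -
        have "p i \<noteq> k" using p True that by (metis permutes_inj injD)
        then show ?thesis using that by (auto simp: restr_mat_def)
      qed
      then have "(\<Prod>i\<in>UNIV - {k}. ?N $ i $ p i) = (\<Prod>i\<in>UNIV - {k}. restr_mat C J $ i $ p i)"
        by (intro prod.cong) auto
      moreover have "?N $ k $ p k = s" 
        using True by (simp add: Mx)
      moreover have "restr_mat C J $ k $ p k = 1"
        using True assms(1) by (simp add: restr_mat_def)
      ultimately show ?thesis
        by (simp add: prod.remove[of UNIV k])
    next
      case False
      obtain i where i: "p i = k" using p by (metis permutes_surj surjD)
      then have "i \<noteq> k" using False by auto
      then have "?N $ i $ p i = 0" using i by (simp add: Mx)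
      then have "(\<Prod>i\<in>UNIV. ?N $ i $ p i) = 0" by (meson UNIV_I finite prod_zero)
      moreover have "restr_mat C J $ k $ p k = 0" using False assms(1) by (simp add: restr_mat_def)
      then have "(\<Prod>i\<in>UNIV. restr_mat C J $ i $ p i) = 0" by (meson UNIV_I finite prod_zero)
      ultimately show ?thesis by (simp only: mult_zero_right)
    qed
    then show "of_int (sign p) * (\<Prod>i\<in>UNIV. ?N $ i $ p i) 
      = s * (of_int (sign p) * (\<Prod>i\<in>UNIV. restr_mat C J $ i $ p i))" by simp
  qed simp
  finally show ?thesis by (simp add: s_def)
qed

lemma principal_minor_empty: "principal_minor C {} = 1"
  by (simp add: principal_minor_def permutes_empty)

text \<open>A weak minimum principle: compare \<open>w\<close> with the multiple of \<open>p\<close> touching it from below.\<close>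

lemma Z_matrix_nonneg:
  fixes C :: "int ^ 'n ^ 'n" and p w :: "'n \<Rightarrow> real"
  assumes Z: "\<And>i j. i \<noteq> j \<Longrightarrow> C $ i $ j \<le> 0"
    and p: "\<And>i. i \<in> J \<Longrightarrow> p i > 0" "\<And>i. i \<in> J \<Longrightarrow> (\<Sum>j\<in>J. of_int (C $ i $ j) * p j) > 0"
    and w: "\<And>i. i \<in> J \<Longrightarrow> (\<Sum>j\<in>J. of_int (C $ i $ j) * w j) \<ge> 0"
    and "k \<in> J"
  shows "w k \<ge> 0"
proof -
  define t where "t = Min ((\<lambda>i. w i / p i) ` J)"
  have t: "t \<le> w i / p i" if "i \<in> J" for i
    unfolding t_def using that by (intro Min_le) auto
  have "t \<in> (\<lambda>i. w i / p i) ` J"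
    unfolding t_def using assms(5) by (intro Min_in) auto
  then obtain i where i: "i \<in> J" "t = w i / p i" by auto
  have "t \<ge> 0"
  proof (rule ccontr)
    assume "\<not> t \<ge> 0"
    have le: "t * p j \<le> w j" if "j \<in> J" for j
      using t[OF that] p(1)[OF that] by (simp add: field_simps)
    have eq: "t * p i = w i" using i p(1)[OF i(1)] by simp
    have "(\<Sum>j\<in>J. of_int (C $ i $ j) * w j) \<le> (\<Sum>j\<in>J. of_int (C $ i $ j) * (t * p j))"
    proof (rule sum_mono)
      fix j assume "j \<in> J"
      then show "of_int (C $ i $ j) * w j \<le> of_int (C $ i $ j) * (t * p j)"
        using le[of j] eq Z[of i j] by (cases "i = j") (auto intro!: mult_left_mono_neg)
    qed
    also have "\<dots> = t * (\<Sum>j\<in>J. of_int (C $ i $ j) * p j)"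
      by (simp add: sum_distrib_left mult_ac)
    also have "\<dots> < 0" using \<open>\<not> t \<ge> 0\<close> p(2)[OF i(1)] by (simp add: mult_neg_pos)
    finally show False using w[OF i(1)] by simp
  qed
  then have "0 \<le> w k / p k" using t[OF assms(5)] by linarith
  then show ?thesis using p(1)[OF assms(5)] by (simp add: zero_le_divide_iff)
qed

text \<open>Induction on \<open>J\<close>: the solution \<open>w\<close> of C_J w = - C_(J,k),
  extended by 1 at \<open>k\<close>, is nonnegative and has image 0 on \<open>J\<close> and the
  Schur complement \<open>s > 0\<close> at \<open>k\<close>. Adding a small multiple of the old
  vector makes all entries and images strictly positive.\<close>

lemma finite_type_positive_on:
  fixes C :: "int ^ 'n ^ 'n"
  assumes "finite_type_cartan C"
  shows "\<exists>p :: 'n \<Rightarrow> real. \<forall>i\<in>J. p i > 0 \<and> (\<Sum>j\<in>J. of_int (C $ i $ j) * p j) > 0"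
proof -
  have "finite J" by simp
  then show ?thesis
  proof (induction J)
    case (insert k J)
    have Z: "C $ i $ j \<le> 0" if "i \<noteq> j" for i j
      using assms that by (auto simp: finite_type_cartan_def)
    have det_pos: "det (restr_mat C J) > 0" for J
      using assms by (cases "J = {}") (auto simp: finite_type_cartan_def det_restr_mat principal_minor_empty)
    obtain p where p: "\<And>i. i \<in> J \<Longrightarrow> p i > 0" 
        "\<And>i. i \<in> J \<Longrightarrow> (\<Sum>j\<in>J. of_int (C $ i $ j) * p j) > (0::real)"
      using insert.IH by blast
    define b :: "real ^ 'n" where "b = (\<chi> i. if i \<in> J then - of_int (C $ i $ k) else 0)"
    have "invertible (restr_mat C J)"
      using det_pos[of J] by (simp add: invertible_det_nz)
    then obtain M where "restr_mat C J ** M = mat 1" by (auto simp: invertible_def)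
    then have "restr_mat C J *v (M *v b) = b"
      by (simp add: matrix_vector_mul_assoc)
    then obtain v where v: "restr_mat C J *v v = b" by blast
    define w where "w = (\<lambda>j. v $ j)"
    have w: "(\<Sum>j\<in>J. of_int (C $ i $ j) * w j) = - of_int (C $ i $ k)" if "i \<in> J" for i
    proof -
      have "b $ i = (\<Sum>j\<in>UNIV. restr_mat C J $ i $ j * w j)"
        by (simp only: v[symmetric] matrix_vector_mult_def w_def vec_lambda_beta)
      also have "\<dots> = (\<Sum>j\<in>J. restr_mat C J $ i $ j * w j)"
        by (rule sum.mono_neutral_right) (use that in \<open>auto simp: restr_mat_def\<close>)
      also have "\<dots> = (\<Sum>j\<in>J. of_int (C $ i $ j) * w j)"
        using that by (intro sum.cong) (auto simp: restr_mat_def)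
      finally show ?thesis using that by (simp add: b_def)
    qed
    have w0: "w j \<ge> 0" if "j \<in> J" for j
    proof (rule Z_matrix_nonneg[OF Z p _ that])
      fix i assume "i \<in> J"
      then have "i \<noteq> k" using insert.hyps by auto
      then show "(\<Sum>j\<in>J. of_int (C $ i $ j) * w j) \<ge> 0" using Z[of i k] w[OF \<open>i \<in> J\<close>] by simp
    qed
    define s where "s = (\<Sum>j\<in>J. of_int (C $ k $ j) * w j) + of_int (C $ k $ k)"
    have "det (restr_mat C (insert k J)) = s * det (restr_mat C J)"
      unfolding s_def by (rule det_restr_mat_insert) (use insert.hyps w in auto)
    then have s: "s > 0" using det_pos[of "insert k J"] det_pos[of J]
      by (metis zero_less_mult_pos2)
    define T where "T = (\<Sum>j\<in>J. of_int (C $ k $ j) * p j)"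
    have T: "T \<le> 0" unfolding T_def
    proof (rule sum_nonpos)
      fix j assume j: "j \<in> J"
      then have "k \<noteq> j" using insert.hyps by auto
      then show "of_int (C $ k $ j) * p j \<le> 0"
        using Z[of k j] p(1)[OF j] by (simp add: mult_nonpos_nonneg less_imp_le)
    qed
    \<comment> \<open>\<open>T\<close> is the nonpositive effect of the old vector at
      \<open>k\<close>; with this choice \<open>s + e * T\<close> equals
      \<open>s / (1 - T)\<close>.\<close>
    define e where "e = s / (1 - T)"
    have e: "e > 0" "s + e * T > 0"
      using s T by (auto simp: e_def field_simps)
    define p' where "p' = (\<lambda>j. if j = k then 1 else w j + e * p j)"
    have sum: "(\<Sum>j\<in>insert k J. of_int (C $ i $ j) * p' j) = of_int (C $ i $ k) + 
      (\<Sum>j\<in>J. of_int (C $ i $ j) * w j) + e * (\<Sum>j\<in>J. of_int (C $ i $ j) * p j)" for i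
    proof -
      have "(\<Sum>j\<in>insert k J. of_int (C $ i $ j) * p' j) = of_int (C $ i $ k) + (\<Sum>j\<in>J. of_int (C $ i $ j) * (w j + e * p j))"
        using insert.hyps by (subst sum.insert) (auto simp: p'_def intro!: sum.cong)
      then show ?thesis by (simp add: algebra_simps sum.distrib sum_distrib_left)
    qed
    have "p' i > 0 \<and> (\<Sum>j\<in>insert k J. of_int (C $ i $ j) * p' j) > 0" if "i \<in> insert k J" for i
    proof (cases "i = k")
      case True
      then show ?thesis unfolding sum using e by (simp add: p'_def s_def T_def algebra_simps)
    next
      case False
      then have i: "i \<in> J" using that by auto
      then show ?thesis unfolding sum using False e p[OF i] w0[OF i] w[OF i]
        by (simp add: p'_def add_nonneg_pos)
    qed
    then show ?case by blast
  qed simp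
qed

locale cartan_data =
  fixes C :: "int ^ 'n ^ 'n" and r :: "'n \<Rightarrow> nat"
  assumes finite_type: "finite_type_cartan C" and symmetrizer: "cartan_symmetrizer C r"
begin

lemma diag: "C $ i $ i = 2" and off_diag: "i \<noteq> j \<Longrightarrow> C $ i $ j \<le> 0"
  and zero_iff: "C $ i $ j = 0 \<longleftrightarrow> C $ j $ i = 0"
  using finite_type by (auto simp: finite_type_cartan_def)

lemma r_pos: "r i > 0" and r_sym: "int (r i) * C $ i $ j = int (r j) * C $ j $ i"
  and r_gcd: "Gcd (r ` cartan_component C i) = 1"
  using symmetrizer by (auto simp: cartan_symmetrizer_def)

text \<open>Supplies the weights in all later comparisons of a quadratic form with a diagonal
  one.\<close>

definition "pvec = (SOME p :: 'n \<Rightarrow> real. \<forall>i. p i > 0 \<and> (\<Sum>j\<in>UNIV. of_int (C $ i $ j) * p j) > 0)"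

lemma pvec: "pvec i > 0" "(\<Sum>j\<in>UNIV. of_int (C $ i $ j) * pvec j) > 0"
proof -
  have "\<exists>p :: 'n \<Rightarrow> real. \<forall>i. p i > 0 \<and> (\<Sum>j\<in>UNIV. of_int (C $ i $ j) * p j) > 0"
    using finite_type_positive_on[OF finite_type, of UNIV] by simp
  from someI_ex[OF this] show "pvec i > 0" "(\<Sum>j\<in>UNIV. of_int (C $ i $ j) * pvec j) > 0"
    by (auto simp: pvec_def)
qed

text \<open>With weights taken from \<open>pvec\<close>, bounding every cross term leaves diagonal
  coefficients proportional to (C pvec)_i / pvec_i, which are positive.\<close>

lemma weighted_am_gm: "x * y \<le> (x\<^sup>2 * (pvec j / pvec i) + y\<^sup>2 * (pvec i / pvec j)) / 2"
proof -
  have "0 \<le> (x * pvec j - y * pvec i)\<^sup>2 / (pvec i * pvec j)"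
    using pvec(1)[of i] pvec(1)[of j] by simp
  also have "\<dots> = x\<^sup>2 * (pvec j / pvec i) + y\<^sup>2 * (pvec i / pvec j) - 2 * (x * y)"
    using pvec(1)[of i] pvec(1)[of j] by (simp add: power2_eq_square field_simps)
  finally show ?thesis by simp
qed

section \<open>The symmetrized Cartan form\<close>

definition Bform :: "('n \<Rightarrow> real) \<Rightarrow> ('n \<Rightarrow> real) \<Rightarrow> real" where
  "Bform x y = (\<Sum>i\<in>UNIV. \<Sum>j\<in>UNIV. of_int (int (r i) * C $ i $ j) * x i * y j)"

lemma Bform_commute: "Bform x y = Bform y x"
proof -
  have "Bform x y = (\<Sum>j\<in>UNIV. \<Sum>i\<in>UNIV. of_int (int (r i) * C $ i $ j) * x i * y j)"
    unfolding Bform_def by (rule sum.swap)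
  also have "\<dots> = Bform y x"
    unfolding Bform_def by (intro sum.cong refl) (subst r_sym, simp add: mult_ac)
  finally show ?thesis .
qed

lemma Bform_add_left: "Bform (\<lambda>i. x i + x' i) y = Bform x y + Bform x' y"
  by (simp add: Bform_def algebra_simps sum.distrib)

lemma Bform_add_right: "Bform x (\<lambda>i. y i + y' i) = Bform x y + Bform x y'"
  by (simp add: Bform_def algebra_simps sum.distrib)

text \<open>Off-diagonal coefficients are nonpositive, so \<open>weighted_am_gm\<close> bounds the
  form below by the sum of x_i^2 r_i (C pvec)_i / pvec_i.\<close>

lemma Bform_pos:
  assumes "x k \<noteq> 0"
  shows "Bform x x > 0"
proof -
  let ?b = "\<lambda>i j. of_int (int (r i) * C $ i $ j) :: real"
  have "0 < (\<Sum>i\<in>UNIV. (x i)\<^sup>2 / pvec i * (real (r i) * (\<Sum>j\<in>UNIV. of_int (C $ i $ j) * pvec j)))"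
  proof (rule sum_pos2[of _ k])
    have pos: "real (r i) * (\<Sum>j\<in>UNIV. of_int (C $ i $ j) * pvec j) > 0" for i
      using pvec(2)[of i] r_pos[of i] by (intro mult_pos_pos) auto
    show "0 < (x k)\<^sup>2 / pvec k * (real (r k) * (\<Sum>j\<in>UNIV. of_int (C $ k $ j) * pvec j))"
      using assms pvec(1)[of k] by (intro mult_pos_pos[OF _ pos]) simp
    show "0 \<le> (x i)\<^sup>2 / pvec i * (real (r i) * (\<Sum>j\<in>UNIV. of_int (C $ i $ j) * pvec j))" for i
      using pvec(1)[of i] by (intro mult_nonneg_nonneg[OF _ less_imp_le[OF pos]]) simp
  qed auto
  also have "\<dots> = (\<Sum>i\<in>UNIV. \<Sum>j\<in>UNIV. ?b i j * ((x i)\<^sup>2 * (pvec j / pvec i)))"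
    by (simp add: sum_distrib_left mult_ac)
  \<comment> \<open>Symmetrizing the sum in \<open>i\<close> and \<open>j\<close> produces the
    right-hand side of \<open>weighted_am_gm\<close>.\<close>
  also have "\<dots> = (\<Sum>i\<in>UNIV. \<Sum>j\<in>UNIV. ?b i j * ((x i)\<^sup>2 * (pvec j / pvec i))) / 2 + 
    (\<Sum>i\<in>UNIV. \<Sum>j\<in>UNIV. ?b i j * ((x j)\<^sup>2 * (pvec i / pvec j))) / 2"
  proof -
    have "(\<Sum>i\<in>UNIV. \<Sum>j\<in>UNIV. ?b i j * ((x j)\<^sup>2 * (pvec i / pvec j))) = 
      (\<Sum>j\<in>UNIV. \<Sum>i\<in>UNIV. ?b i j * ((x j)\<^sup>2 * (pvec i / pvec j)))" by (rule sum.swap)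
    also have "\<dots> = (\<Sum>i\<in>UNIV. \<Sum>j\<in>UNIV. ?b i j * ((x i)\<^sup>2 * (pvec j / pvec i)))"
      by (intro sum.cong refl) (subst r_sym, simp)
    finally show ?thesis by simp
  qed
  also have "\<dots> = (\<Sum>i\<in>UNIV. \<Sum>j\<in>UNIV. ?b i j * (((x i)\<^sup>2 * (pvec j / pvec i) + (x j)\<^sup>2 * (pvec i / pvec j)) / 2))"
    by (simp add: sum.distrib[symmetric] sum_divide_distrib add_divide_distrib distrib_left)
  also have "\<dots> \<le> Bform x x"
    unfolding Bform_def
  proof (intro sum_mono)
    fix i j
    show "?b i j * (((x i)\<^sup>2 * (pvec j / pvec i) + (x j)\<^sup>2 * (pvec i / pvec j)) / 2) \<le> ?b i j * x i * x j"
    proof (cases "i = j")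
      case True
      then show ?thesis using pvec(1)[of i] by (simp add: power2_eq_square)
    next
      case False
      then have "?b i j \<le> 0" using off_diag[OF False]
        by (metis mult_nonneg_nonpos of_int_le_0_iff of_nat_0_le_iff)
      then show ?thesis unfolding mult.assoc by (intro mult_left_mono_neg weighted_am_gm)
    qed
  qed
  finally show ?thesis .
qed

lemma Bform_indicator_left: "Bform (\<lambda>i. u * of_bool (i = k)) y = (\<Sum>j\<in>UNIV. of_int (int (r k) * C $ k $ j) * u * y j)"
proof -
  have "Bform (\<lambda>i. u * of_bool (i = k)) y = (\<Sum>i\<in>UNIV. if i = k then (\<Sum>j\<in>UNIV. of_int (int (r k) * C $ k $ j) * u * y j) else 0)"
    unfolding Bform_def by (intro sum.cong) auto
  then show ?thesis by simp
qed

lemma Bform_indicators: "Bform (\<lambda>i. u * of_bool (i = k)) (\<lambda>i. v * of_bool (i = l)) = of_int (int (r k) * C $ k $ l) * u * v"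
proof -
  have "(\<Sum>j\<in>UNIV. of_int (int (r k) * C $ k $ j) * u * (v * of_bool (j = l))) = 
    (\<Sum>j\<in>UNIV. if j = l then of_int (int (r k) * C $ k $ l) * u * v else 0)"
    by (intro sum.cong) auto
  then show ?thesis by (simp add: Bform_indicator_left)
qed

text \<open>Positivity on the vector with entries a = - C_ij at \<open>i\<close> and 2 at
  \<open>j\<close> gives C_ij C_ji < 4. As r_i is at most r_j, the factor - C_ji is the smaller one,
  hence 1.\<close>

lemma edge_le:
  assumes "i \<noteq> j" "C $ i $ j \<noteq> 0" "r i \<le> r j"
  shows "C $ j $ i = -1" "int (r j) = - C $ i $ j * int (r i)"
proof -
  define a b where "a = - C $ i $ j" and "b = - C $ j $ i"
  have ab: "a > 0" "b > 0"
    using assms off_diag[of i j] off_diag[of j i] zero_iff[of i j] by (auto simp: a_def b_def)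
  have rab: "int (r i) * a = int (r j) * b" using r_sym[of i j] by (simp add: a_def b_def)
  let ?x = "\<lambda>k. of_int a * of_bool (k = i) + 2 * of_bool (k = j) :: real"
  have "Bform ?x ?x > 0"
    using ab assms(1) by (intro Bform_pos[of _ j]) auto
  also have "Bform ?x ?x = 
      of_int (int (r i) * C $ i $ i) * of_int a * of_int a + of_int (int (r j) * C $ j $ j) * 2 * 2 
      + 2 * (of_int (int (r i) * C $ i $ j) * of_int a * 2)"
    unfolding Bform_add_left Bform_add_right Bform_indicators r_sym[of i j] by simp
  also have "\<dots> = of_int (8 * int (r j) - 2 * (int (r i) * a) * a)"
    by (simp add: diag a_def algebra_simps)
  finally have "2 * (int (r i) * a) * a < 8 * int (r j)" by linarith
  then have "int (r j) * (a * b) < int (r j) * 4" unfolding rab by (simp add: mult_ac)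
  then have ab4: "a * b < 4" using r_pos[of j] by simp
  have "int (r j) * b \<le> int (r j) * a"
    unfolding rab[symmetric] using assms(3) ab by (intro mult_right_mono) auto
  then have "b \<le> a" using r_pos[of j] by simp
  then have "b * b \<le> a * b" using ab by (intro mult_right_mono) auto
  moreover have "2 * 2 \<le> b * b" if "2 \<le> b" using that by (intro mult_mono) auto
  ultimately have "b = 1" using ab(2) ab4 by linarith
  then show "C $ j $ i = -1" "int (r j) = - C $ i $ j * int (r i)"
    using rab by (auto simp: a_def b_def mult_ac)
qed

text \<open>By \<open>edge_le\<close>, the larger symmetrizer on an edge is an integral multiple of
  the smaller one, and the symmetrized entry depends on these two values only. The factor 2 for
  unequal values is what \<open>plateau_unique_exit\<close> uses.\<close>

lemma edge_B:
  assumes "i \<noteq> j" "C $ i $ j \<noteq> 0"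
  shows "int (r i) * C $ i $ j = - int (max (r i) (r j))" 
    and "r i \<noteq> r j \<Longrightarrow> 2 * min (r i) (r j) \<le> max (r i) (r j)"
proof -
  have *: "int (r i) * C $ i $ j = - int (max (r i) (r j)) \<and> 
    (r i \<noteq> r j \<longrightarrow> 2 * min (r i) (r j) \<le> max (r i) (r j))" 
    if "i \<noteq> j" "C $ i $ j \<noteq> 0" "r i \<le> r j" for i j
  proof -
    define a where "a = - C $ i $ j"
    have e: "int (r j) = a * int (r i)" using edge_le[OF that] by (simp add: a_def)
    have "a > 0" using that off_diag[of i j] by (simp add: a_def)
    moreover have "a \<noteq> 1" if "r i \<noteq> r j" using e that by auto
    ultimately have "2 * int (r i) \<le> a * int (r i)" if "r i \<noteq> r j"
      using that by (intro mult_right_mono) auto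
    then show ?thesis using e that by (auto simp: a_def max_def min_def)
  qed
  show "int (r i) * C $ i $ j = - int (max (r i) (r j))"
    using *[OF assms] *[of j i] assms zero_iff[of i j] r_sym[of i j] by (cases "r i \<le> r j") (auto simp: max.commute)
  show "r i \<noteq> r j \<Longrightarrow> 2 * min (r i) (r j) \<le> max (r i) (r j)"
    using *[OF assms] *[of j i] assms zero_iff[of i j] by (cases "r i \<le> r j") (auto simp: max.commute min.commute)
qed

section \<open>Connected sets with a constant symmetrizer\<close>

definition ind :: "'n set \<Rightarrow> 'n \<Rightarrow> real" where "ind S = (\<lambda>i. of_bool (i \<in> S))"

definition plateau :: "'n \<Rightarrow> 'n set \<Rightarrow> bool" where
  "plateau i S \<longleftrightarrow> i \<in> S \<and> (\<forall>s\<in>S. r s = r i) \<and> Bform (ind S) (ind S) \<le> 2 * real (r i)"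

text \<open>
  A plateau stands for a connected set of vertices with a constant value of \<open>r\<close>: a connected set
  contains at least as many edges as a tree, which is what the bound on the form says.
\<close>

lemma Bform_ind_le:
  assumes "k \<notin> S" "s \<in> S" "C $ k $ s \<noteq> 0" "u \<ge> 0"
  shows "Bform (\<lambda>i. u * of_bool (i = k)) (ind S) \<le> - u * real (max (r k) (r s))"
proof -
  have "Bform (\<lambda>i. u * of_bool (i = k)) (ind S) = (\<Sum>j\<in>UNIV. u * (of_int (int (r k) * C $ k $ j) * ind S j))"
    by (simp add: Bform_indicator_left mult_ac)
  also have "\<dots> = (\<Sum>j\<in>S. u * of_int (int (r k) * C $ k $ j))"
    by (intro sum.mono_neutral_cong_right) (auto simp: ind_def)
  also have "\<dots> = u * of_int (int (r k) * C $ k $ s) + (\<Sum>j\<in>S - {s}. u * of_int (int (r k) * C $ k $ j))"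
    using assms by (subst sum.remove[of S s]) auto
  also have "(\<Sum>j\<in>S - {s}. u * of_int (int (r k) * C $ k $ j)) \<le> 0"
  proof (rule sum_nonpos)
    fix j assume "j \<in> S - {s}"
    then have "C $ k $ j \<le> 0" using assms off_diag[of k j] by auto
    then have "int (r k) * C $ k $ j \<le> 0" by (simp add: mult_nonneg_nonpos)
    then show "u * of_int (int (r k) * C $ k $ j) \<le> 0"
      using assms(4) by (metis mult_nonneg_nonpos of_int_le_0_iff)
  qed
  also have "int (r k) * C $ k $ s = - int (max (r k) (r s))"
    using assms by (intro edge_B) auto
  finally show ?thesis by simp
qed

lemma plateauD:
  assumes "plateau i S"
  shows "i \<in> S" "s \<in> S \<Longrightarrow> r s = r i" "Bform (ind S) (ind S) \<le> 2 * real (r i)"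
  using assms unfolding plateau_def by blast+

lemma ind_insert: "k \<notin> S \<Longrightarrow> ind (insert k S) = (\<lambda>i. ind S i + 1 * of_bool (i = k))"
  by (auto simp: ind_def fun_eq_iff)

text \<open>Joining a neighbour \<open>v\<close> with the same \<open>r\<close> adds 2 r_i on the
  diagonal and at most - 2 r_i from the edges to \<open>S\<close>, so the bound on the form
  survives. A plateau of maximal cardinality is therefore closed under such neighbours.\<close>

lemma maximal_plateau:
  obtains S where "plateau i S" "\<And>s v. s \<in> S \<Longrightarrow> C $ s $ v \<noteq> 0 \<Longrightarrow> r v = r i \<Longrightarrow> v \<in> S"
proof -
  have i: "plateau i {i}"
    unfolding plateau_def using Bform_indicators[of 1 i 1 i] by (simp add: ind_def diag)
  define S where "S = arg_max card (plateau i)"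
  have "\<forall>T. plateau i T \<longrightarrow> card T < Suc (card (UNIV :: 'n set))"
    by (intro allI impI le_imp_less_Suc card_mono) auto
  with i have max0: "plateau i S \<and> (\<forall>T. plateau i T \<longrightarrow> card T \<le> card S)"
    unfolding S_def by (rule arg_max_nat_lemma)
  note max = conjunct1[OF max0] conjunct2[OF max0]
  note S = max(1) max(2)[rule_format]
  show ?thesis
  proof (rule that[OF S(1)])
    fix s v assume sv: "s \<in> S" "C $ s $ v \<noteq> 0" "r v = r i"
    show "v \<in> S"
    proof (rule ccontr)
      assume v: "v \<notin> S"
      have rs: "r s = r i" using plateauD(2)[OF S(1) sv(1)] .
      have "Bform (ind (insert v S)) (ind (insert v S)) = 
         Bform (ind S) (ind S) + 2 * Bform (\<lambda>i. 1 * of_bool (i = v)) (ind S) + of_int (int (r v) * C $ v $ v) * 1 * 1"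
        unfolding ind_insert[OF v] Bform_add_left Bform_add_right Bform_indicators
        using Bform_commute[of "ind S" "\<lambda>i. 1 * of_bool (i = v)"] by simp
      also have "\<dots> \<le> 2 * real (r i) + 2 * (- 1 * real (max (r v) (r s))) + 2 * real (r i)"
        using Bform_ind_le[of v S s 1] v sv zero_iff[of s v] plateauD(3)[OF S(1)] by (simp add: diag)
      also have "\<dots> = 2 * real (r i)" using rs sv by simp
      finally have "plateau i (insert v S)"
        using plateauD(1,2)[OF S(1)] sv(3) unfolding plateau_def by blast
      from S(2)[OF this] v show False by simp
    qed
  qed
qed

text \<open>Two different exits would make the form nonpositive on a nonzero vector: it is at most 2
  r_i on \<open>S\<close>, each exit with its optimal weight lowers it by at least r_i, and the
  entry between the exits is nonpositive.\<close>

lemma plateau_unique_exit: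
  assumes S: "plateau i S" and j: "s \<in> S" "C $ s $ j \<noteq> 0" "r j \<noteq> r i" and k: "t \<in> S" "C $ t $ k \<noteq> 0" "r k \<noteq> r i"
  shows "j = k"
proof (rule ccontr)
  assume jk: "j \<noteq> k"
  have notin: "j \<notin> S" "k \<notin> S" using plateauD(2)[OF S] j(3) k(3) by blast+
  \<comment> \<open>The minimizer of 2 r_j u^2 - 2 u max(r_j, r_i), which bounds the contribution of
    an exit \<open>j\<close> joined to the all-ones vector on \<open>S\<close>.\<close>
  define u where "u = (\<lambda>j. real (max (r j) (r i)) / (2 * real (r j)))"
  have u: "u j > 0" for j using r_pos[of j] by (auto simp: u_def max_def intro!: divide_pos_pos)
  have exit: "of_int (int (r j) * C $ j $ j) * u j * u j + 2 * Bform (\<lambda>i. u j * of_bool (i = j)) (ind S) \<le> - real (r i)"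
    if "s \<in> S" "C $ s $ j \<noteq> 0" "r j \<noteq> r i" for s j
  proof -
    have "j \<notin> S" "r s = r i" using plateauD(2)[OF S] that(1,3) by blast+
    define M where "M = real (max (r j) (r i))"
    have "j \<noteq> s" using \<open>j \<notin> S\<close> that by auto
    then have "2 * min (r j) (r s) \<le> max (r j) (r s)"
      using edge_B(2)[of j s] that zero_iff[of s j] \<open>r s = r i\<close> by auto
    then have "2 * real (min (r j) (r i)) \<le> M" unfolding M_def \<open>r s = r i\<close> by linarith
    then have "2 * real (min (r j) (r i)) * M \<le> M * M" by (intro mult_right_mono) (auto simp: M_def)
    moreover have "real (min (r j) (r i)) * M = real (r i) * real (r j)"
      by (auto simp: M_def min_def max_def)
    ultimately have M: "2 * (real (r i) * real (r j)) \<le> M * M" by (simp add: mult.assoc)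
    have "Bform (\<lambda>i. u j * of_bool (i = j)) (ind S) \<le> - u j * real (max (r j) (r s))"
      using \<open>j \<notin> S\<close> that zero_iff[of s j] u[of j] by (intro Bform_ind_le) auto
    then have "of_int (int (r j) * C $ j $ j) * u j * u j + 2 * Bform (\<lambda>i. u j * of_bool (i = j)) (ind S)
      \<le> 2 * real (r j) * u j * u j - 2 * u j * M"
      by (simp add: diag M_def \<open>r s = r i\<close>)
    also have "\<dots> = - (M * M) / (2 * real (r j))"
      using r_pos[of j] by (simp add: u_def M_def[symmetric] field_simps)
    also have "\<dots> \<le> - real (r i)"
      using M r_pos[of j] by (simp add: field_simps)
    finally show ?thesis .
  qed
  let ?x = "\<lambda>a. ind S a + (u j * of_bool (a = j) + u k * of_bool (a = k))"
  have "Bform ?x ?x > 0"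
    using notin jk u[of j] by (intro Bform_pos[of _ j]) (auto simp: ind_def)
  also have "Bform ?x ?x = Bform (ind S) (ind S) 
     + (of_int (int (r j) * C $ j $ j) * u j * u j + 2 * Bform (\<lambda>i. u j * of_bool (i = j)) (ind S))
     + (of_int (int (r k) * C $ k $ k) * u k * u k + 2 * Bform (\<lambda>i. u k * of_bool (i = k)) (ind S))
     + 2 * (of_int (int (r j) * C $ j $ k) * u j * u k)"
    unfolding Bform_add_left Bform_add_right 
    Bform_indicators
      Bform_commute[of "ind S" "\<lambda>a. u j * of_bool (a = j)"] Bform_commute[of "ind S" "\<lambda>a. u k * of_bool (a = k)"]
    using r_sym[of k j] by simp
  also have "\<dots> \<le> 2 * real (r i) - real (r i) - real (r i) + 0"
  proof -
    have "int (r j) * C $ j $ k \<le> 0" using off_diag[OF jk] by (simp add: mult_nonneg_nonpos)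
    then have "of_int (int (r j) * C $ j $ k) * u j * u k \<le> 0"
      using u[of j] u[of k] by (meson mult_nonpos_nonneg of_int_le_0_iff less_imp_le)
    then show ?thesis using plateauD(3)[OF S] exit[OF j] exit[OF k] by simp
  qed
  finally show False by simp
qed

text \<open>A maximal plateau at \<open>i\<close> can be left only towards \<open>j\<close>, and one
  at \<open>j\<close> only towards \<open>i\<close>, so their union contains the component of
  \<open>i\<close>. Hence r_i divides every symmetrizer of that component, and their gcd is
  1.\<close>

theorem multiple_edge:
  assumes "i \<noteq> j" "C $ i $ j \<noteq> 0" "r i < r j"
  shows "r i = 1"
proof -
  obtain S where S: "plateau i S" "\<And>s v. s \<in> S \<Longrightarrow> C $ s $ v \<noteq> 0 \<Longrightarrow> r v = r i \<Longrightarrow> v \<in> S"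
    using maximal_plateau[of i] by blast
  obtain T where T: "plateau j T" "\<And>s v. s \<in> T \<Longrightarrow> C $ s $ v \<noteq> 0 \<Longrightarrow> r v = r j \<Longrightarrow> v \<in> T"
    using maximal_plateau[of j] by blast
  have iS: "i \<in> S" "j \<in> T" using plateauD(1)[OF S(1)] plateauD(1)[OF T(1)] .
  have closed: "v \<in> S \<union> T" if "s \<in> S \<union> T" "C $ s $ v \<noteq> 0" for s v
  proof (cases "s \<in> S")
    case True
    show ?thesis
    proof (cases "r v = r i")
      case False
      have "v = j" by (rule plateau_unique_exit[OF S(1) True that(2) False iS(1) assms(2)]) (use assms in auto)
      then show ?thesis using iS by auto
    qed (use S(2)[OF True that(2)] in auto)
  next
    case False
    then have s: "s \<in> T" using that by auto
    show ?thesis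
    proof (cases "r v = r j")
      case False
      have "v = i" by (rule plateau_unique_exit[OF T(1) s that(2) False iS(2)]) (use assms zero_iff[of i j] in auto)
      then show ?thesis using iS by auto
    qed (use T(2)[OF s that(2)] in auto)
  qed
  have "v \<in> S \<union> T" if "(i, v) \<in> {(a, b). C $ a $ b \<noteq> 0}\<^sup>*" for v
    using that by (induction rule: rtrancl_induct) (use iS closed in auto)
  then have comp: "cartan_component C i \<subseteq> S \<union> T" by (auto simp: cartan_component_def)
  have "int (r i) dvd int (r j)" using edge_le(2)[OF assms(1,2)] assms(3) by simp
  then have "r i dvd r j" by simp
  then have "r i dvd r v" if "v \<in> cartan_component C i" for v
    using that comp plateauD(2)[OF S(1)] plateauD(2)[OF T(1)] by (metis UnE subsetD dvd_refl)
  then have "r i dvd Gcd (r ` cartan_component C i)" by (auto intro: Gcd_greatest)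
  then show ?thesis by (simp add: r_gcd)
qed

end

section \<open>A difference equation with periodic solutions\<close>

text \<open>The interval consists of \<open>N\<close> blocks of length \<open>D\<close>, and the
  block number \<open>(b - u - 1) div D\<close> determines an element of the residue class.\<close>

lemma card_residue_class_interval:
  fixes D u t :: int
  assumes "D > 0"
  shows "card {b \<in> {u<..u + int N * D}. D dvd b - t} \<le> N"
proof -
  let ?S = "{b \<in> {u<..u + int N * D}. D dvd b - t}"
  have "inj_on (\<lambda>b. (b - u - 1) div D) ?S"
  proof (rule inj_onI)
    fix b b' assume b: "b \<in> ?S" "b' \<in> ?S" "(b - u - 1) div D = (b' - u - 1) div D"
    have "D dvd (b - t) - (b' - t)" by (rule dvd_diff) (use b in auto)
    then have "(b - u - 1) mod D = (b' - u - 1) mod D"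
      by (simp add: mod_eq_dvd_iff)
    then show "b = b'" using b(3) by (metis add_diff_cancel_right' diff_add_cancel div_mult_mod_eq)
  qed
  moreover have "(\<lambda>b. (b - u - 1) div D) ` ?S \<subseteq> {0..<int N}"
  proof clarify
    fix b assume b: "b \<in> {u<..u + int N * D}"
    have "(b - u - 1) div D * D \<le> b - u - 1"
      using pos_mod_sign[OF assms, of "b - u - 1"] div_mult_mod_eq[of "b - u - 1" D] by linarith
    then have "(b - u - 1) div D * D < int N * D" using b by simp
    then have "(b - u - 1) div D < int N" using assms by (simp only: mult_less_cancel_right_pos)
    then show "(b - u - 1) div D \<in> {0..<int N}"
      using b assms by (auto simp: pos_imp_zdiv_nonneg_iff)
  qed
  ultimately have "card ?S \<le> card {0..<int N}"
    by (intro card_inj_on_le) auto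
  then show ?thesis by simp
qed

context cartan_data
begin

section \<open>The recurrence defined by C(z)\<close>

definition bond :: "'n \<Rightarrow> 'n \<Rightarrow> nat" where "bond i j = nat (- C $ i $ j)"

text \<open>The exponents \<open>bond i j\<close> - 1, \<open>bond i j\<close> - 3, ..., 1 -
  \<open>bond i j\<close> of z in - [C_ij]_z.\<close>

definition exps :: "'n \<Rightarrow> 'n \<Rightarrow> int set" where
  "exps i j = {k. \<bar>k\<bar> < int (bond i j) \<and> odd (k + int (bond i j))}"

lemma bond_min: 
  assumes "i \<noteq> j" "C $ i $ j \<noteq> 0"
  shows "bond i j * min (r i) (r j) = r j"
proof -
  have m: "int (bond i j) = - C $ i $ j" using off_diag[OF assms(1)] by (simp add: bond_def)
  have "int (r i) * int (bond i j) = int (max (r i) (r j))"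
    using edge_B(1)[OF assms] by (simp add: m)
  then have e: "r i * bond i j = max (r i) (r j)" by (metis of_nat_eq_iff of_nat_mult)
  show ?thesis
  proof (cases "r i \<le> r j")
    case True
    then show ?thesis using e by (simp add: mult.commute)
  next
    case False
    then have "bond i j = 1" using e r_pos[of i] by simp
    then show ?thesis using False by simp
  qed
qed

lemma bond_le: "i \<noteq> j \<Longrightarrow> bond i j \<le> r j"
proof (cases "C $ i $ j = 0")
  case False
  assume "i \<noteq> j"
  have "bond i j * 1 \<le> bond i j * min (r i) (r j)"
    using r_pos[of i] r_pos[of j] by (intro mult_le_mono2) simp
  then show ?thesis using bond_min[OF \<open>i \<noteq> j\<close> False] by simp
qed (simp add: bond_def)

text \<open>\<open>multiple_edge\<close> makes the smaller of two unequal symmetrizers 1, and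
  \<open>bond_min\<close> then gives the bond. The later parity and symmetry arguments about edges
  reduce to these three cases.\<close>

lemma edge_cases:
  assumes "i \<noteq> j" "C $ i $ j \<noteq> 0"
  obtains "r i = r j" "bond i j = 1" | "r i = 1" "r j > 1" "bond i j = r j" | "r j = 1" "r i > 1" "bond i j = 1"
proof -
  note m = bond_min[OF assms]
  consider "r i = r j" | "r i < r j" | "r j < r i" by linarith
  then show thesis
  proof cases
    case 1 then show ?thesis using that(1) m r_pos[of j] by simp
  next
    case 2
    have "r i = 1" using multiple_edge[OF assms 2] .
    then show ?thesis using that(2) m 2 by simp
  next
    case 3
    have "r j = 1" using multiple_edge[of j i] assms zero_iff[of i j] 3 by auto
    then show ?thesis using that(3) m 3 by simp
  qed
qed

text \<open>If x_j(a) is the coefficient of z^(-a), this is the coefficient of z^(-s) in row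
  \<open>i\<close> of C(z) x.\<close>

definition Cop :: "('n \<Rightarrow> int \<Rightarrow> int) \<Rightarrow> 'n \<Rightarrow> int \<Rightarrow> int" where
  "Cop x i s = x i (s + int (r i)) + x i (s - int (r i)) - (\<Sum>j\<in>UNIV - {i}. \<Sum>k\<in>exps i j. x j (s + k))"

text \<open>Truncations of the solution of \<open>Cop x i s = \<delta>\<^sub>i\<^sub>l \<delta>\<^sub>s\<^sub>0\<close> supported in nonnegative degrees.\<close>

primrec trunc_sol :: "'n \<Rightarrow> nat \<Rightarrow> 'n \<Rightarrow> int \<Rightarrow> int" where
  "trunc_sol l 0 = (\<lambda>i a. 0)"
| "trunc_sol l (Suc n) = (\<lambda>i a. if a = int n + int (r i) 
     then of_bool (n = 0 \<and> i = l) - trunc_sol l n i (int n - int (r i))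
       + (\<Sum>j\<in>UNIV - {i}. \<Sum>k\<in>exps i j. trunc_sol l n j (int n + k))
     else trunc_sol l n i a)"

lemma trunc_sol_stable: "a < int n + int (r i) \<Longrightarrow> n \<le> m \<Longrightarrow> trunc_sol l m i a = trunc_sol l n i a"
proof (induction m)
  case (Suc m)
  then show ?case by (cases "n = Suc m") auto
qed simp

text \<open>Stage \<open>Suc n\<close> fixes the value at n + r_i, so a - r_i + 1 is the first stage
  at which position \<open>a\<close> is final; below r_i it is stage 0, with value 0.\<close>

definition sol :: "'n \<Rightarrow> 'n \<Rightarrow> int \<Rightarrow> int" where
  "sol l i a = trunc_sol l (nat (a - int (r i) + 1)) i a"

lemma sol_low: "a < int (r i) \<Longrightarrow> sol l i a = 0"
  by (simp add: sol_def)

lemma sol_eq_trunc: "a < int n + int (r i) \<Longrightarrow> sol l i a = trunc_sol l n i a"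
proof -
  assume a: "a < int n + int (r i)"
  then have "nat (a - int (r i) + 1) \<le> n" by linarith
  then show ?thesis unfolding sol_def by (intro trunc_sol_stable[symmetric]) auto
qed

text \<open>This makes the recurrence causal: at time s it determines the values at s + r_j and
  reads x_j only at smaller positions.\<close>

lemma exps_lt: "k \<in> exps i j \<Longrightarrow> i \<noteq> j \<Longrightarrow> \<bar>k\<bar> < int (r j)"
  using bond_le[of i j] by (auto simp: exps_def)

theorem Cop_sol: "Cop (sol l) i s = of_bool (i = l \<and> s = 0)"
proof (cases "s < 0")
  case True
  have "(\<Sum>j\<in>UNIV - {i}. \<Sum>k\<in>exps i j. sol l j (s + k)) = 0"
  proof (intro sum.neutral ballI)
    fix j k assume "j \<in> UNIV - {i}" "k \<in> exps i j"
    then have "\<bar>k\<bar> < int (r j)" by (intro exps_lt[of k i j]) auto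
    then show "sol l j (s + k) = 0" using True by (intro sol_low) linarith
  qed
  moreover have "sol l i (s + int (r i)) = 0" "sol l i (s - int (r i)) = 0"
    using True by (intro sol_low; linarith)+
  ultimately show ?thesis using True by (simp add: Cop_def)
next
  case False
  define n where "n = nat s"
  have s: "s = int n" using False by (simp add: n_def)
  have "sol l i (s + int (r i)) = trunc_sol l (Suc n) i (int n + int (r i))"
    unfolding s by (rule sol_eq_trunc) simp
  moreover have "sol l i (s - int (r i)) = trunc_sol l n i (int n - int (r i))"
    unfolding s using r_pos[of i] by (intro sol_eq_trunc) simp
  moreover have "(\<Sum>j\<in>UNIV - {i}. \<Sum>k\<in>exps i j. sol l j (s + k)) = 
    (\<Sum>j\<in>UNIV - {i}. \<Sum>k\<in>exps i j. trunc_sol l n j (int n + k))"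
  proof (intro sum.cong refl)
    fix j k assume "j \<in> UNIV - {i}" "k \<in> exps i j"
    then have "\<bar>k\<bar> < int (r j)" by (intro exps_lt[of k i j]) auto
    then show "sol l j (s + k) = trunc_sol l n j (int n + k)" 
      unfolding s by (intro sol_eq_trunc) linarith
  qed
  ultimately show ?thesis by (simp add: Cop_def s conj_commute)
qed

section \<open>The energy of a window\<close>

text \<open>The congruence is chosen so that the points (j, s + k) entering \<open>Cop\<close> at
  (i, s) are the neighbours of both (i, s + r_i) and (i, s - r_i). An interval of length 2 r_j
  contains \<open>bond i j\<close> members of a class for the modulus 2 min(r_i, r_j).\<close>

definition linked :: "'n \<times> int \<Rightarrow> 'n \<times> int \<Rightarrow> bool" where
  "linked u v \<longleftrightarrow> fst u \<noteq> fst v \<and> C $ fst u $ fst v \<noteq> 0 \<and>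
     2 * int (min (r (fst u)) (r (fst v))) dvd snd u - snd v - int (max (r (fst u)) (r (fst v)))"

text \<open>Exchanging the two points changes the congruence by 2 max(r_i, r_j), a multiple of the
  modulus because on an edge the minimum divides the maximum.\<close>

lemma linked_sym: "linked u v \<longleftrightarrow> linked v u"
proof -
  have "linked v u" if "linked u v" for u v
  proof -
    obtain i a j b where uv: "u = (i, a)" "v = (j, b)" by (metis surj_pair)
    have ij: "i \<noteq> j" "C $ i $ j \<noteq> 0" using that by (auto simp: linked_def uv)
    have "2 * int (min (r i) (r j)) dvd a - b - int (max (r i) (r j))"
      using that by (simp add: linked_def uv)
    moreover have "int (min (r i) (r j)) dvd int (max (r i) (r j))"
      by (rule edge_cases[OF ij]) auto
    then have "2 * int (min (r i) (r j)) dvd 2 * int (max (r i) (r j))"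
      by (intro mult_dvd_mono) auto
    ultimately have "2 * int (min (r i) (r j)) dvd 
      - (a - b - int (max (r i) (r j))) - 2 * int (max (r i) (r j))"
      by (simp only: dvd_diff dvd_minus_iff)
    then show ?thesis using ij zero_iff[of i j]
      by (simp add: linked_def uv min.commute max.commute algebra_simps)
  qed
  then show ?thesis by blast
qed

text \<open>Both endpoints see the same neighbours, since their distance 2 r_i is a multiple of the
  modulus. For r_i = 1 < r_j the condition is a parity; in the other cases the bound on |k| leaves
  only k = 0.\<close>

lemma linked_exps:
  assumes "e = int (r i) \<or> e = - int (r i)" "\<bar>k\<bar> < int (r j)" 
  shows "linked (i, s + e) (j, s + k) \<longleftrightarrow> i \<noteq> j \<and> k \<in> exps i j"
proof (cases "i \<noteq> j \<and> C $ i $ j \<noteq> 0")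
  case False
  then show ?thesis by (auto simp: linked_def exps_def bond_def)
next
  case True
  then have ij: "i \<noteq> j" "C $ i $ j \<noteq> 0" by auto
  have eq: "linked (i, s + e) (j, s + k) \<longleftrightarrow> 2 * int (min (r i) (r j)) dvd e - k - int (max (r i) (r j))"
    using ij by (simp add: linked_def algebra_simps)
  show ?thesis unfolding eq using ij
  proof (rule edge_cases)
    assume c: "r i = r j" "bond i j = 1"
    have "2 * int (r j) dvd e - k - int (r j) \<longleftrightarrow> k = 0"
    proof
      assume d: "2 * int (r j) dvd e - k - int (r j)"
      have "2 * int (r j) dvd (e - k - int (r j)) + (int (r j) - e)"
        using assms(1) c(1) d by (intro dvd_add) auto
      then have "2 * int (r j) dvd k" by simp
      then have "k \<noteq> 0 \<Longrightarrow> 2 * int (r j) \<le> \<bar>k\<bar>" using zdvd_imp_le[of "2 * int (r j)" "\<bar>k\<bar>"] by simp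
      then show "k = 0" using assms(2) r_pos[of j] by linarith
    qed (use assms c in auto)
    then show "2 * int (min (r i) (r j)) dvd e - k - int (max (r i) (r j)) \<longleftrightarrow> i \<noteq> j \<and> k \<in> exps i j"
      using c ij by (auto simp: exps_def)
  next
    assume c: "r i = 1" "r j > 1" "bond i j = r j"
    have "odd e" using assms(1) c by auto
    then have "even (e - k - int (r j)) \<longleftrightarrow> odd (k + int (r j))" by presburger
    then show "2 * int (min (r i) (r j)) dvd e - k - int (max (r i) (r j)) \<longleftrightarrow> i \<noteq> j \<and> k \<in> exps i j"
      using c ij assms(2) by (simp add: exps_def min_def max_def)
  next
    assume c: "r j = 1" "r i > 1" "bond i j = 1"
    have "k = 0" using assms(2) c by simp
    moreover have "even (e - int (r i))" using assms(1) by auto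
    ultimately show "2 * int (min (r i) (r j)) dvd e - k - int (max (r i) (r j)) \<longleftrightarrow> i \<noteq> j \<and> k \<in> exps i j"
      using c ij by (simp add: exps_def min_def max_def)
  qed
qed

text \<open>The entries exchanged in one time step do not interact, so the simultaneous replacement
  splits into independent ones.\<close>

lemma not_linked_simultaneous:
  assumes "e = 1 \<or> e = - (1::int)"
  shows "\<not> linked (i, s + e * int (r i)) (j, s + e * int (r j))"
proof
  assume "linked (i, s + e * int (r i)) (j, s + e * int (r j))"
  then have ij: "i \<noteq> j" "C $ i $ j \<noteq> 0" 
    and d: "2 * int (min (r i) (r j)) dvd e * int (r i) - e * int (r j) - int (max (r i) (r j))"
    by (auto simp: linked_def)
  show False using ij
  proof (rule edge_cases)
    assume c: "r i = r j"
    then have "2 * int (r j) dvd int (r j)" using d by simp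
    then show False using r_pos[of j] zdvd_imp_le by fastforce
  next
    assume c: "r i = 1" "r j > 1"
    then have "even (e - e * int (r j) - int (r j))" using d by (simp add: min_def max_def)
    then show False using assms by auto
  next
    assume c: "r j = 1" "r i > 1"
    then have "even (e * int (r i) - e - int (r i))" using d by (simp add: min_def max_def)
    then show False using assms by auto
  qed
qed

text \<open>The quadratic form of 2 minus the adjacency matrix of \<open>linked\<close>, restricted
  to the positions in \<Omega>; the double sum counts each edge twice.\<close>

definition energy :: "('n \<Rightarrow> int \<Rightarrow> int) \<Rightarrow> ('n \<times> int) set \<Rightarrow> int" where
  "energy x \<Omega> = 2 * (\<Sum>u\<in>\<Omega>. (case_prod x u)\<^sup>2)
     - (\<Sum>u\<in>\<Omega>. \<Sum>v\<in>\<Omega>. of_bool (linked u v) * case_prod x u * case_prod x v)"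

text \<open>The state from which the recurrence determines the next values; half-open, so that
  consecutive windows differ in one entry for each index.\<close>

definition window :: "int \<Rightarrow> ('n \<times> int) set" where
  "window \<tau> = Sigma UNIV (\<lambda>i. {\<tau> - int (r i)<..\<tau> + int (r i)})"

lemma finite_window: "finite (window \<tau>)" by (simp add: window_def)

lemma energy_Un:
  assumes "finite M" "finite N" "M \<inter> N = {}" "\<And>u v. u \<in> N \<Longrightarrow> v \<in> N \<Longrightarrow> \<not> linked u v"
  shows "energy x (M \<union> N) = energy x M +
    (\<Sum>u\<in>N. 2 * (case_prod x u)\<^sup>2 - 2 * case_prod x u * (\<Sum>v\<in>M. of_bool (linked u v) * case_prod x v))"
proof -
  let ?f = "\<lambda>u v. of_bool (linked u v) * case_prod x u * case_prod x v"
  have "(\<Sum>u\<in>M \<union> N. \<Sum>v\<in>M \<union> N. ?f u v) = 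
    (\<Sum>u\<in>M. \<Sum>v\<in>M. ?f u v) + (\<Sum>u\<in>M. \<Sum>v\<in>N. ?f u v) + ((\<Sum>u\<in>N. \<Sum>v\<in>M. ?f u v) + (\<Sum>u\<in>N. \<Sum>v\<in>N. ?f u v))"
    using assms by (simp add: sum.union_disjoint sum.distrib)
  also have "(\<Sum>u\<in>N. \<Sum>v\<in>N. ?f u v) = 0" using assms(4) by (intro sum.neutral ballI) simp
  also have "(\<Sum>u\<in>M. \<Sum>v\<in>N. ?f u v) = (\<Sum>u\<in>N. \<Sum>v\<in>M. ?f u v)"
    by (subst sum.swap, intro sum.cong refl) (auto simp: linked_sym)
  finally have "(\<Sum>u\<in>M \<union> N. \<Sum>v\<in>M \<union> N. ?f u v) = (\<Sum>u\<in>M. \<Sum>v\<in>M. ?f u v) + 2 * (\<Sum>u\<in>N. \<Sum>v\<in>M. ?f u v)"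
    by simp
  moreover have "(\<Sum>u\<in>N. \<Sum>v\<in>M. ?f u v) = (\<Sum>u\<in>N. case_prod x u * (\<Sum>v\<in>M. of_bool (linked u v) * case_prod x v))"
    unfolding sum_distrib_left by (intro sum.cong refl) (simp add: mult_ac)
  ultimately show ?thesis
    using assms(1-3) 
    by (simp add: energy_def sum.union_disjoint sum_subtractf sum_distrib_left mult.assoc distrib_left)
qed

text \<open>
  Passing from time \<open>s - 1\<close> to \<open>s\<close> replaces the value \<open>x\<^sub>i(s - r\<^sub>i)\<close> by \<open>x\<^sub>i(s + r\<^sub>i)\<close>, which is the
  reflection of the energy form in that coordinate.
\<close>

lemma energy_conserved:
  assumes "\<And>i. Cop x i s = 0"
  shows "energy x (window s) = energy x (window (s - 1))"
proof -
  \<comment> \<open>\<open>M\<close> is common to the two consecutive windows; \<open>N 1\<close>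
    holds the entries that come in, \<open>N (-1)\<close> those that drop out.\<close>
  define M where "M = Sigma UNIV (\<lambda>i. {s - int (r i)<..<s + int (r i)})"
  define N where "N = (\<lambda>e::int. range (\<lambda>i. (i, s + e * int (r i))))"
  have fin: "finite M" "finite (N e)" for e by (auto simp: M_def N_def)
  have W: "window s = M \<union> N 1" "window (s - 1) = M \<union> N (-1)"
    using r_pos by (force simp: window_def M_def N_def)+
  have val: "(\<Sum>v\<in>M. of_bool (linked (i, s + e * int (r i)) v) * case_prod x v)
     = x i (s + int (r i)) + x i (s - int (r i))" if e: "e = 1 \<or> e = - 1" for e i
  proof -
    have "(\<Sum>v\<in>M. of_bool (linked (i, s + e * int (r i)) v) * case_prod x v)
      = (\<Sum>j\<in>UNIV. \<Sum>b\<in>{s - int (r j)<..<s + int (r j)}. of_bool (linked (i, s + e * int (r i)) (j, b)) * x j b)"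
      unfolding M_def by (subst sum.Sigma) (simp_all add: split_def)
    also have "\<dots> = (\<Sum>j\<in>UNIV - {i}. \<Sum>k\<in>exps i j. x j (s + k))"
    proof (rule sum.mono_neutral_cong_right)
      show "\<forall>j\<in>UNIV - (UNIV - {i}). (\<Sum>b\<in>{s - int (r j)<..<s + int (r j)}. of_bool (linked (i, s + e * int (r i)) (j, b)) * x j b) = 0"
        by (auto simp: linked_def)
      fix j assume j: "j \<in> UNIV - {i}"
      have iff: "linked (i, s + e * int (r i)) (j, b) \<longleftrightarrow> b - s \<in> exps i j" if "b \<in> {s - int (r j)<..<s + int (r j)}" for b
        using linked_exps[of "e * int (r i)" i "b - s" j s] e that j by auto
      have "(\<Sum>b\<in>{s - int (r j)<..<s + int (r j)}. of_bool (linked (i, s + e * int (r i)) (j, b)) * x j b)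
        = (\<Sum>b\<in>(\<lambda>k. s + k) ` exps i j. x j b)"
      proof (rule sum.mono_neutral_cong_right)
        show "(\<lambda>k. s + k) ` exps i j \<subseteq> {s - int (r j)<..<s + int (r j)}"
          using exps_lt[of _ i j] j by force
        show "\<forall>b\<in>{s - int (r j)<..<s + int (r j)} - (\<lambda>k. s + k) ` exps i j. 
            of_bool (linked (i, s + e * int (r i)) (j, b)) * x j b = 0"
        proof
          fix b assume b: "b \<in> {s - int (r j)<..<s + int (r j)} - (\<lambda>k. s + k) ` exps i j"
          have "b - s \<notin> exps i j"
          proof
            assume "b - s \<in> exps i j"
            then have "s + (b - s) \<in> (\<lambda>k. s + k) ` exps i j" by (rule imageI)
            then show False using b by simp
          qed
          then show "of_bool (linked (i, s + e * int (r i)) (j, b)) * x j b = 0" using iff[of b] b by simp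
        qed
        fix b assume "b \<in> (\<lambda>k. s + k) ` exps i j"
        then obtain k where k: "b = s + k" "k \<in> exps i j" by auto
        then have "b \<in> {s - int (r j)<..<s + int (r j)}" using exps_lt[of k i j] j by auto
        then show "of_bool (linked (i, s + e * int (r i)) (j, b)) * x j b = x j b"
          using iff[of b] k by simp
      qed simp
      also have "\<dots> = (\<Sum>k\<in>exps i j. x j (s + k))"
        by (subst sum.reindex) auto
      finally show "(\<Sum>b\<in>{s - int (r j)<..<s + int (r j)}. of_bool (linked (i, s + e * int (r i)) (j, b)) * x j b)
        = (\<Sum>k\<in>exps i j. x j (s + k))" .
    qed auto
    also have "\<dots> = x i (s + int (r i)) + x i (s - int (r i))"
      using assms[of i] by (simp add: Cop_def)
    finally show ?thesis .
  qed
  \<comment> \<open>With y the entry in \<open>N e\<close> and y' its counterpart at the other end,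
    the contribution is 2 y^2 - 2 y (y + y') = - 2 y y', symmetric in y and y'.\<close>
  have main: "energy x (M \<union> N e) = energy x M - 2 * (\<Sum>i\<in>UNIV. x i (s + int (r i)) * x i (s - int (r i)))"
    if e: "e = 1 \<or> e = -1" for e
  proof -
    have "energy x (M \<union> N e) = energy x M + (\<Sum>u\<in>N e. 2 * (case_prod x u)\<^sup>2 
        - 2 * case_prod x u * (\<Sum>v\<in>M. of_bool (linked u v) * case_prod x v))"
    proof (rule energy_Un)
      show "M \<inter> N e = {}" using e by (auto simp: M_def N_def)
      show "\<not> linked u v" if "u \<in> N e" "v \<in> N e" for u v
        using that not_linked_simultaneous[OF e] by (auto simp: N_def)
    qed (use fin in auto)
    also have "(\<Sum>u\<in>N e. 2 * (case_prod x u)\<^sup>2 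
        - 2 * case_prod x u * (\<Sum>v\<in>M. of_bool (linked u v) * case_prod x v)) = 
      (\<Sum>i\<in>UNIV. 2 * (x i (s + e * int (r i)))\<^sup>2 
        - 2 * x i (s + e * int (r i)) * (x i (s + int (r i)) + x i (s - int (r i))))"
      unfolding N_def by (subst sum.reindex) (auto simp: val[OF e] intro!: inj_onI)
    also have "\<dots> = (\<Sum>i\<in>UNIV. - 2 * (x i (s + int (r i)) * x i (s - int (r i))))"
      using e by (intro sum.cong refl) (auto simp: power2_eq_square algebra_simps)
    finally show ?thesis by (simp add: sum_distrib_left sum_negf)
  qed
  show ?thesis unfolding W using main[of 1] main[of "-1"] by simp
qed

text \<open>The positions of \<open>j\<close> linked to (i, a) lie in one residue class modulo 2
  min(r_i, r_j), and the window has length 2 r_j in the direction \<open>j\<close>, which is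
  \<open>bond i j\<close> times that modulus by \<open>bond_min\<close>.\<close>

lemma sum_linked_le:
  fixes g :: "'n \<Rightarrow> real"
  assumes "\<And>j. g j \<ge> 0"
  shows "(\<Sum>v\<in>window \<tau>. of_bool (linked (i, a) v) * g (fst v)) \<le> (\<Sum>j\<in>UNIV - {i}. real (bond i j) * g j)"
proof -
  have "(\<Sum>v\<in>window \<tau>. of_bool (linked (i, a) v) * g (fst v))
    = (\<Sum>j\<in>UNIV. \<Sum>b\<in>{\<tau> - int (r j)<..\<tau> + int (r j)}. of_bool (linked (i, a) (j, b)) * g j)"
    unfolding window_def by (subst sum.Sigma) (simp_all add: split_def)
  also have "\<dots> = (\<Sum>j\<in>UNIV. real (card {b \<in> {\<tau> - int (r j)<..\<tau> + int (r j)}. linked (i, a) (j, b)}) * g j)"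
  proof (intro sum.cong refl)
    fix j
    have "(\<Sum>b\<in>{\<tau> - int (r j)<..\<tau> + int (r j)}. of_bool (linked (i, a) (j, b)) * g j) = 
       (\<Sum>b\<in>{b \<in> {\<tau> - int (r j)<..\<tau> + int (r j)}. linked (i, a) (j, b)}. g j)"
      by (rule sum.mono_neutral_cong_right) auto
    then show "(\<Sum>b\<in>{\<tau> - int (r j)<..\<tau> + int (r j)}. of_bool (linked (i, a) (j, b)) * g j) = 
       real (card {b \<in> {\<tau> - int (r j)<..\<tau> + int (r j)}. linked (i, a) (j, b)}) * g j" by simp
  qed
  also have "\<dots> = (\<Sum>j\<in>UNIV - {i}. real (card {b \<in> {\<tau> - int (r j)<..\<tau> + int (r j)}. linked (i, a) (j, b)}) * g j)"
    by (rule sum.mono_neutral_right) (auto simp: linked_def)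
  also have "\<dots> \<le> (\<Sum>j\<in>UNIV - {i}. real (bond i j) * g j)"
  proof (intro sum_mono mult_right_mono assms)
    fix j assume j: "j \<in> UNIV - {i}"
    have "card {b \<in> {\<tau> - int (r j)<..\<tau> + int (r j)}. linked (i, a) (j, b)} \<le> bond i j"
    proof (cases "C $ i $ j = 0")
      case True
      then show ?thesis by (simp add: linked_def)
    next
      case False
      define D where "D = 2 * int (min (r i) (r j))"
      define t where "t = a - int (max (r i) (r j))"
      have "D > 0" using r_pos[of i] r_pos[of j] by (simp add: D_def)
      have "int (bond i j * min (r i) (r j)) = int (r j)" using bond_min[OF _ False] j by auto
      then have len: "int (bond i j) * D = 2 * int (r j)" by (simp add: D_def mult_ac)
      have "{b \<in> {\<tau> - int (r j)<..\<tau> + int (r j)}. linked (i, a) (j, b)} \<subseteq> 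
         {b \<in> {\<tau> - int (r j)<..\<tau> - int (r j) + int (bond i j) * D}. D dvd b - t}"
      proof clarify
        fix b assume b: "b \<in> {\<tau> - int (r j)<..\<tau> + int (r j)}" "linked (i, a) (j, b)"
        then have "D dvd - (a - b - int (max (r i) (r j)))"
          unfolding dvd_minus_iff by (simp add: linked_def D_def)
        then show "b \<in> {\<tau> - int (r j)<..\<tau> - int (r j) + int (bond i j) * D} \<and> D dvd b - t"
          using b(1) len by (simp add: t_def algebra_simps)
      qed
      then have "card {b \<in> {\<tau> - int (r j)<..\<tau> + int (r j)}. linked (i, a) (j, b)} \<le> 
         card {b \<in> {\<tau> - int (r j)<..\<tau> - int (r j) + int (bond i j) * D}. D dvd b - t}"
        by (rule card_mono[rotated]) (rule finite_subset[of _ "{\<tau> - int (r j)<..\<tau> - int (r j) + int (bond i j) * D}"], auto)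
      also have "\<dots> \<le> bond i j" by (rule card_residue_class_interval[OF \<open>D > 0\<close>])
      finally show ?thesis .
    qed
    then show "real (card {b \<in> {\<tau> - int (r j)<..\<tau> + int (r j)}. linked (i, a) (j, b)}) \<le> real (bond i j)" by simp
  qed
  finally show ?thesis .
qed

text \<open>The margin left on the diagonal once the cross terms of the energy are absorbed.\<close>

definition gap :: "'n \<Rightarrow> real" where
  "gap i = (\<Sum>j\<in>UNIV. of_int (C $ i $ j) * pvec j) / pvec i"

lemma gap_pos: "gap i > 0"
  using pvec by (simp add: gap_def)

lemma gap_eq: "gap i = 2 - (\<Sum>j\<in>UNIV - {i}. real (bond i j) * (pvec j / pvec i))"
proof -
  have "(\<Sum>j\<in>UNIV. of_int (C $ i $ j) * pvec j) = 2 * pvec i + (\<Sum>j\<in>UNIV - {i}. of_int (C $ i $ j) * pvec j)"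
    by (subst sum.remove[of _ i]) (auto simp: diag)
  also have "(\<Sum>j\<in>UNIV - {i}. of_int (C $ i $ j) * pvec j) = (\<Sum>j\<in>UNIV - {i}. - (real (bond i j) * pvec j))"
    using off_diag[of i] by (intro sum.cong refl) (auto simp: bond_def)
  finally show ?thesis using pvec(1)[of i]
    by (simp add: gap_def sum_negf diff_divide_distrib sum_divide_distrib)
qed

text \<open>\<open>weighted_am_gm\<close> on linked pairs followed by \<open>sum_linked_le\<close>:
  the row of index \<open>i\<close> loses at most the sum of bond_ij pvec_j / pvec_i, which is 2 -
  gap_i. The energy thus inherits definiteness from \<open>C\<close>.\<close>

lemma energy_lower_bound:
  "(\<Sum>u\<in>window \<tau>. gap (fst u) * (of_int (case_prod x u))\<^sup>2) \<le> of_int (energy x (window \<tau>))"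
proof -
  let ?x = "\<lambda>u. of_int (case_prod x u) :: real"
  let ?I = "\<lambda>u v. of_bool (linked u v) :: real"
  have "(\<Sum>u\<in>window \<tau>. \<Sum>v\<in>window \<tau>. ?I u v * ?x u * ?x v) \<le>
    (\<Sum>u\<in>window \<tau>. \<Sum>v\<in>window \<tau>. ?I u v * (((?x u)\<^sup>2 * (pvec (fst v) / pvec (fst u)) + (?x v)\<^sup>2 * (pvec (fst u) / pvec (fst v))) / 2))"
    unfolding mult.assoc by (intro sum_mono mult_left_mono weighted_am_gm) simp
  also have "\<dots> = (\<Sum>u\<in>window \<tau>. \<Sum>v\<in>window \<tau>. ?I u v * ((?x u)\<^sup>2 * (pvec (fst v) / pvec (fst u)))) / 2 +
      (\<Sum>u\<in>window \<tau>. \<Sum>v\<in>window \<tau>. ?I u v * ((?x v)\<^sup>2 * (pvec (fst u) / pvec (fst v)))) / 2"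
    by (simp add: sum.distrib[symmetric] sum_divide_distrib add_divide_distrib distrib_left)
  also have "(\<Sum>u\<in>window \<tau>. \<Sum>v\<in>window \<tau>. ?I u v * ((?x v)\<^sup>2 * (pvec (fst u) / pvec (fst v)))) = 
    (\<Sum>u\<in>window \<tau>. \<Sum>v\<in>window \<tau>. ?I u v * ((?x u)\<^sup>2 * (pvec (fst v) / pvec (fst u))))"
    by (subst sum.swap, intro sum.cong refl) (simp only: linked_sym)
  also have "\<And>z. z / 2 + z / 2 = (z::real)" by simp
  also have "(\<Sum>u\<in>window \<tau>. \<Sum>v\<in>window \<tau>. ?I u v * ((?x u)\<^sup>2 * (pvec (fst v) / pvec (fst u)))) =
    (\<Sum>u\<in>window \<tau>. (?x u)\<^sup>2 * (\<Sum>v\<in>window \<tau>. ?I u v * (pvec (fst v) / pvec (fst u))))"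
    unfolding sum_distrib_left by (intro sum.cong refl) (simp add: mult_ac)
  also have "\<dots> \<le> (\<Sum>u\<in>window \<tau>. (?x u)\<^sup>2 * (2 - gap (fst u)))"
  proof (intro sum_mono mult_left_mono)
    fix u
    have "(\<Sum>v\<in>window \<tau>. ?I (fst u, snd u) v * (pvec (fst v) / pvec (fst u))) \<le>
       (\<Sum>j\<in>UNIV - {fst u}. real (bond (fst u) j) * (pvec j / pvec (fst u)))"
      using pvec(1) by (intro sum_linked_le) (auto simp: less_imp_le)
    then show "(\<Sum>v\<in>window \<tau>. ?I u v * (pvec (fst v) / pvec (fst u))) \<le> 2 - gap (fst u)"
      by (simp add: gap_eq)
  qed simp
  finally have "(\<Sum>u\<in>window \<tau>. \<Sum>v\<in>window \<tau>. ?I u v * ?x u * ?x v) \<le> (\<Sum>u\<in>window \<tau>. (?x u)\<^sup>2 * (2 - gap (fst u)))" .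
  moreover have "of_int (energy x (window \<tau>)) = 2 * (\<Sum>u\<in>window \<tau>. (?x u)\<^sup>2) - (\<Sum>u\<in>window \<tau>. \<Sum>v\<in>window \<tau>. ?I u v * ?x u * ?x v)"
    by (simp add: energy_def)
  ultimately show ?thesis
    by (simp add: algebra_simps sum_subtractf sum_distrib_left)
qed

section \<open>Boundedness and periodicity of the solution\<close>

text \<open>The source of \<open>sol\<close> sits at time 0, so conservation starts from
  \<open>window 0\<close>.\<close>

lemma sol_energy: "energy (sol l) (window (int n)) = energy (sol l) (window 0)"
proof (induction n)
  case (Suc n)
  then show ?case using energy_conserved[of "sol l" "int (Suc n)"] by (simp add: Cop_sol)
qed simp

lemma sol_bounded: "\<exists>B. \<forall>i a. \<bar>sol l i a\<bar> \<le> B"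
proof -
  define E where "E = real_of_int (energy (sol l) (window 0))"
  define g where "g = Min (range gap)"
  have g: "g > 0" "g \<le> gap i" for i
    using gap_pos by (auto simp: g_def intro: Min_le)
  have bound: "g * (of_int (sol l i a))\<^sup>2 \<le> E" if "a \<ge> int (r i)" for i a
  proof -
    \<comment> \<open>The time of the window whose last position for the index \<open>i\<close> is
      \<open>a\<close>.\<close>
    define \<tau> where "\<tau> = nat (a - int (r i))"
    have mem: "(i, a) \<in> window (int \<tau>)"
      using that r_pos[of i] by (auto simp: window_def \<tau>_def)
    have "g * (of_int (sol l i a))\<^sup>2 \<le> gap i * (of_int (sol l i a))\<^sup>2"
      using g by (intro mult_right_mono) auto
    also have "\<dots> = (\<Sum>u\<in>{(i, a)}. gap (fst u) * (of_int (case_prod (sol l) u))\<^sup>2)" by simp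
    also have "\<dots> \<le> (\<Sum>u\<in>window (int \<tau>). gap (fst u) * (of_int (case_prod (sol l) u))\<^sup>2)"
      using mem gap_pos by (intro sum_mono2 finite_window) (auto simp: less_imp_le)
    also have "\<dots> \<le> E"
      unfolding E_def sol_energy[of l \<tau>, symmetric] by (rule energy_lower_bound)
    finally show ?thesis .
  qed
  have "\<bar>sol l i a\<bar> \<le> max 0 \<lceil>E / g\<rceil>" for i a
  proof (cases "a \<ge> int (r i)")
    case True
    have "\<bar>sol l i a\<bar> \<le> (sol l i a)\<^sup>2"
      using power_increasing[of 1 2 "\<bar>sol l i a\<bar>"] by (cases "sol l i a = 0") auto
    then have "real_of_int \<bar>sol l i a\<bar> \<le> (of_int (sol l i a))\<^sup>2" 
      by (metis of_int_le_iff of_int_power)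
    also have "\<dots> \<le> E / g" using bound[OF True] g(1) by (simp add: field_simps)
    finally show ?thesis by linarith
  qed (simp add: sol_low)
  then show ?thesis by blast
qed

text \<open>Bounded integral states take finitely many values, so two of them coincide; a state
  determines its successor, and the sequence repeats from there on.\<close>

theorem sol_periodic: "\<exists>N>0. \<exists>a0. \<forall>i a. a > a0 \<longrightarrow> sol l i (a + int N) = sol l i a"
proof -
  obtain B where B: "\<And>i a. \<bar>sol l i a\<bar> \<le> B" using sol_bounded by blast
  define st where "st = (\<lambda>\<tau>::nat. \<lambda>u\<in>window 0. sol l (fst u) (int \<tau> + snd u))"
  have "range st \<subseteq> window 0 \<rightarrow>\<^sub>E {-B..B}"
    using B by (auto simp: st_def abs_le_iff) (metis minus_le_iff)
  then have "finite (range st)"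
    by (rule finite_subset) (intro finite_PiE finite_window, simp)
  then have "\<not> inj st" using finite_imageD by fastforce
  then obtain m1 m2 where m: "m1 \<noteq> m2" "st m1 = st m2" by (auto simp: inj_def)
  then obtain t N where tN: "N > 0" "st (t + N) = st t"
    by (metis add_diff_inverse_nat linorder_neqE_nat not_less_iff_gr_or_eq zero_less_diff)
  have stE: "sol l i (int p + b) = sol l i (int q + b)" 
    if "st p = st q" "- int (r i) < b" "b \<le> int (r i)" for p q i b
    using fun_cong[OF that(1), of "(i, b)"] that by (simp add: st_def window_def)
  have step: "st (p + N) = st p" if "p \<ge> t" for p
    using that
  proof (induction p rule: dec_induct)
    case (step p)
    show ?case
    proof
      fix u :: "'n \<times> int"
      obtain i b where u: "u = (i, b)" by (cases u)
      show "st (Suc p + N) u = st (Suc p) u"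
      proof (cases "u \<in> window 0")
        case True
        then have b: "- int (r i) < b" "b \<le> int (r i)" by (auto simp: u window_def)
        have "sol l i (int (Suc p + N) + b) = sol l i (int (Suc p) + b)"
        \<comment> \<open>Advancing the window merely shifts all positions except the last one,
          which the recurrence produces from the old state.\<close>
        proof (cases "b = int (r i)")
          case False
          then show ?thesis using stE[OF step.IH, of i "b + 1"] b by (simp add: add_ac)
        next
          case True
          have val: "sol l i (int (Suc p) + int (r i)) = 
             (\<Sum>j\<in>UNIV - {i}. \<Sum>k\<in>exps i j. sol l j (int (Suc p) + k)) - sol l i (int (Suc p) - int (r i))" for p
            using Cop_sol[of l i "int (Suc p)"] by (simp add: Cop_def)
          have "sol l i (int (Suc (p + N)) - int (r i)) = sol l i (int (Suc p) - int (r i))"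
            using stE[OF step.IH, of i "1 - int (r i)"] r_pos[of i] by (simp add: algebra_simps)
          moreover have "(\<Sum>j\<in>UNIV - {i}. \<Sum>k\<in>exps i j. sol l j (int (Suc (p + N)) + k)) =
            (\<Sum>j\<in>UNIV - {i}. \<Sum>k\<in>exps i j. sol l j (int (Suc p) + k))"
          proof (intro sum.cong refl)
            fix j k assume "j \<in> UNIV - {i}" "k \<in> exps i j"
            then have "\<bar>k\<bar> < int (r j)" by (intro exps_lt[of k i j]) auto
            then show "sol l j (int (Suc (p + N)) + k) = sol l j (int (Suc p) + k)"
              using stE[OF step.IH, of j "1 + k"] by (simp add: algebra_simps)
          qed
          ultimately show ?thesis using val[of p] val[of "p + N"] True by simp
        qed
        then show ?thesis using True by (simp add: st_def u)
      qed (simp add: st_def)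
    qed
  qed (use tN in simp)
  have "sol l i (a + int N) = sol l i a" if "a > int t" for i a
  proof -
    define p where "p = nat a"
    have "sol l i (int (p + N) + 0) = sol l i (int p + 0)"
      using that r_pos[of i] by (intro stE step) (auto simp: p_def)
    then show ?thesis using that by (simp add: p_def)
  qed
  then show ?thesis using tN(1) by blast
qed

end

section \<open>The ring \<open>\<UU>\<close>\<close>

definition rpoly :: "rat poly \<Rightarrow> 'a::field_char_0 \<Rightarrow> 'a" where
  "rpoly p x = poly (map_poly of_rat p) x"

lemma rpoly_0 [simp]: "rpoly 0 x = 0" and rpoly_pCons: "rpoly (pCons a p) x = of_rat a + x * rpoly p x"
  by (simp_all add: rpoly_def map_poly_pCons)

lemma rpoly_1 [simp]: "rpoly 1 x = 1"
  by (simp add: rpoly_def)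

lemma rpoly_add: "rpoly (p + q) x = rpoly p x + rpoly q x"
  by (induction p q rule: poly_induct2) (simp_all add: rpoly_pCons of_rat_add algebra_simps)

lemma rpoly_smult: "rpoly (Polynomial.smult c p) x = of_rat c * rpoly p x"
  by (induction p) (simp_all add: rpoly_pCons of_rat_mult algebra_simps)

lemma rpoly_mult: "rpoly (p * q) x = rpoly p x * rpoly q x"
  by (induction p) (simp_all add: rpoly_pCons rpoly_add rpoly_smult algebra_simps)

lemma rpoly_minus: "rpoly (- p) x = - rpoly p x"
  by (induction p) (simp_all add: rpoly_pCons of_rat_minus)

text \<open>The local ring at \<open>x\<close>: on it \<open>ratfun_at\<close> does not depend on
  the chosen fraction and is a homomorphism.\<close>

definition reg_at :: "'a::field_char_0 \<Rightarrow> ratfun \<Rightarrow> bool" where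
  "reg_at x R \<longleftrightarrow> (\<exists>a b. R = Fract a b \<and> rpoly b x \<noteq> 0)"

lemma ratfun_at_Fract:
  assumes "rpoly b x \<noteq> 0"
  shows "ratfun_at (Fract a b) x = rpoly a x / rpoly b x"
  unfolding ratfun_at_def
proof (rule the_equality)
  show "\<exists>a' b'. Fract a b = Fract a' b' \<and> poly (map_poly of_rat b') x \<noteq> 0 \<and>
    rpoly a x / rpoly b x = poly (map_poly of_rat a') x / poly (map_poly of_rat b') x"
    using assms by (auto simp: rpoly_def)
next
  fix v assume "\<exists>a' b'. Fract a b = Fract a' b' \<and> poly (map_poly of_rat b') x \<noteq> 0 \<and>
     v = poly (map_poly of_rat a') x / poly (map_poly of_rat b') x"
  then obtain a' b' where ab: "Fract a b = Fract a' b'" "rpoly b' x \<noteq> 0" "v = rpoly a' x / rpoly b' x"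
    by (auto simp: rpoly_def)
  have "b \<noteq> 0" "b' \<noteq> 0" using assms ab(2) by auto
  then have "a * b' = a' * b" using ab(1) by (simp add: eq_fract)
  then have "rpoly a x * rpoly b' x = rpoly a' x * rpoly b x" by (metis rpoly_mult)
  then show "v = rpoly a x / rpoly b x" using assms ab by (simp add: frac_eq_eq)
qed

lemma reg_atE:
  assumes "reg_at x R"
  obtains a b where "R = Fract a b" "rpoly b x \<noteq> 0" "b \<noteq> 0" "ratfun_at R x = rpoly a x / rpoly b x"
  using assms ratfun_at_Fract[where x = x] by (auto simp: reg_at_def) (metis rpoly_0)

lemma reg_at_FractI: "rpoly b x \<noteq> 0 \<Longrightarrow> reg_at x (Fract a b)"
  by (auto simp: reg_at_def)

lemma reg_at_add: 
  assumes "reg_at x R" "reg_at x S"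
  shows "reg_at x (R + S)" "ratfun_at (R + S) x = ratfun_at R x + ratfun_at S x"
proof -
  obtain a b where R: "R = Fract a b" "rpoly b x \<noteq> 0" "b \<noteq> 0" "ratfun_at R x = rpoly a x / rpoly b x"
    using assms(1) by (rule reg_atE)
  obtain c d where S: "S = Fract c d" "rpoly d x \<noteq> 0" "d \<noteq> 0" "ratfun_at S x = rpoly c x / rpoly d x"
    using assms(2) by (rule reg_atE)
  have e: "R + S = Fract (a * d + c * b) (b * d)" using R S by simp
  have nz: "rpoly (b * d) x \<noteq> 0" using R S by (simp add: rpoly_mult)
  show "reg_at x (R + S)" unfolding e by (rule reg_at_FractI[OF nz])
  show "ratfun_at (R + S) x = ratfun_at R x + ratfun_at S x"
    unfolding e ratfun_at_Fract[OF nz] R(4) S(4) using R(2) S(2) 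
    by (simp add: rpoly_mult rpoly_add field_simps)
qed

lemma reg_at_mult: 
  assumes "reg_at x R" "reg_at x S"
  shows "reg_at x (R * S)" "ratfun_at (R * S) x = ratfun_at R x * ratfun_at S x"
proof -
  obtain a b where R: "R = Fract a b" "rpoly b x \<noteq> 0" "b \<noteq> 0" "ratfun_at R x = rpoly a x / rpoly b x"
    using assms(1) by (rule reg_atE)
  obtain c d where S: "S = Fract c d" "rpoly d x \<noteq> 0" "d \<noteq> 0" "ratfun_at S x = rpoly c x / rpoly d x"
    using assms(2) by (rule reg_atE)
  have e: "R * S = Fract (a * c) (b * d)" using R S by simp
  have nz: "rpoly (b * d) x \<noteq> 0" using R S by (simp add: rpoly_mult)
  show "reg_at x (R * S)" unfolding e by (rule reg_at_FractI[OF nz])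
  show "ratfun_at (R * S) x = ratfun_at R x * ratfun_at S x"
    unfolding e ratfun_at_Fract[OF nz] R(4) S(4) using R(2) S(2) 
    by (simp add: rpoly_mult)
qed

lemma reg_at_inverse: 
  assumes "reg_at x R" "ratfun_at R x \<noteq> 0"
  shows "reg_at x (inverse R)" "ratfun_at (inverse R) x = inverse (ratfun_at R x)"
proof -
  obtain a b where R: "R = Fract a b" "rpoly b x \<noteq> 0" "b \<noteq> 0" "ratfun_at R x = rpoly a x / rpoly b x"
    using assms(1) by (rule reg_atE)
  have nz: "rpoly a x \<noteq> 0" using assms(2) R by auto
  have e: "inverse R = Fract b a" using R by simp
  show "reg_at x (inverse R)" unfolding e by (rule reg_at_FractI[OF nz])
  show "ratfun_at (inverse R) x = inverse (ratfun_at R x)"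
    unfolding e ratfun_at_Fract[OF nz] R(4) by simp
qed

lemma reg_at_minus: 
  assumes "reg_at x R"
  shows "reg_at x (- R)" "ratfun_at (- R) x = - ratfun_at R x"
proof -
  obtain a b where R: "R = Fract a b" "rpoly b x \<noteq> 0" "b \<noteq> 0" "ratfun_at R x = rpoly a x / rpoly b x"
    using assms(1) by (rule reg_atE)
  have e: "- R = Fract (- a) b" using R by simp
  show "reg_at x (- R)" unfolding e by (rule reg_at_FractI[OF R(2)])
  show "ratfun_at (- R) x = - ratfun_at R x"
    unfolding e ratfun_at_Fract[OF R(2)] R(4) by (simp add: rpoly_minus)
qed

lemma reg_at_diff: 
  assumes "reg_at x R" "reg_at x S"
  shows "reg_at x (R - S)" "ratfun_at (R - S) x = ratfun_at R x - ratfun_at S x"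
  using reg_at_add[OF assms(1) reg_at_minus(1)[OF assms(2)]] reg_at_minus(2)[OF assms(2)] by simp_all

lemma reg_at_1: "reg_at x 1" "ratfun_at 1 x = 1"
  using reg_at_FractI[of 1 x 1] ratfun_at_Fract[of 1 x 1] by (simp_all add: One_fract_def)

lemma reg_at_0: "reg_at x 0" "ratfun_at 0 x = 0"
  using reg_at_FractI[of 1 x 0] ratfun_at_Fract[of 1 x 0] by (simp_all add: Zero_fract_def)

lemma reg_at_zvar: "reg_at x zvar" "ratfun_at zvar x = x"
  using reg_at_FractI[of 1 x "[:0, 1:]"] ratfun_at_Fract[of 1 x "[:0, 1:]"] 
  by (simp_all add: zvar_def rpoly_pCons)

lemma reg_at_power: 
  assumes "reg_at x R"
  shows "reg_at x (R ^ n)" "ratfun_at (R ^ n) x = ratfun_at R x ^ n"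
proof -
  have "reg_at x (R ^ n) \<and> ratfun_at (R ^ n) x = ratfun_at R x ^ n"
    by (induction n) (auto simp: reg_at_1 reg_at_mult assms)
  then show "reg_at x (R ^ n)" "ratfun_at (R ^ n) x = ratfun_at R x ^ n" by auto
qed

lemma reg_at_of_nat: "reg_at x (of_nat n) \<and> ratfun_at (of_nat n) x = of_nat n"
  by (induction n) (auto simp: reg_at_0 reg_at_1 reg_at_add)

lemma reg_at_of_int: "reg_at x (of_int n)" "ratfun_at (of_int n) x = of_int n"
  using reg_at_of_nat[of x] by (cases n rule: int_cases2; auto simp: reg_at_minus)+

lemma reg_at_sum: 
  assumes "\<And>i. i \<in> A \<Longrightarrow> reg_at x (f i)"
  shows "reg_at x (\<Sum>i\<in>A. f i) \<and> ratfun_at (\<Sum>i\<in>A. f i) x = (\<Sum>i\<in>A. ratfun_at (f i) x)"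
  using assms by (induction A rule: infinite_finite_induct) (auto simp: reg_at_0 reg_at_add)

lemma zvar_nonzero: "zvar \<noteq> 0"
  using reg_at_zvar(2)[of "1::complex"] reg_at_0(2)[of "1::complex"] by auto

lemma zvar_neq_inverse: "zvar \<noteq> inverse zvar"
proof
  assume e: "zvar = inverse zvar"
  have "ratfun_at (inverse zvar) (2::complex) = inverse 2"
    using reg_at_inverse(2)[OF reg_at_zvar(1)[of "2::complex"]] by (simp add: reg_at_zvar)
  then show False using reg_at_zvar(2)[of "2::complex"] e by simp
qed

lemma reg_at_inverse_zvar:
  assumes "x \<noteq> 0"
  shows "reg_at x (inverse zvar)" "ratfun_at (inverse zvar) x = inverse x"
  using reg_at_inverse[OF reg_at_zvar(1)] assms by (auto simp: reg_at_zvar)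

lemma reg_at_zvar_powi:
  assumes "x \<noteq> 0"
  shows "reg_at x (zvar powi n)" "ratfun_at (zvar powi n) x = x powi n"
  using reg_at_power[OF reg_at_inverse_zvar(1)[OF assms]] reg_at_power[OF reg_at_zvar(1)] assms
  by (auto simp: power_int_def reg_at_zvar reg_at_inverse_zvar)

lemma reg_at_int_poly:
  assumes "reg_at x R"
  shows "reg_at x (poly (map_poly of_int p) R) \<and> 
    ratfun_at (poly (map_poly of_int p) R) x = poly (map_poly of_int p) (ratfun_at R x)"
  by (induction p) (auto simp: map_poly_pCons reg_at_0 reg_at_of_int reg_at_add reg_at_mult assms)

section \<open>Closure properties and poles of \<UU>\<close>

lemma UU_induct [consumes 1, case_names zero base diff]:
  assumes "R \<in> \<UU>" "P 0" 
    "\<And>k p Q. poly Q 0 = 1 \<Longrightarrow> (\<And>\<zeta>::complex. poly (map_poly of_int Q) \<zeta> = 0 \<Longrightarrow> \<exists>N>0. \<zeta> ^ N = 1) \<Longrightarrow>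
       P (inverse zvar ^ k * poly (map_poly of_int p) zvar / poly (map_poly of_int Q) (inverse zvar))"
    "\<And>R S. R \<in> \<UU> \<Longrightarrow> S \<in> \<UU> \<Longrightarrow> P R \<Longrightarrow> P S \<Longrightarrow> P (R - S)"
  shows "P R"
  using assms(1) unfolding \<UU>_def
proof (induction rule: group_closure.induct)
  case (base s)
  then show ?case using assms(2,3) by blast
next
  case (diff s t)
  then show ?case using assms(4) unfolding \<UU>_def by blast
qed

lemma UU_base:
  assumes "poly Q 0 = 1" "\<And>\<zeta>::complex. poly (map_poly of_int Q) \<zeta> = 0 \<Longrightarrow> \<exists>N>0. \<zeta> ^ N = 1"
  shows "inverse zvar ^ k * poly (map_poly of_int p) zvar / poly (map_poly of_int Q) (inverse zvar) \<in> \<UU>"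
  unfolding \<UU>_def using assms by (intro group_closure.base insertI2) blast

lemma UU_0 [simp]: "0 \<in> \<UU>" and UU_diff: "R \<in> \<UU> \<Longrightarrow> S \<in> \<UU> \<Longrightarrow> R - S \<in> \<UU>"
  and UU_add: "R \<in> \<UU> \<Longrightarrow> S \<in> \<UU> \<Longrightarrow> R + S \<in> \<UU>" and UU_minus: "R \<in> \<UU> \<Longrightarrow> - R \<in> \<UU>"
  unfolding \<UU>_def by (auto intro: group_closure.diff group_closure_add)

lemma poly_map_of_int_mult: 
  "poly (map_poly of_int (p * q)) x = poly (map_poly of_int p) x * poly (map_poly of_int q) (x::'a::comm_ring_1)"
proof -
  have add: "poly (map_poly of_int (p + q)) x = poly (map_poly of_int p) x + poly (map_poly of_int q) x" for p q :: "int poly"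
    by (induction p q rule: poly_induct2) (simp_all add: map_poly_pCons algebra_simps)
  have smult: "poly (map_poly of_int (Polynomial.smult c p)) x = of_int c * poly (map_poly of_int p) x" for c and p :: "int poly"
    by (induction p) (simp_all add: map_poly_pCons algebra_simps)
  show ?thesis
    by (induction p) (simp_all add: map_poly_pCons add smult algebra_simps)
qed

lemma UU_mult:
  assumes "R \<in> \<UU>" "S \<in> \<UU>"
  shows "R * S \<in> \<UU>"
  using assms(1)
proof (induction rule: UU_induct)
  case (base k p Q)
  note Q = base
  show ?case using assms(2)
  proof (induction rule: UU_induct)
    case (base k' p' Q')
    have "inverse zvar ^ (k + k') * poly (map_poly of_int (p * p')) zvar / poly (map_poly of_int (Q * Q')) (inverse zvar) \<in> \<UU>"
      using Q base by (intro UU_base) (auto simp: poly_map_of_int_mult)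
    then show ?case by (simp add: poly_map_of_int_mult power_add mult_ac)
  next
    case (diff R S)
    then show ?case using UU_diff by (simp add: right_diff_distrib)
  qed simp
next
  case (diff R S)
  then show ?case using UU_diff by (simp add: left_diff_distrib)
qed simp

lemma UU_Laurent: "inverse zvar ^ k * poly (map_poly of_int p) zvar \<in> \<UU>"
  using UU_base[of 1 k p] by simp

lemma UU_1 [simp]: "1 \<in> \<UU>"
  using UU_Laurent[of 0 1] by simp

lemma UU_of_int [simp]: "of_int n \<in> \<UU>"
  using UU_Laurent[of 0 "[:n:]"] by (simp add: map_poly_pCons)

lemma UU_zvar_powi [simp]: "zvar powi n \<in> \<UU>"
proof -
  have z: "zvar \<in> \<UU>" using UU_Laurent[of 0 "[:0, 1:]"] by (simp add: map_poly_pCons)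
  have i: "inverse zvar \<in> \<UU>" using UU_Laurent[of 1 1] by simp
  have "zvar ^ n \<in> \<UU>" "inverse zvar ^ n \<in> \<UU>" for n
    by (induction n) (auto intro: UU_mult z i)
  then show ?thesis by (auto simp: power_int_def)
qed

lemma UU_sum: "(\<And>i. i \<in> A \<Longrightarrow> f i \<in> \<UU>) \<Longrightarrow> (\<Sum>i\<in>A. f i) \<in> \<UU>"
  by (induction A rule: infinite_finite_induct) (auto intro: UU_add)

text \<open>The zeros of Q = 1 - X^N are roots of unity. This inverse sums the periodic tails in
  \<open>column_solution\<close>.\<close>

lemma UU_periodic:
  assumes "N > 0"
  shows "inverse (1 - zvar powi (- int N)) \<in> \<UU>"
proof -
  let ?Q = "1 - Polynomial.monom 1 N :: int poly"
  have e: "poly (map_poly of_int ?Q) x = 1 - x ^ N" for x :: "'a::comm_ring_1"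
  proof -
    have "map_poly of_int ?Q = (1 - Polynomial.monom 1 N :: 'a poly)"
      by (intro poly_eqI) (simp add: coeff_map_poly)
    then show ?thesis by (simp add: poly_monom)
  qed
  have "inverse zvar ^ 0 * poly (map_poly of_int 1) zvar / poly (map_poly of_int ?Q) (inverse zvar) \<in> \<UU>"
    using assms by (intro UU_base) (auto simp: e poly_monom)
  then show ?thesis by (simp add: e power_int_minus power_inverse inverse_eq_divide power_one_over)
qed

text \<open>Away from 0, the poles of an element of \<UU> are inverses of zeros of \<open>Q\<close>,
  hence roots of unity.\<close>

lemma UU_regular:
  assumes "R \<in> \<UU>" "x \<noteq> 0" "\<And>N. N > 0 \<Longrightarrow> x ^ N \<noteq> (1::complex)"
  shows "reg_at x R"
  using assms(1)
proof (induction rule: UU_induct)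
  case (base k p Q)
  have "poly (map_poly of_int Q) (inverse x) \<noteq> 0"
  proof
    assume "poly (map_poly of_int Q) (inverse x) = 0"
    then obtain N where "N > 0" "inverse x ^ N = 1" using base(2) by blast
    then show False using assms(3)[of N] assms(2) by (simp add: power_inverse)
  qed
  then show ?case
    unfolding divide_inverse
    using assms(2) reg_at_int_poly[OF reg_at_zvar(1), of x p] reg_at_int_poly[OF reg_at_inverse_zvar(1), of x Q]
    by (intro reg_at_mult(1) reg_at_inverse(1) reg_at_power(1) reg_at_inverse_zvar(1)) (auto simp: reg_at_inverse_zvar)
qed (auto simp: reg_at_0 reg_at_diff)

subsection \<open>Expansion in \<open>z\<^sup>-\<^sup>1\<close>\<close>

lemma of_rat_fls: "of_rat a = (fls_const a :: rat fls)"
proof (cases a)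
  case (Fract p q)
  have "(fls_const a :: rat fls) * of_int q = of_int p"
    using Fract(2) unfolding fls_of_int Fract(1) 
    by (simp add: Fract_of_int_quotient)
  moreover have "(of_int q :: rat fls) \<noteq> 0" using Fract(2) by simp
  ultimately have "fls_const a = (of_int p / of_int q :: rat fls)" by (metis eq_divide_imp)
  then show ?thesis unfolding Fract(1) using Fract(2) 
    by (simp add: of_rat_rat)
qed

lemma rpoly_X_inv_high: "k > 0 \<Longrightarrow> fls_nth (rpoly p (fls_X_inv :: rat fls)) k = 0"
  by (induction p arbitrary: k) (auto simp: rpoly_pCons of_rat_fls fls_X_inv_times_conv_shift)

lemma rpoly_X_inv_nth: "fls_nth (rpoly p (fls_X_inv :: rat fls)) (- int n) = Polynomial.coeff p n"
proof (induction p arbitrary: n)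
  case (pCons a p)
  then show ?case
    by (cases n) (auto simp: rpoly_pCons of_rat_fls fls_X_inv_times_conv_shift rpoly_X_inv_high)
qed simp

text \<open>\<open>fls_X_inv\<close> is transcendental over the rationals:
  \<open>rpoly_X_inv_nth\<close> recovers every coefficient of a polynomial from its value there, so
  no nonzero denominator vanishes.\<close>

lemma reg_at_X_inv: "reg_at (fls_X_inv :: rat fls) R"
proof (cases R)
  case (Fract a b)
  have "rpoly b (fls_X_inv :: rat fls) \<noteq> 0"
  proof
    assume "rpoly b (fls_X_inv :: rat fls) = 0"
    then have "Polynomial.coeff b n = 0" for n using rpoly_X_inv_nth[of b n] by simp
    then show False using Fract by (simp add: poly_eq_iff)
  qed
  then show ?thesis unfolding Fract by (rule reg_at_FractI)
qed

definition int_fls :: "rat fls \<Rightarrow> bool" where "int_fls f \<longleftrightarrow> (\<forall>n. fls_nth f n \<in> \<int>)"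

lemma int_fls_mult: 
  assumes "int_fls f" "int_fls g" shows "int_fls (f * g)"
  using assms unfolding int_fls_def fls_times_nth(1) by (auto intro!: Ints_sum Ints_mult)

text \<open>Constant term 1 lets the convolution identity be solved for each coefficient without
  division.\<close>

lemma int_fps_inverse:
  fixes g :: "rat fps"
  assumes "\<And>n. fps_nth g n \<in> \<int>" "fps_nth g 0 = 1"
  shows "fps_nth (inverse g) n \<in> \<int>"
proof (induction n rule: less_induct)
  case (less n)
  show ?case
  proof (cases "n = 0")
    case False
    have "g * inverse g = 1" using assms(2) by (intro inverse_mult_eq_1') simp
    then have "fps_nth (g * inverse g) n = 0" using False by simp
    then have "fps_nth g 0 * fps_nth (inverse g) n + (\<Sum>i\<in>{0<..n}. fps_nth g i * fps_nth (inverse g) (n - i)) = 0"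
      by (simp add: fps_mult_nth sum.head)
    then have "fps_nth (inverse g) n = - (\<Sum>i\<in>{0<..n}. fps_nth g i * fps_nth (inverse g) (n - i))"
      using assms(2) by simp
    then show ?thesis using assms(1) less by (auto intro!: Ints_minus Ints_sum Ints_mult)
  qed (use assms in simp)
qed

lemma int_poly_X:
  "\<exists>g :: rat fps. poly (map_poly of_int Q) fls_X = fps_to_fls g \<and> (\<forall>n. fps_nth g n \<in> \<int>) \<and> fps_nth g 0 = of_int (poly Q 0)"
proof (induction Q)
  case (pCons a Q)
  then obtain g :: "rat fps" where g: "poly (map_poly of_int Q) fls_X = fps_to_fls g" "\<And>n. fps_nth g n \<in> \<int>" by blast
  have "poly (map_poly of_int (pCons a Q)) fls_X = fps_to_fls (of_int a + fps_X * g)"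
    by (simp add: map_poly_pCons g(1) fls_times_fps_to_fls)
  moreover have "fps_nth (of_int a + fps_X * g) n \<in> \<int>" for n
    using g(2) by (cases n) (auto simp: fps_of_int[symmetric])
  moreover have "fps_nth (of_int a + fps_X * g) 0 = of_int (poly (pCons a Q) 0)"
    by (simp add: fps_of_int[symmetric])
  ultimately show ?case by blast
qed (auto intro: exI[of _ 0])

text \<open>Integrality of the expansion, by which the floor in \<open>zcoeff\<close> loses nothing
  and \<open>zcoeff\<close> is additive on \<UU>.\<close>

lemma UU_int_fls: "R \<in> \<UU> \<Longrightarrow> int_fls (ratfun_at R fls_X_inv)"
proof (induction rule: UU_induct)
  case zero
  then show ?case by (simp add: reg_at_0 int_fls_def)
next
  case (base k p Q)
  let ?X = "fls_X_inv :: rat fls"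
  have inv: "inverse ?X = fls_X" by (rule fls_inverse_X_inv)
  have [simp]: "?X \<noteq> 0" by simp
  obtain g :: "rat fps" where g: "poly (map_poly of_int Q) fls_X = fps_to_fls g" "\<And>n. fps_nth g n \<in> \<int>" "fps_nth g 0 = 1"
    using int_poly_X[of Q] base(1) by auto
  have "fps_to_fls (g * inverse g) = 1" 
    using g(3) by (subst inverse_mult_eq_1') auto
  then have ig: "inverse (fps_to_fls g) = fps_to_fls (inverse g)"
    by (intro inverse_unique) (simp add: fls_times_fps_to_fls)
  have "ratfun_at (poly (map_poly of_int Q) (inverse zvar)) ?X = fps_to_fls g"
    using reg_at_int_poly[OF reg_at_inverse_zvar(1), of ?X Q] g(1) inv
    by (simp add: reg_at_inverse_zvar)
  moreover have "fps_to_fls g \<noteq> 0" using g(3) by (metis fps_to_fls_eq_0_iff fps_zero_nth zero_neq_one)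
  ultimately have "ratfun_at (inverse zvar ^ k * poly (map_poly of_int p) zvar / poly (map_poly of_int Q) (inverse zvar)) ?X
     = fls_X ^ k * poly (map_poly of_int p) ?X * fps_to_fls (inverse g)"
    unfolding divide_inverse
    using reg_at_int_poly[OF reg_at_zvar(1), of ?X p] inv
    by (subst reg_at_mult(2) reg_at_inverse(2) reg_at_power(2) reg_at_inverse_zvar(2) | 
      simp add: reg_at_X_inv reg_at_zvar ig)+
  moreover have "int_fls (fls_X ^ k)" by (auto simp: int_fls_def fls_X_power_nth)
  moreover have "int_fls (poly (map_poly of_int p) ?X)"
    by (induction p) (auto simp: map_poly_pCons int_fls_def fls_of_int_nth fls_X_inv_times_conv_shift)
  moreover have "int_fls (fps_to_fls (inverse g))"
    using int_fps_inverse[OF g(2,3)] by (auto simp: int_fls_def)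
  ultimately show ?case by (simp add: int_fls_mult)
next
  case (diff R S)
  then show ?case
    by (auto simp: reg_at_diff[OF reg_at_X_inv reg_at_X_inv] int_fls_def)
qed

lemma of_int_zcoeff: "R \<in> \<UU> \<Longrightarrow> of_int (zcoeff s R) = fls_nth (ratfun_at R (fls_X_inv :: rat fls)) (- s)"
  using UU_int_fls[of R] unfolding zcoeff_def int_fls_def by (simp add: of_int_floor)

lemma zcoeff_eqI: "R \<in> \<UU> \<Longrightarrow> fls_nth (ratfun_at R (fls_X_inv :: rat fls)) (- s) = of_int n \<Longrightarrow> zcoeff s R = n"
  using of_int_zcoeff[of R s] by simp

lemma zcoeff_add: "R \<in> \<UU> \<Longrightarrow> S \<in> \<UU> \<Longrightarrow> zcoeff s (R + S) = zcoeff s R + zcoeff s S"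
  by (intro zcoeff_eqI UU_add) (auto simp: reg_at_add[OF reg_at_X_inv reg_at_X_inv] of_int_zcoeff)

lemma zcoeff_minus: "R \<in> \<UU> \<Longrightarrow> zcoeff s (- R) = - zcoeff s R"
  by (intro zcoeff_eqI UU_minus) (auto simp: reg_at_minus[OF reg_at_X_inv] of_int_zcoeff)

lemma zcoeff_diff: "R \<in> \<UU> \<Longrightarrow> S \<in> \<UU> \<Longrightarrow> zcoeff s (R - S) = zcoeff s R - zcoeff s S"
  using zcoeff_add[of R "- S"] zcoeff_minus[of S] UU_minus[of S] by simp

lemma zcoeff_of_int: "zcoeff s (of_int n) = (if s = 0 then n else 0)"
  by (intro zcoeff_eqI) (auto simp: reg_at_of_int fls_of_int_nth)

lemma zcoeff_shift:
  assumes "R \<in> \<UU>"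
  shows "zcoeff s (zvar powi n * R) = zcoeff (s - n) R"
proof -
  let ?X = "fls_X_inv :: rat fls"
  have [simp]: "?X \<noteq> 0" by simp
  have up: "fls_nth (?X ^ k * f) m = fls_nth f (m + int k)" for k f m
    by (induction k arbitrary: m) (simp_all add: power_Suc mult.assoc fls_X_inv_times_conv_shift(1) fls_shifted_times_simps add_ac)
  have down: "fls_nth (fls_X ^ k * f) m = fls_nth f (m - int k)" for k and f :: "rat fls" and m
    by (induction k arbitrary: m) (simp_all add: power_Suc mult.assoc fls_X_times_conv_shift(1) fls_shifted_times_simps algebra_simps)
  have "fls_nth (?X powi n * f) m = fls_nth f (m + n)" for f m
    using up[of "nat n" f m] down[of "nat (-n)" f m] by (auto simp: power_int_def fls_inverse_X_inv)
  then have "fls_nth (ratfun_at (zvar powi n * R) ?X) (- s) = of_int (zcoeff (s - n) R)"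
    using of_int_zcoeff[OF assms, of "s - n"]
    by (simp add: reg_at_mult(2)[OF reg_at_X_inv reg_at_X_inv] reg_at_zvar_powi algebra_simps)
  then show ?thesis using assms by (intro zcoeff_eqI UU_mult) auto
qed

subsection \<open>Evaluation at powers of \<open>q\<close>\<close>

text \<open>The powers of \<open>q\<close> are pairwise distinct, so a nonzero numerator vanishes at
  only finitely many of them.\<close>

lemma finite_zeros_on_powers:
  assumes "R \<noteq> 0" "q \<noteq> 0" "\<And>N. N > 0 \<Longrightarrow> q ^ N \<noteq> (1::complex)"
  shows "finite {m. ratfun_at R (q ^ m) = 0}"
proof (cases R)
  case (Fract a b)
  have inj: "inj (\<lambda>m. q ^ m)"
  proof (rule injI)
    fix m n assume e: "q ^ m = q ^ n"
    have "m = n" if "q ^ m = q ^ n" "m \<le> n" for m n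
    proof -
      have "q ^ m * q ^ (n - m) = q ^ n" using that(2) by (simp flip: power_add)
      then have "q ^ m * 1 = q ^ m * q ^ (n - m)" using that(1) by simp
      then have "q ^ (n - m) = 1" using assms(2) by simp
      then show ?thesis using assms(3)[of "n - m"] that by (cases "n - m") auto
    qed
    then show "m = n" using e by (metis nat_le_linear)
  qed
  have fin: "finite {m. rpoly p (q ^ m) = 0}" if "p \<noteq> 0" for p
  proof -
    have "map_poly of_rat p \<noteq> (0 :: complex poly)" using that by (simp add: map_poly_eq_0_iff)
    then have "finite {x. poly (map_poly of_rat p) x = (0::complex)}" by (rule poly_roots_finite)
    then have "finite ((\<lambda>m. q ^ m) -` {x. poly (map_poly of_rat p) x = (0::complex)})"
      using inj by (rule finite_vimageI)
    then show ?thesis by (simp add: rpoly_def vimage_def)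
  qed
  have "a \<noteq> 0" using assms(1) Fract by (auto simp: Zero_fract_def eq_fract)
  \<comment> \<open>At zeros of the denominator nothing is claimed about \<open>ratfun_at\<close>;
    these finitely many exponents are added to the exceptional set.\<close>
  have "{m. ratfun_at R (q ^ m) = 0} \<subseteq> {m. rpoly a (q ^ m) = 0} \<union> {m. rpoly b (q ^ m) = 0}"
    by (auto simp: Fract(1) ratfun_at_Fract)
  then show ?thesis using fin[OF \<open>a \<noteq> 0\<close>] fin[of b] Fract(2) by (meson finite_UnI finite_subset)
qed

section \<open>The quantized Cartan matrix\<close>

declare power_int_of_nat [simp del]

lemma exp_set_Suc: 
  "{k::int. \<bar>k\<bar> < int (Suc c) \<and> odd (k + int (Suc c))} = 
    insert (- int c) ((\<lambda>k. k + 1) ` {k. \<bar>k\<bar> < int c \<and> odd (k + int c)})" (is "?L = insert _ (_ ` ?R)")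
proof (intro equalityI subsetI)
  fix k assume k: "k \<in> ?L"
  show "k \<in> insert (- int c) ((\<lambda>k. k + 1) ` ?R)"
  proof (cases "k = - int c")
    case False
    have "k \<noteq> 1 - int c"
    proof
      assume "k = 1 - int c"
      then have "k + int (Suc c) = 2" by simp
      then have "even (k + int (Suc c))" by (simp only: even_numeral)
      then show False using k by blast
    qed
    then have "k - 1 \<in> ?R" using k False by (auto simp: abs_less_iff)
    then have "k - 1 + 1 \<in> (\<lambda>k. k + 1) ` ?R" by (rule imageI)
    then show ?thesis by simp
  qed simp
qed auto

text \<open>A geometric sum: \<open>exp_set_Suc\<close> peels off the lowest exponent and shifts the
  rest by one.\<close>

lemma qint_expand:
  fixes w :: "'a::field"
  assumes "w \<noteq> 0" "w \<noteq> inverse w"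
  shows "qint w (- int c) = - (\<Sum>k | \<bar>k\<bar> < int c \<and> odd (k + int c). w powi k)"
proof -
  let ?S = "\<lambda>c. {k::int. \<bar>k\<bar> < int c \<and> odd (k + int c)}"
  have fin: "finite (?S c)" for c by (rule finite_subset[of _ "{- int c..int c}"]) auto
  have "(w - inverse w) * (\<Sum>k\<in>?S c. w powi k) = w powi int c - w powi (- int c)"
  proof (induction c)
    case (Suc c)
    have "(\<Sum>k\<in>?S (Suc c). w powi k) = w powi (- int c) + (\<Sum>k\<in>(\<lambda>k. k + 1) ` ?S c. w powi k)"
      unfolding exp_set_Suc using fin by (subst sum.insert) auto
    also have "(\<Sum>k\<in>(\<lambda>k. k + 1) ` ?S c. w powi k) = w * (\<Sum>k\<in>?S c. w powi k)"
      using assms(1) by (subst sum.reindex) (auto simp: sum_distrib_left power_int_add mult.commute)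
    finally have "(w - inverse w) * (\<Sum>k\<in>?S (Suc c). w powi k) = 
        (w - inverse w) * w powi (- int c) + w * ((w - inverse w) * (\<Sum>k\<in>?S c. w powi k))"
      by (simp only: distrib_left mult_ac)
    also have "\<dots> = w powi (int c + 1) - w powi (- int c - 1)"
      unfolding Suc using assms(1) by (simp add: algebra_simps power_int_add power_int_diff field_simps)
    finally have "(w - inverse w) * (\<Sum>k\<in>?S (Suc c). w powi k) = w powi (int c + 1) - w powi (- int c - 1)" .
    moreover have "- int (Suc c) = - int c - 1" "int (Suc c) = int c + 1" by simp_all
    ultimately show ?case by (simp only:)
  qed simp
  then show ?thesis using assms(2) by (simp add: qint_def field_simps)
qed

lemma qint_uminus: "qint x (- l) = - qint x l"
proof -
  have "x powi - l - x powi l = - (x powi l - x powi - l)" by simp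
  then show ?thesis unfolding qint_def minus_minus by (simp only: minus_divide_left)
qed

lemma qint_mult: "x \<noteq> inverse x \<Longrightarrow> (x - inverse x) * qint x l = x powi l - x powi (- l)"
  by (simp add: qint_def)

text \<open>The exponent is - a because solutions of the recurrence list coefficients of powers of
  z^(-1). The cutoff at \<open>B\<close> is harmless as long as the support keeps the margin
  demanded in \<open>Lsum_shift\<close>.\<close>

definition Lsum :: "int \<Rightarrow> (int \<Rightarrow> int) \<Rightarrow> ratfun" where
  "Lsum B f = (\<Sum>a\<in>{-B..B}. of_int (f a) * zvar powi (- a))"

lemma Lsum_shift:
  assumes "\<And>a. \<bar>a\<bar> > b \<Longrightarrow> f a = 0" "b + \<bar>k\<bar> \<le> B"
  shows "zvar powi k * Lsum B f = Lsum B (\<lambda>s. f (s + k))"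
proof -
  let ?S = "{a \<in> {-B..B}. f a \<noteq> 0}" and ?T = "{s \<in> {-B..B}. f (s + k) \<noteq> 0}"
  have b: "\<bar>a\<bar> \<le> b" if "f a \<noteq> 0" for a using assms(1)[of a] that by force
  have "zvar powi k * Lsum B f = (\<Sum>a\<in>?S. zvar powi k * (of_int (f a) * zvar powi (- a)))"
    unfolding Lsum_def sum_distrib_left by (rule sum.mono_neutral_right) auto
  also have "\<dots> = (\<Sum>s\<in>?T. of_int (f (s + k)) * zvar powi (- s))"
  proof (rule sum.reindex_bij_witness[where i = "\<lambda>s. s + k" and j = "\<lambda>a. a - k"])
    fix a assume "a \<in> ?S"
    then show "a - k \<in> ?T" using b[of a] assms(2) by auto
    show "of_int (f (a - k + k)) * zvar powi (- (a - k)) = zvar powi k * (of_int (f a) * zvar powi (- a))"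
      using zvar_nonzero by (simp add: power_int_diff power_int_minus field_simps)
  next
    fix s assume "s \<in> ?T"
    then show "s + k \<in> ?S" using b[of "s + k"] assms(2) by auto
  qed auto
  also have "\<dots> = Lsum B (\<lambda>s. f (s + k))"
    unfolding Lsum_def by (rule sum.mono_neutral_left) auto
  finally show ?thesis .
qed

lemma Lsum_add: "Lsum B f + Lsum B g = Lsum B (\<lambda>a. f a + g a)"
  and Lsum_diff: "Lsum B f - Lsum B g = Lsum B (\<lambda>a. f a - g a)"
  by (simp_all add: Lsum_def sum.distrib[symmetric] sum_subtractf[symmetric] algebra_simps)

lemma Lsum_sum: "(\<Sum>i\<in>A. Lsum B (f i)) = Lsum B (\<lambda>a. \<Sum>i\<in>A. f i a)"
  unfolding Lsum_def by (subst sum.swap) (simp add: sum_distrib_right)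

lemma Lsum_UU: "Lsum B f \<in> \<UU>"
  unfolding Lsum_def by (intro UU_sum UU_mult) auto

lemma Lsum_delta: "\<bar>m\<bar> \<le> B \<Longrightarrow> Lsum B (\<lambda>s. of_bool (s = m)) = zvar powi (- m)"
proof -
  assume "\<bar>m\<bar> \<le> B"
  then have "(\<Sum>a\<in>{-B..B}. of_int (of_bool (a = m)) * zvar powi (- a)) = (\<Sum>a\<in>{m}. zvar powi (- a))"
    by (intro sum.mono_neutral_cong_right) auto
  then show ?thesis by (simp add: Lsum_def)
qed

context cartan_data
begin

lemma Cz_entry: "Cz C r $ i $ j = (if i = j then zvar powi int (r i) + zvar powi (- int (r i))
   else - (\<Sum>k\<in>exps i j. zvar powi k))"
proof (cases "i = j")
  case False
  then have "C $ i $ j = - int (bond i j)" using off_diag[of i j] by (simp add: bond_def)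
  then show ?thesis using False qint_expand[OF zvar_nonzero zvar_neq_inverse, of "bond i j"]
    by (simp add: Cz_def exps_def)
qed (simp add: Cz_def)

lemma Cz_UU [simp]: "Cz C r $ i $ j \<in> \<UU>"
  unfolding Cz_entry by (simp add: UU_add UU_minus UU_sum)

text \<open>The column is the generating function of \<open>sol\<close>. Multiplied by 1 - z^(-N),
  with \<open>N\<close> an eventual period, it becomes a Laurent polynomial, so the inversion takes
  place among rational functions without infinite sums.\<close>

lemma column_solution:
  "\<exists>v. (\<forall>j. v j \<in> \<UU>) \<and> (\<forall>i. (\<Sum>j\<in>UNIV. Cz C r $ i $ j * v j) = of_bool (i = l))"
proof -
  obtain N a0 where N: "N > 0" "\<And>i a. a > a0 \<Longrightarrow> sol l i (a + int N) = sol l i a"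
    using sol_periodic[of l] by blast
  \<comment> \<open>The coefficients of 1 - z^(-N) times the generating function of
    \<open>sol l i\<close>; the periodic tail cancels.\<close>
  define d where "d = (\<lambda>i a. sol l i a - sol l i (a - int N))"
  define b where "b = \<bar>a0\<bar> + int N"
  define M where "M = Max (range r)"
  have M: "r i \<le> M" for i by (auto simp: M_def)
  \<comment> \<open>The shifts in \<open>Cop\<close> move positions by at most \<open>M\<close>, so
    the support of \<open>d\<close> never leaves the summation range.\<close>
  define B where "B = b + int M"
  have supp: "d i a = 0" if "\<bar>a\<bar> > b" for i a
  proof (cases "a < 0")
    case True
    then show ?thesis using r_pos[of i] by (simp add: d_def sol_low)
  next
    case False
    then have "a - int N > a0" using that by (simp add: b_def)
    from N(2)[OF this, of i] show ?thesis by (simp add: d_def)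
  qed
  have exps_M: "\<bar>k\<bar> \<le> int M" if "k \<in> exps i j" "i \<noteq> j" for i j k
    using exps_lt[OF that] M[of j] by linarith
  have Cop_d: "Cop d i s = of_bool (i = l \<and> s = 0) - of_bool (i = l \<and> s = int N)" for i s
  proof -
    have "Cop d i s = Cop (sol l) i s - Cop (sol l) i (s - int N)"
      by (simp add: Cop_def d_def sum_subtractf algebra_simps)
    then show ?thesis by (simp add: Cop_sol)
  qed
  define D where "D = (\<lambda>j. Lsum B (d j))"
  have row: "(\<Sum>j\<in>UNIV. Cz C r $ i $ j * D j) = of_bool (i = l) * (1 - zvar powi (- int N))" for i
  proof -
    have shift: "zvar powi k * D j = Lsum B (\<lambda>s. d j (s + k))" if "\<bar>k\<bar> \<le> int M" for j k
      unfolding D_def using supp that by (intro Lsum_shift[of b]) (auto simp: B_def)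
    have "(\<Sum>j\<in>UNIV. Cz C r $ i $ j * D j) = Cz C r $ i $ i * D i + (\<Sum>j\<in>UNIV - {i}. Cz C r $ i $ j * D j)"
      by (simp add: sum.remove[of UNIV i])
    also have "Cz C r $ i $ i * D i = Lsum B (\<lambda>s. d i (s + int (r i)) + d i (s - int (r i)))"
      using shift[of "int (r i)" i] shift[of "- int (r i)" i] M[of i] 
      by (simp add: Cz_entry distrib_right Lsum_add)
    also have "(\<Sum>j\<in>UNIV - {i}. Cz C r $ i $ j * D j) = (\<Sum>j\<in>UNIV - {i}. - Lsum B (\<lambda>s. \<Sum>k\<in>exps i j. d j (s + k)))"
    proof (rule sum.cong)
      fix j assume j: "j \<in> UNIV - {i}"
      have "Cz C r $ i $ j * D j = - (\<Sum>k\<in>exps i j. zvar powi k * D j)"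
        using j by (simp add: Cz_entry sum_distrib_right)
      also have "(\<Sum>k\<in>exps i j. zvar powi k * D j) = (\<Sum>k\<in>exps i j. Lsum B (\<lambda>s. d j (s + k)))"
        using j exps_M by (intro sum.cong shift) auto
      finally show "Cz C r $ i $ j * D j = - Lsum B (\<lambda>s. \<Sum>k\<in>exps i j. d j (s + k))"
        by (simp add: Lsum_sum)
    qed simp
    also have "\<dots> = - Lsum B (\<lambda>s. \<Sum>j\<in>UNIV - {i}. \<Sum>k\<in>exps i j. d j (s + k))"
      by (simp add: sum_negf Lsum_sum)
    finally have "(\<Sum>j\<in>UNIV. Cz C r $ i $ j * D j) = Lsum B (Cop d i)"
      by (simp add: Lsum_diff Cop_def[abs_def])
    also have "Cop d i = (\<lambda>s. of_bool (i = l \<and> s = 0) - of_bool (i = l \<and> s = int N))"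
      by (rule ext) (rule Cop_d)
    also have "Lsum B \<dots> = of_bool (i = l) * (1 - zvar powi (- int N))"
    proof (cases "i = l")
      case True
      have "\<bar>int N\<bar> \<le> B" by (simp add: B_def b_def)
      then show ?thesis using True by (simp add: Lsum_diff[symmetric] Lsum_delta)
    qed (simp add: Lsum_def)
    finally show ?thesis .
  qed
  have nz: "1 - zvar powi (- int N) \<noteq> 0"
  proof
    assume "1 - zvar powi (- int N) = 0"
    then have "zvar ^ N = 1" using zvar_nonzero by (simp add: power_int_minus power_int_of_nat)
    then have "(2::complex) ^ N = 1" using reg_at_power(2)[OF reg_at_zvar(1)[of "2::complex"], of N]
      by (simp add: reg_at_zvar reg_at_1)
    then have "norm ((2::complex) ^ N) = 1" by simp
    then show False using N(1) one_less_power[of "2::real" N] by (simp add: norm_power)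
  qed
  define v where "v = (\<lambda>j. inverse (1 - zvar powi (- int N)) * D j)"
  have "(\<Sum>j\<in>UNIV. Cz C r $ i $ j * v j) = of_bool (i = l)" for i
  proof -
    have "(\<Sum>j\<in>UNIV. Cz C r $ i $ j * v j) = inverse (1 - zvar powi (- int N)) * (\<Sum>j\<in>UNIV. Cz C r $ i $ j * D j)"
      by (simp add: v_def sum_distrib_left mult_ac)
    then show ?thesis using nz by (simp add: row)
  qed
  moreover have "v j \<in> \<UU>" for j
    unfolding v_def D_def by (intro UU_mult UU_periodic N(1) Lsum_UU)
  ultimately show ?thesis by blast
qed

abbreviation "Ct \<equiv> Cz_inv C r"

lemma Cz_inv_exists: "\<exists>X. Cz C r ** X = mat 1 \<and> (\<forall>i j. X $ i $ j \<in> \<UU>)"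
proof -
  obtain v where v: "\<And>l j. v l j \<in> \<UU>" "\<And>l i. (\<Sum>j\<in>UNIV. Cz C r $ i $ j * v l j) = of_bool (i = l)"
    using column_solution by metis
  then have "Cz C r ** (\<chi> j l. v l j) = mat 1" 
    by (simp add: matrix_matrix_mult_def mat_def vec_eq_iff)
  then show ?thesis using v(1) by (intro exI[of _ "\<chi> j l. v l j"]) simp
qed

text \<open>A right inverse of a square matrix over a field is two-sided, so the inverse selected by
  \<open>matrix_inv\<close> is the one built from the columns of
  \<open>column_solution\<close>.\<close>

lemma Ct_mat: "Cz C r ** Ct = mat 1" "Ct ** Cz C r = mat 1" and Ct_UU [simp]: "Ct $ i $ j \<in> \<UU>"
proof -
  obtain X where X: "Cz C r ** X = mat 1" "\<And>i j. X $ i $ j \<in> \<UU>" using Cz_inv_exists by blast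
  have "Cz C r ** Ct = mat 1 \<and> Ct ** Cz C r = mat 1"
    unfolding Cz_inv_def matrix_inv_def
    by (rule someI[of _ X]) (use X matrix_left_right_inverse in blast)
  then show m: "Cz C r ** Ct = mat 1" "Ct ** Cz C r = mat 1" by auto
  have "Ct = Ct ** (Cz C r ** X)" by (simp add: X)
  also have "\<dots> = X" by (simp add: matrix_mul_assoc m)
  finally show "Ct $ i $ j \<in> \<UU>" using X(2) by simp
qed

lemma Cz_Ct: "(\<Sum>j\<in>UNIV. Cz C r $ i $ j * Ct $ j $ k) = of_bool (i = k)"
  using arg_cong[OF Ct_mat(1), of "\<lambda>M. M $ i $ k"] by (simp add: matrix_matrix_mult_def mat_def)

lemma Ct_Cz: "(\<Sum>j\<in>UNIV. Ct $ i $ j * Cz C r $ j $ k) = of_bool (i = k)"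
  using arg_cong[OF Ct_mat(2), of "\<lambda>M. M $ i $ k"] by (simp add: matrix_matrix_mult_def mat_def)

definition comm_fun :: "'n \<Rightarrow> 'n \<Rightarrow> ratfun" where
  "comm_fun i j = Ct $ j $ i * (zvar powi int (r j) - zvar powi (- int (r j)))"

lemma comm_fun_UU [simp]: "comm_fun i j \<in> \<UU>"
  by (simp add: comm_fun_def UU_mult UU_diff)

text \<open>With x = l - k and \<rho> = r_j, the product (z^x - z^(-x)) (z^\<rho> - z^(-\<rho>)) has
  four terms; the constant coefficients of the correspondingly shifted entry of the inverse are the
  four delta contributions to \<gamma>, with opposite sign.\<close>

lemma gamma_eq: "\<gamma> C r i l j k = - zcoeff 0 ((zvar powi (l - k) - zvar powi (k - l)) * comm_fun i j)"
proof -
  define x where "x = l - k"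
  define \<rho> where "\<rho> = int (r j)"
  let ?c = "\<lambda>s. zcoeff s (Ct $ j $ i)"
  \<comment> \<open>These points may coincide, hence the four indicator sums over \<open>S\<close>
    are evaluated separately.\<close>
  define S where "S = {- \<rho> - x, x + \<rho>, \<rho> - x, x - \<rho>}"
  let ?g = "\<lambda>s. ?c s * (- of_bool (s = - \<rho> - x) - of_bool (s = x + \<rho>) + of_bool (s = \<rho> - x) + of_bool (s = x - \<rho>))"
  have "\<gamma> C r i l j k = Sum_any ?g"
    unfolding \<gamma>_def x_def[symmetric] \<rho>_def[symmetric]
    by (rule arg_cong[where f = Sum_any]) (auto simp: fun_eq_iff)
  also have "\<dots> = (\<Sum>s\<in>S. ?g s)"
    by (rule Sum_any.expand_superset) (auto simp: S_def)
  also have "\<dots> = - (\<Sum>s\<in>S. ?c s * of_bool (s = - \<rho> - x)) - (\<Sum>s\<in>S. ?c s * of_bool (s = x + \<rho>)) 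
     + (\<Sum>s\<in>S. ?c s * of_bool (s = \<rho> - x)) + (\<Sum>s\<in>S. ?c s * of_bool (s = x - \<rho>))"
    by (simp only: distrib_left right_diff_distrib mult_minus_right sum.distrib sum_subtractf sum_negf)
  also have "\<dots> = - ?c (- \<rho> - x) - ?c (x + \<rho>) + ?c (\<rho> - x) + ?c (x - \<rho>)"
  proof -
    have "(\<Sum>s\<in>S. ?c s * of_bool (s = a)) = ?c a" if "a \<in> S" for a
    proof -
      have "(\<Sum>s\<in>S. ?c s * of_bool (s = a)) = (\<Sum>s\<in>S. if s = a then ?c s else 0)"
        by (intro sum.cong) auto
      then show ?thesis using that by (simp add: S_def)
    qed
    then show ?thesis by (simp add: S_def)
  qed
  finally have g: "\<gamma> C r i l j k = - ?c (- \<rho> - x) - ?c (x + \<rho>) + ?c (\<rho> - x) + ?c (x - \<rho>)" .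
  have "(zvar powi (l - k) - zvar powi (k - l)) * comm_fun i j = 
     zvar powi (x + \<rho>) * Ct $ j $ i - zvar powi (x - \<rho>) * Ct $ j $ i 
     - zvar powi (\<rho> - x) * Ct $ j $ i + zvar powi (- x - \<rho>) * Ct $ j $ i"
  proof -
    have e: "l - k = x" "k - l = - x" by (auto simp: x_def)
    have p: "zvar powi (x + \<rho>) = zvar powi x * zvar powi \<rho>" "zvar powi (x - \<rho>) = zvar powi x * zvar powi (- \<rho>)"
      "zvar powi (\<rho> - x) = zvar powi \<rho> * zvar powi (- x)" "zvar powi (- x - \<rho>) = zvar powi (- x) * zvar powi (- \<rho>)"
      using zvar_nonzero by (simp_all flip: power_int_add)
    show ?thesis unfolding comm_fun_def e p \<rho>_def[symmetric] by (simp add: algebra_simps)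
  qed
  then have "zcoeff 0 ((zvar powi (l - k) - zvar powi (k - l)) * comm_fun i j) =
     ?c (- (x + \<rho>)) - ?c (- (x - \<rho>)) - ?c (- (\<rho> - x)) + ?c (- (- x - \<rho>))"
    by (simp add: zcoeff_add zcoeff_diff UU_add UU_diff UU_mult zcoeff_shift)
  then show ?thesis unfolding g by (simp add: algebra_simps)
qed

end

locale cartan_q = cartan_data +
  fixes q :: complex
  assumes q_nonzero: "q \<noteq> 0" and q_not_root: "\<And>N. N > 0 \<Longrightarrow> q ^ N \<noteq> 1"
begin

section \<open>Structure constants of the Heisenberg algebra at q^m\<close>

definition ev :: "int \<Rightarrow> ratfun \<Rightarrow> complex" where "ev m R = ratfun_at R (q powi m)"

lemma q_powi_nonzero [simp]: "q powi m \<noteq> 0"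
  using q_nonzero by simp

declare q_nonzero [simp]

lemma q_powi_not_root: 
  assumes "m \<noteq> 0" "N > 0" shows "(q powi m) ^ N \<noteq> 1"
proof
  assume "(q powi m) ^ N = 1"
  then have e: "q powi (m * int N) = 1" by (simp add: power_int_mult power_int_of_nat)
  have "q ^ nat \<bar>m * int N\<bar> = 1"
  proof (cases "m * int N \<ge> 0")
    case True
    then show ?thesis using e by (simp add: power_int_def)
  next
    case False
    then have "inverse q ^ nat \<bar>m * int N\<bar> = 1" using e by (simp add: power_int_def split: if_splits)
    then show ?thesis by (simp add: power_inverse)
  qed
  then show False using q_not_root[of "nat \<bar>m * int N\<bar>"] assms by simp
qed

lemma q_powi_neq_inverse: "m \<noteq> 0 \<Longrightarrow> q powi m \<noteq> inverse (q powi m)"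
proof
  assume m: "m \<noteq> 0" "q powi m = inverse (q powi m)"
  then have "(q powi m) ^ 2 = 1" unfolding power2_eq_square by (metis q_powi_nonzero right_inverse)
  then show False using q_powi_not_root[of m 2] m by simp
qed

lemma UU_reg: "m \<noteq> 0 \<Longrightarrow> R \<in> \<UU> \<Longrightarrow> reg_at (q powi m) R"
  using q_powi_not_root by (intro UU_regular) auto

lemma ev_add: "m \<noteq> 0 \<Longrightarrow> R \<in> \<UU> \<Longrightarrow> S \<in> \<UU> \<Longrightarrow> ev m (R + S) = ev m R + ev m S"
  and ev_diff: "m \<noteq> 0 \<Longrightarrow> R \<in> \<UU> \<Longrightarrow> S \<in> \<UU> \<Longrightarrow> ev m (R - S) = ev m R - ev m S"
  and ev_mult: "m \<noteq> 0 \<Longrightarrow> R \<in> \<UU> \<Longrightarrow> S \<in> \<UU> \<Longrightarrow> ev m (R * S) = ev m R * ev m S"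
  and ev_minus: "m \<noteq> 0 \<Longrightarrow> R \<in> \<UU> \<Longrightarrow> ev m (- R) = - ev m R"
  and ev_sum: "m \<noteq> 0 \<Longrightarrow> (\<And>i. i \<in> A \<Longrightarrow> f i \<in> \<UU>) \<Longrightarrow> ev m (\<Sum>i\<in>A. f i) = (\<Sum>i\<in>A. ev m (f i))"
  and ev_of_int [simp]: "ev m (of_int n) = of_int n"
  and ev_1 [simp]: "ev m 1 = 1" and ev_0 [simp]: "ev m 0 = 0"
  and ev_zvar_powi: "ev m (zvar powi l) = q powi (l * m)"
  using reg_at_sum[of A "q powi m" f] UU_reg[of m]
  by (simp_all add: ev_def reg_at_add reg_at_diff reg_at_mult reg_at_minus UU_reg reg_at_1 reg_at_0 reg_at_of_int
      reg_at_zvar_powi power_int_mult[symmetric] mult.commute)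

text \<open>\<open>exps i j\<close> is symmetric about 0, so C(z) is invariant under z ->
  1/z.\<close>

lemma ev_Cz_sym: "m \<noteq> 0 \<Longrightarrow> ev (- m) (Cz C r $ i $ j) = ev m (Cz C r $ i $ j)"
proof -
  assume m: "m \<noteq> 0"
  have sym: "(\<Sum>k\<in>exps i j. q powi (k * (- m))) = (\<Sum>k\<in>exps i j. q powi (k * m))"
    by (rule sum.reindex_bij_witness[of _ uminus uminus]) (auto simp: exps_def)
  show ?thesis using m sym
    by (auto simp: Cz_entry ev_add ev_minus UU_sum ev_sum ev_zvar_powi)
qed

lemma ev_Cz_Ct: "m \<noteq> 0 \<Longrightarrow> (\<Sum>j\<in>UNIV. ev m (Cz C r $ i $ j) * ev m (Ct $ j $ k)) = of_bool (i = k)"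
  using arg_cong[OF Cz_Ct[of i k], of "ev m"] by (simp add: ev_sum UU_mult ev_mult)

lemma ev_Ct_Cz: "m \<noteq> 0 \<Longrightarrow> (\<Sum>j\<in>UNIV. ev m (Ct $ i $ j) * ev m (Cz C r $ j $ k)) = of_bool (i = k)"
  using arg_cong[OF Ct_Cz[of i k], of "ev m"] by (simp add: ev_sum UU_mult ev_mult)

text \<open>The inverse of an invariant matrix is invariant: C(q^m) = C(q^(-m)) is inserted between
  its two inverses.\<close>

lemma ev_Ct_sym: "m \<noteq> 0 \<Longrightarrow> ev (- m) (Ct $ i $ j) = ev m (Ct $ i $ j)"
proof -
  assume m: "m \<noteq> 0"
  have "ev (- m) (Ct $ i $ j) = (\<Sum>a\<in>UNIV. of_bool (i = a) * ev (- m) (Ct $ a $ j))"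
    by simp
  also have "\<dots> = (\<Sum>a\<in>UNIV. (\<Sum>b\<in>UNIV. ev m (Ct $ i $ b) * ev m (Cz C r $ b $ a)) * ev (- m) (Ct $ a $ j))"
    by (simp add: ev_Ct_Cz[OF m])
  also have "\<dots> = (\<Sum>b\<in>UNIV. ev m (Ct $ i $ b) * (\<Sum>a\<in>UNIV. ev (- m) (Cz C r $ b $ a) * ev (- m) (Ct $ a $ j)))"
    unfolding sum_distrib_left sum_distrib_right by (subst sum.swap) (simp add: ev_Cz_sym[OF m] mult_ac)
  also have "\<dots> = ev m (Ct $ i $ j)" using m by (simp add: ev_Cz_Ct)
  finally show ?thesis .
qed

text \<open>The scalar in front of the central element in [a_i[m], a_j[-m]].\<close>

definition Bm :: "int \<Rightarrow> 'a \<Rightarrow> 'a \<Rightarrow> complex" where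
  "Bm m i j = (q powi m - q powi (- m)) * ev m (Bz C r $ i $ j)"

lemma ev_qint: "m \<noteq> 0 \<Longrightarrow> ev m (qint zvar l) = qint (q powi m) l" "m \<noteq> 0 \<Longrightarrow> reg_at (q powi m) (qint zvar l)"
proof -
  assume m: "m \<noteq> 0"
  let ?x = "q powi m"
  have d: "reg_at ?x (zvar - inverse zvar)" "ratfun_at (zvar - inverse zvar) ?x = ?x - inverse ?x"
    using reg_at_diff[OF reg_at_zvar(1) reg_at_inverse_zvar(1), of ?x] by (auto simp: reg_at_zvar reg_at_inverse_zvar)
  have n: "reg_at ?x (zvar powi l - zvar powi (- l))" "ratfun_at (zvar powi l - zvar powi (- l)) ?x = ?x powi l - ?x powi (- l)"
    using reg_at_diff[OF reg_at_zvar_powi(1) reg_at_zvar_powi(1), of ?x l "- l"] by (auto simp: reg_at_zvar_powi)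
  have "?x - inverse ?x \<noteq> 0" using q_powi_neq_inverse[OF m] by simp
  then show "reg_at ?x (qint zvar l)" "ev m (qint zvar l) = qint ?x l"
    unfolding ev_def qint_def divide_inverse using n d by (auto simp: reg_at_mult reg_at_inverse)
qed

lemma Bm_eq: "m \<noteq> 0 \<Longrightarrow> Bm m i j = (q powi (int (r i) * m) - q powi (- int (r i) * m)) * ev m (Cz C r $ i $ j)"
proof -
  assume m: "m \<noteq> 0"
  have "ev m (Bz C r $ i $ j) = qint (q powi m) (int (r i)) * ev m (Cz C r $ i $ j)"
    using ev_qint[OF m, of "int (r i)"] UU_reg[OF m Cz_UU[of i j]] by (simp add: Bz_def ev_def reg_at_mult)
  then show ?thesis using qint_mult[OF q_powi_neq_inverse[OF m], of "int (r i)"]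
    by (simp add: Bm_def power_int_minus power_int_mult[symmetric] mult.commute mult.assoc[symmetric])
qed

text \<open>In each case of \<open>edge_cases\<close> the two products of q-integers consist of the
  same two factors. The mere equality r_i bond_ij = r_j bond_ji would not give this, whence the
  dependence on the gcd normalization.\<close>

lemma Bz_sym: "Bz C r $ i $ j = Bz C r $ j $ i"
proof (cases "i = j \<or> C $ i $ j = 0")
  case True
  then show ?thesis using zero_iff[of i j] by (auto simp: Bz_def Cz_def qint_def)
next
  case False
  then have ij: "i \<noteq> j" "C $ i $ j \<noteq> 0" by auto
  have C: "C $ i $ j = - int (bond i j)" "C $ j $ i = - int (bond j i)"
    using off_diag[of i j] off_diag[of j i] ij by (auto simp: bond_def)
  have s: "r i * bond i j = r j * bond j i"
    using r_sym[of i j] unfolding C by simp (metis of_nat_eq_iff of_nat_mult)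
  have eq: "(Bz C r $ i $ j = Bz C r $ j $ i) \<longleftrightarrow> 
      qint zvar (int (r i)) * qint zvar (int (bond i j)) = qint zvar (int (r j)) * qint zvar (int (bond j i))"
    using ij by (simp add: Bz_def Cz_def C qint_uminus)
  show ?thesis unfolding eq using ij
  proof (rule edge_cases)
    assume c: "r i = r j" "bond i j = 1"
    then have "bond j i = 1" using s r_pos[of j] by simp
    then show "qint zvar (int (r i)) * qint zvar (int (bond i j)) = qint zvar (int (r j)) * qint zvar (int (bond j i))"
      using c by simp
  next
    assume c: "r i = 1" "bond i j = r j"
    then have "bond j i = 1" using s r_pos[of j] by simp
    then show "qint zvar (int (r i)) * qint zvar (int (bond i j)) = qint zvar (int (r j)) * qint zvar (int (bond j i))"
      using c by simp
  next
    assume c: "r j = 1" "bond i j = 1"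
    then have "bond j i = r i" using s by simp
    then show "qint zvar (int (r i)) * qint zvar (int (bond i j)) = qint zvar (int (r j)) * qint zvar (int (bond j i))"
      using c by simp
  qed
qed

lemma Bm_sym: "Bm m i j = Bm m j i"
  unfolding Bm_def by (subst Bz_sym) simp

lemma Bm_neg: "m \<noteq> 0 \<Longrightarrow> Bm (- m) i j = - Bm m i j"
  by (simp add: Bm_eq ev_Cz_sym algebra_simps)

text \<open>The commutator of \<open>y\<^sub>i[m]\<close> and \<open>y\<^sub>j[-m]\<close> is \<open>comm_fun i j\<close> evaluated at \<open>q\<^sup>m\<close>, times \<open>c\<^sub>m\<close>.\<close>

lemma ev_comm_fun:
  assumes "m \<noteq> 0"
  shows "(\<Sum>a\<in>UNIV. \<Sum>b\<in>UNIV. ev m (Ct $ a $ i) * ev (- m) (Ct $ b $ j) * Bm m a b) = ev m (comm_fun i j)"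
proof -
  have "(\<Sum>a\<in>UNIV. \<Sum>b\<in>UNIV. ev m (Ct $ a $ i) * ev (- m) (Ct $ b $ j) * Bm m a b)
    = (\<Sum>a\<in>UNIV. ev m (Ct $ a $ i) * (q powi (int (r a) * m) - q powi (- int (r a) * m)) 
        * (\<Sum>b\<in>UNIV. ev m (Cz C r $ a $ b) * ev m (Ct $ b $ j)))"
    unfolding sum_distrib_left by (intro sum.cong refl) (simp add: Bm_eq[OF assms] ev_Ct_sym[OF assms] mult_ac)
  also have "\<dots> = (\<Sum>a\<in>UNIV. if a = j then ev m (Ct $ a $ i) * (q powi (int (r a) * m) - q powi (- int (r a) * m)) else 0)"
    by (intro sum.cong refl) (simp add: ev_Cz_Ct[OF assms])
  also have "\<dots> = ev m (comm_fun i j)"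
    using assms by (simp add: comm_fun_def ev_mult UU_diff ev_diff ev_zvar_powi)
  finally show ?thesis .
qed

lemma comm_fun_neg: "m \<noteq> 0 \<Longrightarrow> ev (- m) (comm_fun i j) = - ev m (comm_fun i j)"
  by (simp add: comm_fun_def ev_mult UU_diff ev_diff ev_zvar_powi ev_Ct_sym) (simp add: algebra_simps)

end

section \<open>Exponentials of power series over an algebra\<close>

context ring
begin

lemma finsum_triangle:
  assumes "\<And>j l. F j l \<in> carrier R"
  shows "(\<Oplus>i\<in>{..k::nat}. \<Oplus>j\<in>{..i}. F j (i - j)) = (\<Oplus>j\<in>{..k}. \<Oplus>l\<in>{..k - j}. F j l)"
proof (induction k)
  case 0
  show ?case using assms by simp
next
  case (Suc k)
  have "(\<Oplus>j\<in>{..k}. \<Oplus>l\<in>{..Suc k - j}. F j l)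
      = (\<Oplus>j\<in>{..k}. (\<Oplus>l\<in>{..k - j}. F j l) \<oplus> F j (Suc k - j))"
  proof (rule finsum_cong')
    fix j assume "j \<in> {..k}"
    then have "Suc k - j = Suc (k - j)" by auto
    then show "(\<Oplus>l\<in>{..Suc k - j}. F j l) = (\<Oplus>l\<in>{..k - j}. F j l) \<oplus> F j (Suc k - j)"
      using assms by (simp add: Pi_def a_comm)
  qed (use assms in auto)
  also have "\<dots> = (\<Oplus>j\<in>{..k}. \<Oplus>l\<in>{..k - j}. F j l) \<oplus> (\<Oplus>j\<in>{..k}. F j (Suc k - j))"
    using assms by (subst finsum_addf) auto
  finally show ?case using assms Suc
    by (simp add: Pi_def a_ac)
qed

lemma finsum_reverse:
  assumes "\<And>i. f i \<in> carrier R"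
  shows "(\<Oplus>i\<in>{..k::nat}. f (k - i)) = (\<Oplus>i\<in>{..k}. f i)"
proof -
  have "(\<Oplus>i\<in>(\<lambda>i. k - i) ` {..k}. f i) = (\<Oplus>i\<in>{..k}. f (k - i))"
    using assms by (intro finsum_reindex) (auto intro!: inj_onI)
  moreover have "(\<lambda>i. k - i) ` {..k} = {..k}"
    by (auto simp: image_iff) (metis diff_diff_cancel diff_le_self atMost_iff)
  ultimately show ?thesis by simp
qed

lemma finsum_single_index:
  assumes "j \<in> A" "finite A" "f j \<in> carrier R" "\<And>i. i \<in> A \<Longrightarrow> i \<noteq> j \<Longrightarrow> f i = \<zero>"
  shows "(\<Oplus>i\<in>A. f i) = f j"
proof -
  have c: "f i \<in> carrier R" if "i \<in> A" for i
    using that assms(3,4) by (cases "i = j") auto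
  have "(\<Oplus>i\<in>A. f i) = (\<Oplus>i\<in>A. if j = i then f i else \<zero>)"
    using c assms by (intro finsum_cong') auto
  also have "\<dots> = f j" using assms c
    by (subst finsum_singleton) auto
  finally show ?thesis .
qed

section \<open>The ring of formal power series\<close>

abbreviation "PS \<equiv> power_series_ring R"

lemma ps_carrier: "f \<in> carrier PS \<longleftrightarrow> (\<forall>k. f k \<in> carrier R)"
  by (simp add: power_series_ring_def)

lemma ps_coeff: "f \<in> carrier PS \<Longrightarrow> f k \<in> carrier R"
  by (simp add: ps_carrier)

lemma ps_mult: "(f \<otimes>\<^bsub>PS\<^esub> g) k = (\<Oplus>i\<in>{..k}. f i \<otimes> g (k - i))"
  by (simp add: power_series_ring_def)

lemma ps_add: "(f \<oplus>\<^bsub>PS\<^esub> g) k = f k \<oplus> g k"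
  by (simp add: power_series_ring_def)

lemma ps_one: "\<one>\<^bsub>PS\<^esub> k = (if k = 0 then \<one> else \<zero>)"
  by (simp add: power_series_ring_def)

lemma ps_zero: "\<zero>\<^bsub>PS\<^esub> k = \<zero>"
  by (simp add: power_series_ring_def)

lemma ps_mult_closed: "f \<in> carrier PS \<Longrightarrow> g \<in> carrier PS \<Longrightarrow> f \<otimes>\<^bsub>PS\<^esub> g \<in> carrier PS"
  by (auto simp: ps_carrier ps_mult intro!: finsum_closed)

lemma ps_assoc:
  assumes "f \<in> carrier PS" "g \<in> carrier PS" "h \<in> carrier PS"
  shows "f \<otimes>\<^bsub>PS\<^esub> g \<otimes>\<^bsub>PS\<^esub> h = f \<otimes>\<^bsub>PS\<^esub> (g \<otimes>\<^bsub>PS\<^esub> h)"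
proof
  fix k
  note c = assms[unfolded ps_carrier, rule_format]
  have "(f \<otimes>\<^bsub>PS\<^esub> g \<otimes>\<^bsub>PS\<^esub> h) k = (\<Oplus>i\<in>{..k}. (\<Oplus>j\<in>{..i}. f j \<otimes> g (i - j)) \<otimes> h (k - i))"
    by (simp add: ps_mult)
  also have "\<dots> = (\<Oplus>i\<in>{..k}. \<Oplus>j\<in>{..i}. f j \<otimes> g (i - j) \<otimes> h (k - (j + (i - j))))"
    by (intro finsum_cong') (auto simp: finsum_ldistr c Pi_def intro!: finsum_cong')
  also have "\<dots> = (\<Oplus>j\<in>{..k}. \<Oplus>l\<in>{..k - j}. f j \<otimes> g l \<otimes> h (k - (j + l)))"
    by (rule finsum_triangle) (simp add: c)
  also have "\<dots> = (f \<otimes>\<^bsub>PS\<^esub> (g \<otimes>\<^bsub>PS\<^esub> h)) k"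
    by (auto simp: ps_mult finsum_rdistr c Pi_def m_assoc intro!: finsum_cong')
  finally show "(f \<otimes>\<^bsub>PS\<^esub> g \<otimes>\<^bsub>PS\<^esub> h) k = (f \<otimes>\<^bsub>PS\<^esub> (g \<otimes>\<^bsub>PS\<^esub> h)) k" .
qed

definition ps_const :: "'a \<Rightarrow> nat \<Rightarrow> 'a" where
  "ps_const a = (\<lambda>k. if k = 0 then a else \<zero>)"

lemma ps_const_mult:
  assumes "a \<in> carrier R" "f \<in> carrier PS"
  shows "(ps_const a \<otimes>\<^bsub>PS\<^esub> f) k = a \<otimes> f k"
proof -
  have "(ps_const a \<otimes>\<^bsub>PS\<^esub> f) k = ps_const a 0 \<otimes> f (k - 0)"
    unfolding ps_mult using assms
    by (intro finsum_single_index) (auto simp: ps_const_def ps_carrier)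
  then show ?thesis by (simp add: ps_const_def)
qed

lemma mult_ps_const:
  assumes "a \<in> carrier R" "f \<in> carrier PS"
  shows "(f \<otimes>\<^bsub>PS\<^esub> ps_const a) k = f k \<otimes> a"
proof -
  have "(f \<otimes>\<^bsub>PS\<^esub> ps_const a) k = f k \<otimes> ps_const a (k - k)"
    unfolding ps_mult using assms
    by (intro finsum_single_index) (auto simp: ps_const_def ps_carrier)
  then show ?thesis by (simp add: ps_const_def)
qed

lemma ps_const_closed: "a \<in> carrier R \<Longrightarrow> ps_const a \<in> carrier PS"
  by (simp add: ps_const_def ps_carrier)

lemma ps_one_const: "\<one>\<^bsub>PS\<^esub> = ps_const \<one>"
  by (auto simp: ps_one ps_const_def)

theorem power_series_ring_is_ring: "ring PS"
proof (rule ringI)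
  show "abelian_group PS"
  proof (rule abelian_groupI)
    fix f assume f: "f \<in> carrier PS"
    then show "\<exists>g\<in>carrier PS. g \<oplus>\<^bsub>PS\<^esub> f = \<zero>\<^bsub>PS\<^esub>"
      by (intro bexI[of _ "\<lambda>k. \<ominus> f k"] ext) (auto simp: ps_add ps_zero ps_carrier l_neg)
  qed (auto simp: ps_add ps_zero ps_carrier a_ac fun_eq_iff)
  show "monoid PS"
    by (rule monoidI)
      (auto simp: ps_mult_closed ps_assoc ps_one_const ps_const_closed ps_const_mult mult_ps_const
        ps_carrier[THEN iffD1, rule_format] fun_eq_iff)
next
  fix f g h assume a: "f \<in> carrier PS" "g \<in> carrier PS" "h \<in> carrier PS"
  note c = a[unfolded ps_carrier, rule_format]
  show "(f \<oplus>\<^bsub>PS\<^esub> g) \<otimes>\<^bsub>PS\<^esub> h = f \<otimes>\<^bsub>PS\<^esub> h \<oplus>\<^bsub>PS\<^esub> g \<otimes>\<^bsub>PS\<^esub> h"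
    by (rule ext) (simp add: ps_mult ps_add c l_distr finsum_addf Pi_def)
  show "h \<otimes>\<^bsub>PS\<^esub> (f \<oplus>\<^bsub>PS\<^esub> g) = h \<otimes>\<^bsub>PS\<^esub> f \<oplus>\<^bsub>PS\<^esub> h \<otimes>\<^bsub>PS\<^esub> g"
    by (rule ext) (simp add: ps_mult ps_add c r_distr finsum_addf Pi_def)
qed

lemma ps_pow_low:
  assumes "F \<in> carrier PS" "F 0 = \<zero>" "k < n"
  shows "(F [^]\<^bsub>PS\<^esub> n) k = \<zero>"
  using assms(3)
proof (induction n arbitrary: k)
  case (Suc n)
  interpret P: ring PS by (rule power_series_ring_is_ring)
  have c: "F i \<in> carrier R" "(F [^]\<^bsub>PS\<^esub> n) i \<in> carrier R" for i
    using assms(1) by (auto intro!: ps_coeff P.nat_pow_closed)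
  have "(F [^]\<^bsub>PS\<^esub> Suc n) k = (\<Oplus>i\<in>{..k}. (F [^]\<^bsub>PS\<^esub> n) i \<otimes> F (k - i))"
    by (simp add: ps_mult)
  also have "\<dots> = (\<Oplus>i\<in>{..k}. \<zero>)"
  proof (rule finsum_cong')
    fix i assume "i \<in> {..k}"
    then have "i < n \<or> k - i = 0" using Suc.prems by auto
    then show "(F [^]\<^bsub>PS\<^esub> n) i \<otimes> F (k - i) = \<zero>"
      using Suc.IH[of i] assms(2) c by auto
  qed auto
  finally show ?case by simp
qed simp

end

text \<open>A unital algebra over a field of characteristic zero, with the scalars as central
  elements. By \<open>scalar_ring_ps\<close> the notion passes to power series and so serves both H
  and H[[h]].\<close>

locale scalar_ring = ring +
  fixes sc :: "'c::field_char_0 \<Rightarrow> 'a"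
  assumes sc_closed [simp]: "sc x \<in> carrier R"
    and sc_add: "sc (x + y) = sc x \<oplus> sc y"
    and sc_mult: "sc (x * y) = sc x \<otimes> sc y"
    and sc_1: "sc 1 = \<one>"
    and sc_commute: "a \<in> carrier R \<Longrightarrow> sc x \<otimes> a = a \<otimes> sc x"
begin

lemma sc_0: "sc 0 = \<zero>"
  using sc_add[of 0 0] by (simp add: r_neg1 add.l_cancel_one)

lemma sc_left_commute: "a \<in> carrier R \<Longrightarrow> b \<in> carrier R \<Longrightarrow> a \<otimes> (sc x \<otimes> b) = sc x \<otimes> (a \<otimes> b)"
  by (metis m_assoc sc_closed sc_commute)

lemma sc_mult_assoc: "a \<in> carrier R \<Longrightarrow> sc x \<otimes> (sc y \<otimes> a) = sc (x * y) \<otimes> a"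
  by (simp add: m_assoc sc_mult)

lemma sc_cancel: 
  assumes "x \<noteq> 0" "a \<in> carrier R" "b \<in> carrier R" "sc x \<otimes> a = sc x \<otimes> b"
  shows "a = b"
proof -
  have "sc (inverse x) \<otimes> (sc x \<otimes> a) = sc (inverse x) \<otimes> (sc x \<otimes> b)" using assms by simp
  then show ?thesis using assms(1-3) by (simp add: sc_mult_assoc sc_1)
qed

lemma scalar_ring_ps: "scalar_ring PS (\<lambda>x. ps_const (sc x))"
proof -
  interpret P: ring PS by (rule power_series_ring_is_ring)
  show ?thesis
  proof
    fix x y :: 'c and a
    show "ps_const (sc x) \<in> carrier PS" by (simp add: ps_const_closed)
    show "ps_const (sc (x + y)) = ps_const (sc x) \<oplus>\<^bsub>PS\<^esub> ps_const (sc y)"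
      by (rule ext) (simp add: ps_add ps_const_def sc_add)
    show "ps_const (sc (x * y)) = ps_const (sc x) \<otimes>\<^bsub>PS\<^esub> ps_const (sc y)"
      by (rule ext) (simp add: ps_const_mult ps_const_closed, simp add: ps_const_def sc_mult)
    show "ps_const (sc 1) = \<one>\<^bsub>PS\<^esub>" by (simp add: ps_one_const sc_1)
    assume "a \<in> carrier PS"
    then show "ps_const (sc x) \<otimes>\<^bsub>PS\<^esub> a = a \<otimes>\<^bsub>PS\<^esub> ps_const (sc x)"
      by (intro ext) (simp add: ps_const_mult mult_ps_const sc_commute[OF ps_coeff])
  qed
qed

section \<open>Exponentials through first order differential equations\<close>

text \<open>The derivation h d/dh. It preserves degrees and is invertible in positive degree, so an
  exponential is determined by its equation and its constant term.\<close>

definition euler :: "(nat \<Rightarrow> 'a) \<Rightarrow> nat \<Rightarrow> 'a" where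
  "euler f = (\<lambda>k. sc (of_nat k) \<otimes> f k)"

lemma euler_closed: "f \<in> carrier PS \<Longrightarrow> euler f \<in> carrier PS"
  by (simp add: euler_def ps_carrier)

lemma euler_add: "f \<in> carrier PS \<Longrightarrow> g \<in> carrier PS \<Longrightarrow> euler (f \<oplus>\<^bsub>PS\<^esub> g) = euler f \<oplus>\<^bsub>PS\<^esub> euler g"
  by (rule ext) (simp add: euler_def ps_add r_distr ps_carrier)

lemma euler_mult:
  assumes "f \<in> carrier PS" "g \<in> carrier PS"
  shows "euler (f \<otimes>\<^bsub>PS\<^esub> g) = euler f \<otimes>\<^bsub>PS\<^esub> g \<oplus>\<^bsub>PS\<^esub> f \<otimes>\<^bsub>PS\<^esub> euler g"
proof
  fix k
  note c = assms[unfolded ps_carrier, rule_format]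
  have "euler (f \<otimes>\<^bsub>PS\<^esub> g) k = (\<Oplus>i\<in>{..k}. sc (of_nat k) \<otimes> (f i \<otimes> g (k - i)))"
    by (simp add: euler_def ps_mult finsum_rdistr c Pi_def)
  also have "\<dots> = (\<Oplus>i\<in>{..k}. euler f i \<otimes> g (k - i) \<oplus> f i \<otimes> euler g (k - i))"
  proof (rule finsum_cong')
    fix i assume "i \<in> {..k}"
    then have "of_nat k = (of_nat i + of_nat (k - i) :: 'c)"
      by (metis atMost_iff le_add_diff_inverse of_nat_add)
    then show "sc (of_nat k) \<otimes> (f i \<otimes> g (k - i)) = euler f i \<otimes> g (k - i) \<oplus> f i \<otimes> euler g (k - i)"
      by (simp add: euler_def sc_add l_distr c sc_left_commute[of "f i"] m_assoc)
  qed (auto simp: euler_def c)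
  also have "\<dots> = (euler f \<otimes>\<^bsub>PS\<^esub> g \<oplus>\<^bsub>PS\<^esub> f \<otimes>\<^bsub>PS\<^esub> euler g) k"
    by (simp add: ps_add ps_mult finsum_addf c euler_def Pi_def)
  finally show "euler (f \<otimes>\<^bsub>PS\<^esub> g) k = (euler f \<otimes>\<^bsub>PS\<^esub> g \<oplus>\<^bsub>PS\<^esub> f \<otimes>\<^bsub>PS\<^esub> euler g) k" .
qed

text \<open>As \<open>G 0\<close> vanishes, coefficient k of the product with \<open>G\<close>
  involves only lower coefficients of the unknown series, and k is invertible for k > 0.\<close>

lemma euler_unique:
  assumes "X \<in> carrier PS" "Y \<in> carrier PS" "G \<in> carrier PS" "G 0 = \<zero>"
    and "euler X = G \<otimes>\<^bsub>PS\<^esub> X" "euler Y = G \<otimes>\<^bsub>PS\<^esub> Y" "X 0 = Y 0"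
  shows "X = Y"
proof
  fix k
  note c = assms(1-3)[unfolded ps_carrier, rule_format]
  show "X k = Y k"
  proof (induction k rule: less_induct)
    case (less k)
    show ?case
    proof (cases "k = 0")
      case True
      then show ?thesis using assms(7) by (simp only:)
    next
      case False
      have IH: "G i \<otimes> X (k - i) = G i \<otimes> Y (k - i)" if "i \<in> {..k}" for i
      proof (cases "i = 0")
        case True
        then show ?thesis using assms(4) c(1,2) by simp
      next
        case i: False
        have "X (k - i) = Y (k - i)" using i False by (intro less) simp
        then show ?thesis by (simp only:)
      qed
      have "(\<Oplus>i\<in>{..k}. G i \<otimes> X (k - i)) = (\<Oplus>i\<in>{..k}. G i \<otimes> Y (k - i))"
        using IH by (intro finsum_cong') (auto intro: c)
      then have "euler X k = euler Y k" unfolding assms(5,6) ps_mult .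
      then have "sc (of_nat k) \<otimes> X k = sc (of_nat k) \<otimes> Y k" by (simp only: euler_def)
      then show ?thesis using False c by (intro sc_cancel[of "of_nat k" "X k" "Y k"]) simp_all
    qed
  qed
qed

definition ps_exp :: "(nat \<Rightarrow> 'a) \<Rightarrow> nat \<Rightarrow> 'a" where
  "ps_exp F = (\<lambda>k. \<Oplus>n\<in>{..k}. sc (1 / fact n) \<otimes> (F [^]\<^bsub>PS\<^esub> n) k)"

text \<open>
  The \<open>n\<close>-th partial sum of the exponential series agrees with \<open>ps_exp F\<close> up to \<open>h\<^sup>n\<close>, which
  reduces identities for \<open>ps_exp\<close> to identities in the ring of power series.
\<close>

primrec exp_sum :: "(nat \<Rightarrow> 'a) \<Rightarrow> nat \<Rightarrow> nat \<Rightarrow> 'a" where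
  "exp_sum F 0 = \<one>\<^bsub>PS\<^esub>"
| "exp_sum F (Suc n) = exp_sum F n \<oplus>\<^bsub>PS\<^esub> ps_const (sc (1 / fact (Suc n))) \<otimes>\<^bsub>PS\<^esub> F [^]\<^bsub>PS\<^esub> Suc n"

lemma exp_sum_closed: "F \<in> carrier PS \<Longrightarrow> exp_sum F n \<in> carrier PS"
proof (induction n)
  interpret P: scalar_ring PS "\<lambda>x. ps_const (sc x)" by (rule scalar_ring_ps)
  { case 0 show ?case by simp
  next
    case (Suc n) then show ?case by (simp del: P.nat_pow_Suc) }
qed

lemma exp_sum_coeff:
  assumes "F \<in> carrier PS"
  shows "exp_sum F n k = (\<Oplus>i\<in>{..n}. sc (1 / fact i) \<otimes> (F [^]\<^bsub>PS\<^esub> i) k)"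
proof (induction n)
  interpret P: scalar_ring PS "\<lambda>x. ps_const (sc x)" by (rule scalar_ring_ps)
  have c: "(F [^]\<^bsub>PS\<^esub> (i::nat)) k \<in> carrier R" for i k
    using assms by (auto intro!: ps_coeff P.nat_pow_closed)
  { case 0 show ?case using c[of 0] by (simp add: sc_1 ps_one)
  next
    case (Suc n) then show ?case
      using assms c[of "Suc n"] by (simp del: P.nat_pow_Suc fact_Suc nat_pow_Suc add: ps_add ps_const_mult Pi_def c a_comm) }
qed

lemma ps_exp_eq_exp_sum:
  assumes "F \<in> carrier PS" "F 0 = \<zero>" "k \<le> n"
  shows "ps_exp F k = exp_sum F n k"
proof -
  interpret P: scalar_ring PS "\<lambda>x. ps_const (sc x)" by (rule scalar_ring_ps)
  have c: "(F [^]\<^bsub>PS\<^esub> (i::nat)) k \<in> carrier R" for i k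
    using assms by (auto intro!: ps_coeff P.nat_pow_closed)
  have "(\<Oplus>i\<in>{..k}. sc (1 / fact i) \<otimes> (F [^]\<^bsub>PS\<^esub> i) k) = (\<Oplus>i\<in>{..n}. sc (1 / fact i) \<otimes> (F [^]\<^bsub>PS\<^esub> i) k)"
    using assms by (intro add.finprod_mono_neutral_cong_left) (auto simp: c ps_pow_low)
  then show ?thesis by (simp add: ps_exp_def exp_sum_coeff assms)
qed

lemma ps_exp_closed: "F \<in> carrier PS \<Longrightarrow> ps_exp F \<in> carrier PS"
proof -
  interpret P: scalar_ring PS "\<lambda>x. ps_const (sc x)" by (rule scalar_ring_ps)
  assume "F \<in> carrier PS"
  then have "(F [^]\<^bsub>PS\<^esub> (n::nat)) k \<in> carrier R" for n k
    by (intro ps_coeff P.nat_pow_closed)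
  then show ?thesis unfolding ps_exp_def ps_carrier
    by (intro allI finsum_closed) simp
qed

lemma ps_exp_0: "F \<in> carrier PS \<Longrightarrow> ps_exp F 0 = \<one>"
  by (simp add: ps_exp_def sc_1 ps_one)

lemma ps_mult_cong_low:
  assumes "f \<in> carrier PS" "f' \<in> carrier PS" "g \<in> carrier PS" "g' \<in> carrier PS" 
    "\<And>i. i \<le> k \<Longrightarrow> f i = f' i" "\<And>i. i \<le> k \<Longrightarrow> g i = g' i"
  shows "(f \<otimes>\<^bsub>PS\<^esub> g) k = (f' \<otimes>\<^bsub>PS\<^esub> g') k"
  unfolding ps_mult
proof (rule finsum_cong')
  show "(\<lambda>i. f' i \<otimes> g' (k - i)) \<in> {..k} \<rightarrow> carrier R"
    using assms(2,4) by (simp add: ps_carrier)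
qed (simp_all add: assms(5,6))

text \<open>
  Applied to the Euler derivation and to inner derivations, this is the only computation with powers
  that the exponential laws need.
\<close>

lemma exp_sum_derivation:
  assumes F: "F \<in> carrier PS"
    and closed: "\<And>x. x \<in> carrier PS \<Longrightarrow> \<delta> x \<in> carrier PS"
    and add: "\<And>x y. x \<in> carrier PS \<Longrightarrow> y \<in> carrier PS \<Longrightarrow> \<delta> (x \<oplus>\<^bsub>PS\<^esub> y) = \<delta> x \<oplus>\<^bsub>PS\<^esub> \<delta> y"
    and mult: "\<And>x y. x \<in> carrier PS \<Longrightarrow> y \<in> carrier PS \<Longrightarrow>
      \<delta> (x \<otimes>\<^bsub>PS\<^esub> y) = \<delta> x \<otimes>\<^bsub>PS\<^esub> y \<oplus>\<^bsub>PS\<^esub> x \<otimes>\<^bsub>PS\<^esub> \<delta> y"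
    and scalar: "\<And>a. \<delta> (ps_const (sc a)) = \<zero>\<^bsub>PS\<^esub>"
    and comm: "\<delta> F \<otimes>\<^bsub>PS\<^esub> F = F \<otimes>\<^bsub>PS\<^esub> \<delta> F"
  shows "\<delta> (exp_sum F (Suc n)) = \<delta> F \<otimes>\<^bsub>PS\<^esub> exp_sum F n"
proof -
  interpret P: scalar_ring PS "\<lambda>x. ps_const (sc x)" by (rule scalar_ring_ps)
  note [simp] = F closed[OF F] exp_sum_closed[OF F]
  have one: "\<delta> \<one>\<^bsub>PS\<^esub> = \<zero>\<^bsub>PS\<^esub>"
    using scalar[of 1] by (simp add: P.sc_1)
  have pow: "\<delta> (F [^]\<^bsub>PS\<^esub> Suc n) = ps_const (sc (of_nat (Suc n))) \<otimes>\<^bsub>PS\<^esub> (\<delta> F \<otimes>\<^bsub>PS\<^esub> F [^]\<^bsub>PS\<^esub> n)" for n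
  proof (induction n)
    case 0
    show ?case by (simp add: one mult P.sc_1)
  next
    case (Suc n)
    have c: "F [^]\<^bsub>PS\<^esub> Suc n \<otimes>\<^bsub>PS\<^esub> \<delta> F = \<delta> F \<otimes>\<^bsub>PS\<^esub> F [^]\<^bsub>PS\<^esub> Suc n"
      using comm by (intro P.group_commutes_pow) auto
    have "\<delta> (F [^]\<^bsub>PS\<^esub> Suc (Suc n)) = \<delta> (F [^]\<^bsub>PS\<^esub> Suc n) \<otimes>\<^bsub>PS\<^esub> F \<oplus>\<^bsub>PS\<^esub> F [^]\<^bsub>PS\<^esub> Suc n \<otimes>\<^bsub>PS\<^esub> \<delta> F"
      by (subst P.nat_pow_Suc, subst mult) auto
    also have "\<dots> = ps_const (sc (of_nat (Suc n))) \<otimes>\<^bsub>PS\<^esub> (\<delta> F \<otimes>\<^bsub>PS\<^esub> F [^]\<^bsub>PS\<^esub> Suc n) 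
       \<oplus>\<^bsub>PS\<^esub> \<delta> F \<otimes>\<^bsub>PS\<^esub> F [^]\<^bsub>PS\<^esub> Suc n"
      unfolding Suc c by (simp add: P.m_assoc)
    also have "\<dots> = ps_const (sc (of_nat (Suc n) + 1)) \<otimes>\<^bsub>PS\<^esub> (\<delta> F \<otimes>\<^bsub>PS\<^esub> F [^]\<^bsub>PS\<^esub> Suc n)"
      by (simp add: P.sc_add P.sc_1 P.l_distr del: P.nat_pow_Suc of_nat_Suc)
    finally show ?case by (simp add: add.commute del: P.nat_pow_Suc)
  qed
  have summand: "\<delta> (ps_const (sc (1 / fact (Suc n))) \<otimes>\<^bsub>PS\<^esub> F [^]\<^bsub>PS\<^esub> Suc n)
     = \<delta> F \<otimes>\<^bsub>PS\<^esub> (ps_const (sc (1 / fact n)) \<otimes>\<^bsub>PS\<^esub> F [^]\<^bsub>PS\<^esub> n)" for n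
  proof -
    have "\<delta> (ps_const (sc (1 / fact (Suc n))) \<otimes>\<^bsub>PS\<^esub> F [^]\<^bsub>PS\<^esub> Suc n)
      = ps_const (sc (1 / fact (Suc n) * of_nat (Suc n))) \<otimes>\<^bsub>PS\<^esub> (\<delta> F \<otimes>\<^bsub>PS\<^esub> F [^]\<^bsub>PS\<^esub> n)"
      by (subst mult) (simp_all only: P.sc_closed P.nat_pow_closed F scalar pow, 
        simp add: P.sc_mult_assoc closed del: P.nat_pow_Suc of_nat_Suc fact_Suc)
    also have "1 / fact (Suc n) * of_nat (Suc n) = (1 / fact n :: 'c)"
      unfolding fact_Suc by (simp del: of_nat_Suc)
    finally show ?thesis by (simp add: P.sc_left_commute[of "\<delta> F"])
  qed
  show ?thesis
  proof (induction n)
    case 0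
    show ?case using summand[of 0] by (simp add: add one closed P.sc_1 P.m_closed)
  next
    case (Suc n)
    have "\<delta> (exp_sum F (Suc (Suc n))) = \<delta> (exp_sum F (Suc n)) \<oplus>\<^bsub>PS\<^esub>
        \<delta> (ps_const (sc (1 / fact (Suc (Suc n)))) \<otimes>\<^bsub>PS\<^esub> F [^]\<^bsub>PS\<^esub> Suc (Suc n))"
      by (subst exp_sum.simps, subst add) (auto simp del: P.nat_pow_Suc exp_sum.simps)
    also have "\<dots> = \<delta> F \<otimes>\<^bsub>PS\<^esub> exp_sum F (Suc n)"
      unfolding Suc summand by (simp add: P.r_distr del: P.nat_pow_Suc)
    finally show ?case .
  qed
qed

lemma euler_scalar: "euler (ps_const (sc a)) = \<zero>\<^bsub>PS\<^esub>"
  by (rule ext) (simp add: euler_def ps_const_def ps_zero sc_0)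

text \<open>\<open>exp_sum_derivation\<close> for the Euler derivation; it lowers the truncation
  from \<open>Suc k\<close> to \<open>k\<close>, and coefficient \<open>k\<close> is exact in
  both.\<close>

lemma euler_ps_exp:
  assumes "F \<in> carrier PS" "F 0 = \<zero>" "euler F \<otimes>\<^bsub>PS\<^esub> F = F \<otimes>\<^bsub>PS\<^esub> euler F"
  shows "euler (ps_exp F) = euler F \<otimes>\<^bsub>PS\<^esub> ps_exp F"
proof
  fix k
  have "euler (ps_exp F) k = euler (exp_sum F (Suc k)) k"
    using assms by (simp add: euler_def ps_exp_eq_exp_sum[of F k "Suc k"] del: exp_sum.simps)
  also have "\<dots> = (euler F \<otimes>\<^bsub>PS\<^esub> exp_sum F k) k"
    by (subst exp_sum_derivation) (use assms in \<open>auto simp: euler_closed euler_add euler_mult euler_scalar\<close>)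
  also have "\<dots> = (euler F \<otimes>\<^bsub>PS\<^esub> ps_exp F) k"
    using assms by (intro ps_mult_cong_low) (auto simp: euler_closed exp_sum_closed ps_exp_closed ps_exp_eq_exp_sum
      intro: ps_exp_eq_exp_sum[of F _ k, symmetric])
  finally show "euler (ps_exp F) k = (euler F \<otimes>\<^bsub>PS\<^esub> ps_exp F) k" .
qed

text \<open>\<open>exp_sum_derivation\<close> for the inner derivation y -> [y, X], which takes
  \<open>F\<close> to \<open>c\<close>.\<close>

lemma ps_exp_bracket:
  assumes F: "F \<in> carrier PS" "F 0 = \<zero>" and X: "X \<in> carrier PS" and c: "c \<in> carrier PS"
    and FX: "F \<otimes>\<^bsub>PS\<^esub> X = X \<otimes>\<^bsub>PS\<^esub> F \<oplus>\<^bsub>PS\<^esub> c" and comm: "c \<otimes>\<^bsub>PS\<^esub> F = F \<otimes>\<^bsub>PS\<^esub> c"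
  shows "ps_exp F \<otimes>\<^bsub>PS\<^esub> X = X \<otimes>\<^bsub>PS\<^esub> ps_exp F \<oplus>\<^bsub>PS\<^esub> c \<otimes>\<^bsub>PS\<^esub> ps_exp F"
proof
  interpret P: scalar_ring PS "\<lambda>x. ps_const (sc x)" by (rule scalar_ring_ps)
  define \<delta> where "\<delta> = (\<lambda>y. y \<otimes>\<^bsub>PS\<^esub> X \<ominus>\<^bsub>PS\<^esub> X \<otimes>\<^bsub>PS\<^esub> y)"
  have \<delta>F: "\<delta> F = c"
    using assms by (simp add: \<delta>_def P.minus_eq P.a_ac P.r_neg P.r_neg1 P.r_neg2)
  fix k
  define E where "E = exp_sum F (Suc k)"
  have E: "E \<in> carrier PS" "exp_sum F k \<in> carrier PS" "ps_exp F \<in> carrier PS"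
    using F by (auto simp: E_def exp_sum_closed ps_exp_closed simp del: exp_sum.simps)
  have "\<delta> E = c \<otimes>\<^bsub>PS\<^esub> exp_sum F k"
    unfolding E_def
  proof (subst exp_sum_derivation)
    fix a show "\<delta> (ps_const (sc a)) = \<zero>\<^bsub>PS\<^esub>"
      using X by (simp add: \<delta>_def P.sc_commute P.minus_eq P.r_neg)
  next
    fix x y assume [simp]: "x \<in> carrier PS" "y \<in> carrier PS"
    note [simp] = X
    show "\<delta> x \<in> carrier PS" by (simp add: \<delta>_def)
    show "\<delta> (x \<oplus>\<^bsub>PS\<^esub> y) = \<delta> x \<oplus>\<^bsub>PS\<^esub> \<delta> y"
      by (simp add: \<delta>_def P.l_distr P.r_distr P.minus_eq P.minus_add P.a_ac)
    show "\<delta> (x \<otimes>\<^bsub>PS\<^esub> y) = \<delta> x \<otimes>\<^bsub>PS\<^esub> y \<oplus>\<^bsub>PS\<^esub> x \<otimes>\<^bsub>PS\<^esub> \<delta> y"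
      by (subst P.a_comm) 
        (auto simp: \<delta>_def P.l_distr P.r_distr P.minus_eq P.l_minus P.r_minus P.m_assoc P.a_assoc P.r_neg1 P.r_neg2)
  qed (use F comm in \<open>auto simp: \<delta>F\<close>)
  then have "E \<otimes>\<^bsub>PS\<^esub> X = X \<otimes>\<^bsub>PS\<^esub> E \<oplus>\<^bsub>PS\<^esub> c \<otimes>\<^bsub>PS\<^esub> exp_sum F k"
    using E X c unfolding \<delta>_def by (metis P.a_comm P.m_closed P.minus_eq P.a_inv_closed P.r_neg1 P.add.inv_solve_right)
  then have "(E \<otimes>\<^bsub>PS\<^esub> X) k = (X \<otimes>\<^bsub>PS\<^esub> E) k \<oplus> (c \<otimes>\<^bsub>PS\<^esub> exp_sum F k) k"
    by (simp add: ps_add)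
  moreover have "(E \<otimes>\<^bsub>PS\<^esub> X) k = (ps_exp F \<otimes>\<^bsub>PS\<^esub> X) k" "(X \<otimes>\<^bsub>PS\<^esub> E) k = (X \<otimes>\<^bsub>PS\<^esub> ps_exp F) k"
    "(c \<otimes>\<^bsub>PS\<^esub> exp_sum F k) k = (c \<otimes>\<^bsub>PS\<^esub> ps_exp F) k"
    using E X c F by (auto intro!: ps_mult_cong_low simp: E_def ps_exp_eq_exp_sum[symmetric] simp del: exp_sum.simps)
  ultimately show "(ps_exp F \<otimes>\<^bsub>PS\<^esub> X) k = (X \<otimes>\<^bsub>PS\<^esub> ps_exp F \<oplus>\<^bsub>PS\<^esub> c \<otimes>\<^bsub>PS\<^esub> ps_exp F) k"
    by (simp add: ps_add)
qed

lemma ps_exp_commute: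
  assumes "F \<in> carrier PS" "F 0 = \<zero>" "X \<in> carrier PS" "F \<otimes>\<^bsub>PS\<^esub> X = X \<otimes>\<^bsub>PS\<^esub> F"
  shows "ps_exp F \<otimes>\<^bsub>PS\<^esub> X = X \<otimes>\<^bsub>PS\<^esub> ps_exp F"
proof -
  interpret P: scalar_ring PS "\<lambda>x. ps_const (sc x)" by (rule scalar_ring_ps)
  show ?thesis
    using ps_exp_bracket[of F X "\<zero>\<^bsub>PS\<^esub>"] assms by (simp add: ps_exp_closed)
qed

lemma euler_0: "F \<in> carrier PS \<Longrightarrow> euler F 0 = \<zero>"
  by (simp add: euler_def sc_0 ps_carrier)

lemma ps_mult_0: "f \<in> carrier PS \<Longrightarrow> g \<in> carrier PS \<Longrightarrow> (f \<otimes>\<^bsub>PS\<^esub> g) 0 = f 0 \<otimes> g 0"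
  by (simp add: ps_mult ps_carrier)

text \<open>Both sides have constant term 1 and satisfy E' = (F' + G') E, where the prime is the
  Euler derivation.\<close>

lemma ps_exp_add:
  assumes F: "F \<in> carrier PS" "F 0 = \<zero>" and G: "G \<in> carrier PS" "G 0 = \<zero>"
    and FF: "euler F \<otimes>\<^bsub>PS\<^esub> F = F \<otimes>\<^bsub>PS\<^esub> euler F" and GG: "euler G \<otimes>\<^bsub>PS\<^esub> G = G \<otimes>\<^bsub>PS\<^esub> euler G"
    and FG: "F \<otimes>\<^bsub>PS\<^esub> euler G = euler G \<otimes>\<^bsub>PS\<^esub> F" "euler F \<otimes>\<^bsub>PS\<^esub> G = G \<otimes>\<^bsub>PS\<^esub> euler F"
  shows "ps_exp (F \<oplus>\<^bsub>PS\<^esub> G) = ps_exp F \<otimes>\<^bsub>PS\<^esub> ps_exp G"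
proof -
  interpret P: scalar_ring PS "\<lambda>x. ps_const (sc x)" by (rule scalar_ring_ps)
  note [simp] = F G euler_closed ps_exp_closed euler_add
  have "ps_exp F \<otimes>\<^bsub>PS\<^esub> euler G = euler G \<otimes>\<^bsub>PS\<^esub> ps_exp F"
    using FG by (intro ps_exp_commute) auto
  then have c: "ps_exp F \<otimes>\<^bsub>PS\<^esub> (euler G \<otimes>\<^bsub>PS\<^esub> ps_exp G) = euler G \<otimes>\<^bsub>PS\<^esub> (ps_exp F \<otimes>\<^bsub>PS\<^esub> ps_exp G)"
    by (simp add: P.m_assoc[symmetric])
  show ?thesis
  proof (rule euler_unique[where G = "euler (F \<oplus>\<^bsub>PS\<^esub> G)"])
    show "euler (ps_exp (F \<oplus>\<^bsub>PS\<^esub> G)) = euler (F \<oplus>\<^bsub>PS\<^esub> G) \<otimes>\<^bsub>PS\<^esub> ps_exp (F \<oplus>\<^bsub>PS\<^esub> G)"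
      using FF GG FG by (intro euler_ps_exp) (auto simp: ps_add P.l_distr P.r_distr P.a_ac)
    show "euler (ps_exp F \<otimes>\<^bsub>PS\<^esub> ps_exp G) = euler (F \<oplus>\<^bsub>PS\<^esub> G) \<otimes>\<^bsub>PS\<^esub> (ps_exp F \<otimes>\<^bsub>PS\<^esub> ps_exp G)"
      using FF GG by (simp add: euler_mult euler_ps_exp c P.l_distr P.m_assoc)
  qed (auto simp: ps_exp_0 ps_mult_0 ps_add euler_0)
qed

definition ps_central :: "(nat \<Rightarrow> 'a) \<Rightarrow> bool" where
  "ps_central K \<longleftrightarrow> K \<in> carrier PS \<and> (\<forall>f\<in>carrier PS. K \<otimes>\<^bsub>PS\<^esub> f = f \<otimes>\<^bsub>PS\<^esub> K)"

text \<open>Both sides satisfy the same first order differential equation.\<close>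

lemma ps_exp_exchange:
  assumes F: "F \<in> carrier PS" "F 0 = \<zero>" and G: "G \<in> carrier PS" "G 0 = \<zero>"
    and FF: "euler F \<otimes>\<^bsub>PS\<^esub> F = F \<otimes>\<^bsub>PS\<^esub> euler F" and GG: "euler G \<otimes>\<^bsub>PS\<^esub> G = G \<otimes>\<^bsub>PS\<^esub> euler G"
    and K: "ps_central K" "ps_central (euler K)" "K 0 = \<zero>" "F \<otimes>\<^bsub>PS\<^esub> G = G \<otimes>\<^bsub>PS\<^esub> F \<oplus>\<^bsub>PS\<^esub> K"
    and L: "ps_central L" "F \<otimes>\<^bsub>PS\<^esub> euler G = euler G \<otimes>\<^bsub>PS\<^esub> F \<oplus>\<^bsub>PS\<^esub> L"
  shows "ps_exp F \<otimes>\<^bsub>PS\<^esub> ps_exp G = ps_exp K \<otimes>\<^bsub>PS\<^esub> (ps_exp G \<otimes>\<^bsub>PS\<^esub> ps_exp F)"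
proof -
  interpret P: scalar_ring PS "\<lambda>x. ps_const (sc x)" by (rule scalar_ring_ps)
  have Kc [simp]: "K \<in> carrier PS" "L \<in> carrier PS" using K L by (auto simp: ps_central_def)
  note [simp] = F G euler_closed ps_exp_closed euler_add
  define A B where "A = ps_exp F" and "B = ps_exp G"
  have [simp]: "A \<in> carrier PS" "B \<in> carrier PS" by (auto simp: A_def B_def)
  have cK: "euler K \<otimes>\<^bsub>PS\<^esub> x = x \<otimes>\<^bsub>PS\<^esub> euler K" "K \<otimes>\<^bsub>PS\<^esub> x = x \<otimes>\<^bsub>PS\<^esub> K" "L \<otimes>\<^bsub>PS\<^esub> x = x \<otimes>\<^bsub>PS\<^esub> L"
    if "x \<in> carrier PS" for x
    using K L that by (auto simp: ps_central_def)
  have eK: "ps_exp K \<otimes>\<^bsub>PS\<^esub> x = x \<otimes>\<^bsub>PS\<^esub> ps_exp K" if "x \<in> carrier PS" for x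
    using that K by (intro ps_exp_commute cK) auto
  \<comment> \<open>The Euler derivative of [F, G] = K; together with [F, G'] = L it yields [G, F']
    = L - K'.\<close>
  have "euler F \<otimes>\<^bsub>PS\<^esub> G \<oplus>\<^bsub>PS\<^esub> F \<otimes>\<^bsub>PS\<^esub> euler G = euler G \<otimes>\<^bsub>PS\<^esub> F \<oplus>\<^bsub>PS\<^esub> G \<otimes>\<^bsub>PS\<^esub> euler F \<oplus>\<^bsub>PS\<^esub> euler K"
    using arg_cong[OF K(4), of euler] by (simp add: euler_mult)
  then have "(euler F \<otimes>\<^bsub>PS\<^esub> G \<oplus>\<^bsub>PS\<^esub> L) \<oplus>\<^bsub>PS\<^esub> euler G \<otimes>\<^bsub>PS\<^esub> F = (G \<otimes>\<^bsub>PS\<^esub> euler F \<oplus>\<^bsub>PS\<^esub> euler K) \<oplus>\<^bsub>PS\<^esub> euler G \<otimes>\<^bsub>PS\<^esub> F"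
    unfolding L(2) by (simp add: P.a_ac)
  then have "euler F \<otimes>\<^bsub>PS\<^esub> G \<oplus>\<^bsub>PS\<^esub> L = G \<otimes>\<^bsub>PS\<^esub> euler F \<oplus>\<^bsub>PS\<^esub> euler K"
    by (subst (asm) P.add.right_cancel) auto
  then have "G \<otimes>\<^bsub>PS\<^esub> euler F = euler F \<otimes>\<^bsub>PS\<^esub> G \<oplus>\<^bsub>PS\<^esub> L \<ominus>\<^bsub>PS\<^esub> euler K"
    by (simp add: P.minus_eq P.a_assoc P.r_neg)
  then have GF: "G \<otimes>\<^bsub>PS\<^esub> euler F = euler F \<otimes>\<^bsub>PS\<^esub> G \<oplus>\<^bsub>PS\<^esub> (L \<ominus>\<^bsub>PS\<^esub> euler K)"
    by (simp add: P.minus_eq P.a_assoc)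
  have A: "euler A = euler F \<otimes>\<^bsub>PS\<^esub> A" and B: "euler B = euler G \<otimes>\<^bsub>PS\<^esub> B"
    using FF GG by (auto simp: A_def B_def euler_ps_exp)
  have AG: "A \<otimes>\<^bsub>PS\<^esub> euler G = euler G \<otimes>\<^bsub>PS\<^esub> A \<oplus>\<^bsub>PS\<^esub> L \<otimes>\<^bsub>PS\<^esub> A"
    unfolding A_def by (rule ps_exp_bracket) (use L in \<open>auto simp: cK(3)[of F]\<close>)
  have BF: "B \<otimes>\<^bsub>PS\<^esub> euler F = euler F \<otimes>\<^bsub>PS\<^esub> B \<oplus>\<^bsub>PS\<^esub> (L \<ominus>\<^bsub>PS\<^esub> euler K) \<otimes>\<^bsub>PS\<^esub> B"
    unfolding B_def by (rule ps_exp_bracket) 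
      (use GF in \<open>auto simp: cK(1)[of G] cK(3)[of G] P.minus_eq P.l_distr P.r_distr P.l_minus P.r_minus\<close>)
  have EK: "euler (ps_exp K) = euler K \<otimes>\<^bsub>PS\<^esub> ps_exp K"
    using K by (intro euler_ps_exp cK) auto
  have "\<zero> = \<zero> \<oplus> L 0"
    using arg_cong[OF L(2), of "\<lambda>f. f 0"] by (simp add: ps_add ps_mult_0 euler_0 ps_coeff)
  then have L0: "L 0 = \<zero>" by (simp add: ps_coeff)
  \<comment> \<open>The common logarithmic derivative: moving \<open>A\<close> past G' contributes
    \<open>L\<close>, moving \<open>B\<close> past F' contributes L - K', and the factor
    \<open>ps_exp K\<close> restores K'.\<close>
  define H where "H = euler F \<oplus>\<^bsub>PS\<^esub> euler G \<oplus>\<^bsub>PS\<^esub> L"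
  have [simp]: "H \<in> carrier PS" by (simp add: H_def)
  have AB: "euler (A \<otimes>\<^bsub>PS\<^esub> B) = H \<otimes>\<^bsub>PS\<^esub> (A \<otimes>\<^bsub>PS\<^esub> B)"
  proof -
    have "euler (A \<otimes>\<^bsub>PS\<^esub> B) = euler F \<otimes>\<^bsub>PS\<^esub> A \<otimes>\<^bsub>PS\<^esub> B \<oplus>\<^bsub>PS\<^esub> (A \<otimes>\<^bsub>PS\<^esub> euler G) \<otimes>\<^bsub>PS\<^esub> B"
      by (simp add: euler_mult A B P.m_assoc)
    also have "\<dots> = H \<otimes>\<^bsub>PS\<^esub> (A \<otimes>\<^bsub>PS\<^esub> B)"
      unfolding AG H_def by (simp add: P.l_distr P.m_assoc P.a_assoc)
    finally show ?thesis .
  qed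
  have aux: "g \<oplus>\<^bsub>PS\<^esub> (f \<oplus>\<^bsub>PS\<^esub> (l \<oplus>\<^bsub>PS\<^esub> \<ominus>\<^bsub>PS\<^esub> k)) \<oplus>\<^bsub>PS\<^esub> k = f \<oplus>\<^bsub>PS\<^esub> g \<oplus>\<^bsub>PS\<^esub> l"
    if "f \<in> carrier PS" "g \<in> carrier PS" "k \<in> carrier PS" "l \<in> carrier PS" for f g k l
  proof -
    have "g \<oplus>\<^bsub>PS\<^esub> (f \<oplus>\<^bsub>PS\<^esub> (l \<oplus>\<^bsub>PS\<^esub> \<ominus>\<^bsub>PS\<^esub> k)) \<oplus>\<^bsub>PS\<^esub> k = g \<oplus>\<^bsub>PS\<^esub> (f \<oplus>\<^bsub>PS\<^esub> l)"
      using that by (simp add: P.a_assoc P.l_neg)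
    then show ?thesis using that by (simp add: P.a_ac)
  qed
  have BA: "euler (B \<otimes>\<^bsub>PS\<^esub> A) \<oplus>\<^bsub>PS\<^esub> euler K \<otimes>\<^bsub>PS\<^esub> (B \<otimes>\<^bsub>PS\<^esub> A) = H \<otimes>\<^bsub>PS\<^esub> (B \<otimes>\<^bsub>PS\<^esub> A)"
  proof -
    have "euler (B \<otimes>\<^bsub>PS\<^esub> A) = euler G \<otimes>\<^bsub>PS\<^esub> B \<otimes>\<^bsub>PS\<^esub> A \<oplus>\<^bsub>PS\<^esub> (B \<otimes>\<^bsub>PS\<^esub> euler F) \<otimes>\<^bsub>PS\<^esub> A"
      by (simp add: euler_mult A B P.m_assoc)
    also have "\<dots> = euler G \<otimes>\<^bsub>PS\<^esub> (B \<otimes>\<^bsub>PS\<^esub> A) \<oplus>\<^bsub>PS\<^esub> (euler F \<otimes>\<^bsub>PS\<^esub> (B \<otimes>\<^bsub>PS\<^esub> A) \<oplus>\<^bsub>PS\<^esub>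
        (L \<otimes>\<^bsub>PS\<^esub> (B \<otimes>\<^bsub>PS\<^esub> A) \<oplus>\<^bsub>PS\<^esub> \<ominus>\<^bsub>PS\<^esub> (euler K \<otimes>\<^bsub>PS\<^esub> (B \<otimes>\<^bsub>PS\<^esub> A))))"
      unfolding BF by (simp add: P.l_distr P.m_assoc a_minus_def P.l_minus)
    finally show ?thesis
      unfolding H_def by (simp add: aux P.l_distr)
  qed
  have "A \<otimes>\<^bsub>PS\<^esub> B = ps_exp K \<otimes>\<^bsub>PS\<^esub> (B \<otimes>\<^bsub>PS\<^esub> A)"
  proof (rule euler_unique[where G = H])
    have "euler (ps_exp K \<otimes>\<^bsub>PS\<^esub> (B \<otimes>\<^bsub>PS\<^esub> A)) = ps_exp K \<otimes>\<^bsub>PS\<^esub> (euler (B \<otimes>\<^bsub>PS\<^esub> A) \<oplus>\<^bsub>PS\<^esub> euler K \<otimes>\<^bsub>PS\<^esub> (B \<otimes>\<^bsub>PS\<^esub> A))"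
      by (simp add: euler_mult[of "ps_exp K"] EK P.r_distr cK(1)[of "ps_exp K"] P.a_ac P.m_assoc)
    also have "\<dots> = H \<otimes>\<^bsub>PS\<^esub> (ps_exp K \<otimes>\<^bsub>PS\<^esub> (B \<otimes>\<^bsub>PS\<^esub> A))"
      unfolding BA by (simp add: P.m_assoc[symmetric] eK[of H])
    finally show "euler (ps_exp K \<otimes>\<^bsub>PS\<^esub> (B \<otimes>\<^bsub>PS\<^esub> A)) = H \<otimes>\<^bsub>PS\<^esub> (ps_exp K \<otimes>\<^bsub>PS\<^esub> (B \<otimes>\<^bsub>PS\<^esub> A))" .
    show "(A \<otimes>\<^bsub>PS\<^esub> B) 0 = (ps_exp K \<otimes>\<^bsub>PS\<^esub> (B \<otimes>\<^bsub>PS\<^esub> A)) 0"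
      by (simp add: ps_mult_0 A_def B_def ps_exp_0)
    show "H 0 = \<zero>" using L0 by (simp add: H_def ps_add euler_0)
  qed (simp_all add: AB)
  then show ?thesis by (simp add: A_def B_def)
qed

end

section \<open>Free algebras and presentations\<close>

lemma word_mult_single: 
  "Poly_Mapping.single (Word u) a * Poly_Mapping.single (Word v) b = Poly_Mapping.single (Word (u @ v)) (a * b)"
  by (simp add: mult_single plus_word_def)

lemma letter_mult_single: 
  "letter g * Poly_Mapping.single (Word v) b = Poly_Mapping.single (Word (g # v)) b"
  by (simp add: letter_def word_mult_single)

lemma scalar_add: "scalar (x + y) = scalar x + scalar y"
  and scalar_mult: "scalar (x * y) = scalar x * scalar y"
  and scalar_1 [simp]: "scalar 1 = 1" and scalar_0 [simp]: "scalar 0 = 0"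
  by (simp_all add: scalar_def single_add mult_single)

lemma scalar_sum: "scalar (sum f A) = (\<Sum>i\<in>A. scalar (f i))"
  by (induction A rule: infinite_finite_induct) (auto simp: scalar_add)

lemma sum_singles:
  fixes f :: "'k \<Rightarrow>\<^sub>0 'c::comm_monoid_add"
  shows "(\<Sum>k\<in>Poly_Mapping.keys f. Poly_Mapping.single k (Poly_Mapping.lookup f k)) = f"
  by (rule poly_mapping_eqI) (auto simp: lookup_sum lookup_single when_def in_keys_iff)

lemma poly_mapping_single_induct:
  fixes f :: "'k \<Rightarrow>\<^sub>0 'c::comm_monoid_add"
  assumes "P 0" "\<And>f g. P f \<Longrightarrow> P g \<Longrightarrow> P (f + g)" "\<And>k c. k \<in> Poly_Mapping.keys f \<Longrightarrow> P (Poly_Mapping.single k c)"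
  shows "P f"
proof -
  have "P (\<Sum>k\<in>A. Poly_Mapping.single k (Poly_Mapping.lookup f k))" if "A \<subseteq> Poly_Mapping.keys f" for A
    using that by (induction A rule: infinite_finite_induct) (auto intro: assms)
  from this[of "Poly_Mapping.keys f"] show ?thesis by (simp add: sum_singles)
qed

lemma scalar_commute: "scalar c * f = f * scalar c"
proof (induction f rule: poly_mapping_single_induct)
  case (3 k d)
  then show ?case by (cases k) (simp add: scalar_def mult_single mult.commute)
qed (simp_all add: distrib_left distrib_right)

lemma free_algebra_simps:
  "mult (free_algebra G) = (*)" "one (free_algebra G) = 1" "zero (free_algebra G) = 0" "add (free_algebra G) = (+)"
  by (simp_all add: free_algebra_def)

lemma mem_free_algebra: 
  "f \<in> carrier (free_algebra G) \<longleftrightarrow> (\<forall>w\<in>Poly_Mapping.keys f. set (letters w) \<subseteq> G)"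
  by (simp add: free_algebra_def)

lemma free_algebra_add: "f \<in> carrier (free_algebra G) \<Longrightarrow> g \<in> carrier (free_algebra G) \<Longrightarrow> f + g \<in> carrier (free_algebra G)"
  unfolding mem_free_algebra using keys_add[of f g] by blast

lemma free_algebra_minus: "f \<in> carrier (free_algebra G) \<Longrightarrow> - f \<in> carrier (free_algebra G)"
  by (simp add: mem_free_algebra Poly_Mapping.keys_def)

lemma free_algebra_diff: "f \<in> carrier (free_algebra G) \<Longrightarrow> g \<in> carrier (free_algebra G) \<Longrightarrow> f - g \<in> carrier (free_algebra G)"
  using free_algebra_add[of f G "- g"] free_algebra_minus[of g G] by simp

lemma free_algebra_mult: 
  assumes "f \<in> carrier (free_algebra G)" "g \<in> carrier (free_algebra G)"
  shows "f * g \<in> carrier (free_algebra G)"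
  unfolding mem_free_algebra
proof
  fix w assume "w \<in> Poly_Mapping.keys (f * g)"
  then obtain u v where "w = u + v" "u \<in> Poly_Mapping.keys f" "v \<in> Poly_Mapping.keys g"
    using keys_mult[of f g] by auto
  then show "set (letters w) \<subseteq> G"
    using assms by (auto simp: mem_free_algebra plus_word_def)
qed

lemma free_algebra_letter: "g \<in> G \<Longrightarrow> letter g \<in> carrier (free_algebra G)"
  by (auto simp: mem_free_algebra letter_def split: if_splits)

lemma free_algebra_scalar [simp]: "scalar c \<in> carrier (free_algebra G)"
  by (auto simp: mem_free_algebra scalar_def zero_word_def split: if_splits)

lemma free_algebra_1 [simp]: "1 \<in> carrier (free_algebra G)"
  using free_algebra_scalar[of 1] by simp

lemma free_algebra_0 [simp]: "0 \<in> carrier (free_algebra G)"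
  by (simp add: mem_free_algebra)

lemma free_algebra_sum: "(\<And>i. i \<in> A \<Longrightarrow> f i \<in> carrier (free_algebra G)) \<Longrightarrow> (\<Sum>i\<in>A. f i) \<in> carrier (free_algebra G)"
  by (induction A rule: infinite_finite_induct) (auto intro: free_algebra_add)

lemma free_algebra_ring: "ring (free_algebra G)"
proof (rule ringI)
  show "abelian_group (free_algebra G)"
    by (rule abelian_groupI)
      (auto simp: free_algebra_simps free_algebra_add add_ac intro!: bexI[of _ "- _"] free_algebra_minus)
  show "Group.monoid (free_algebra G)"
    by (rule monoidI) (auto simp: free_algebra_simps free_algebra_mult mult.assoc)
qed (auto simp: free_algebra_simps algebra_simps)

lemma free_algebra_a_inv: "f \<in> carrier (free_algebra G) \<Longrightarrow> \<ominus>\<^bsub>free_algebra G\<^esub> f = - f"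
proof -
  interpret ring "free_algebra G" by (rule free_algebra_ring)
  assume "f \<in> carrier (free_algebra G)"
  then show ?thesis using free_algebra_minus[of f G]
    by (intro minus_equality) (auto simp: free_algebra_simps)
qed

lemma free_algebra_induct [consumes 1, case_names scalar add letter]:
  assumes "f \<in> carrier (free_algebra G)" 
    and scalar: "\<And>c. P (scalar c)"
    and add: "\<And>f h. P f \<Longrightarrow> P h \<Longrightarrow> P (f + h)"
    and letter: "\<And>g f. g \<in> G \<Longrightarrow> f \<in> carrier (free_algebra G) \<Longrightarrow> P f \<Longrightarrow> P (letter g * f)"
  shows "P f"
proof -
  have single: "set w \<subseteq> G \<Longrightarrow> Poly_Mapping.single (Word w) c \<in> carrier (free_algebra G) \<and> P (Poly_Mapping.single (Word w) c)" for w c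
  proof (induction w)
    case Nil
    then show ?case using scalar[of c] by (auto simp: mem_free_algebra scalar_def zero_word_def split: if_splits)
  next
    case (Cons g w)
    then show ?case using letter[of g "Poly_Mapping.single (Word w) c"] 
        free_algebra_mult[OF free_algebra_letter[of g G], of "Poly_Mapping.single (Word w) c"]
      by (auto simp: letter_mult_single)
  qed
  show ?thesis
  proof (rule poly_mapping_single_induct)
    show "P 0" using scalar[of 0] by simp
    fix k c assume "k \<in> Poly_Mapping.keys f"
    then show "P (Poly_Mapping.single k c)"
      using assms(1) single[of "letters k" c] by (auto simp: mem_free_algebra)
  qed (rule add)
qed

locale presentation =
  fixes G :: "'g set" and S :: "('g word \<Rightarrow>\<^sub>0 'c::comm_ring_1) set"
  assumes relations_closed: "S \<subseteq> carrier (free_algebra G)"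
begin

abbreviation "FA \<equiv> (free_algebra G :: ('g word \<Rightarrow>\<^sub>0 'c) ring)"
abbreviation "RI \<equiv> genideal FA S"
abbreviation "PA \<equiv> presented_algebra G S"
abbreviation "cls \<equiv> presented_class G S"

sublocale FA: ring FA by (rule free_algebra_ring)
sublocale RI: ideal RI FA by (rule FA.genideal_ideal[OF relations_closed])
sublocale PA: ring PA unfolding presented_algebra_def by (rule RI.quotient_is_ring)

lemma cls_hom: "ring_hom_ring FA PA cls"
  unfolding presented_algebra_def presented_class_def by (rule RI.rcos_ring_hom_ring)

sublocale cls: ring_hom_ring FA PA cls by (rule cls_hom)

lemma cls_closed: "f \<in> carrier FA \<Longrightarrow> cls f \<in> carrier PA"
  by (rule cls.hom_closed)

lemma cls_mult: "f \<in> carrier FA \<Longrightarrow> g \<in> carrier FA \<Longrightarrow> cls (f * g) = cls f \<otimes>\<^bsub>PA\<^esub> cls g"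
  and cls_add: "f \<in> carrier FA \<Longrightarrow> g \<in> carrier FA \<Longrightarrow> cls (f + g) = cls f \<oplus>\<^bsub>PA\<^esub> cls g"
  using cls.hom_mult[of f g] cls.hom_add[of f g] by (simp_all add: free_algebra_simps)

lemma cls_1: "cls 1 = \<one>\<^bsub>PA\<^esub>" and cls_0: "cls 0 = \<zero>\<^bsub>PA\<^esub>"
  using cls.hom_one cls.hom_zero by (simp_all add: free_algebra_simps)

lemma cls_surj: "X \<in> carrier PA \<Longrightarrow> \<exists>f\<in>carrier FA. X = cls f"
  by (auto simp: presented_algebra_def FactRing_def A_RCOSETS_def' presented_class_def a_r_coset_def' A_RCOSETS_defs a_r_coset_defs)

lemma cls_eq_iff: 
  assumes "f \<in> carrier FA" "g \<in> carrier FA"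
  shows "cls f = cls g \<longleftrightarrow> f - g \<in> RI"
proof -
  have "f \<ominus>\<^bsub>FA\<^esub> g = f - g" using assms by (simp add: a_minus_def free_algebra_a_inv free_algebra_simps)
  then show ?thesis 
    using FA.quotient_eq_iff_same_a_r_cos[OF RI.is_ideal assms] by (simp add: presented_class_def)
qed

lemma RI_rel: "x \<in> S \<Longrightarrow> x \<in> RI"
  using FA.genideal_self[OF relations_closed] by auto

lemma RI_sum: "(\<And>i. i \<in> A \<Longrightarrow> f i \<in> RI) \<Longrightarrow> (\<Sum>i\<in>A. f i) \<in> RI"
proof (induction A rule: infinite_finite_induct)
  case (insert x A)
  then show ?case using RI.a_closed[of "f x" "\<Sum>i\<in>A. f i"] by (simp add: free_algebra_simps)
qed (use RI.zero_closed in \<open>simp_all add: free_algebra_simps\<close>)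

lemma RI_mult: "x \<in> RI \<Longrightarrow> f \<in> carrier FA \<Longrightarrow> f * x \<in> RI" "x \<in> RI \<Longrightarrow> f \<in> carrier FA \<Longrightarrow> x * f \<in> RI"
  using RI.I_l_closed[of x f] RI.I_r_closed[of x f] by (simp_all add: free_algebra_simps)

lemma RI_add: "x \<in> RI \<Longrightarrow> y \<in> RI \<Longrightarrow> x + y \<in> RI"
  using RI.a_closed[of x y] by (simp add: free_algebra_simps)

lemma cls_finsum: "finite A \<Longrightarrow> (\<And>i. i \<in> A \<Longrightarrow> f i \<in> carrier FA) \<Longrightarrow> cls (\<Sum>i\<in>A. f i) = (\<Oplus>\<^bsub>PA\<^esub>i\<in>A. cls (f i))"
proof (induction A rule: finite_induct)
  case (insert x A)
  have "(\<Sum>i\<in>A. f i) \<in> carrier FA" by (rule free_algebra_sum) (use insert in auto)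
  then show ?case using insert by (subst PA.finsum_insert) (auto simp: cls_add cls_closed)
qed (simp add: cls_0)

text \<open>Commuting with \<open>z\<close> modulo the ideal passes to products by [z, g f] = [z, g]
  f + g [z, f].\<close>

lemma central_if_commutes_with_generators:
  assumes "z \<in> carrier FA" "\<And>g. g \<in> G \<Longrightarrow> z * letter g - letter g * z \<in> RI" "X \<in> carrier PA"
  shows "cls z \<otimes>\<^bsub>PA\<^esub> X = X \<otimes>\<^bsub>PA\<^esub> cls z"
proof -
  obtain f where f: "f \<in> carrier FA" "X = cls f" using cls_surj[OF assms(3)] by auto
  have "z * f - f * z \<in> RI" using f(1)
  proof (induction f rule: free_algebra_induct)
    case (scalar c)
    then show ?case using RI.zero_closed by (simp add: scalar_commute free_algebra_simps)
  next
    case (add f h)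
    have "z * (f + h) - (f + h) * z = (z * f - f * z) + (z * h - h * z)" by (simp add: algebra_simps)
    then show ?case using RI_add[OF add] by simp
  next
    case (letter g f)
    have "z * (letter g * f) - letter g * f * z = 
       (z * letter g - letter g * z) * f + letter g * (z * f - f * z)" by (simp add: algebra_simps)
    moreover have "(z * letter g - letter g * z) * f \<in> RI"
      using letter assms(2) by (intro RI_mult) auto
    moreover have "letter g * (z * f - f * z) \<in> RI"
      using letter by (intro RI_mult free_algebra_letter) auto
    ultimately show ?case using RI_add by metis
  qed
  then have "cls (z * f) = cls (f * z)" using f(1) assms(1) by (simp add: cls_eq_iff free_algebra_mult)
  then show ?thesis using f assms(1) by (simp add: cls_mult)
qed

end

section \<open>Exponentials in the Heisenberg algebra\<close>

context cartan_q
begin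

lemma heis_relations_closed: "heis_relations C r q \<subseteq> carrier (free_algebra heis_letters)"
proof -
  have [simp]: "letter (LA i m) \<in> carrier (free_algebra heis_letters)" if "m \<noteq> 0" for i m
    using that by (intro free_algebra_letter) (auto simp: heis_letters_def)
  have [simp]: "letter (LC s) \<in> carrier (free_algebra heis_letters)" if "s > 0" for s
    using that by (intro free_algebra_letter) (auto simp: heis_letters_def)
  have [simp]: "letter g \<in> carrier (free_algebra heis_letters)" if "g \<in> heis_letters" for g :: "'a heis_letter"
    using that by (rule free_algebra_letter)
  show ?thesis unfolding heis_relations_def
    by (auto intro!: free_algebra_diff free_algebra_mult)
qed

sublocale HP: presentation heis_letters "heis_relations C r q"
  by unfold_locales (rule heis_relations_closed)

abbreviation "H \<equiv> Heis C r q"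
abbreviation "sc \<equiv> heis_scalar C r q"

lemma Heis_eq: "H = HP.PA" by (simp add: Heis_def)

lemma sc_eq: "sc x = HP.cls (scalar x)" by (simp add: heis_scalar_def)

sublocale HS: scalar_ring H sc
proof (intro scalar_ring.intro)
  show "ring H" unfolding Heis_eq by (rule HP.PA.ring_axioms)
  show "scalar_ring_axioms H sc"
  proof
    fix x y a
    show "sc x \<in> carrier H" unfolding Heis_eq sc_eq by (intro HP.cls_closed) simp
    show "sc (x + y) = sc x \<oplus>\<^bsub>H\<^esub> sc y" "sc (x * y) = sc x \<otimes>\<^bsub>H\<^esub> sc y" "sc 1 = \<one>\<^bsub>H\<^esub>"
      unfolding Heis_eq sc_eq by (simp_all add: scalar_add scalar_mult HP.cls_add HP.cls_mult HP.cls_1)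
    show "sc x \<otimes>\<^bsub>H\<^esub> a = a \<otimes>\<^bsub>H\<^esub> sc x" if "a \<in> carrier H"
      using that HP.RI.zero_closed unfolding Heis_eq sc_eq
      by (intro HP.central_if_commutes_with_generators) (auto simp: scalar_commute free_algebra_simps)
  qed
qed

section \<open>Linear elements and their generating series\<close>

definition linF :: "('a \<Rightarrow> complex) \<Rightarrow> int \<Rightarrow> ('a heis_letter word \<Rightarrow>\<^sub>0 complex)" where
  "linF u m = (\<Sum>i\<in>UNIV. scalar (u i) * letter (LA i m))"

definition lin :: "('a \<Rightarrow> complex) \<Rightarrow> int \<Rightarrow> 'a heis" where
  "lin u m = HP.cls (linF u m)"

lemma LA_closed: "m \<noteq> 0 \<Longrightarrow> letter (LA i m) \<in> carrier (free_algebra heis_letters)"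
  by (rule free_algebra_letter) (auto simp: heis_letters_def)

lemma LC_closed: "s > 0 \<Longrightarrow> letter (LC s) \<in> carrier (free_algebra heis_letters)"
  by (rule free_algebra_letter) (auto simp: heis_letters_def)

lemma linF_closed: "m \<noteq> 0 \<Longrightarrow> linF u m \<in> carrier (free_algebra heis_letters)"
  unfolding linF_def by (intro free_algebra_sum free_algebra_mult LA_closed) auto

lemma lin_closed [simp]: "m \<noteq> 0 \<Longrightarrow> lin u m \<in> carrier H"
  unfolding lin_def Heis_eq by (intro HP.cls_closed linF_closed)

lemma heis_c_closed [simp]: "s > 0 \<Longrightarrow> heis_c C r q s \<in> carrier H"
  unfolding heis_c_def Heis_eq by (intro HP.cls_closed LC_closed)

lemma heis_c_central:
  assumes "s > 0" "X \<in> carrier H"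
  shows "heis_c C r q s \<otimes>\<^bsub>H\<^esub> X = X \<otimes>\<^bsub>H\<^esub> heis_c C r q s"
  using assms unfolding heis_c_def Heis_eq
  by (intro HP.central_if_commutes_with_generators HP.RI_rel LC_closed)
    (auto simp: heis_relations_def)

lemma lin_smult: "m \<noteq> 0 \<Longrightarrow> sc x \<otimes>\<^bsub>H\<^esub> lin u m = lin (\<lambda>i. x * u i) m"
proof -
  assume m: "m \<noteq> 0"
  have "scalar x * linF u m = linF (\<lambda>i. x * u i) m"
    by (simp add: linF_def sum_distrib_left scalar_mult mult.assoc)
  then show ?thesis using HP.cls_mult[OF free_algebra_scalar linF_closed[OF m], of x u]
    by (simp only: lin_def Heis_eq sc_eq)
qed

lemma lin_add: "m \<noteq> 0 \<Longrightarrow> lin u m \<oplus>\<^bsub>H\<^esub> lin v m = lin (\<lambda>i. u i + v i) m"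
proof -
  assume m: "m \<noteq> 0"
  have "linF u m + linF v m = linF (\<lambda>i. u i + v i) m"
    by (simp add: linF_def sum.distrib scalar_add distrib_right)
  then show ?thesis using HP.cls_add[OF linF_closed[OF m] linF_closed[OF m], of u v]
    by (simp only: lin_def Heis_eq)
qed

lemma heis_y_eq: "m \<noteq> 0 \<Longrightarrow> heis_y C r q j m = lin (\<lambda>i. ev m (Ct $ i $ j)) m"
  unfolding heis_y_def lin_def linF_def Heis_eq
  by (subst HP.cls_finsum) (auto simp: free_algebra_mult LA_closed HP.cls_mult sc_eq heis_a_def ev_def 
      intro!: HP.PA.finsum_cong' HP.PA.m_closed HP.cls_closed)

lemma heis_a_eq: "m \<noteq> 0 \<Longrightarrow> heis_a C r q i m = lin (\<lambda>j. of_bool (j = i)) m"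
proof -
  have "(\<Sum>j\<in>UNIV. scalar (of_bool (j = i)) * letter (LA j m)) = (\<Sum>j\<in>UNIV. if j = i then letter (LA i m) else 0 :: 'a heis_letter word \<Rightarrow>\<^sub>0 complex)"
    by (intro sum.cong) auto
  then show ?thesis by (simp add: heis_a_def lin_def linF_def)
qed

definition bracket :: "int \<Rightarrow> ('a \<Rightarrow> complex) \<Rightarrow> ('a \<Rightarrow> complex) \<Rightarrow> complex" where
  "bracket m u v = (\<Sum>i\<in>UNIV. \<Sum>j\<in>UNIV. u i * v j * Bm m i j)"

lemma lin_commutator:
  assumes "m \<noteq> 0" "s \<noteq> 0"
  shows "lin u m \<otimes>\<^bsub>H\<^esub> lin v s = lin v s \<otimes>\<^bsub>H\<^esub> lin u m \<oplus>\<^bsub>H\<^esub> sc (of_bool (m = - s) * bracket m u v) \<otimes>\<^bsub>H\<^esub> heis_c C r q (nat \<bar>m\<bar>)"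
proof -
  let ?c = "letter (LC (nat \<bar>m\<bar>)) :: 'a heis_letter word \<Rightarrow>\<^sub>0 complex"
  have c: "?c \<in> carrier (free_algebra heis_letters)" using assms by (intro LC_closed) simp
  note cl = linF_closed[OF assms(1)] linF_closed[OF assms(2)]
  have swap: "scalar a * x * (scalar b * y) = scalar (a * b) * (x * y)" for a b :: complex and x y :: "'a heis_letter word \<Rightarrow>\<^sub>0 complex"
    by (metis mult.assoc scalar_commute scalar_mult)
  have 1: "linF u m * linF v s = (\<Sum>i\<in>UNIV. \<Sum>j\<in>UNIV. scalar (u i * v j) * (letter (LA i m) * letter (LA j s)))"
    unfolding linF_def sum_product swap ..
  have 2: "linF v s * linF u m = (\<Sum>i\<in>UNIV. \<Sum>j\<in>UNIV. scalar (u i * v j) * (letter (LA j s) * letter (LA i m)))"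
    unfolding linF_def sum_product swap by (subst sum.swap) (simp add: mult.commute)
  have 3: "scalar (of_bool (m = - s) * bracket m u v) * ?c = 
    (\<Sum>i\<in>UNIV. \<Sum>j\<in>UNIV. scalar (u i * v j) * (scalar (of_bool (m = - s) * (q powi m - q powi (- m)) * ratfun_at (Bz C r $ i $ j) (q powi m)) * ?c))"
  proof -
    have e: "of_bool (m = - s) * bracket m u v = 
      (\<Sum>i\<in>UNIV. \<Sum>j\<in>UNIV. (u i * v j) * (of_bool (m = - s) * (q powi m - q powi (- m)) * ratfun_at (Bz C r $ i $ j) (q powi m)))"
      by (simp add: bracket_def Bm_def ev_def sum_distrib_left mult_ac)
    show ?thesis unfolding e scalar_sum sum_distrib_right
      by (intro sum.cong refl) (simp only: scalar_mult mult.assoc)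
  qed
  have collect: "(\<Sum>i\<in>UNIV. \<Sum>j\<in>UNIV. c i j * x i j) - ((\<Sum>i\<in>UNIV. \<Sum>j\<in>UNIV. c i j * y i j) + (\<Sum>i\<in>UNIV. \<Sum>j\<in>UNIV. c i j * z i j))
     = (\<Sum>i\<in>UNIV. \<Sum>j\<in>UNIV. c i j * (x i j - y i j - z i j))" for c x y z :: "'a \<Rightarrow> 'a \<Rightarrow> 'a heis_letter word \<Rightarrow>\<^sub>0 complex"
    by (simp add: right_diff_distrib distrib_left sum_subtractf sum.distrib diff_diff_eq)
  have "linF u m * linF v s - (linF v s * linF u m + scalar (of_bool (m = - s) * bracket m u v) * ?c) =
    (\<Sum>i\<in>UNIV. \<Sum>j\<in>UNIV. scalar (u i * v j) * (letter (LA i m) * letter (LA j s) - letter (LA j s) * letter (LA i m)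
      - scalar (of_bool (m = - s) * (q powi m - q powi (- m)) * ratfun_at (Bz C r $ i $ j) (q powi m)) * ?c))"
    unfolding 1 2 3 by (rule collect)
  also have "\<dots> \<in> HP.RI"
    using assms by (intro HP.RI_sum HP.RI_mult(1) HP.RI_rel) (auto simp: heis_relations_def)
  finally have "HP.cls (linF u m * linF v s) = HP.cls (linF v s * linF u m + scalar (of_bool (m = - s) * bracket m u v) * ?c)"
    using cl c by (subst HP.cls_eq_iff) (auto intro!: free_algebra_add free_algebra_mult)
  then show ?thesis unfolding lin_def Heis_eq sc_eq heis_c_def
    using cl c by (simp add: HP.cls_mult HP.cls_add free_algebra_mult)
qed

text \<open>The coefficient function \<open>U\<close> is indexed by all integers: its values in
  positive and in negative degree give the two halves of one vertex operator.\<close>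

definition ser_pos :: "('a \<Rightarrow> int \<Rightarrow> complex) \<Rightarrow> nat \<Rightarrow> 'a heis" where
  "ser_pos U = (\<lambda>k. if k = 0 then \<zero>\<^bsub>H\<^esub> else lin (\<lambda>i. U i (int k)) (int k))"

definition ser_neg :: "('a \<Rightarrow> int \<Rightarrow> complex) \<Rightarrow> nat \<Rightarrow> 'a heis" where
  "ser_neg U = (\<lambda>k. if k = 0 then \<zero>\<^bsub>H\<^esub> else lin (\<lambda>i. U i (- int k)) (- int k))"

text \<open>c_m is placed in degree 2m, the degree of the commutator of h^m a_i[m] and h^m
  a_j[-m].\<close>

definition ser_c :: "(nat \<Rightarrow> complex) \<Rightarrow> nat \<Rightarrow> 'a heis" where
  "ser_c \<kappa> = (\<lambda>k. if k > 0 \<and> even k then sc (\<kappa> (k div 2)) \<otimes>\<^bsub>H\<^esub> heis_c C r q (k div 2) else \<zero>\<^bsub>H\<^esub>)"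

abbreviation "Hh \<equiv> power_series_ring H"

sublocale HhS: scalar_ring Hh "\<lambda>x. HS.ps_const (sc x)"
  by (rule HS.scalar_ring_ps)

lemma ser_closed [simp]: "ser_pos U \<in> carrier Hh" "ser_neg U \<in> carrier Hh" "ser_c \<kappa> \<in> carrier Hh"
  by (auto simp: HS.ps_carrier ser_pos_def ser_neg_def ser_c_def elim!: evenE)

lemma ser_0 [simp]: "ser_pos U 0 = \<zero>\<^bsub>H\<^esub>" "ser_neg U 0 = \<zero>\<^bsub>H\<^esub>" "ser_c \<kappa> 0 = \<zero>\<^bsub>H\<^esub>"
  by (simp_all add: ser_pos_def ser_neg_def ser_c_def)

lemma ser_add: 
  "ser_pos U \<oplus>\<^bsub>Hh\<^esub> ser_pos V = ser_pos (\<lambda>i m. U i m + V i m)"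
  "ser_neg U \<oplus>\<^bsub>Hh\<^esub> ser_neg V = ser_neg (\<lambda>i m. U i m + V i m)"
  "ser_c \<kappa> \<oplus>\<^bsub>Hh\<^esub> ser_c \<mu> = ser_c (\<lambda>m. \<kappa> m + \<mu> m)"
  by (auto simp: fun_eq_iff HS.ps_add ser_pos_def ser_neg_def ser_c_def lin_add HS.sc_add HS.l_distr)

lemma euler_ser: 
  "HS.euler (ser_pos U) = ser_pos (\<lambda>i m. of_int \<bar>m\<bar> * U i m)"
  "HS.euler (ser_neg U) = ser_neg (\<lambda>i m. of_int \<bar>m\<bar> * U i m)"
  "HS.euler (ser_c \<kappa>) = ser_c (\<lambda>m. of_nat (2 * m) * \<kappa> m)"
  by (auto simp: fun_eq_iff HS.euler_def ser_pos_def ser_neg_def ser_c_def lin_smult HS.sc_mult_assoc HS.m_assoc elim!: evenE)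

lemma ser_c_central: "HS.ps_central (ser_c \<kappa>)"
  unfolding HS.ps_central_def
proof (intro conjI ballI)
  fix f assume f: "f \<in> carrier Hh"
  have c: "ser_c \<kappa> i \<otimes>\<^bsub>H\<^esub> x = x \<otimes>\<^bsub>H\<^esub> ser_c \<kappa> i" if "x \<in> carrier H" for i x
  proof (cases "i > 0 \<and> even i")
    case True
    then have "i div 2 > 0" by auto
    then have "sc y \<otimes>\<^bsub>H\<^esub> heis_c C r q (i div 2) \<otimes>\<^bsub>H\<^esub> x = x \<otimes>\<^bsub>H\<^esub> (sc y \<otimes>\<^bsub>H\<^esub> heis_c C r q (i div 2))" for y
      using that heis_c_central[of "i div 2" x] HS.sc_left_commute[of x "heis_c C r q (i div 2)" y]
      by (simp add: HS.m_assoc)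
    then show ?thesis using True by (simp add: ser_c_def)
  qed (use that in \<open>auto simp: ser_c_def\<close>)
  show "ser_c \<kappa> \<otimes>\<^bsub>Hh\<^esub> f = f \<otimes>\<^bsub>Hh\<^esub> ser_c \<kappa>"
  proof
    fix k
    have cl: "f i \<in> carrier H" "ser_c \<kappa> i \<in> carrier H" for i
      using f HS.ps_coeff[of "ser_c \<kappa>"] by (simp_all add: HS.ps_coeff)
    have "(ser_c \<kappa> \<otimes>\<^bsub>Hh\<^esub> f) k = (\<Oplus>\<^bsub>H\<^esub>i\<in>{..k}. ser_c \<kappa> i \<otimes>\<^bsub>H\<^esub> f (k - i))" by (simp add: HS.ps_mult)
    also have "\<dots> = (\<Oplus>\<^bsub>H\<^esub>i\<in>{..k}. f (k - i) \<otimes>\<^bsub>H\<^esub> ser_c \<kappa> (k - (k - i)))"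
      by (rule HS.finsum_cong') (auto simp: cl c)
    also have "\<dots> = (\<Oplus>\<^bsub>H\<^esub>i\<in>{..k}. f i \<otimes>\<^bsub>H\<^esub> ser_c \<kappa> (k - i))"
      by (rule HS.finsum_reverse[of "\<lambda>i. f i \<otimes>\<^bsub>H\<^esub> ser_c \<kappa> (k - i)"]) (simp add: cl)
    finally show "(ser_c \<kappa> \<otimes>\<^bsub>Hh\<^esub> f) k = (f \<otimes>\<^bsub>Hh\<^esub> ser_c \<kappa>) k" by (simp add: HS.ps_mult)
  qed
qed simp

text \<open>Only equal degrees i = j contribute a commutator, of degree 2i; hence at most the middle
  term of each convolution is affected.\<close>

lemma series_commutator:
  assumes f: "f \<in> carrier Hh" and g: "g \<in> carrier Hh" and h: "h \<in> carrier Hh"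
    and comm: "\<And>i j. f i \<otimes>\<^bsub>H\<^esub> g j = g j \<otimes>\<^bsub>H\<^esub> f i \<oplus>\<^bsub>H\<^esub> (if i = j then h (2 * i) else \<zero>\<^bsub>H\<^esub>)"
    and odd: "\<And>k. odd k \<Longrightarrow> h k = \<zero>\<^bsub>H\<^esub>"
  shows "f \<otimes>\<^bsub>Hh\<^esub> g = g \<otimes>\<^bsub>Hh\<^esub> f \<oplus>\<^bsub>Hh\<^esub> h"
proof
  fix k
  have cl: "f i \<in> carrier H" "g i \<in> carrier H" "h i \<in> carrier H" for i
    using f g h by (simp_all add: HS.ps_coeff)
  have "(f \<otimes>\<^bsub>Hh\<^esub> g) k = (\<Oplus>\<^bsub>H\<^esub>i\<in>{..k}. g (k - i) \<otimes>\<^bsub>H\<^esub> f (k - (k - i)) \<oplus>\<^bsub>H\<^esub> (if i = k - i then h k else \<zero>\<^bsub>H\<^esub>))"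
    unfolding HS.ps_mult
  proof (rule HS.finsum_cong')
    fix i assume "i \<in> {..k}"
    then have i: "k - (k - i) = i" by simp
    have "(if i = k - i then h (2 * i) else \<zero>\<^bsub>H\<^esub>) = (if i = k - i then h k else \<zero>\<^bsub>H\<^esub>)"
      by (intro if_cong arg_cong[of _ _ h] refl) linarith
    then show "f i \<otimes>\<^bsub>H\<^esub> g (k - i) = g (k - i) \<otimes>\<^bsub>H\<^esub> f (k - (k - i)) \<oplus>\<^bsub>H\<^esub> (if i = k - i then h k else \<zero>\<^bsub>H\<^esub>)"
      using comm[of i "k - i"] by (simp only: i)
  qed (auto simp: cl)
  also have "\<dots> = (\<Oplus>\<^bsub>H\<^esub>i\<in>{..k}. g (k - i) \<otimes>\<^bsub>H\<^esub> f (k - (k - i))) \<oplus>\<^bsub>H\<^esub> (\<Oplus>\<^bsub>H\<^esub>i\<in>{..k}. if i = k - i then h k else \<zero>\<^bsub>H\<^esub>)"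
    by (rule HS.finsum_addf) (auto simp: cl)
  also have "(\<Oplus>\<^bsub>H\<^esub>i\<in>{..k}. g (k - i) \<otimes>\<^bsub>H\<^esub> f (k - (k - i))) = (g \<otimes>\<^bsub>Hh\<^esub> f) k"
    unfolding HS.ps_mult by (rule HS.finsum_reverse[of "\<lambda>i. g i \<otimes>\<^bsub>H\<^esub> f (k - i)"]) (simp add: cl)
  also have "(\<Oplus>\<^bsub>H\<^esub>i\<in>{..k}. if i = k - i then h k else \<zero>\<^bsub>H\<^esub>) = h k"
  proof (cases "even k")
    case True
    then have "(\<Oplus>\<^bsub>H\<^esub>i\<in>{..k}. if i = k - i then h k else \<zero>\<^bsub>H\<^esub>) = (if k div 2 = k - k div 2 then h k else \<zero>\<^bsub>H\<^esub>)"
      by (intro HS.finsum_single_index) (auto simp: cl)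
    then show ?thesis using True by auto
  next
    case False
    then have "(\<Oplus>\<^bsub>H\<^esub>i\<in>{..k}. if i = k - i then h k else \<zero>\<^bsub>H\<^esub>) = (\<Oplus>\<^bsub>H\<^esub>i\<in>{..k}. \<zero>\<^bsub>H\<^esub>)"
      by (intro HS.finsum_cong') (auto simp: odd)
    then show ?thesis using odd[OF False] by simp
  qed
  finally show "(f \<otimes>\<^bsub>Hh\<^esub> g) k = (g \<otimes>\<^bsub>Hh\<^esub> f \<oplus>\<^bsub>Hh\<^esub> h) k" by (simp add: HS.ps_add)
qed

text \<open>The commutator pairing of the negative half of \<open>U\<close> with the positive half
  of \<open>V\<close>; it becomes the 2-cocycle in the product of normally ordered
  exponentials.\<close>

definition cocycle :: "('a \<Rightarrow> int \<Rightarrow> complex) \<Rightarrow> ('a \<Rightarrow> int \<Rightarrow> complex) \<Rightarrow> nat \<Rightarrow> complex" where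
  "cocycle U V = (\<lambda>m. bracket (- int m) (\<lambda>i. U i (- int m)) (\<lambda>i. V i (int m)))"

lemma ser_neg_pos: "ser_neg U \<otimes>\<^bsub>Hh\<^esub> ser_pos V = ser_pos V \<otimes>\<^bsub>Hh\<^esub> ser_neg U \<oplus>\<^bsub>Hh\<^esub> ser_c (cocycle U V)"
proof (rule series_commutator[OF ser_closed(2) ser_closed(1) ser_closed(3)])
  fix i j
  show "ser_neg U i \<otimes>\<^bsub>H\<^esub> ser_pos V j = ser_pos V j \<otimes>\<^bsub>H\<^esub> ser_neg U i \<oplus>\<^bsub>H\<^esub> (if i = j then ser_c (cocycle U V) (2 * i) else \<zero>\<^bsub>H\<^esub>)"
  proof (cases "i = 0 \<or> j = 0")
    case False
    then show ?thesis 
      using lin_commutator[of "- int i" "int j" "\<lambda>a. U a (- int i)" "\<lambda>a. V a (int j)"]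
      by (auto simp: ser_neg_def ser_pos_def ser_c_def cocycle_def HS.sc_0)
  qed (auto simp: ser_neg_def ser_pos_def ser_c_def)
qed (simp add: ser_c_def)

lemma ser_pos_pos: "ser_pos U \<otimes>\<^bsub>Hh\<^esub> ser_pos V = ser_pos V \<otimes>\<^bsub>Hh\<^esub> ser_pos U"
proof -
  have "ser_pos U \<otimes>\<^bsub>Hh\<^esub> ser_pos V = ser_pos V \<otimes>\<^bsub>Hh\<^esub> ser_pos U \<oplus>\<^bsub>Hh\<^esub> \<zero>\<^bsub>Hh\<^esub>"
  proof (rule series_commutator)
    fix i j
    show "ser_pos U i \<otimes>\<^bsub>H\<^esub> ser_pos V j = ser_pos V j \<otimes>\<^bsub>H\<^esub> ser_pos U i \<oplus>\<^bsub>H\<^esub> (if i = j then \<zero>\<^bsub>Hh\<^esub> (2 * i) else \<zero>\<^bsub>H\<^esub>)"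
    proof (cases "i = 0 \<or> j = 0")
      case False
      then show ?thesis 
        using lin_commutator[of "int i" "int j" "\<lambda>a. U a (int i)" "\<lambda>a. V a (int j)"]
        by (auto simp: ser_pos_def HS.sc_0 HS.ps_zero)
    qed (auto simp: ser_pos_def HS.ps_zero)
  qed (simp_all add: HS.ps_zero)
  then show ?thesis by simp
qed

lemma ser_neg_neg: "ser_neg U \<otimes>\<^bsub>Hh\<^esub> ser_neg V = ser_neg V \<otimes>\<^bsub>Hh\<^esub> ser_neg U"
proof -
  have "ser_neg U \<otimes>\<^bsub>Hh\<^esub> ser_neg V = ser_neg V \<otimes>\<^bsub>Hh\<^esub> ser_neg U \<oplus>\<^bsub>Hh\<^esub> \<zero>\<^bsub>Hh\<^esub>"
  proof (rule series_commutator)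
    fix i j
    show "ser_neg U i \<otimes>\<^bsub>H\<^esub> ser_neg V j = ser_neg V j \<otimes>\<^bsub>H\<^esub> ser_neg U i \<oplus>\<^bsub>H\<^esub> (if i = j then \<zero>\<^bsub>Hh\<^esub> (2 * i) else \<zero>\<^bsub>H\<^esub>)"
    proof (cases "i = 0 \<or> j = 0")
      case False
      then show ?thesis 
        using lin_commutator[of "- int i" "- int j" "\<lambda>a. U a (- int i)" "\<lambda>a. V a (- int j)"]
        by (auto simp: ser_neg_def HS.sc_0 HS.ps_zero)
    qed (auto simp: ser_neg_def HS.ps_zero)
  qed (simp_all add: HS.ps_zero)
  then show ?thesis by simp
qed

section \<open>Normally ordered exponentials\<close>

text \<open>Normal ordering: the central factor, then the positive modes, then the negative modes.
  All generators of Y_u turn out to have this form.\<close>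

definition gexp :: "(nat \<Rightarrow> complex) \<Rightarrow> ('a \<Rightarrow> int \<Rightarrow> complex) \<Rightarrow> nat \<Rightarrow> 'a heis" where
  "gexp \<kappa> U = HS.ps_exp (ser_c \<kappa>) \<otimes>\<^bsub>Hh\<^esub> (HS.ps_exp (ser_pos U) \<otimes>\<^bsub>Hh\<^esub> HS.ps_exp (ser_neg U))"

lemma gexp_closed [simp]: "gexp \<kappa> U \<in> carrier Hh"
  unfolding gexp_def by (intro HhS.m_closed HS.ps_exp_closed ser_closed)

lemma ser_c_commute: "f \<in> carrier Hh \<Longrightarrow> ser_c \<kappa> \<otimes>\<^bsub>Hh\<^esub> f = f \<otimes>\<^bsub>Hh\<^esub> ser_c \<kappa>"
  using ser_c_central[of \<kappa>] by (simp only: HS.ps_central_def)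

lemma exp_ser_c_commute: "f \<in> carrier Hh \<Longrightarrow> HS.ps_exp (ser_c \<kappa>) \<otimes>\<^bsub>Hh\<^esub> f = f \<otimes>\<^bsub>Hh\<^esub> HS.ps_exp (ser_c \<kappa>)"
  by (intro HS.ps_exp_commute ser_c_commute) simp_all

lemma exp_ser_c_add: "HS.ps_exp (ser_c (\<lambda>m. \<kappa> m + \<mu> m)) = HS.ps_exp (ser_c \<kappa>) \<otimes>\<^bsub>Hh\<^esub> HS.ps_exp (ser_c \<mu>)"
  unfolding ser_add(3)[symmetric] by (rule HS.ps_exp_add) (simp_all add: euler_ser, (rule ser_c_commute, simp)+)

lemma exp_ser_pos_add: "HS.ps_exp (ser_pos (\<lambda>i m. U i m + V i m)) = HS.ps_exp (ser_pos U) \<otimes>\<^bsub>Hh\<^esub> HS.ps_exp (ser_pos V)"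
  unfolding ser_add(1)[symmetric] by (rule HS.ps_exp_add) (simp_all add: euler_ser, (rule ser_pos_pos)+)

lemma exp_ser_neg_add: "HS.ps_exp (ser_neg (\<lambda>i m. U i m + V i m)) = HS.ps_exp (ser_neg U) \<otimes>\<^bsub>Hh\<^esub> HS.ps_exp (ser_neg V)"
  unfolding ser_add(2)[symmetric] by (rule HS.ps_exp_add) (simp_all add: euler_ser, (rule ser_neg_neg)+)

lemma exp_neg_pos: "HS.ps_exp (ser_neg U) \<otimes>\<^bsub>Hh\<^esub> HS.ps_exp (ser_pos V) = 
  HS.ps_exp (ser_c (cocycle U V)) \<otimes>\<^bsub>Hh\<^esub> (HS.ps_exp (ser_pos V) \<otimes>\<^bsub>Hh\<^esub> HS.ps_exp (ser_neg U))"
proof (rule HS.ps_exp_exchange)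
  show "HS.ps_central (HS.euler (ser_c (cocycle U V)))" unfolding euler_ser by (rule ser_c_central)
  show "ser_neg U \<otimes>\<^bsub>Hh\<^esub> HS.euler (ser_pos V) = HS.euler (ser_pos V) \<otimes>\<^bsub>Hh\<^esub> ser_neg U \<oplus>\<^bsub>Hh\<^esub> ser_c (cocycle U (\<lambda>i m. of_int \<bar>m\<bar> * V i m))"
    unfolding euler_ser by (rule ser_neg_pos)
  show "HS.euler (ser_neg U) \<otimes>\<^bsub>Hh\<^esub> ser_neg U = ser_neg U \<otimes>\<^bsub>Hh\<^esub> HS.euler (ser_neg U)"
    unfolding euler_ser by (rule ser_neg_neg)
  show "HS.euler (ser_pos V) \<otimes>\<^bsub>Hh\<^esub> ser_pos V = ser_pos V \<otimes>\<^bsub>Hh\<^esub> HS.euler (ser_pos V)"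
    unfolding euler_ser by (rule ser_pos_pos)
qed (use ser_neg_pos ser_c_central in simp_all)

text \<open>Only the negative half of the left factor has to pass the positive half of the right
  one, and \<open>exp_neg_pos\<close> supplies the central factor for this.\<close>

theorem gexp_mult: "gexp \<kappa> U \<otimes>\<^bsub>Hh\<^esub> gexp \<mu> V = gexp (\<lambda>m. \<kappa> m + \<mu> m + cocycle U V m) (\<lambda>i m. U i m + V i m)"
proof -
  let ?k = "\<lambda>\<kappa>. HS.ps_exp (ser_c \<kappa>)" and ?p = "\<lambda>U. HS.ps_exp (ser_pos U)" and ?n = "\<lambda>U. HS.ps_exp (ser_neg U)"
  note cl [simp] = HS.ps_exp_closed[OF ser_closed(1)] HS.ps_exp_closed[OF ser_closed(2)] HS.ps_exp_closed[OF ser_closed(3)]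
  have "gexp \<kappa> U \<otimes>\<^bsub>Hh\<^esub> gexp \<mu> V = ?k \<kappa> \<otimes>\<^bsub>Hh\<^esub> (?p U \<otimes>\<^bsub>Hh\<^esub> ?n U \<otimes>\<^bsub>Hh\<^esub> ?k \<mu> \<otimes>\<^bsub>Hh\<^esub> (?p V \<otimes>\<^bsub>Hh\<^esub> ?n V))"
    by (simp add: gexp_def HhS.m_assoc)
  also have "?p U \<otimes>\<^bsub>Hh\<^esub> ?n U \<otimes>\<^bsub>Hh\<^esub> ?k \<mu> = ?k \<mu> \<otimes>\<^bsub>Hh\<^esub> (?p U \<otimes>\<^bsub>Hh\<^esub> ?n U)"
    by (rule exp_ser_c_commute[symmetric]) simp
  also have "?k \<kappa> \<otimes>\<^bsub>Hh\<^esub> (?k \<mu> \<otimes>\<^bsub>Hh\<^esub> (?p U \<otimes>\<^bsub>Hh\<^esub> ?n U) \<otimes>\<^bsub>Hh\<^esub> (?p V \<otimes>\<^bsub>Hh\<^esub> ?n V)) =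
    ?k \<kappa> \<otimes>\<^bsub>Hh\<^esub> ?k \<mu> \<otimes>\<^bsub>Hh\<^esub> (?p U \<otimes>\<^bsub>Hh\<^esub> (?n U \<otimes>\<^bsub>Hh\<^esub> ?p V) \<otimes>\<^bsub>Hh\<^esub> ?n V)"
    by (simp add: HhS.m_assoc)
  also have "?n U \<otimes>\<^bsub>Hh\<^esub> ?p V = ?k (cocycle U V) \<otimes>\<^bsub>Hh\<^esub> (?p V \<otimes>\<^bsub>Hh\<^esub> ?n U)" by (rule exp_neg_pos)
  also have "?p U \<otimes>\<^bsub>Hh\<^esub> (?k (cocycle U V) \<otimes>\<^bsub>Hh\<^esub> (?p V \<otimes>\<^bsub>Hh\<^esub> ?n U)) \<otimes>\<^bsub>Hh\<^esub> ?n V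
     = (?p U \<otimes>\<^bsub>Hh\<^esub> ?k (cocycle U V)) \<otimes>\<^bsub>Hh\<^esub> (?p V \<otimes>\<^bsub>Hh\<^esub> ?n U \<otimes>\<^bsub>Hh\<^esub> ?n V)"
    by (simp add: HhS.m_assoc)
  also have "?p U \<otimes>\<^bsub>Hh\<^esub> ?k (cocycle U V) = ?k (cocycle U V) \<otimes>\<^bsub>Hh\<^esub> ?p U"
    by (rule exp_ser_c_commute[symmetric]) simp
  also have "?k \<kappa> \<otimes>\<^bsub>Hh\<^esub> ?k \<mu> \<otimes>\<^bsub>Hh\<^esub> (?k (cocycle U V) \<otimes>\<^bsub>Hh\<^esub> ?p U \<otimes>\<^bsub>Hh\<^esub> (?p V \<otimes>\<^bsub>Hh\<^esub> ?n U \<otimes>\<^bsub>Hh\<^esub> ?n V))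
     = (?k \<kappa> \<otimes>\<^bsub>Hh\<^esub> ?k \<mu> \<otimes>\<^bsub>Hh\<^esub> ?k (cocycle U V)) \<otimes>\<^bsub>Hh\<^esub> ((?p U \<otimes>\<^bsub>Hh\<^esub> ?p V) \<otimes>\<^bsub>Hh\<^esub> (?n U \<otimes>\<^bsub>Hh\<^esub> ?n V))"
    by (simp add: HhS.m_assoc)
  also have "\<dots> = gexp (\<lambda>m. \<kappa> m + \<mu> m + cocycle U V m) (\<lambda>i m. U i m + V i m)"
    by (simp add: gexp_def exp_ser_c_add exp_ser_pos_add exp_ser_neg_add)
  finally show ?thesis .
qed

lemma ps_exp_zero: "HS.ps_exp \<zero>\<^bsub>Hh\<^esub> = \<one>\<^bsub>Hh\<^esub>"
proof (rule HS.euler_unique[where G = "\<zero>\<^bsub>Hh\<^esub>"])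
  have 0: "HS.euler \<zero>\<^bsub>Hh\<^esub> = \<zero>\<^bsub>Hh\<^esub>" by (simp add: HS.euler_def HS.ps_zero fun_eq_iff)
  show "HS.euler (HS.ps_exp \<zero>\<^bsub>Hh\<^esub>) = \<zero>\<^bsub>Hh\<^esub> \<otimes>\<^bsub>Hh\<^esub> HS.ps_exp \<zero>\<^bsub>Hh\<^esub>"
    by (subst HS.euler_ps_exp) (simp_all add: 0 HS.ps_zero)
  show "HS.euler \<one>\<^bsub>Hh\<^esub> = \<zero>\<^bsub>Hh\<^esub> \<otimes>\<^bsub>Hh\<^esub> \<one>\<^bsub>Hh\<^esub>"
    using HS.euler_scalar[of 1] by (simp add: HhS.sc_1)
qed (simp_all add: HS.ps_exp_closed HS.ps_exp_0 HS.ps_one HS.ps_zero)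

lemma lin_0: "lin (\<lambda>i. 0) m = \<zero>\<^bsub>H\<^esub>"
  by (simp add: lin_def linF_def HP.cls_0 Heis_eq)

lemma ser_zero: "ser_c (\<lambda>_. 0) = \<zero>\<^bsub>Hh\<^esub>" "ser_pos (\<lambda>_ _. 0) = \<zero>\<^bsub>Hh\<^esub>" "ser_neg (\<lambda>_ _. 0) = \<zero>\<^bsub>Hh\<^esub>"
  by (auto simp: fun_eq_iff ser_c_def ser_pos_def ser_neg_def lin_0 HS.sc_0 HS.ps_zero)

lemma gexp_0: "gexp (\<lambda>_. 0) (\<lambda>_ _. 0) = \<one>\<^bsub>Hh\<^esub>"
  by (simp add: gexp_def ser_zero ps_exp_zero)

lemma heis_exp_eq: "heis_exp C r q F = HS.ps_exp F"
  by (simp add: heis_exp_def HS.ps_exp_def)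

lemma t_elem_eq: "t_elem C r q R = gexp (\<lambda>m. ev (int m) R) (\<lambda>_ _. 0)"
proof -
  have "t_elem C r q R = heis_exp C r q (ser_c (\<lambda>m. ev (int m) R))"
    unfolding t_elem_def ser_c_def ev_def ..
  then show ?thesis by (simp add: gexp_def ser_zero ps_exp_zero heis_exp_eq HS.ps_exp_closed)
qed

text \<open>One coefficient function serves both halves, because q^(-l k) is q^(l m) for m =
  -k.\<close>

lemma vertex_eq:
  assumes "\<And>m. m \<noteq> 0 \<Longrightarrow> x m = lin (u m) m"
  shows "vertex C r q x l = gexp (\<lambda>_. 0) (\<lambda>i m. q powi (l * m) * u m i)"
proof -
  have "(\<lambda>m. if m = 0 then \<zero>\<^bsub>H\<^esub> else sc (q powi (l * int m)) \<otimes>\<^bsub>H\<^esub> x (int m)) = ser_pos (\<lambda>i m. q powi (l * m) * u m i)"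
    by (auto simp: fun_eq_iff ser_pos_def assms lin_smult)
  moreover have "(\<lambda>m. if m = 0 then \<zero>\<^bsub>H\<^esub> else sc (q powi (- l * int m)) \<otimes>\<^bsub>H\<^esub> x (- int m)) = ser_neg (\<lambda>i m. q powi (l * m) * u m i)"
    by (auto simp: fun_eq_iff ser_neg_def assms lin_smult)
  ultimately show ?thesis
    unfolding vertex_def gexp_def heis_exp_eq by (simp add: ser_zero ps_exp_zero HS.ps_exp_closed)
qed

end

section \<open>Fock modules\<close>

text \<open>A function on multi-indices \<nu> stands for a formal power series in variables x_i:
  \<open>raise i\<close> is multiplication by x_i and \<open>lower i\<close> is the derivative in
  x_i.\<close>

type_synonym 'i fock = "('i \<Rightarrow> nat) \<Rightarrow> complex"

definition raise :: "'i \<Rightarrow> 'i fock \<Rightarrow> 'i fock" where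
  "raise i f = (\<lambda>\<nu>. if \<nu> i > 0 then f (\<nu>(i := \<nu> i - 1)) else 0)"

definition lower :: "'i \<Rightarrow> 'i fock \<Rightarrow> 'i fock" where
  "lower i f = (\<lambda>\<nu>. of_nat (\<nu> i + 1) * f (\<nu>(i := \<nu> i + 1)))"

lemma raise_raise: "raise i (raise j f) = raise j (raise i f)"
  by (cases "i = j") (auto simp: raise_def fun_eq_iff fun_upd_twist)

lemma lower_lower: "lower i (lower j f) = lower j (lower i f)"
  by (cases "i = j") (auto simp: lower_def fun_eq_iff fun_upd_twist)

lemma lower_raise: "lower i (raise j f) \<nu> = raise j (lower i f) \<nu> + of_bool (i = j) * f \<nu>"
proof (cases "i = j")
  case True
  then show ?thesis by (cases "\<nu> j") (auto simp: lower_def raise_def distrib_right fun_upd_idem)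
next
  case False
  then show ?thesis by (auto simp: lower_def raise_def fun_upd_twist)
qed

definition vacuum :: "'i fock" where "vacuum = (\<lambda>\<nu>. of_bool (\<nu> = (\<lambda>_. 0)))"

lemma lower_vacuum: "lower i vacuum = (\<lambda>_. 0)"
proof
  fix \<nu> :: "'a \<Rightarrow> nat"
  have "\<nu>(i := \<nu> i + 1) \<noteq> (\<lambda>_. 0)"
  proof
    assume "\<nu>(i := \<nu> i + 1) = (\<lambda>_. 0)"
    from fun_cong[OF this, of i] show False by simp
  qed
  then show "lower i vacuum \<nu> = 0" by (simp add: lower_def vacuum_def)
qed

definition fock_linear :: "('i fock \<Rightarrow> 'i fock) \<Rightarrow> bool" where
  "fock_linear T \<longleftrightarrow> (\<forall>f g. T (\<lambda>\<nu>. f \<nu> + g \<nu>) = (\<lambda>\<nu>. T f \<nu> + T g \<nu>)) \<and> (\<forall>c f. T (\<lambda>\<nu>. c * f \<nu>) = (\<lambda>\<nu>. c * T f \<nu>))"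

lemma fock_linearD:
  assumes "fock_linear T"
  shows "T (\<lambda>\<nu>. f \<nu> + g \<nu>) \<nu> = T f \<nu> + T g \<nu>" "T (\<lambda>\<nu>. c * f \<nu>) \<nu> = c * T f \<nu>" "T (\<lambda>\<nu>. 0) \<nu> = 0" 
    "T (\<lambda>\<nu>. - f \<nu>) \<nu> = - T f \<nu>" "T (\<lambda>\<nu>. \<Sum>i\<in>A. F i \<nu>) \<nu> = (\<Sum>i\<in>A. T (F i) \<nu>)"
proof -
  have add: "T (\<lambda>\<nu>. f \<nu> + g \<nu>) = (\<lambda>\<nu>. T f \<nu> + T g \<nu>)" and sm: "T (\<lambda>\<nu>. c * f \<nu>) = (\<lambda>\<nu>. c * T f \<nu>)" for f g c
    using assms unfolding fock_linear_def by blast+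
  show "T (\<lambda>\<nu>. f \<nu> + g \<nu>) \<nu> = T f \<nu> + T g \<nu>" "T (\<lambda>\<nu>. c * f \<nu>) \<nu> = c * T f \<nu>" by (simp_all only: add sm)
  have z: "T (\<lambda>\<nu>. 0) = (\<lambda>\<nu>. 0)" using sm[of 0 "\<lambda>_. 0"] by simp
  then show "T (\<lambda>\<nu>. 0) \<nu> = 0" by simp
  show "T (\<lambda>\<nu>. - f \<nu>) \<nu> = - T f \<nu>" using sm[of "-1" f] by simp
  have "T (\<lambda>\<nu>. \<Sum>i\<in>A. F i \<nu>) = (\<lambda>\<nu>. \<Sum>i\<in>A. T (F i) \<nu>)"
    by (induction A rule: infinite_finite_induct) (simp_all add: z add)
  then show "T (\<lambda>\<nu>. \<Sum>i\<in>A. F i \<nu>) \<nu> = (\<Sum>i\<in>A. T (F i) \<nu>)" by simp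
qed

lemma raise_linear: "fock_linear (raise i)"
  by (auto simp: fock_linear_def raise_def fun_eq_iff)

lemma lower_linear: "fock_linear (lower i)"
  by (auto simp: fock_linear_def lower_def fun_eq_iff algebra_simps)

text \<open>
  A module in which \<open>c\<^sub>M\<close> acts by \<open>1\<close>, the generators \<open>a\<^sub>i[M]\<close>, \<open>a\<^sub>i[-M]\<close> act as creation
  and annihilation operators, \<open>a\<^sub>i[2M]\<close> acts by the scalar \<open>\<alpha>\<^sub>i\<close>, and all other generators by \<open>0\<close>.
\<close>

locale fock_rep = cartan_q C r q for C :: "int ^ 'n ^ 'n" and r and q +
  fixes M :: nat and \<alpha> :: "'n \<Rightarrow> complex"
  assumes M_pos: "M > 0"
begin

text \<open>The sign makes the commutator [x_i, \<open>annih j\<close>] equal to + B_ij, since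
  multiplication by a variable and its derivative have commutator -1.\<close>

definition annih :: "'n \<Rightarrow> 'n fock \<Rightarrow> 'n fock" where
  "annih j f = (\<lambda>\<nu>. - (\<Sum>k\<in>UNIV. Bm (int M) k j * lower k f \<nu>))"

fun opl :: "'n heis_letter \<Rightarrow> 'n fock \<Rightarrow> 'n fock" where
  "opl (LA i m) f = (if m = int M then raise i f else if m = - int M then annih i f
     else if m = 2 * int M then (\<lambda>\<nu>. \<alpha> i * f \<nu>) else (\<lambda>\<nu>. 0))"
| "opl (LC s) f = (if s = M then f else (\<lambda>\<nu>. 0))"

lemma annih_linear: "fock_linear (annih i)"
  unfolding fock_linear_def annih_def
  by (auto simp: fun_eq_iff fock_linearD[OF lower_linear] sum.distrib distrib_left sum_distrib_left mult_ac)

lemma opl_linear: "fock_linear (opl g)"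
proof (cases g)
  case (LA i m)
  consider "m = int M" | "m = - int M" "m \<noteq> int M" | "m = 2 * int M" "m \<noteq> int M" "m \<noteq> - int M" | "m \<noteq> int M" "m \<noteq> - int M" "m \<noteq> 2 * int M" 
    by blast
  then show ?thesis
  proof cases
    case 1
    then have "opl g = raise i" using LA by (simp add: fun_eq_iff)
    then show ?thesis using raise_linear by simp
  next
    case 2
    then have "opl g = annih i" using LA by (simp add: fun_eq_iff)
    then show ?thesis using annih_linear by simp
  next
    case 3
    then have "opl g = (\<lambda>f \<nu>. \<alpha> i * f \<nu>)" using LA by (simp add: fun_eq_iff)
    then show ?thesis by (simp add: fock_linear_def fun_eq_iff algebra_simps)
  next
    case 4
    then have "opl g = (\<lambda>f \<nu>. 0)" using LA by (simp add: fun_eq_iff)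
    then show ?thesis by (simp add: fock_linear_def fun_eq_iff)
  qed
next
  case (LC s)
  then have "opl g = (if s = M then (\<lambda>f. f) else (\<lambda>f \<nu>. 0))" by (auto simp: fun_eq_iff)
  then show ?thesis by (auto simp: fock_linear_def)
qed

definition opw :: "'n heis_letter word \<Rightarrow> 'n fock \<Rightarrow> 'n fock" where
  "opw w f = foldr opl (letters w) f"

lemma opw_linear: "fock_linear (opw w)"
proof -
  have "fock_linear (foldr opl ws)" for ws
  proof (induction ws)
    case Nil
    then show ?case by (simp add: fock_linear_def)
  next
    case (Cons g ws)
    then show ?case using opl_linear[of g] by (simp add: fock_linear_def)
  qed
  then show ?thesis by (simp add: opw_def[abs_def] fock_linear_def)
qed

definition act :: "('n heis_letter word \<Rightarrow>\<^sub>0 complex) \<Rightarrow> 'n fock \<Rightarrow> 'n fock" where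
  "act F f = (\<lambda>\<nu>. \<Sum>w\<in>Poly_Mapping.keys F. Poly_Mapping.lookup F w * opw w f \<nu>)"

lemma act_superset:
  assumes "finite S" "Poly_Mapping.keys F \<subseteq> S"
  shows "act F f \<nu> = (\<Sum>w\<in>S. Poly_Mapping.lookup F w * opw w f \<nu>)"
  unfolding act_def using assms by (intro sum.mono_neutral_left) (auto simp: in_keys_iff)

lemma act_add: "act (F + G) f \<nu> = act F f \<nu> + act G f \<nu>"
proof -
  let ?S = "Poly_Mapping.keys F \<union> Poly_Mapping.keys G"
  have "act (F + G) f \<nu> = (\<Sum>w\<in>?S. Poly_Mapping.lookup (F + G) w * opw w f \<nu>)"
    using keys_add[of F G] by (intro act_superset) auto
  then show ?thesis
    by (simp add: act_superset[of ?S F] act_superset[of ?S G] lookup_add distrib_right sum.distrib)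
qed

lemma act_0: "act 0 f \<nu> = 0"
  by (simp add: act_def)

lemma act_minus: "act (- F) f \<nu> = - act F f \<nu>"
  using act_add[of "- F" F f \<nu>] by (simp add: act_0 eq_neg_iff_add_eq_0)

lemma act_diff: "act (F - G) f \<nu> = act F f \<nu> - act G f \<nu>"
  using act_add[of F "- G" f \<nu>] by (simp add: act_minus)

lemma act_single: "act (Poly_Mapping.single w c) f \<nu> = c * opw w f \<nu>"
  by (simp add: act_def)

lemma act_scalar: "act (scalar c) f \<nu> = c * f \<nu>"
  by (simp add: scalar_def act_single opw_def zero_word_def)

lemma act_letter: "act (letter g) f \<nu> = opl g f \<nu>"
  by (simp add: letter_def act_single opw_def)

lemma act_linear: "fock_linear (act F)"
  unfolding fock_linear_def act_def
  by (auto simp: fun_eq_iff fock_linearD[OF opw_linear] sum.distrib distrib_left sum_distrib_left mult_ac)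

lemma act_mult: "act (F * G) f \<nu> = act F (act G f) \<nu>"
proof (induction F arbitrary: \<nu> rule: poly_mapping_single_induct)
  case (3 u a)
  show ?case
  proof (induction G arbitrary: \<nu> rule: poly_mapping_single_induct)
    case 1
    have "act 0 f = (\<lambda>\<nu>. 0)" by (simp add: fun_eq_iff act_0)
    then show ?case by (simp add: act_0 fock_linearD[OF act_linear])
  next
    case (2 G G')
    have "act (G + G') f = (\<lambda>\<nu>. act G f \<nu> + act G' f \<nu>)" by (simp add: fun_eq_iff act_add)
    then show ?case by (simp add: distrib_left act_add 2 fock_linearD[OF act_linear])
  next
    case (3 v b)
    have e: "act (Poly_Mapping.single v b) f = (\<lambda>\<nu>. b * opw v f \<nu>)" by (simp add: fun_eq_iff act_single)
    show ?case unfolding e mult_single act_single fock_linearD(2)[OF opw_linear]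
      by (simp add: opw_def plus_word_def)
  qed
qed (simp_all add: act_0 act_add distrib_right)

lemma raise_annih: "raise i (annih j f) \<nu> = annih j (raise i f) \<nu> + Bm (int M) i j * f \<nu>"
proof -
  have "annih j (raise i f) \<nu> = - (\<Sum>k\<in>UNIV. Bm (int M) k j * raise i (lower k f) \<nu>) 
     - (\<Sum>k\<in>UNIV. if k = i then Bm (int M) i j * f \<nu> else 0)"
  proof -
    have "(\<Sum>k\<in>UNIV. Bm (int M) k j * (of_bool (k = i) * f \<nu>)) = (\<Sum>k\<in>UNIV. if k = i then Bm (int M) i j * f \<nu> else 0)"
      by (intro sum.cong) auto
    then show ?thesis unfolding annih_def lower_raise distrib_left sum.distrib by simp
  qed
  moreover have "raise i (annih j f) \<nu> = - (\<Sum>k\<in>UNIV. Bm (int M) k j * raise i (lower k f) \<nu>)"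
    unfolding annih_def fock_linearD(4)[OF raise_linear] fock_linearD(5)[OF raise_linear] fock_linearD(2)[OF raise_linear] ..
  ultimately show ?thesis by simp
qed

lemma annih_annih: "annih i (annih j f) \<nu> = annih j (annih i f) \<nu>"
proof -
  have e: "annih i (annih j f) \<nu> = (\<Sum>k\<in>UNIV. \<Sum>l\<in>UNIV. Bm (int M) k i * Bm (int M) l j * lower k (lower l f) \<nu>)" for i j
    unfolding annih_def fock_linearD(4)[OF lower_linear] fock_linearD(5)[OF lower_linear] fock_linearD(2)[OF lower_linear]
    by (simp add: sum_negf sum_distrib_left mult.assoc)
  show ?thesis unfolding e by (subst sum.swap) (simp add: lower_lower mult_ac)
qed

text \<open>The modes M and -M obey the canonical relations through \<open>raise_annih\<close>. The
  scalar action of a_i[2M] is consistent because its commutator with a_j[-2M] is a multiple of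
  c_(2M), which acts by 0.\<close>

lemma opl_comm:
  assumes "m \<noteq> 0" "s \<noteq> 0"
  shows "opl (LA i m) (opl (LA j s) f) \<nu> - opl (LA j s) (opl (LA i m) f) \<nu>
    = of_bool (m = - s) * Bm m i j * opl (LC (nat \<bar>m\<bar>)) f \<nu>"
proof -
  have M: "int M \<noteq> - int M" "2 * int M \<noteq> int M" "2 * int M \<noteq> - int M" "M \<noteq> 2 * M" using M_pos by auto
  have zero: "opl g (\<lambda>\<nu>. 0) \<nu> = 0" for g \<nu> by (rule fock_linearD(3)[OF opl_linear])
  have sm: "opl g (\<lambda>\<nu>. c * f \<nu>) \<nu> = c * opl g f \<nu>" for g c f \<nu> by (rule fock_linearD(2)[OF opl_linear])
  consider "m = int M" "s = int M" | "m = int M" "s = - int M" | "m = - int M" "s = int M" | "m = - int M" "s = - int M"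
    | "m = 2 * int M" | "s = 2 * int M" "m \<noteq> 2 * int M"
    | "m \<noteq> int M" "m \<noteq> - int M" "m \<noteq> 2 * int M" | "s \<noteq> int M" "s \<noteq> - int M" "s \<noteq> 2 * int M" "m = int M \<or> m = - int M"
    by blast
  then show ?thesis
  proof cases
    case 1
    then show ?thesis using M raise_raise[of i j f] by simp
  next
    case 2
    then show ?thesis using M raise_annih[of i j f \<nu>] by simp
  next
    case 3
    then show ?thesis using M raise_annih[of j i f \<nu>] M_pos by (simp add: Bm_neg Bm_sym[of "int M" j i])
  next
    case 4
    then show ?thesis using M annih_annih[of i j f \<nu>] by simp
  next
    case 5
    have "opl (LA i m) = (\<lambda>f \<nu>. \<alpha> i * f \<nu>)" using 5 M by (auto simp: fun_eq_iff)
    then have "opl (LA i m) (opl (LA j s) f) \<nu> - opl (LA j s) (opl (LA i m) f) \<nu> = 0"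
      by (simp only: sm) simp
    moreover have "nat \<bar>m\<bar> \<noteq> M" using 5 M_pos by simp
    ultimately show ?thesis by simp
  next
    case 6
    have "opl (LA j s) = (\<lambda>f \<nu>. \<alpha> j * f \<nu>)" using 6 M by (auto simp: fun_eq_iff)
    then have "opl (LA i m) (opl (LA j s) f) \<nu> - opl (LA j s) (opl (LA i m) f) \<nu> = 0"
      by (simp only: sm) simp
    moreover have "m = - s \<Longrightarrow> nat \<bar>m\<bar> \<noteq> M" using 6 M_pos by simp
    ultimately show ?thesis by auto
  next
    case 7
    have "opl (LA i m) = (\<lambda>f \<nu>. 0)" using 7 by (auto simp: fun_eq_iff)
    then have "opl (LA i m) (opl (LA j s) f) \<nu> - opl (LA j s) (opl (LA i m) f) \<nu> = 0"
      by (simp only: zero) simp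
    moreover have "nat \<bar>m\<bar> \<noteq> M" using 7 by auto
    ultimately show ?thesis by simp
  next
    case 8
    have "opl (LA j s) = (\<lambda>f \<nu>. 0)" using 8 by (auto simp: fun_eq_iff)
    then have "opl (LA i m) (opl (LA j s) f) \<nu> - opl (LA j s) (opl (LA i m) f) \<nu> = 0"
      by (simp only: zero) simp
    moreover have "m \<noteq> - s" using 8 by auto
    ultimately show ?thesis by simp
  qed
qed

definition ker_ideal :: "('n heis_letter word \<Rightarrow>\<^sub>0 complex) set" where
  "ker_ideal = {F \<in> carrier (free_algebra heis_letters). \<forall>f \<nu>. act F f \<nu> = 0}"

lemma RI_subset_ker: "HP.RI \<subseteq> ker_ideal"
proof (rule HP.FA.genideal_minimal)
  show "ideal ker_ideal HP.FA"
  proof (rule idealI[OF free_algebra_ring])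
    show "subgroup ker_ideal (add_monoid HP.FA)"
    proof (rule group.subgroupI[OF HP.FA.a_group])
      show "ker_ideal \<noteq> {}" by (auto simp: ker_ideal_def act_0 intro!: exI[of _ 0])
      fix a assume a: "a \<in> ker_ideal"
      then have "inv\<^bsub>add_monoid HP.FA\<^esub> a = - a"
        using free_algebra_a_inv[of a heis_letters] by (auto simp: ker_ideal_def a_inv_def)
      then show "inv\<^bsub>add_monoid HP.FA\<^esub> a \<in> ker_ideal"
        using a by (auto simp: ker_ideal_def act_minus free_algebra_minus)
    qed (auto simp: ker_ideal_def act_add free_algebra_simps free_algebra_add)
    fix a x assume a: "a \<in> ker_ideal" and x: "x \<in> carrier HP.FA"
    have "act a f = (\<lambda>\<nu>. 0)" for f using a by (auto simp: ker_ideal_def fun_eq_iff)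
    then show "x \<otimes>\<^bsub>HP.FA\<^esub> a \<in> ker_ideal" "a \<otimes>\<^bsub>HP.FA\<^esub> x \<in> ker_ideal"
      using a x by (auto simp: ker_ideal_def free_algebra_simps free_algebra_mult act_mult fock_linearD[OF act_linear])
  qed
  have 1: "act (letter (LA i m) * letter (LA j s) - letter (LA j s) * letter (LA i m)
        - scalar (of_bool (m = - s) * (q powi m - q powi (- m)) * ratfun_at (Bz C r $ i $ j) (q powi m))
          * letter (LC (nat \<bar>m\<bar>))) f \<nu> = 0" if "m \<noteq> 0" "s \<noteq> 0" for i j m s f \<nu>
  proof -
    have e: "act (letter g) f = opl g f" for g f by (simp add: fun_eq_iff act_letter)
    have "act (letter (LA i m) * letter (LA j s) - letter (LA j s) * letter (LA i m)
        - scalar (of_bool (m = - s) * (q powi m - q powi (- m)) * ratfun_at (Bz C r $ i $ j) (q powi m))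
          * letter (LC (nat \<bar>m\<bar>))) f \<nu> = 
       opl (LA i m) (opl (LA j s) f) \<nu> - opl (LA j s) (opl (LA i m) f) \<nu> 
        - of_bool (m = - s) * (q powi m - q powi (- m)) * ratfun_at (Bz C r $ i $ j) (q powi m) * opl (LC (nat \<bar>m\<bar>)) f \<nu>"
      by (simp only: act_diff act_mult act_scalar e)
    then show ?thesis unfolding opl_comm[OF that] by (simp add: Bm_def ev_def)
  qed
  have 2: "act (letter (LC s) * letter g - letter g * letter (LC s)) f \<nu> = 0" for s g f \<nu>
  proof -
    have e: "act (letter g) f = opl g f" for g f by (simp add: fun_eq_iff act_letter)
    show ?thesis using fock_linearD(3)[OF opl_linear, of g \<nu>] by (simp add: act_diff act_mult e)
  qed
  show "heis_relations C r q \<subseteq> ker_ideal"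
  proof
    fix x assume x: "x \<in> heis_relations C r q"
    have "act x f \<nu> = 0" for f \<nu>
      using x unfolding heis_relations_def
    proof (elim UnE CollectE exE conjE)
      fix i j m s assume "m \<noteq> 0" "s \<noteq> 0" and x: "x = letter (LA i m) * letter (LA j s) - letter (LA j s) * letter (LA i m)
        - scalar (of_bool (m = - s) * (q powi m - q powi (- m)) * ratfun_at (Bz C r $ i $ j) (q powi m))
          * letter (LC (nat \<bar>m\<bar>))"
      then show "act x f \<nu> = 0" unfolding x by (intro 1)
    qed (simp only: 2)
    then show "x \<in> ker_ideal" using heis_relations_closed x unfolding ker_ideal_def by blast
  qed
qed

text \<open>The vacuum expectation value; it does not depend on the chosen representative, since the
  relations act by 0.\<close>

definition func :: "'n heis \<Rightarrow> complex" where
  "func X = act (SOME F. F \<in> carrier HP.FA \<and> X = HP.cls F) vacuum (\<lambda>_. 0)"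

lemma func_cls:
  assumes "F \<in> carrier HP.FA"
  shows "func (HP.cls F) = act F vacuum (\<lambda>_. 0)"
proof -
  define F' where "F' = (SOME F'. F' \<in> carrier HP.FA \<and> HP.cls F = HP.cls F')"
  have F': "F' \<in> carrier HP.FA \<and> HP.cls F = HP.cls F'"
    unfolding F'_def by (rule someI[of _ F]) (use assms in simp)
  then have "F - F' \<in> HP.RI" using assms HP.cls_eq_iff by blast
  then have "act (F - F') vacuum (\<lambda>_. 0) = 0" using RI_subset_ker by (auto simp: ker_ideal_def)
  then show ?thesis by (simp add: func_def F'_def act_diff)
qed

lemma H_rep: 
  assumes "X \<in> carrier H" obtains F where "F \<in> carrier HP.FA" "X = HP.cls F"
  using HP.cls_surj assms unfolding Heis_eq by blast

lemma func_add: "X \<in> carrier H \<Longrightarrow> Y \<in> carrier H \<Longrightarrow> func (X \<oplus>\<^bsub>H\<^esub> Y) = func X + func Y"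
proof -
  assume X: "X \<in> carrier H" and Y: "Y \<in> carrier H"
  obtain F G where "F \<in> carrier HP.FA" "X = HP.cls F" "G \<in> carrier HP.FA" "Y = HP.cls G"
    using H_rep[OF X] H_rep[OF Y] by metis
  then show ?thesis unfolding Heis_eq by (simp add: HP.cls_add[symmetric] func_cls free_algebra_add act_add)
qed

lemma func_0: "func \<zero>\<^bsub>H\<^esub> = 0"
  unfolding Heis_eq HP.cls_0[symmetric] by (subst func_cls) (simp_all add: act_0)

lemma func_1: "func \<one>\<^bsub>H\<^esub> = 1"
  unfolding Heis_eq HP.cls_1[symmetric] by (subst func_cls) (simp_all add: act_scalar[of 1, simplified] vacuum_def)

lemma func_finsum: "finite A \<Longrightarrow> (\<And>i. i \<in> A \<Longrightarrow> f i \<in> carrier H) \<Longrightarrow> func (\<Oplus>\<^bsub>H\<^esub>i\<in>A. f i) = (\<Sum>i\<in>A. func (f i))"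
proof (induction A rule: finite_induct)
  case (insert x A)
  have "(\<Oplus>\<^bsub>H\<^esub>i\<in>A. f i) \<in> carrier H" using insert by (intro HS.finsum_closed) auto
  then show ?case using insert by (subst HS.finsum_insert) (auto simp: func_add)
qed (simp add: func_0)

lemma func_cls_mult: "F \<in> carrier HP.FA \<Longrightarrow> G \<in> carrier HP.FA \<Longrightarrow> 
   func (HP.cls F \<otimes>\<^bsub>H\<^esub> HP.cls G) = act F (act G vacuum) (\<lambda>_. 0)"
  unfolding Heis_eq by (simp add: HP.cls_mult[symmetric] func_cls free_algebra_mult act_mult)

lemma func_sc: "X \<in> carrier H \<Longrightarrow> func (sc x \<otimes>\<^bsub>H\<^esub> X) = x * func X"
  by (erule H_rep) (simp add: sc_eq func_cls_mult func_cls act_scalar)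

lemma func_c: "s > 0 \<Longrightarrow> X \<in> carrier H \<Longrightarrow> func (heis_c C r q s \<otimes>\<^bsub>H\<^esub> X) = of_bool (s = M) * func X"
  by (erule H_rep) (simp add: heis_c_def func_cls_mult func_cls act_letter LC_closed)

lemma act_linF: "act (linF u m) f \<nu> = (\<Sum>i\<in>UNIV. u i * opl (LA i m) f \<nu>)"
proof -
  have "act (\<Sum>i\<in>A. scalar (u i) * letter (LA i m)) f \<nu> = (\<Sum>i\<in>A. u i * opl (LA i m) f \<nu>)" for A
    by (induction A rule: infinite_finite_induct) (simp_all add: act_0 act_add act_mult act_scalar act_letter)
  then show ?thesis by (simp add: linF_def)
qed

text \<open>Multiplication by a variable leaves no constant term, so among the positive modes only
  the scalar ones survive.\<close>

lemma func_lin_left: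
  assumes "m > 0" "X \<in> carrier H"
  shows "func (lin u m \<otimes>\<^bsub>H\<^esub> X) = of_bool (m = 2 * int M) * (\<Sum>i\<in>UNIV. u i * \<alpha> i) * func X"
  using assms(2)
proof (rule H_rep)
  fix F assume F: "F \<in> carrier HP.FA" "X = HP.cls F"
  have "opl (LA i m) f (\<lambda>_. 0) = of_bool (m = 2 * int M) * \<alpha> i * f (\<lambda>_. 0)" for i f
    using assms(1) M_pos by (auto simp: raise_def)
  then show ?thesis using F assms(1)
    by (simp add: lin_def func_cls_mult linF_closed act_linF func_cls sum_distrib_left sum_distrib_right mult_ac)
qed

lemma func_lin_right:
  assumes "m < 0" "X \<in> carrier H"
  shows "func (X \<otimes>\<^bsub>H\<^esub> lin u m) = 0"
  using assms(2)
proof (rule H_rep)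
  fix F assume F: "F \<in> carrier HP.FA" "X = HP.cls F"
  have "opl (LA i m) vacuum \<nu> = 0" for i \<nu>
    using assms(1) by (auto simp: annih_def lower_vacuum)
  then have "act (linF u m) vacuum = (\<lambda>\<nu>. 0)" by (simp add: fun_eq_iff act_linF)
  then show ?thesis using F assms(1)
    by (simp add: lin_def func_cls_mult linF_closed fock_linearD[OF act_linear])
qed

text \<open>The expectation values f(k) of the coefficients satisfy k f(k) = 2M x f(k - 2M), because
  c_M and the modes 2M both enter in degree 2M of h.\<close>

theorem func_gexp: "func (gexp \<kappa> U (2 * M * n)) = (\<kappa> M + (\<Sum>i\<in>UNIV. U i (2 * int M) * \<alpha> i)) ^ n / fact n"
proof -
  define x where "x = \<kappa> M + (\<Sum>i\<in>UNIV. U i (2 * int M) * \<alpha> i)"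
  define f where "f = (\<lambda>k. func (gexp \<kappa> U k))"
  let ?K = "HS.ps_exp (ser_c \<kappa>)" and ?P = "HS.ps_exp (ser_pos U)" and ?N = "HS.ps_exp (ser_neg U)"
  note cl [simp] = HS.ps_exp_closed[OF ser_closed(1)] HS.ps_exp_closed[OF ser_closed(2)] HS.ps_exp_closed[OF ser_closed(3)]
  note eu = HS.euler_closed[OF ser_closed(1)] HS.euler_closed[OF ser_closed(2)] HS.euler_closed[OF ser_closed(3)]
  have eK: "HS.euler ?K = HS.euler (ser_c \<kappa>) \<otimes>\<^bsub>Hh\<^esub> ?K"
    by (rule HS.euler_ps_exp) (simp_all add: euler_ser, rule ser_c_commute, simp)
  have eP: "HS.euler ?P = HS.euler (ser_pos U) \<otimes>\<^bsub>Hh\<^esub> ?P"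
    by (rule HS.euler_ps_exp) (simp_all add: euler_ser, rule ser_pos_pos)
  have eN: "HS.euler ?N = ?N \<otimes>\<^bsub>Hh\<^esub> HS.euler (ser_neg U)"
  proof -
    have c: "HS.euler (ser_neg U) \<otimes>\<^bsub>Hh\<^esub> ser_neg U = ser_neg U \<otimes>\<^bsub>Hh\<^esub> HS.euler (ser_neg U)"
      unfolding euler_ser by (rule ser_neg_neg)
    show ?thesis using HS.ps_exp_commute[OF ser_closed(2) ser_0(2) eu(2) c[symmetric]]
      by (subst HS.euler_ps_exp) (simp_all add: c)
  qed
  have swap: "?K \<otimes>\<^bsub>Hh\<^esub> HS.euler (ser_pos U) = HS.euler (ser_pos U) \<otimes>\<^bsub>Hh\<^esub> ?K"
    by (rule exp_ser_c_commute[OF eu(1)])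
  \<comment> \<open>Positive modes are brought to the left of \<open>gexp\<close> and negative modes
    to its right, where the vacuum functional evaluates them.\<close>
  have ode: "HS.euler (gexp \<kappa> U) = HS.euler (ser_c \<kappa>) \<otimes>\<^bsub>Hh\<^esub> gexp \<kappa> U \<oplus>\<^bsub>Hh\<^esub> 
     (HS.euler (ser_pos U) \<otimes>\<^bsub>Hh\<^esub> gexp \<kappa> U \<oplus>\<^bsub>Hh\<^esub> gexp \<kappa> U \<otimes>\<^bsub>Hh\<^esub> HS.euler (ser_neg U))"
  proof -
    have "HS.euler (gexp \<kappa> U) = HS.euler (ser_c \<kappa>) \<otimes>\<^bsub>Hh\<^esub> gexp \<kappa> U \<oplus>\<^bsub>Hh\<^esub> 
      ((?K \<otimes>\<^bsub>Hh\<^esub> HS.euler (ser_pos U)) \<otimes>\<^bsub>Hh\<^esub> (?P \<otimes>\<^bsub>Hh\<^esub> ?N) \<oplus>\<^bsub>Hh\<^esub> gexp \<kappa> U \<otimes>\<^bsub>Hh\<^esub> HS.euler (ser_neg U))"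
      unfolding gexp_def
      by (simp add: HS.euler_mult eK eP eN eu HhS.m_assoc HhS.r_distr)
    then show ?thesis unfolding swap by (simp add: gexp_def HhS.m_assoc eu)
  qed
  note gc = HS.ps_coeff[OF gexp_closed[of \<kappa> U]] HS.ps_coeff[OF eu(1)] HS.ps_coeff[OF eu(2)] HS.ps_coeff[OF eu(3)]
  note mc = HS.ps_coeff[OF HS.ps_mult_closed]
  have left: "func ((g \<otimes>\<^bsub>Hh\<^esub> gexp \<kappa> U) k) = (if 2 * M \<le> k then y * f (k - 2 * M) else 0)"
    if g: "g \<in> carrier Hh" "\<And>i X. X \<in> carrier H \<Longrightarrow> func (g i \<otimes>\<^bsub>H\<^esub> X) = of_bool (i = 2 * M) * y * func X" for g y k
  proof -
    have "func ((g \<otimes>\<^bsub>Hh\<^esub> gexp \<kappa> U) k) = (\<Sum>i\<le>k. func (g i \<otimes>\<^bsub>H\<^esub> gexp \<kappa> U (k - i)))"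
      unfolding HS.ps_mult using g(1) gc(1) by (intro func_finsum) (auto simp: HS.ps_coeff)
    also have "\<dots> = (\<Sum>i\<le>k. if i = 2 * M then y * f (k - 2 * M) else 0)"
      by (intro sum.cong) (auto simp: g(2)[OF gc(1)] f_def)
    finally show ?thesis by simp
  qed
  have L1: "func (HS.euler (ser_c \<kappa>) i \<otimes>\<^bsub>H\<^esub> X) = of_bool (i = 2 * M) * (of_nat (2 * M) * \<kappa> M) * func X" 
    if X: "X \<in> carrier H" for i X
  proof (cases "i > 0 \<and> even i")
    case True
    then have "i div 2 > 0" by auto
    then show ?thesis using X True unfolding euler_ser
      by (auto simp: ser_c_def HS.m_assoc func_sc func_c)
  next
    case False
    then have "i \<noteq> 2 * M" using M_pos by auto
    then show ?thesis using X False unfolding euler_ser by (auto simp: ser_c_def func_0)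
  qed
  have L2: "func (HS.euler (ser_pos U) i \<otimes>\<^bsub>H\<^esub> X) = of_bool (i = 2 * M) * (of_nat (2 * M) * (\<Sum>i\<in>UNIV. U i (2 * int M) * \<alpha> i)) * func X" 
    if X: "X \<in> carrier H" for i X
  proof (cases "i = 0")
    case False
    then have "func (HS.euler (ser_pos U) i \<otimes>\<^bsub>H\<^esub> X) = 
      of_bool (int i = 2 * int M) * (\<Sum>j\<in>UNIV. of_int \<bar>int i\<bar> * U j (int i) * \<alpha> j) * func X"
      using X unfolding euler_ser by (simp add: ser_pos_def func_lin_left)
    moreover have "int i = 2 * int M \<longleftrightarrow> i = 2 * M" by linarith
    ultimately show ?thesis by (auto simp: sum_distrib_left mult_ac)
  next
    case True
    then show ?thesis using X M_pos unfolding euler_ser by (simp add: ser_pos_def func_0)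
  qed
  have R: "func ((gexp \<kappa> U \<otimes>\<^bsub>Hh\<^esub> HS.euler (ser_neg U)) k) = 0" for k
  proof -
    have "func (X \<otimes>\<^bsub>H\<^esub> HS.euler (ser_neg U) i) = 0" if "X \<in> carrier H" for X i
      using that unfolding euler_ser by (auto simp: ser_neg_def func_0 func_lin_right)
    then have "(\<Sum>i\<le>k. func (gexp \<kappa> U i \<otimes>\<^bsub>H\<^esub> HS.euler (ser_neg U) (k - i))) = 0" using gc by simp
    then show ?thesis unfolding HS.ps_mult using gc by (subst func_finsum) auto
  qed
  have rec: "of_nat k * f k = (if 2 * M \<le> k then of_nat (2 * M) * x * f (k - 2 * M) else 0)" for k
  proof -
    have "of_nat k * f k = func (HS.euler (gexp \<kappa> U) k)"
      unfolding HS.euler_def f_def using gc(1) by (simp add: func_sc)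
    also have "\<dots> = func ((HS.euler (ser_c \<kappa>) \<otimes>\<^bsub>Hh\<^esub> gexp \<kappa> U) k) + (func ((HS.euler (ser_pos U) \<otimes>\<^bsub>Hh\<^esub> gexp \<kappa> U) k) 
       + func ((gexp \<kappa> U \<otimes>\<^bsub>Hh\<^esub> HS.euler (ser_neg U)) k))"
      unfolding ode HS.ps_add using eu by (simp add: func_add mc)
    finally show ?thesis using left[OF eu(3) L1] left[OF eu(1) L2] R by (simp add: x_def algebra_simps)
  qed
  have "f 0 = 1"
    by (simp add: f_def gexp_def HS.ps_mult_0 HS.ps_mult_closed HS.ps_exp_0 func_1)
  then have "f (2 * M * n) = x ^ n / fact n"
  proof (induction n)
    case (Suc n)
    have "of_nat (2 * M * Suc n) * f (2 * M * Suc n) = of_nat (2 * M) * x * f (2 * M * n)"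
      using rec[of "2 * M * Suc n"] by simp
    then have "of_nat (2 * M) * (of_nat (Suc n) * f (2 * M * Suc n)) = of_nat (2 * M) * (x * f (2 * M * n))"
      by (simp only: of_nat_mult mult.assoc)
    then have "of_nat (Suc n) * f (2 * M * Suc n) = x * f (2 * M * n)"
      using M_pos by (subst (asm) mult_cancel_left) simp
    then show ?case using Suc by (simp add: field_simps del: of_nat_Suc)
  qed simp
  then show ?thesis by (simp add: f_def x_def)
qed

end

section \<open>Words in the presented algebra\<close>

context
  fixes C :: "int ^ 'n ^ 'n" and r :: "'n \<Rightarrow> nat"
begin

lemma letter_word: "letter g = Poly_Mapping.single (Word [g]) 1"
  by (simp add: letter_def)

lemma LT_power_word: 
  "(LT_power k :: 'n yt_letter word \<Rightarrow>\<^sub>0 int) = Poly_Mapping.single (Word (if k \<ge> 0 then replicate (nat k) LT else replicate (nat (- k)) LTinv)) 1"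
proof -
  have "letter g ^ n = Poly_Mapping.single (Word (replicate n g)) (1::int)" for n and g :: "'n yt_letter"
    by (induction n) (simp_all add: letter_mult_single zero_word_def[symmetric])
  then show ?thesis by (simp add: LT_power_def)
qed

interpretation YP: presentation "UNIV :: 'n yt_letter set" "yt_relations C r"
  by unfold_locales (simp add: mem_free_algebra subsetI)

lemma FA_UNIV [simp]: "x \<in> carrier (free_algebra UNIV)"
  by (simp add: mem_free_algebra)

definition wc :: "'n yt_letter list \<Rightarrow> ('n yt_letter word \<Rightarrow>\<^sub>0 int) set" where
  "wc w = YP.cls (Poly_Mapping.single (Word w) 1)"

lemma wc_closed [simp]: "wc w \<in> carrier YP.PA"
  unfolding wc_def by (rule YP.cls_closed) simp

lemma wc_append: "wc (u @ v) = wc u \<otimes>\<^bsub>YP.PA\<^esub> wc v"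
  by (simp add: wc_def YP.cls_mult[symmetric] word_mult_single)

lemma wc_Cons: "wc (g # v) = wc [g] \<otimes>\<^bsub>YP.PA\<^esub> wc v"
  using wc_append[of "[g]" v] by simp

lemma wc_Nil [simp]: "wc [] = \<one>\<^bsub>YP.PA\<^esub>"
  by (simp add: wc_def YP.cls_1[symmetric] zero_word_def[symmetric])

definition T_word :: "'n yt_letter list \<Rightarrow> bool" where "T_word w \<longleftrightarrow> set w \<subseteq> {LT, LTinv}"

lemma wc_T_letter_central:
  assumes "g = LT \<or> g = LTinv" "X \<in> carrier YP.PA"
  shows "wc [g] \<otimes>\<^bsub>YP.PA\<^esub> X = X \<otimes>\<^bsub>YP.PA\<^esub> wc [g]"
  unfolding wc_def letter_word[symmetric]
  using assms by (intro YP.central_if_commutes_with_generators YP.RI_rel) (auto simp: yt_relations_def)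

lemma wc_T_central: "T_word \<tau> \<Longrightarrow> X \<in> carrier YP.PA \<Longrightarrow> wc \<tau> \<otimes>\<^bsub>YP.PA\<^esub> X = X \<otimes>\<^bsub>YP.PA\<^esub> wc \<tau>"
proof (induction \<tau>)
  case (Cons g \<tau>)
  then have g: "g = LT \<or> g = LTinv" "T_word \<tau>" by (auto simp: T_word_def)
  have "wc (g # \<tau>) \<otimes>\<^bsub>YP.PA\<^esub> X = wc [g] \<otimes>\<^bsub>YP.PA\<^esub> (X \<otimes>\<^bsub>YP.PA\<^esub> wc \<tau>)"
    using Cons g by (simp add: wc_Cons[of g \<tau>] YP.PA.m_assoc)
  also have "\<dots> = X \<otimes>\<^bsub>YP.PA\<^esub> wc [g] \<otimes>\<^bsub>YP.PA\<^esub> wc \<tau>"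
    using wc_T_letter_central[OF g(1) Cons.prems(2)] Cons.prems(2) by (simp add: YP.PA.m_assoc[symmetric])
  also have "\<dots> = X \<otimes>\<^bsub>YP.PA\<^esub> wc (g # \<tau>)"
    using Cons.prems(2) by (simp add: wc_Cons[of g \<tau>] YP.PA.m_assoc)
  finally show ?case .
qed simp

fun inv_letter :: "'n yt_letter \<Rightarrow> 'n yt_letter" where
  "inv_letter (LY i l) = LYinv i l" | "inv_letter (LYinv i l) = LY i l"
| "inv_letter LT = LTinv" | "inv_letter LTinv = LT"

lemma wc_inv_letter: "wc [g, inv_letter g] = \<one>\<^bsub>YP.PA\<^esub>"
proof -
  have "letter g * letter (inv_letter g) - 1 \<in> yt_relations C r"
    by (cases g) (auto simp: yt_relations_def)
  then have "letter g * letter (inv_letter g) - 1 \<in> YP.RI" by (rule YP.RI_rel)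
  then have "YP.cls (letter g * letter (inv_letter g)) = YP.cls 1"
    by (subst YP.cls_eq_iff) simp_all
  then show ?thesis by (simp add: wc_def letter_word word_mult_single YP.cls_1)
qed

lemma inv_inv_letter [simp]: "inv_letter (inv_letter g) = g"
  by (cases g) auto

lemma wc_inv_letter': "wc [inv_letter g, g] = \<one>\<^bsub>YP.PA\<^esub>"
  using wc_inv_letter[of "inv_letter g"] by simp

definition inv_word :: "'n yt_letter list \<Rightarrow> 'n yt_letter list" where
  "inv_word w = rev (map inv_letter w)"

lemma inv_word_T: "T_word \<tau> \<Longrightarrow> T_word (inv_word \<tau>)"
  by (auto simp: T_word_def inv_word_def)

lemma wc_inv_word: "wc (inv_word w @ w) = \<one>\<^bsub>YP.PA\<^esub>"
proof (induction w)
  case (Cons g w)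
  have "wc (inv_word (g # w) @ g # w) = wc (inv_word w) \<otimes>\<^bsub>YP.PA\<^esub> (wc [inv_letter g, g] \<otimes>\<^bsub>YP.PA\<^esub> wc w)"
    unfolding wc_append[symmetric] by (simp add: inv_word_def)
  then show ?case using Cons by (simp add: wc_inv_letter' wc_append)
qed (simp add: inv_word_def)

text \<open>The power of t is left unspecified on purpose: in this form the property passes to
  inverses, and exact powers are recovered later by mapping to \<open>Yt\<close>.\<close>

definition qcomm :: "('n yt_letter word \<Rightarrow>\<^sub>0 int) set \<Rightarrow> ('n yt_letter word \<Rightarrow>\<^sub>0 int) set \<Rightarrow> bool" where
  "qcomm X Y \<longleftrightarrow> (\<exists>\<tau>. T_word \<tau> \<and> X \<otimes>\<^bsub>YP.PA\<^esub> Y = wc \<tau> \<otimes>\<^bsub>YP.PA\<^esub> (Y \<otimes>\<^bsub>YP.PA\<^esub> X))"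

lemma qcomm_sym:
  assumes "qcomm X Y" "X \<in> carrier YP.PA" "Y \<in> carrier YP.PA"
  shows "qcomm Y X"
proof -
  obtain \<tau> where \<tau>: "T_word \<tau>" "X \<otimes>\<^bsub>YP.PA\<^esub> Y = wc \<tau> \<otimes>\<^bsub>YP.PA\<^esub> (Y \<otimes>\<^bsub>YP.PA\<^esub> X)"
    using assms(1) by (auto simp: qcomm_def)
  have "wc (inv_word \<tau>) \<otimes>\<^bsub>YP.PA\<^esub> (X \<otimes>\<^bsub>YP.PA\<^esub> Y) = wc (inv_word \<tau> @ \<tau>) \<otimes>\<^bsub>YP.PA\<^esub> (Y \<otimes>\<^bsub>YP.PA\<^esub> X)"
    unfolding \<tau>(2) wc_append using assms by (simp add: YP.PA.m_assoc)
  then have "Y \<otimes>\<^bsub>YP.PA\<^esub> X = wc (inv_word \<tau>) \<otimes>\<^bsub>YP.PA\<^esub> (X \<otimes>\<^bsub>YP.PA\<^esub> Y)"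
    using assms by (simp add: wc_inv_word)
  then show ?thesis using inv_word_T[OF \<tau>(1)] by (auto simp: qcomm_def)
qed

text \<open>X Y = \<tau> Y X is multiplied by the inverse of \<open>X\<close> on both sides, and the
  central \<tau> is moved out.\<close>

lemma qcomm_inv:
  assumes "qcomm X Y" and cl: "X \<in> carrier YP.PA" "Y \<in> carrier YP.PA" "X' \<in> carrier YP.PA"
    and inv: "X \<otimes>\<^bsub>YP.PA\<^esub> X' = \<one>\<^bsub>YP.PA\<^esub>" "X' \<otimes>\<^bsub>YP.PA\<^esub> X = \<one>\<^bsub>YP.PA\<^esub>"
  shows "qcomm X' Y"
proof -
  obtain \<tau> where \<tau>: "T_word \<tau>" "X \<otimes>\<^bsub>YP.PA\<^esub> Y = wc \<tau> \<otimes>\<^bsub>YP.PA\<^esub> (Y \<otimes>\<^bsub>YP.PA\<^esub> X)"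
    using assms(1) by (auto simp: qcomm_def)
  have "Y \<otimes>\<^bsub>YP.PA\<^esub> X' = (X' \<otimes>\<^bsub>YP.PA\<^esub> X) \<otimes>\<^bsub>YP.PA\<^esub> (Y \<otimes>\<^bsub>YP.PA\<^esub> X')"
    using cl by (simp add: inv)
  also have "\<dots> = X' \<otimes>\<^bsub>YP.PA\<^esub> ((X \<otimes>\<^bsub>YP.PA\<^esub> Y) \<otimes>\<^bsub>YP.PA\<^esub> X')"
    using cl by (simp add: YP.PA.m_assoc)
  also have "\<dots> = X' \<otimes>\<^bsub>YP.PA\<^esub> wc \<tau> \<otimes>\<^bsub>YP.PA\<^esub> Y \<otimes>\<^bsub>YP.PA\<^esub> (X \<otimes>\<^bsub>YP.PA\<^esub> X')"
    unfolding \<tau>(2) using cl by (simp add: YP.PA.m_assoc)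
  also have "X' \<otimes>\<^bsub>YP.PA\<^esub> wc \<tau> = wc \<tau> \<otimes>\<^bsub>YP.PA\<^esub> X'" using wc_T_central[OF \<tau>(1) cl(3)] by simp
  finally have "Y \<otimes>\<^bsub>YP.PA\<^esub> X' = wc \<tau> \<otimes>\<^bsub>YP.PA\<^esub> (X' \<otimes>\<^bsub>YP.PA\<^esub> Y)"
    using cl by (simp add: inv YP.PA.m_assoc)
  then have "qcomm Y X'" using \<tau>(1) by (auto simp: qcomm_def)
  then show ?thesis by (rule qcomm_sym[OF _ cl(2,3)])
qed

text \<open>The defining relations only treat pairs of \<open>LY\<close> letters; pairs with inverse
  letters follow through \<open>qcomm_inv\<close> and \<open>qcomm_sym\<close>.\<close>

lemma qcomm_letters: "qcomm (wc [g]) (wc [h])"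
proof -
  have inv: "wc [g] \<otimes>\<^bsub>YP.PA\<^esub> wc [inv_letter g] = \<one>\<^bsub>YP.PA\<^esub>" "wc [inv_letter g] \<otimes>\<^bsub>YP.PA\<^esub> wc [g] = \<one>\<^bsub>YP.PA\<^esub>" for g
    using wc_inv_letter[of g] wc_inv_letter'[of g] by (simp_all add: wc_append[symmetric])
  have YY: "qcomm (wc [LY i l]) (wc [LY j k])" for i l j k
  proof -
    define \<tau> where "\<tau> = (let c = \<gamma> C r i l j k in if c \<ge> 0 then replicate (nat c) LT else replicate (nat (- c)) (LTinv :: 'n yt_letter))"
    have "letter (LY i l) * letter (LY j k) - LT_power (\<gamma> C r i l j k) * letter (LY j k) * letter (LY i l) \<in> YP.RI"
      unfolding yt_relations_def by (rule YP.RI_rel[unfolded yt_relations_def], rule UnI2) blast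
    then have "YP.cls (letter (LY i l) * letter (LY j k)) = YP.cls (LT_power (\<gamma> C r i l j k) * letter (LY j k) * letter (LY i l))"
      by (subst YP.cls_eq_iff) simp_all
    moreover have "LT_power (\<gamma> C r i l j k) = Poly_Mapping.single (Word \<tau>) 1"
      by (simp add: LT_power_word \<tau>_def Let_def)
    ultimately have "wc [LY i l, LY j k] = wc (\<tau> @ [LY j k, LY i l])"
      by (simp add: wc_def letter_word word_mult_single)
    moreover have "T_word \<tau>" by (auto simp: T_word_def \<tau>_def Let_def)
    ultimately show ?thesis unfolding qcomm_def wc_append[symmetric] by (intro exI[of _ \<tau>]) simp
  qed
  have VY: "qcomm (wc [LYinv i l]) (wc [LY j k])" for i l j k
    by (rule qcomm_inv[OF YY[of i l j k]]) (use inv[of "LY i l"] in simp_all)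
  have YV: "qcomm (wc [LY j k]) (wc [LYinv i l])" for i l j k
    by (rule qcomm_sym[OF VY]) simp_all
  have VV: "qcomm (wc [LYinv j k]) (wc [LYinv i l])" for i l j k
    by (rule qcomm_inv[OF YV]) (use inv[of "LY j k"] in simp_all)
  have T: "qcomm (wc [g]) (wc [h])" if "g = LT \<or> g = LTinv" for g h
    unfolding qcomm_def using wc_T_letter_central[OF that] by (intro exI[of _ "[]"]) (simp add: T_word_def)
  have T': "qcomm (wc [h]) (wc [g])" if "g = LT \<or> g = LTinv" for g h
    by (rule qcomm_sym[OF T[OF that]]) simp_all
  show ?thesis by (cases g; cases h) (use YY VY YV VV T T' in auto)
qed

lemma qcomm_word: "\<exists>\<tau>. T_word \<tau> \<and> wc (a @ [g]) = wc (\<tau> @ g # a)"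
proof (induction a)
  case Nil
  then show ?case by (intro exI[of _ "[]"]) (simp add: T_word_def)
next
  case (Cons h a)
  then obtain \<tau> where \<tau>: "T_word \<tau>" "wc (a @ [g]) = wc (\<tau> @ g # a)" by blast
  obtain \<sigma> where \<sigma>: "T_word \<sigma>" "wc [h] \<otimes>\<^bsub>YP.PA\<^esub> wc [g] = wc \<sigma> \<otimes>\<^bsub>YP.PA\<^esub> (wc [g] \<otimes>\<^bsub>YP.PA\<^esub> wc [h])"
    using qcomm_letters[of h g] by (auto simp: qcomm_def)
  have "wc ((h # a) @ [g]) = wc [h] \<otimes>\<^bsub>YP.PA\<^esub> wc (\<tau> @ g # a)"
    using \<tau>(2) wc_Cons[of h "a @ [g]"] by simp
  also have "\<dots> = (wc [h] \<otimes>\<^bsub>YP.PA\<^esub> wc \<tau>) \<otimes>\<^bsub>YP.PA\<^esub> (wc [g] \<otimes>\<^bsub>YP.PA\<^esub> wc a)"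
    by (simp add: wc_append wc_Cons[of g a] YP.PA.m_assoc)
  also have "wc [h] \<otimes>\<^bsub>YP.PA\<^esub> wc \<tau> = wc \<tau> \<otimes>\<^bsub>YP.PA\<^esub> wc [h]" using wc_T_central[OF \<tau>(1)] by simp
  also have "wc \<tau> \<otimes>\<^bsub>YP.PA\<^esub> wc [h] \<otimes>\<^bsub>YP.PA\<^esub> (wc [g] \<otimes>\<^bsub>YP.PA\<^esub> wc a) = wc \<tau> \<otimes>\<^bsub>YP.PA\<^esub> ((wc [h] \<otimes>\<^bsub>YP.PA\<^esub> wc [g]) \<otimes>\<^bsub>YP.PA\<^esub> wc a)"
    by (simp add: YP.PA.m_assoc)
  also have "\<dots> = wc ((\<tau> @ \<sigma>) @ g # h # a)"
    unfolding \<sigma>(2) by (simp add: wc_append wc_Cons[of g "h # a"] wc_Cons[of h a] YP.PA.m_assoc)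
  finally show ?case using \<tau>(1) \<sigma>(1) by (intro exI[of _ "\<tau> @ \<sigma>"]) (auto simp: T_word_def)
qed

fun ex_letter :: "'n yt_letter \<Rightarrow> ('n \<times> int) \<Rightarrow>\<^sub>0 int" where
  "ex_letter (LY i l) = frag_of (i, l)" | "ex_letter (LYinv i l) = - frag_of (i, l)"
| "ex_letter LT = 0" | "ex_letter LTinv = 0"

definition ex :: "'n yt_letter list \<Rightarrow> ('n \<times> int) \<Rightarrow>\<^sub>0 int" where
  "ex w = sum_list (map ex_letter w)"

fun tdeg_letter :: "'n yt_letter \<Rightarrow> int" where
  "tdeg_letter LT = 1" | "tdeg_letter LTinv = -1" | "tdeg_letter _ = 0"

definition tdeg :: "'n yt_letter list \<Rightarrow> int" where
  "tdeg w = sum_list (map tdeg_letter w)"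

lemma ex_simps [simp]: "ex [] = 0" "ex (g # w) = ex_letter g + ex w" "ex (u @ v) = ex u + ex v"
  by (simp_all add: ex_def)

lemma tdeg_simps [simp]: "tdeg [] = 0" "tdeg (g # w) = tdeg_letter g + tdeg w" "tdeg (u @ v) = tdeg u + tdeg v"
  by (simp_all add: tdeg_def)

lemma ex_inv_letter: "ex_letter (inv_letter g) = - ex_letter g" and tdeg_inv_letter: "tdeg_letter (inv_letter g) = - tdeg_letter g"
  by (cases g; simp)+

lemma ex_inv_word: "ex (inv_word w) = - ex w"
  by (induction w) (simp_all add: inv_word_def ex_inv_letter)

lemma lookup_ex_neg: "Poly_Mapping.lookup (ex w) (i, l) < 0 \<Longrightarrow> LYinv i l \<in> set w"
proof (induction w)
  case (Cons g w)
  have "Poly_Mapping.lookup (ex_letter g) (i, l) \<ge> 0" if "g \<noteq> LYinv i l"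
    using that by (cases g) (auto simp: lookup_single when_def)
  then show ?case using Cons by (cases "g = LYinv i l") (auto simp: lookup_add)
qed simp

lemma lookup_ex_pos: "Poly_Mapping.lookup (ex w) (i, l) > 0 \<Longrightarrow> LY i l \<in> set w"
proof (induction w)
  case (Cons g w)
  have "Poly_Mapping.lookup (ex_letter g) (i, l) \<le> 0" if "g \<noteq> LY i l"
    using that by (cases g) (auto simp: lookup_single when_def)
  then show ?case using Cons by (cases "g = LY i l") (auto simp: lookup_add)
qed simp

text \<open>Induction on the length: a first letter not in t must be balanced by its inverse later
  in the word. \<open>qcomm_word\<close> moves that inverse next to it, and the two cancel at the
  cost of a word in t.\<close>

lemma ex_zero_word: "ex w = 0 \<Longrightarrow> \<exists>\<tau>. T_word \<tau> \<and> wc w = wc \<tau>"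
proof (induction w rule: length_induct)
  case (1 w)
  show ?case
  proof (cases w)
    case Nil
    then show ?thesis by (intro exI[of _ "[]"]) (simp add: T_word_def)
  next
    case (Cons g u)
    show ?thesis
    proof (cases "g = LT \<or> g = LTinv")
      case True
      then have "ex u = 0" using 1(2) Cons by auto
      then obtain \<tau> where "T_word \<tau>" "wc u = wc \<tau>" using 1(1) Cons by force
      then show ?thesis using True Cons 
        by (intro exI[of _ "g # \<tau>"]) (auto simp: T_word_def wc_Cons[of g u] wc_Cons[of g \<tau>])
    next
      case False
      have e: "ex u = - ex_letter g" using 1(2) Cons by (simp add: eq_neg_iff_add_eq_0 add.commute)
      have "inv_letter g \<in> set u"
      proof (cases g)
        case (LY i l)
        then show ?thesis using e lookup_ex_neg[of u i l] by simp
      next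
        case (LYinv i l)
        then show ?thesis using e lookup_ex_pos[of u i l] by simp
      qed (use False in auto)
      then obtain a b where u: "u = a @ inv_letter g # b" by (meson split_list)
      obtain \<tau> where \<tau>: "T_word \<tau>" "wc (a @ [inv_letter g]) = wc (\<tau> @ inv_letter g # a)"
        using qcomm_word by blast
      have "wc w = wc [g] \<otimes>\<^bsub>YP.PA\<^esub> wc (a @ [inv_letter g]) \<otimes>\<^bsub>YP.PA\<^esub> wc b"
        unfolding wc_append[symmetric] by (simp add: Cons u)
      also have "\<dots> = (wc [g] \<otimes>\<^bsub>YP.PA\<^esub> wc \<tau>) \<otimes>\<^bsub>YP.PA\<^esub> (wc [inv_letter g] \<otimes>\<^bsub>YP.PA\<^esub> wc (a @ b))"
        unfolding \<tau>(2) by (simp add: wc_append wc_Cons[of "inv_letter g" a] YP.PA.m_assoc)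
      also have "wc [g] \<otimes>\<^bsub>YP.PA\<^esub> wc \<tau> = wc \<tau> \<otimes>\<^bsub>YP.PA\<^esub> wc [g]" using wc_T_central[OF \<tau>(1)] by simp
      also have "wc \<tau> \<otimes>\<^bsub>YP.PA\<^esub> wc [g] \<otimes>\<^bsub>YP.PA\<^esub> (wc [inv_letter g] \<otimes>\<^bsub>YP.PA\<^esub> wc (a @ b))
         = wc \<tau> \<otimes>\<^bsub>YP.PA\<^esub> (wc [g, inv_letter g] \<otimes>\<^bsub>YP.PA\<^esub> wc (a @ b))"
        by (simp add: wc_Cons[of g "[inv_letter g]"] YP.PA.m_assoc)
      finally have w: "wc w = wc \<tau> \<otimes>\<^bsub>YP.PA\<^esub> wc (a @ b)" by (simp add: wc_inv_letter)
      have "ex (a @ b) = 0" using 1(2) Cons u by (simp add: ex_inv_letter)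
      then obtain \<sigma> where "T_word \<sigma>" "wc (a @ b) = wc \<sigma>" using 1(1) Cons u by force
      then show ?thesis using \<tau>(1) w 
        by (intro exI[of _ "\<tau> @ \<sigma>"]) (auto simp: T_word_def wc_append)
    qed
  qed
qed

lemma same_exponent_words:
  assumes "ex w = ex w'"
  shows "\<exists>\<tau>. T_word \<tau> \<and> wc w = wc (\<tau> @ w')"
proof -
  have "ex (w @ inv_word w') = 0" using assms by (simp add: ex_inv_word)
  then obtain \<tau> where \<tau>: "T_word \<tau>" "wc (w @ inv_word w') = wc \<tau>" using ex_zero_word by blast
  have "wc w = wc w \<otimes>\<^bsub>YP.PA\<^esub> wc (inv_word w' @ w')" by (simp add: wc_inv_word)
  also have "\<dots> = wc (w @ inv_word w') \<otimes>\<^bsub>YP.PA\<^esub> wc w'" by (simp add: wc_append YP.PA.m_assoc)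
  finally show ?thesis using \<tau> by (auto simp: wc_append)
qed

lemma tdeg_neg: "T_word w \<Longrightarrow> tdeg w < 0 \<Longrightarrow> LTinv \<in> set w"
proof (induction w)
  case (Cons g w)
  then show ?case by (cases "g = LTinv") (auto simp: T_word_def)
qed simp

lemma tdeg_pos: "T_word w \<Longrightarrow> tdeg w > 0 \<Longrightarrow> LT \<in> set w"
proof (induction w)
  case (Cons g w)
  then show ?case by (cases "g = LT") (auto simp: T_word_def)
qed simp

text \<open>The same cancellation, now without remainder because the letters are central.\<close>

lemma T_word_degree_0: "T_word w \<Longrightarrow> tdeg w = 0 \<Longrightarrow> wc w = \<one>\<^bsub>YP.PA\<^esub>"
proof (induction w rule: length_induct)
  case (1 w)
  show ?case
  proof (cases w)
    case (Cons g u)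
    then have g: "g = LT \<or> g = LTinv" "T_word u" using 1(2) by (auto simp: T_word_def)
    have "inv_letter g \<in> set u"
      using g tdeg_neg[OF g(2)] tdeg_pos[OF g(2)] 1(3) Cons by auto
    then obtain a b where u: "u = a @ inv_letter g # b" by (meson split_list)
    have "wc w = wc [g] \<otimes>\<^bsub>YP.PA\<^esub> wc a \<otimes>\<^bsub>YP.PA\<^esub> wc (inv_letter g # b)"
      unfolding wc_append[symmetric] by (simp add: Cons u)
    also have "wc [g] \<otimes>\<^bsub>YP.PA\<^esub> wc a = wc a \<otimes>\<^bsub>YP.PA\<^esub> wc [g]" by (rule wc_T_letter_central[OF g(1)]) simp
    also have "wc a \<otimes>\<^bsub>YP.PA\<^esub> wc [g] \<otimes>\<^bsub>YP.PA\<^esub> wc (inv_letter g # b) = wc a \<otimes>\<^bsub>YP.PA\<^esub> (wc [g, inv_letter g] \<otimes>\<^bsub>YP.PA\<^esub> wc b)"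
      by (simp add: wc_Cons[of g "[inv_letter g]"] wc_Cons[of "inv_letter g" b] YP.PA.m_assoc)
    finally have "wc w = wc (a @ b)" by (simp add: wc_inv_letter wc_append)
    moreover have "T_word (a @ b)" "tdeg (a @ b) = 0" "length (a @ b) < length w"
      using 1(2,3) Cons u by (auto simp: T_word_def tdeg_inv_letter)
    ultimately show ?thesis using 1(1) by auto
  qed simp
qed

lemma exists_word_with_exponent: "\<exists>w. ex w = e"
proof (rule frag_induction[of e UNIV])
  show "\<exists>w. ex w = 0" by (rule exI[of _ "[]"]) simp
  show "\<exists>w. ex w = frag_of x" for x by (cases x) (rule exI[of _ "[LY (fst x) (snd x)]"], simp)
  show "\<exists>w. ex w = a - b" if ab: "\<exists>w. ex w = a" "\<exists>w. ex w = b" for a b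
  proof -
    obtain u v where "ex u = a" "ex v = b" using ab by blast
    then show ?thesis by (intro exI[of _ "u @ inv_word v"]) (simp add: ex_inv_word)
  qed
qed simp

end

section \<open>Monomials and their independence\<close>

text \<open>The additive extension of \<open>g\<close> to the free abelian group of
  exponents.\<close>

definition esum :: "('p \<Rightarrow>\<^sub>0 int) \<Rightarrow> ('p \<Rightarrow> 'b::comm_ring_1) \<Rightarrow> 'b" where
  "esum e g = (\<Sum>p\<in>Poly_Mapping.keys e. of_int (Poly_Mapping.lookup e p) * g p)"

lemma esum_superset:
  assumes "finite S" "Poly_Mapping.keys e \<subseteq> S"
  shows "esum e g = (\<Sum>p\<in>S. of_int (Poly_Mapping.lookup e p) * g p)"
  unfolding esum_def using assms by (intro sum.mono_neutral_left) (auto simp: in_keys_iff)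

lemma esum_add: "esum (e + f) g = esum e g + esum f g"
proof -
  let ?S = "Poly_Mapping.keys e \<union> Poly_Mapping.keys f"
  have "esum (e + f) g = (\<Sum>p\<in>?S. of_int (Poly_Mapping.lookup (e + f) p) * g p)"
    using keys_add[of e f] by (intro esum_superset) auto
  then show ?thesis
    by (simp add: esum_superset[of ?S e] esum_superset[of ?S f] lookup_add distrib_right sum.distrib)
qed

lemma esum_0 [simp]: "esum 0 g = 0"
  by (simp add: esum_def)

lemma esum_frag_of [simp]: "esum (frag_of p) g = g p"
  by (simp add: esum_def)

lemma esum_minus: "esum (- e) g = - esum e g"
  using esum_add[of "- e" e g] by (simp add: eq_neg_iff_add_eq_0)

lemma esum_diff: "esum (e - f) g = esum e g - esum f g"
  using esum_add[of e "- f" g] by (simp add: esum_minus)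

lemma esum_sum: "esum (\<Sum>i\<in>A. e i) g = (\<Sum>i\<in>A. esum (e i) g)"
  by (induction A rule: infinite_finite_induct) (simp_all add: esum_add)

lemma esum_fun_minus: "esum e (\<lambda>p. - g p) = - esum e g"
  by (simp add: esum_def sum_negf)

lemma esum_fun_diff: "esum e (\<lambda>p. g p - h p) = esum e g - esum e h"
  by (simp add: esum_def right_diff_distrib sum_subtractf)

lemma esum_fun_0 [simp]: "esum e (\<lambda>p. 0) = 0"
  by (simp add: esum_def)

lemma esum_mult_right: "esum e (\<lambda>p. g p * c) = esum e g * c"
  by (simp add: esum_def sum_distrib_right mult.assoc)

lemma esum_mult_left: "esum e (\<lambda>p. c * g p) = c * esum e g"
  using esum_mult_right[of e g c] by (simp add: mult.commute)

lemma esum_prod: "esum e g * esum f h * c = esum e (\<lambda>p. esum f (\<lambda>s. g p * h s * c))"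
  by (simp only: esum_mult_right esum_mult_left)

lemma esum_sum_fun: "esum e (\<lambda>p. \<Sum>i\<in>A. g i p) = (\<Sum>i\<in>A. esum e (g i))"
  unfolding esum_def by (simp add: sum_distrib_left) (rule sum.swap)

lemma esum_UU: "(\<And>p. g p \<in> \<UU>) \<Longrightarrow> esum e g \<in> \<UU>"
  unfolding esum_def by (intro UU_sum UU_mult) auto

text \<open>Along the curve \<eta>_j = s^(f(j) + 1) with injective \<open>f\<close>, distinct data
  give distinct polynomials in s; a value of s avoiding the finitely many roots of their differences
  separates all of them.\<close>

lemma distinct_evaluation:
  fixes a :: "'g \<Rightarrow> complex" and b :: "'g \<Rightarrow> 'n::finite \<Rightarrow> complex"
  assumes "finite A" "\<And>g h. g \<in> A \<Longrightarrow> h \<in> A \<Longrightarrow> g \<noteq> h \<Longrightarrow> a g \<noteq> a h \<or> b g \<noteq> b h"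
  shows "\<exists>\<eta>. inj_on (\<lambda>g. a g + (\<Sum>j\<in>UNIV. \<eta> j * b g j)) A"
proof -
  obtain f :: "'n \<Rightarrow> nat" where f: "inj f" using finite_imp_inj_to_nat_seg[of "UNIV :: 'n set"] by auto
  define P where "P = (\<lambda>g h. [:a g - a h:] + (\<Sum>j\<in>UNIV. Polynomial.monom (b g j - b h j) (Suc (f j))))"
  have poly_P: "poly (P g h) s = (a g - a h) + (\<Sum>j\<in>UNIV. s ^ Suc (f j) * (b g j - b h j))" for g h s
    by (simp add: P_def poly_sum poly_monom mult.commute)
  have c0: "Polynomial.coeff (P g h) 0 = a g - a h" for g h
    by (simp add: P_def coeff_sum)
  have cS: "Polynomial.coeff (P g h) (Suc (f j)) = b g j - b h j" for g h j
  proof -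
    have "(f i = f j) = (i = j)" for i using f by (auto dest: injD)
    then show ?thesis unfolding P_def by (simp add: coeff_sum)
  qed
  have nz: "P g h \<noteq> 0" if "g \<in> A" "h \<in> A" "g \<noteq> h" for g h
  proof
    assume "P g h = 0"
    then have "a g = a h" "b g j = b h j" for j using c0[of g h] cS[of g h j] by simp_all
    then show False using assms(2)[OF that] by auto
  qed
  let ?R = "\<Union>(g, h)\<in>{(g, h) \<in> A \<times> A. g \<noteq> h}. {s. poly (P g h) s = 0}"
  have "finite {(g, h) \<in> A \<times> A. g \<noteq> h}" by (rule finite_subset[of _ "A \<times> A"]) (use assms(1) in auto)
  then have "finite ?R"
  proof (rule finite_UN_I)
    fix x assume "x \<in> {(g, h) \<in> A \<times> A. g \<noteq> h}"
    then obtain g h where x: "x = (g, h)" and gh: "g \<in> A" "h \<in> A" "g \<noteq> h" by blast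
    show "finite (case x of (g, h) \<Rightarrow> {s. poly (P g h) s = 0})"
      unfolding x prod.case by (rule poly_roots_finite[OF nz[OF gh]])
  qed
  then obtain s where s: "s \<notin> ?R" using ex_new_if_finite[OF infinite_UNIV_char_0] by blast
  have "inj_on (\<lambda>g. a g + (\<Sum>j\<in>UNIV. s ^ Suc (f j) * b g j)) A"
  proof (rule inj_onI, rule ccontr)
    fix g h assume g: "g \<in> A" "h \<in> A" and e: "a g + (\<Sum>j\<in>UNIV. s ^ Suc (f j) * b g j) = a h + (\<Sum>j\<in>UNIV. s ^ Suc (f j) * b h j)" 
      and ne: "g \<noteq> h"
    have "poly (P g h) s = 0"
      using e unfolding poly_P right_diff_distrib sum_subtractf by (simp add: algebra_simps)
    then show False using s g ne by blast
  qed
  then show ?thesis by (rule exI[of _ "\<lambda>j. s ^ Suc (f j)"])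
qed

text \<open>A Vandermonde argument: vanishing for powers extends to all polynomials, and the product
  over the other points isolates \<open>g\<close>.\<close>

lemma power_sums_zero:
  fixes x :: "'g \<Rightarrow> complex" and c :: "'g \<Rightarrow> complex"
  assumes "finite A" "inj_on x A" "\<And>n. (\<Sum>g\<in>A. c g * x g ^ n) = 0" "g \<in> A"
  shows "c g = 0"
proof -
  have poly: "(\<Sum>g\<in>A. c g * poly p (x g)) = 0" for p
  proof -
    have "(\<Sum>g\<in>A. c g * poly p (x g)) = (\<Sum>i\<le>degree p. Polynomial.coeff p i * (\<Sum>g\<in>A. c g * x g ^ i))"
      unfolding poly_altdef sum_distrib_left by (subst sum.swap) (simp add: mult_ac)
    then show ?thesis by (simp add: assms(3))
  qed
  define p where "p = (\<Prod>h\<in>A - {g}. [:- x h, 1:])"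
  have "poly p (x h) = 0" if "h \<in> A - {g}" for h
    unfolding p_def poly_prod using assms(1) that by (intro prod_zero) auto
  then have "(\<Sum>h\<in>A. c h * poly p (x h)) = c g * poly p (x g)"
    using assms(1,4) by (simp add: sum.remove[of A g])
  moreover have "poly p (x g) \<noteq> 0"
    unfolding p_def poly_prod using assms(1,2,4) by (auto simp: inj_on_def)
  ultimately show ?thesis using poly[of p] by simp
qed

context cartan_q
begin

text \<open>The product of the transposed inverse of C(z), B(z) and the inverse is symmetric by
  \<open>Bz_sym\<close>; cancelling C(z) on either side gives the two expressions.\<close>

lemma comm_fun_sym: "comm_fun i j = comm_fun j i"
proof -
  let ?D = "\<lambda>a. qint zvar (int (r a))"
  have B: "Bz C r $ a $ b = ?D a * Cz C r $ a $ b" for a b by (simp add: Bz_def)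
  have "(\<Sum>a\<in>UNIV. \<Sum>b\<in>UNIV. Ct $ a $ i * Bz C r $ a $ b * Ct $ b $ j) = 
    (\<Sum>a\<in>UNIV. Ct $ a $ i * ?D a * (\<Sum>b\<in>UNIV. Cz C r $ a $ b * Ct $ b $ j))"
    unfolding B sum_distrib_left by (simp add: mult_ac)
  also have "\<dots> = (\<Sum>a\<in>UNIV. if a = j then Ct $ a $ i * ?D a else 0)"
    by (intro sum.cong) (auto simp: Cz_Ct)
  finally have 1: "(\<Sum>a\<in>UNIV. \<Sum>b\<in>UNIV. Ct $ a $ i * Bz C r $ a $ b * Ct $ b $ j) = Ct $ j $ i * ?D j" by simp
  have "(\<Sum>a\<in>UNIV. \<Sum>b\<in>UNIV. Ct $ a $ i * Bz C r $ a $ b * Ct $ b $ j) = 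
     (\<Sum>a\<in>UNIV. \<Sum>b\<in>UNIV. Ct $ a $ i * (?D b * Cz C r $ b $ a) * Ct $ b $ j)"
    by (intro sum.cong refl) (subst Bz_sym, simp add: B)
  also have "\<dots> = (\<Sum>b\<in>UNIV. ?D b * Ct $ b $ j * (\<Sum>a\<in>UNIV. Cz C r $ b $ a * Ct $ a $ i))"
    unfolding sum_distrib_left by (subst sum.swap) (simp add: mult_ac)
  also have "\<dots> = (\<Sum>b\<in>UNIV. if b = i then ?D b * Ct $ b $ j else 0)"
    by (intro sum.cong) (auto simp: Cz_Ct)
  finally have 2: "(\<Sum>a\<in>UNIV. \<Sum>b\<in>UNIV. Ct $ a $ i * Bz C r $ a $ b * Ct $ b $ j) = ?D i * Ct $ i $ j" by simp
  have "comm_fun i j = (zvar - inverse zvar) * (Ct $ j $ i * ?D j)" for i j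
    unfolding comm_fun_def qint_mult[OF zvar_neq_inverse, symmetric] by (simp add: mult_ac)
  then show ?thesis using 1 2 by (simp add: mult.commute)
qed

type_synonym 'k expo = "('k \<times> int) \<Rightarrow>\<^sub>0 int"

section \<open>Labels of monomials and their group law\<close>

text \<open>Coordinates in the a_i[m] of the linear exponent of a monomial, obtained from y_j[m] =
  sum of Ct_ij(q^m) a_i[m].\<close>

definition ycoef :: "'a expo \<Rightarrow> 'a \<Rightarrow> int \<Rightarrow> complex" where
  "ycoef e = (\<lambda>i m. esum e (\<lambda>(j, l). q powi (l * m) * ev m (Ct $ i $ j)))"

text \<open>The label (R, e) stands for t_R times the normally ordered product of the Y_(j,l) to the
  powers e(j, l).\<close>

definition Mon :: "ratfun \<times> 'a expo \<Rightarrow> nat \<Rightarrow> 'a heis" where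
  "Mon g = gexp (\<lambda>m. ev (int m) (fst g)) (ycoef (snd g))"

text \<open>The 2-cocycle on exponents as an element of \<UU>, whose values at q^m are those of
  \<open>cocycle\<close>.\<close>

definition tw :: "'a expo \<Rightarrow> 'a expo \<Rightarrow> ratfun" where
  "tw e f = esum e (\<lambda>(i, l). esum f (\<lambda>(j, k). - (zvar powi (k - l) * comm_fun i j)))"

lemma tw_UU [simp]: "tw e f \<in> \<UU>"
  unfolding tw_def by (auto intro!: esum_UU UU_minus UU_mult split: prod.split)

lemma tw_add: "tw (e + e') f = tw e f + tw e' f" "tw e (f + f') = tw e f + tw e f'"
  and tw_minus: "tw (- e) f = - tw e f" "tw e (- f) = - tw e f"
  and tw_0 [simp]: "tw 0 f = 0" "tw e 0 = 0"
proof -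
  show "tw e (f + f') = tw e f + tw e f'" "tw e (- f) = - tw e f" "tw e 0 = 0"
    unfolding tw_def by (simp_all add: split_def esum_add esum_minus esum_fun_minus esum_fun_diff)
qed (simp_all add: tw_def esum_add esum_minus)

lemma gexp_cong:
  assumes "\<And>m. m > 0 \<Longrightarrow> \<kappa> m = \<kappa>' m" "\<And>i m. m \<noteq> 0 \<Longrightarrow> U i m = U' i m"
  shows "gexp \<kappa> U = gexp \<kappa>' U'"
proof -
  have "ser_c \<kappa> = ser_c \<kappa>'" using assms(1) by (auto simp: ser_c_def fun_eq_iff elim!: evenE)
  moreover have "ser_pos U = ser_pos U'" "ser_neg U = ser_neg U'" 
    using assms(2) by (simp_all add: ser_pos_def ser_neg_def fun_eq_iff)
  ultimately show ?thesis by (simp add: gexp_def)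
qed

lemma ev_esum: "m \<noteq> 0 \<Longrightarrow> (\<And>p. g p \<in> \<UU>) \<Longrightarrow> ev m (esum e g) = esum e (\<lambda>p. ev m (g p))"
  unfolding esum_def by (simp add: ev_sum ev_mult UU_mult)

text \<open>Bilinear expansion followed by \<open>ev_comm_fun\<close> at -m; oddness of
  \<open>comm_fun\<close> produces the sign in \<open>tw\<close>.\<close>

lemma cocycle_ycoef:
  assumes "m > 0"
  shows "cocycle (ycoef e) (ycoef f) m = ev (int m) (tw e f)"
proof -
  let ?m = "int m"
  let ?A = "\<lambda>p a. q powi (snd p * - ?m) * ev (- ?m) (Ct $ a $ fst p)"
  let ?B = "\<lambda>s b. q powi (snd s * ?m) * ev ?m (Ct $ b $ fst s)"
  have "cocycle (ycoef e) (ycoef f) m = (\<Sum>a\<in>UNIV. \<Sum>b\<in>UNIV. esum e (\<lambda>p. ?A p a) * esum f (\<lambda>s. ?B s b) * Bm (- ?m) a b)"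
    by (simp add: cocycle_def bracket_def ycoef_def split_def)
  also have "\<dots> = (\<Sum>a\<in>UNIV. \<Sum>b\<in>UNIV. esum e (\<lambda>p. esum f (\<lambda>s. ?A p a * ?B s b * Bm (- ?m) a b)))"
    by (simp only: esum_prod)
  also have "\<dots> = esum e (\<lambda>p. esum f (\<lambda>s. \<Sum>a\<in>UNIV. \<Sum>b\<in>UNIV. ?A p a * ?B s b * Bm (- ?m) a b))"
    by (simp add: esum_sum_fun)
  also have "\<dots> = esum e (\<lambda>p. esum f (\<lambda>s. ev ?m (- (zvar powi (snd s - snd p) * comm_fun (fst p) (fst s)))))"
  proof -
    have "(\<Sum>a\<in>UNIV. \<Sum>b\<in>UNIV. ?A p a * ?B s b * Bm (- ?m) a b) = ev ?m (- (zvar powi (snd s - snd p) * comm_fun (fst p) (fst s)))" for p s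
    proof -
      have "(\<Sum>a\<in>UNIV. \<Sum>b\<in>UNIV. ?A p a * ?B s b * Bm (- ?m) a b) = q powi (snd p * - ?m) * q powi (snd s * ?m) *
        (\<Sum>a\<in>UNIV. \<Sum>b\<in>UNIV. ev (- ?m) (Ct $ a $ fst p) * ev (- (- ?m)) (Ct $ b $ fst s) * Bm (- ?m) a b)"
        by (simp add: sum_distrib_left mult_ac)
      also have "\<dots> = q powi (snd p * - ?m) * q powi (snd s * ?m) * ev (- ?m) (comm_fun (fst p) (fst s))"
        using assms by (subst ev_comm_fun) simp_all
      also have "q powi (snd p * - ?m) * q powi (snd s * ?m) = q powi ((snd s - snd p) * ?m)"
        by (simp flip: power_int_add add: algebra_simps)
      finally show ?thesis using assms by (simp add: comm_fun_neg ev_minus UU_mult ev_mult ev_zvar_powi)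
    qed
    then show ?thesis by simp
  qed
  also have "\<dots> = ev ?m (tw e f)"
    using assms unfolding tw_def split_def by (simp add: ev_esum esum_UU UU_mult UU_minus)
  finally show ?thesis .
qed

text \<open>The central extension of the group of exponents by \<UU> with cocycle
  \<open>tw\<close>.\<close>

fun gmul :: "ratfun \<times> 'a expo \<Rightarrow> ratfun \<times> 'a expo \<Rightarrow> ratfun \<times> 'a expo" where
  "gmul (R, e) (S, f) = (R + S + tw e f, e + f)"

definition GU :: "(ratfun \<times> 'a expo) set" where "GU = \<UU> \<times> UNIV"

lemma gmul_GU [simp]: "g \<in> GU \<Longrightarrow> h \<in> GU \<Longrightarrow> gmul g h \<in> GU"
  by (cases g; cases h) (auto simp: GU_def intro: UU_add)

lemma Mon_closed [simp]: "Mon g \<in> carrier Hh"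
  by (simp add: Mon_def)

lemma Mon_mult: "g \<in> GU \<Longrightarrow> h \<in> GU \<Longrightarrow> Mon g \<otimes>\<^bsub>Hh\<^esub> Mon h = Mon (gmul g h)"
proof -
  assume gh: "g \<in> GU" "h \<in> GU"
  obtain R e S f where e: "g = (R, e)" "h = (S, f)" by (metis surj_pair)
  then have UU: "R \<in> \<UU>" "S \<in> \<UU>" using gh by (auto simp: GU_def)
  show ?thesis unfolding Mon_def gexp_mult e
  proof (rule gexp_cong)
    show "ev (int m) (fst (R, e)) + ev (int m) (fst (S, f)) + cocycle (ycoef (snd (R, e))) (ycoef (snd (S, f))) m
      = ev (int m) (fst (gmul (R, e) (S, f)))" if "m > 0" for m
      using that by (simp add: cocycle_ycoef ev_add UU UU_add)
  qed (simp add: ycoef_def esum_add)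
qed

lemma Mon_one: "Mon (0, 0) = \<one>\<^bsub>Hh\<^esub>"
  unfolding gexp_0[symmetric] Mon_def by (rule gexp_cong) (simp_all add: ycoef_def)

lemma t_elem_Mon: "t_elem C r q R = Mon (R, 0)"
  unfolding t_elem_eq Mon_def by (rule gexp_cong) (simp_all add: ycoef_def)

lemma Y_tilde_Mon: "Y_tilde C r q j l = Mon (0, frag_of (j, l))"
  unfolding Y_tilde_def Mon_def
  by (subst vertex_eq[OF heis_y_eq], simp) (rule gexp_cong, simp_all add: ycoef_def)

text \<open>The term \<open>tw e e\<close> compensates \<open>tw e (- e)\<close>, which is its
  negative.\<close>

definition ginv :: "ratfun \<times> 'a expo \<Rightarrow> ratfun \<times> 'a expo" where
  "ginv g = (- fst g + tw (snd g) (snd g), - snd g)"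

lemma ginv_GU [simp]: "g \<in> GU \<Longrightarrow> ginv g \<in> GU"
  by (auto simp: GU_def ginv_def intro: UU_add UU_minus UU_diff)

lemma gmul_ginv: "gmul g (ginv g) = (0, 0)" "gmul (ginv g) g = (0, 0)"
  by (cases g; simp add: ginv_def tw_minus)+

lemma inv_Mon: "g \<in> GU \<Longrightarrow> inv\<^bsub>Hh\<^esub> Mon g = Mon (ginv g)"
  by (rule HhS.inv_char) (simp_all add: Mon_mult gmul_ginv Mon_one)

text \<open>a_i[m] is the combination of the y_j[m] with coefficients C(q^m)_ji, so \<open>e\<close>
  lists the exponents in column \<open>i\<close> of C(z). The first component is 0 because both
  sides are normally ordered.\<close>

lemma A_tilde_Mon: "\<exists>e. A_tilde C r q i l = Mon (0, e)"
proof -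
  define e :: "'a expo" where "e = frag_of (i, l + int (r i)) + frag_of (i, l - int (r i)) 
     - (\<Sum>j\<in>UNIV - {i}. \<Sum>k\<in>exps j i. frag_of (j, l + k))"
  have y: "ycoef e b m = q powi (l * m) * of_bool (b = i)" if m: "m \<noteq> 0" for b m
  proof -
    have p: "q powi ((l + k) * m) = q powi (l * m) * q powi (k * m)" for k
      by (simp flip: power_int_add add: algebra_simps)
    have "ycoef e b m = q powi ((l + int (r i)) * m) * ev m (Ct $ b $ i) + q powi ((l + - int (r i)) * m) * ev m (Ct $ b $ i)
      - (\<Sum>j\<in>UNIV - {i}. \<Sum>k\<in>exps j i. q powi ((l + k) * m) * ev m (Ct $ b $ j))"
      by (simp add: ycoef_def e_def esum_add esum_diff esum_sum)
    also have "\<dots> = q powi (l * m) * (ev m (Ct $ b $ i) * (q powi (int (r i) * m) + q powi (- int (r i) * m))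
       - (\<Sum>j\<in>UNIV - {i}. ev m (Ct $ b $ j) * (\<Sum>k\<in>exps j i. q powi (k * m))))"
      unfolding p by (simp add: algebra_simps sum_distrib_left)
    also have "ev m (Ct $ b $ i) * (q powi (int (r i) * m) + q powi (- int (r i) * m)) = ev m (Ct $ b $ i) * ev m (Cz C r $ i $ i)"
      using m by (simp add: Cz_entry ev_add ev_zvar_powi)
    also have "(\<Sum>j\<in>UNIV - {i}. ev m (Ct $ b $ j) * (\<Sum>k\<in>exps j i. q powi (k * m))) = - (\<Sum>j\<in>UNIV - {i}. ev m (Ct $ b $ j) * ev m (Cz C r $ j $ i))"
      using m unfolding sum_negf[symmetric] by (intro sum.cong) (auto simp: Cz_entry ev_minus UU_sum ev_sum ev_zvar_powi)
    also have "ev m (Ct $ b $ i) * ev m (Cz C r $ i $ i) - - (\<Sum>j\<in>UNIV - {i}. ev m (Ct $ b $ j) * ev m (Cz C r $ j $ i))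
       = (\<Sum>j\<in>UNIV. ev m (Ct $ b $ j) * ev m (Cz C r $ j $ i))"
      by (simp add: sum.remove[of UNIV i])
    finally show ?thesis by (simp add: ev_Ct_Cz[OF m])
  qed
  have "A_tilde C r q i l = Mon (0, e)"
    unfolding A_tilde_def Mon_def
    by (subst vertex_eq[OF heis_a_eq], simp) (rule gexp_cong, simp_all add: y)
  then show ?thesis by blast
qed

text \<open>An exponent as a vector of Laurent polynomials, from which \<open>zcoeff_ypol\<close>
  recovers it; so two distinct exponents differ at q^(2M) for almost all M.\<close>

definition ypol :: "'a expo \<Rightarrow> 'a \<Rightarrow> ratfun" where
  "ypol e j = esum e (\<lambda>(i, l). of_bool (i = j) * zvar powi l)"

lemma ypol_UU [simp]: "ypol e j \<in> \<UU>"
  unfolding ypol_def by (rule esum_UU) (auto split: prod.split)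

lemma ev_ypol: "m \<noteq> 0 \<Longrightarrow> ev m (ypol e j) = esum e (\<lambda>p. of_bool (fst p = j) * q powi (snd p * m))"
proof -
  assume m: "m \<noteq> 0"
  have "ypol e j = esum e (\<lambda>p. if fst p = j then zvar powi snd p else 0)"
    unfolding ypol_def split_def by (intro arg_cong[of _ _ "esum e"] ext) simp
  moreover have "ev m (esum e (\<lambda>p. if fst p = j then zvar powi snd p else 0)) =
      esum e (\<lambda>p. ev m (if fst p = j then zvar powi snd p else 0))"
    by (rule ev_esum[OF m]) simp
  moreover have "ev m (if fst p = j then zvar powi snd p else 0) = of_bool (fst p = j) * q powi (snd p * m)" for p
    using m by (simp add: ev_zvar_powi)
  ultimately show ?thesis by simp
qed

lemma zcoeff_ypol: "zcoeff l (ypol e j) = Poly_Mapping.lookup e (j, l)"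
proof (rule frag_induction[of e UNIV])
  show "zcoeff l (ypol 0 j) = Poly_Mapping.lookup 0 (j, l)"
    using zcoeff_of_int[of l 0] by (simp add: ypol_def)
  show "zcoeff l (ypol (frag_of p) j) = Poly_Mapping.lookup (frag_of p) (j, l)" for p
    using zcoeff_of_int[of l 0] zcoeff_shift[of 1 l "snd p"] zcoeff_of_int[of "l - snd p" 1]
    by (cases p) (auto simp: ypol_def lookup_single when_def)
  show "zcoeff l (ypol (a - b) j) = Poly_Mapping.lookup (a - b) (j, l)"
    if "zcoeff l (ypol a j) = Poly_Mapping.lookup a (j, l)" "zcoeff l (ypol b j) = Poly_Mapping.lookup b (j, l)" for a b
  proof -
    have "ypol (a - b) j = ypol a j - ypol b j" by (simp add: ypol_def esum_diff)
    then show ?thesis using that by (simp add: zcoeff_diff lookup_minus)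
  qed
qed simp

lemma finite_ev_zero: "R \<in> \<UU> \<Longrightarrow> R \<noteq> 0 \<Longrightarrow> finite {m::nat. ev (int m) R = 0}"
  using finite_zeros_on_powers[of R q] q_not_root by (simp add: ev_def power_int_of_nat)

text \<open>If two distinct labels are not separated by M, a fixed nonzero element of \<UU> vanishes
  at q^M or at q^(2M); each pair thus excludes finitely many M.\<close>

lemma separating_index:
  assumes "finite A" "A \<subseteq> GU"
  shows "\<exists>M>0. \<forall>g\<in>A. \<forall>h\<in>A. g \<noteq> h \<longrightarrow> ev (int M) (fst g) \<noteq> ev (int M) (fst h) \<or>
    (\<lambda>j. ev (2 * int M) (ypol (snd g) j)) \<noteq> (\<lambda>j. ev (2 * int M) (ypol (snd h) j))"
proof -
  define bad where "bad = (\<lambda>(g, h). {M::nat. ev (int M) (fst g) = ev (int M) (fst h) \<and>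
    (\<lambda>j. ev (2 * int M) (ypol (snd g) j)) = (\<lambda>j. ev (2 * int M) (ypol (snd h) j))} - {0})"
  have "finite (bad (g, h))" if "g \<in> A" "h \<in> A" "g \<noteq> h" for g h
  proof (cases "fst g = fst h")
    case False
    have UU: "fst g \<in> \<UU>" "fst h \<in> \<UU>" using that assms(2) by (auto simp: GU_def)
    have "finite {M::nat. ev (int M) (fst g - fst h) = 0}"
      using False UU by (intro finite_ev_zero UU_diff) auto
    moreover have "bad (g, h) \<subseteq> {M::nat. ev (int M) (fst g - fst h) = 0}"
      using UU by (auto simp: bad_def ev_diff)
    ultimately show ?thesis by (rule finite_subset[rotated])
  next
    case True
    then have "snd g \<noteq> snd h" using that(3) by (simp add: prod_eq_iff)
    then obtain p where "Poly_Mapping.lookup (snd g) p \<noteq> Poly_Mapping.lookup (snd h) p" by (meson poly_mapping_eqI)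
    then have "ypol (snd g) (fst p) \<noteq> ypol (snd h) (fst p)"
      using zcoeff_ypol[of "snd p" _ "fst p"] by (metis prod.collapse)
    then have "finite {m::nat. ev (int m) (ypol (snd g) (fst p) - ypol (snd h) (fst p)) = 0}"
      by (intro finite_ev_zero UU_diff) auto
    then have "finite ((\<lambda>M. 2 * M) -` {m::nat. ev (int m) (ypol (snd g) (fst p) - ypol (snd h) (fst p)) = 0})"
      by (rule finite_vimageI) (simp add: inj_def)
    moreover have "bad (g, h) \<subseteq> (\<lambda>M. 2 * M) -` {m::nat. ev (int m) (ypol (snd g) (fst p) - ypol (snd h) (fst p)) = 0}"
    proof
      fix M assume "M \<in> bad (g, h)"
      then have "M > 0" and e: "(\<lambda>j. ev (2 * int M) (ypol (snd g) j)) = (\<lambda>j. ev (2 * int M) (ypol (snd h) j))"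
        by (auto simp: bad_def)
      then show "M \<in> (\<lambda>M. 2 * M) -` {m::nat. ev (int m) (ypol (snd g) (fst p) - ypol (snd h) (fst p)) = 0}"
        using fun_cong[OF e, of "fst p"] by (simp add: ev_diff)
    qed
    ultimately show ?thesis by (rule finite_subset[rotated])
  qed
  moreover have "finite {(g, h) \<in> A \<times> A. g \<noteq> h}" 
    by (rule finite_subset[of _ "A \<times> A"]) (use assms(1) in auto)
  ultimately have "finite (\<Union>x\<in>{(g, h) \<in> A \<times> A. g \<noteq> h}. bad x)"
    by (intro finite_UN_I) auto
  then have fin: "finite (insert 0 (\<Union>x\<in>{(g, h) \<in> A \<times> A. g \<noteq> h}. bad x))" by (rule finite.insertI)
  obtain M where M: "M \<notin> insert 0 (\<Union>x\<in>{(g, h) \<in> A \<times> A. g \<noteq> h}. bad x)"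
    by (rule exE[OF ex_new_if_finite[OF infinite_UNIV_nat fin]])
  from M have M0: "M \<noteq> 0" by (rule contrapos_nn) (simp only: insertI1)
  have Mb: "M \<notin> bad x" if "x \<in> {(g, h) \<in> A \<times> A. g \<noteq> h}" for x
    using M by (rule contrapos_nn) (rule insertI2, rule UN_I[OF that])
  show ?thesis
  proof (intro exI[of _ M] conjI ballI impI)
    show "M > 0" using M0 by simp
    fix g h assume "g \<in> A" "h \<in> A" "g \<noteq> h"
    then have "M \<notin> bad (g, h)" by (intro Mb) simp
    then show "ev (int M) (fst g) \<noteq> ev (int M) (fst h) \<or>
      (\<lambda>j. ev (2 * int M) (ypol (snd g) j)) \<noteq> (\<lambda>j. ev (2 * int M) (ypol (snd h) j))"
      using M0 unfolding bad_def prod.case by blast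
  qed
qed

text \<open>
  The functionals of the Fock modules take the monomial with label \<open>(R, e)\<close> to the powers of a number
  which, for a suitable module, determines the label among finitely many given ones.
\<close>

theorem Mon_independent:
  assumes A: "finite A" "A \<subseteq> GU" and zero: "(\<Oplus>\<^bsub>Hh\<^esub>g\<in>A. HS.ps_const (sc (c g)) \<otimes>\<^bsub>Hh\<^esub> Mon g) = \<zero>\<^bsub>Hh\<^esub>" and g: "g \<in> A"
  shows "c g = 0"
proof -
  obtain M where M: "M > 0" "\<And>g h. g \<in> A \<Longrightarrow> h \<in> A \<Longrightarrow> g \<noteq> h \<Longrightarrow> ev (int M) (fst g) \<noteq> ev (int M) (fst h) \<or>
    (\<lambda>j. ev (2 * int M) (ypol (snd g) j)) \<noteq> (\<lambda>j. ev (2 * int M) (ypol (snd h) j))"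
    using separating_index[OF A] by blast
  obtain \<eta> where \<eta>: "inj_on (\<lambda>g. ev (int M) (fst g) + (\<Sum>j\<in>UNIV. \<eta> j * ev (2 * int M) (ypol (snd g) j))) A"
    using distinct_evaluation[of A "\<lambda>g. ev (int M) (fst g)" "\<lambda>g j. ev (2 * int M) (ypol (snd g) j)"] A(1) M(2) by blast
  \<comment> \<open>This solves the transposed system: pairing with a column of \<open>Ct\<close> at
    q^(2M) returns the prescribed \<eta>_j.\<close>
  define \<alpha> where "\<alpha> = (\<lambda>i. \<Sum>k\<in>UNIV. ev (2 * int M) (Cz C r $ k $ i) * \<eta> k)"
  interpret F: fock_rep C r q M \<alpha> by unfold_locales (rule M(1))
  have M2: "2 * int M \<noteq> 0" using M(1) by simp
  have inner: "(\<Sum>i\<in>UNIV. ev (2 * int M) (Ct $ i $ j) * \<alpha> i) = \<eta> j" for j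
  proof -
    have "(\<Sum>i\<in>UNIV. ev (2 * int M) (Ct $ i $ j) * \<alpha> i) = 
      (\<Sum>k\<in>UNIV. \<eta> k * (\<Sum>i\<in>UNIV. ev (2 * int M) (Cz C r $ k $ i) * ev (2 * int M) (Ct $ i $ j)))"
      unfolding \<alpha>_def sum_distrib_left by (subst sum.swap) (simp add: mult_ac)
    also have "\<dots> = (\<Sum>k\<in>UNIV. if k = j then \<eta> k else 0)"
      by (intro sum.cong) (auto simp: ev_Cz_Ct[OF M2])
    finally show ?thesis by simp
  qed
  have val: "F.func (Mon g (2 * M * n)) = (ev (int M) (fst g) + (\<Sum>j\<in>UNIV. \<eta> j * ev (2 * int M) (ypol (snd g) j))) ^ n / fact n" for g n
  proof -
    let ?w = "\<lambda>p. q powi (snd p * (2 * int M))"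
    have "(\<Sum>i\<in>UNIV. ycoef (snd g) i (2 * int M) * \<alpha> i) = 
       esum (snd g) (\<lambda>p. \<Sum>i\<in>UNIV. ?w p * ev (2 * int M) (Ct $ i $ fst p) * \<alpha> i)"
      by (simp only: ycoef_def split_def esum_sum_fun esum_mult_right)
    also have "\<dots> = esum (snd g) (\<lambda>p. ?w p * \<eta> (fst p))"
      by (simp only: mult.assoc sum_distrib_left[symmetric] inner)
    also have "\<dots> = esum (snd g) (\<lambda>p. \<Sum>j\<in>UNIV. of_bool (fst p = j) * ?w p * \<eta> j)"
    proof -
      have "(\<Sum>j\<in>UNIV. of_bool (fst p = j) * ?w p * \<eta> j) = (\<Sum>j\<in>UNIV. if fst p = j then ?w p * \<eta> j else 0)" for p
        by (intro sum.cong) auto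
      then show ?thesis by simp
    qed
    also have "\<dots> = (\<Sum>j\<in>UNIV. \<eta> j * ev (2 * int M) (ypol (snd g) j))"
      unfolding esum_sum_fun esum_mult_right ev_ypol[OF M2] by (simp only: mult.commute)
    finally show ?thesis unfolding Mon_def F.func_gexp by simp
  qed
  have "(\<Sum>g\<in>A. c g * (ev (int M) (fst g) + (\<Sum>j\<in>UNIV. \<eta> j * ev (2 * int M) (ypol (snd g) j))) ^ n) = 0" for n
  proof -
    let ?k = "2 * M * n"
    have coeff: "finite B \<Longrightarrow> (\<Oplus>\<^bsub>Hh\<^esub>g\<in>B. HS.ps_const (sc (c g)) \<otimes>\<^bsub>Hh\<^esub> Mon g) k = (\<Oplus>\<^bsub>H\<^esub>g\<in>B. sc (c g) \<otimes>\<^bsub>H\<^esub> Mon g k)" for B k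
    proof (induction B rule: finite_induct)
      case (insert x B)
      have 1: "HS.ps_const (sc (c g)) \<otimes>\<^bsub>Hh\<^esub> Mon g \<in> carrier Hh" for g
        by (intro HhS.m_closed HS.ps_const_closed HS.sc_closed Mon_closed)
      have 2: "sc (c g) \<otimes>\<^bsub>H\<^esub> Mon g k \<in> carrier H" for g
        by (intro HS.m_closed HS.sc_closed HS.ps_coeff Mon_closed)
      have "(\<Oplus>\<^bsub>Hh\<^esub>g\<in>insert x B. HS.ps_const (sc (c g)) \<otimes>\<^bsub>Hh\<^esub> Mon g) =
        HS.ps_const (sc (c x)) \<otimes>\<^bsub>Hh\<^esub> Mon x \<oplus>\<^bsub>Hh\<^esub> (\<Oplus>\<^bsub>Hh\<^esub>g\<in>B. HS.ps_const (sc (c g)) \<otimes>\<^bsub>Hh\<^esub> Mon g)"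
        by (rule HhS.finsum_insert[OF insert.hyps]) (rule Pi_I, rule 1, rule 1)
      moreover have "(\<Oplus>\<^bsub>H\<^esub>g\<in>insert x B. sc (c g) \<otimes>\<^bsub>H\<^esub> Mon g k) =
        sc (c x) \<otimes>\<^bsub>H\<^esub> Mon x k \<oplus>\<^bsub>H\<^esub> (\<Oplus>\<^bsub>H\<^esub>g\<in>B. sc (c g) \<otimes>\<^bsub>H\<^esub> Mon g k)"
        by (rule HS.finsum_insert[OF insert.hyps]) (rule Pi_I, rule 2, rule 2)
      moreover have "(f \<oplus>\<^bsub>Hh\<^esub> g) k = f k \<oplus>\<^bsub>H\<^esub> g k" for f g by (simp add: HS.ps_add)
      moreover have "(HS.ps_const (sc (c x)) \<otimes>\<^bsub>Hh\<^esub> Mon x) k = sc (c x) \<otimes>\<^bsub>H\<^esub> Mon x k"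
        by (rule HS.ps_const_mult[OF HS.sc_closed Mon_closed])
      ultimately show ?case by (simp only: insert.IH)
    qed (simp add: HS.ps_zero)
    have "0 = F.func ((\<Oplus>\<^bsub>Hh\<^esub>g\<in>A. HS.ps_const (sc (c g)) \<otimes>\<^bsub>Hh\<^esub> Mon g) ?k)"
      unfolding zero by (simp add: HS.ps_zero F.func_0)
    also have "\<dots> = (\<Sum>g\<in>A. F.func (sc (c g) \<otimes>\<^bsub>H\<^esub> Mon g ?k))"
      unfolding coeff[OF A(1)]
      by (rule F.func_finsum[OF A(1)]) (intro HS.m_closed HS.sc_closed HS.ps_coeff Mon_closed)
    also have "\<dots> = (\<Sum>g\<in>A. c g * (ev (int M) (fst g) + (\<Sum>j\<in>UNIV. \<eta> j * ev (2 * int M) (ypol (snd g) j))) ^ n) / fact n"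
      by (simp add: F.func_sc HS.ps_coeff val sum_divide_distrib)
    finally show ?thesis by simp
  qed
  from power_sums_zero[OF A(1) \<eta> this g] show ?thesis .
qed

end

section \<open>The algebras of integral combinations of monomials\<close>

context scalar_ring
begin

text \<open>Integral combinations are indexed by the free abelian group on the labels, on which maps
  of labels act through \<open>push\<close>.\<close>

definition zcomb :: "('k \<Rightarrow> 'a) \<Rightarrow> ('k \<Rightarrow>\<^sub>0 int) \<Rightarrow> 'a" where
  "zcomb f n = (\<Oplus>k\<in>Poly_Mapping.keys n. sc (of_int (Poly_Mapping.lookup n k)) \<otimes> f k)"

context
  fixes f :: "'k \<Rightarrow> 'a"
  assumes f: "\<And>k. f k \<in> carrier R"
begin

lemma zcomb_closed: "zcomb f n \<in> carrier R"
  unfolding zcomb_def by (rule finsum_closed) (simp add: f)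

lemma zcomb_superset:
  assumes "finite S" "Poly_Mapping.keys n \<subseteq> S"
  shows "zcomb f n = (\<Oplus>k\<in>S. sc (of_int (Poly_Mapping.lookup n k)) \<otimes> f k)"
  unfolding zcomb_def using assms
  by (intro add.finprod_mono_neutral_cong_left) (auto simp: in_keys_iff sc_0 f)

lemma zcomb_0: "zcomb f 0 = \<zero>"
  by (simp add: zcomb_def)

lemma zcomb_frag_of: "zcomb f (frag_of k) = f k"
  by (simp add: zcomb_def sc_1 f)

lemma zcomb_add: "zcomb f (m + n) = zcomb f m \<oplus> zcomb f n"
proof -
  let ?S = "Poly_Mapping.keys m \<union> Poly_Mapping.keys n"
  have "zcomb f (m + n) = (\<Oplus>k\<in>?S. sc (of_int (Poly_Mapping.lookup (m + n) k)) \<otimes> f k)"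
    using keys_add[of m n] by (intro zcomb_superset) auto
  also have "\<dots> = (\<Oplus>k\<in>?S. sc (of_int (Poly_Mapping.lookup m k)) \<otimes> f k \<oplus> sc (of_int (Poly_Mapping.lookup n k)) \<otimes> f k)"
    by (rule finsum_cong') (simp_all add: lookup_add sc_add l_distr f)
  also have "\<dots> = (\<Oplus>k\<in>?S. sc (of_int (Poly_Mapping.lookup m k)) \<otimes> f k) \<oplus> (\<Oplus>k\<in>?S. sc (of_int (Poly_Mapping.lookup n k)) \<otimes> f k)"
    by (rule finsum_addf) (simp_all add: f)
  also have "\<dots> = zcomb f m \<oplus> zcomb f n"
    by (simp add: zcomb_superset[of ?S])
  finally show ?thesis .
qed

lemma zcomb_minus: "zcomb f (- n) = \<ominus> zcomb f n"
  by (rule minus_equality[symmetric]) (simp_all add: zcomb_add[symmetric] zcomb_0 zcomb_closed)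

lemma zcomb_diff: "zcomb f (m - n) = zcomb f m \<ominus> zcomb f n"
  using zcomb_add[of m "- n"] by (simp add: zcomb_minus minus_eq)

end

lemma zcomb_push:
  assumes "\<And>k. f k \<in> carrier R"
  shows "zcomb f (frag_extend (frag_of \<circ> p) n) = zcomb (f \<circ> p) n"
  using subset_UNIV
proof (induction n rule: frag_induction)
  case (diff a b)
  then show ?case using assms by (simp only: frag_extend_diff zcomb_diff comp_apply)
qed (simp_all add: zcomb_0 zcomb_frag_of assms)

lemma zcomb_cong_on:
  assumes "\<And>k. f k \<in> carrier R" "\<And>k. g k \<in> carrier R" "Poly_Mapping.keys n \<subseteq> S" "\<And>k. k \<in> S \<Longrightarrow> f k = g k"
  shows "zcomb f n = zcomb g n"
  unfolding zcomb_def by (rule finsum_cong') (use assms in auto)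

lemma zcomb_mult_left:
  assumes "\<And>k. f k \<in> carrier R" "a \<in> carrier R"
  shows "a \<otimes> zcomb f n = zcomb (\<lambda>k. a \<otimes> f k) n"
  using subset_UNIV
proof (induction n rule: frag_induction)
  case (diff m n)
  have "a \<otimes> (zcomb f m \<ominus> zcomb f n) = a \<otimes> zcomb f m \<ominus> a \<otimes> zcomb f n"
    by (simp add: minus_eq r_distr r_minus assms zcomb_closed)
  then show ?case using diff by (simp add: zcomb_diff assms)
qed (simp_all add: zcomb_0 zcomb_frag_of assms)

lemma zcomb_mult_right:
  assumes "\<And>k. f k \<in> carrier R" "a \<in> carrier R"
  shows "zcomb f n \<otimes> a = zcomb (\<lambda>k. f k \<otimes> a) n"
  using subset_UNIV
proof (induction n rule: frag_induction)
  case (diff m n)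
  have "(zcomb f m \<ominus> zcomb f n) \<otimes> a = zcomb f m \<otimes> a \<ominus> zcomb f n \<otimes> a"
    by (simp add: minus_eq l_distr l_minus assms zcomb_closed)
  then show ?case using diff by (simp add: zcomb_diff assms)
qed (simp_all add: zcomb_0 zcomb_frag_of assms)

end

abbreviation push :: "('k \<Rightarrow> 'l) \<Rightarrow> ('k \<Rightarrow>\<^sub>0 int) \<Rightarrow> ('l \<Rightarrow>\<^sub>0 int)" where
  "push p \<equiv> frag_extend (frag_of \<circ> p)"

lemma push_push: "push f (push g n) = push (f \<circ> g) n"
  using frag_extend_compose[of "frag_of \<circ> f" g n] by (simp add: comp_assoc)

lemma keys_push: "Poly_Mapping.keys (push p n) \<subseteq> p ` Poly_Mapping.keys n"
  using keys_frag_extend[of "frag_of \<circ> p" n] by auto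

lemma push_cong: "Poly_Mapping.keys n \<subseteq> S \<Longrightarrow> (\<And>k. k \<in> S \<Longrightarrow> f k = g k) \<Longrightarrow> push f n = push g n"
  by (rule frag_extend_eq) auto

context cartan_q
begin

abbreviation Lc :: "(ratfun \<times> 'a expo \<Rightarrow>\<^sub>0 int) \<Rightarrow> nat \<Rightarrow> 'a heis" where
  "Lc \<equiv> HhS.zcomb Mon"

text \<open>Labels are confined to R in \<UU>, where evaluation at q^m is additive and
  \<open>Mon\<close> therefore multiplicative.\<close>

definition GZ :: "(ratfun \<times> 'a expo \<Rightarrow>\<^sub>0 int) set" where
  "GZ = {n. Poly_Mapping.keys n \<subseteq> GU}"

lemma GZ_0: "0 \<in> GZ" and GZ_frag_of: "g \<in> GU \<Longrightarrow> frag_of g \<in> GZ" 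
  and GZ_minus: "n \<in> GZ \<Longrightarrow> - n \<in> GZ" and GZ_add: "m \<in> GZ \<Longrightarrow> n \<in> GZ \<Longrightarrow> m + n \<in> GZ" 
  and GZ_diff: "m \<in> GZ \<Longrightarrow> n \<in> GZ \<Longrightarrow> m - n \<in> GZ"
  using keys_add[of m n] keys_diff[of m n] by (auto simp: GZ_def)

lemma GZ_push: "n \<in> GZ \<Longrightarrow> (\<And>g. g \<in> GU \<Longrightarrow> p g \<in> GU) \<Longrightarrow> push p n \<in> GZ"
  using keys_push[of p n] by (force simp: GZ_def)

lemmas Lc_simps = HhS.zcomb_0[of Mon, OF Mon_closed] HhS.zcomb_frag_of[of Mon, OF Mon_closed] HhS.zcomb_add[of Mon, OF Mon_closed]
  HhS.zcomb_minus[of Mon, OF Mon_closed] HhS.zcomb_diff[of Mon, OF Mon_closed]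

lemma Lc_closed [simp]: "Lc n \<in> carrier Hh"
  by (rule HhS.zcomb_closed) simp

lemma Mon_Lc: "g \<in> GU \<Longrightarrow> n \<in> GZ \<Longrightarrow> Mon g \<otimes>\<^bsub>Hh\<^esub> Lc n = Lc (push (gmul g) n)"
  unfolding HhS.zcomb_mult_left[of Mon, OF Mon_closed Mon_closed] HhS.zcomb_push[of Mon, OF Mon_closed]
  by (rule HhS.zcomb_cong_on[where S = GU]) (auto simp: GZ_def Mon_mult)

lemma Lc_Mon: "g \<in> GU \<Longrightarrow> n \<in> GZ \<Longrightarrow> Lc n \<otimes>\<^bsub>Hh\<^esub> Mon g = Lc (push (\<lambda>h. gmul h g) n)"
  unfolding HhS.zcomb_mult_right[of Mon, OF Mon_closed Mon_closed] HhS.zcomb_push[of Mon, OF Mon_closed]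
  by (rule HhS.zcomb_cong_on[where S = GU]) (auto simp: GZ_def Mon_mult)

text \<open>\<open>Mon_independent\<close> with integral coefficients; through it Y_u is additively
  the free abelian group on the labels.\<close>

lemma Lc_eq_0: 
  assumes "n \<in> GZ" "Lc n = \<zero>\<^bsub>Hh\<^esub>"
  shows "n = 0"
proof -
  have "Poly_Mapping.lookup n g = 0" if "g \<in> Poly_Mapping.keys n" for g
    using Mon_independent[of "Poly_Mapping.keys n" "\<lambda>g. of_int (Poly_Mapping.lookup n g)" g] assms that
    by (simp add: GZ_def HhS.zcomb_def)
  then show ?thesis by (metis in_keys_iff keys_eq_empty equals0I)
qed

lemma Lc_inj: 
  assumes "m \<in> GZ" "n \<in> GZ" "Lc m = Lc n"
  shows "m = n"
proof -
  have "Lc (m - n) = \<zero>\<^bsub>Hh\<^esub>" unfolding Lc_simps assms(3) by (rule HhS.r_right_minus_eq[THEN iffD2]) simp_all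
  then show ?thesis using Lc_eq_0[OF GZ_diff[OF assms(1,2)]] by simp
qed

text \<open>Stated for a general subgroup \<open>J\<close>: \<open>GZ\<close> yields the subring and
  \<open>JZ\<close> the ideal.\<close>

lemma Lc_left_mult_closed:
  assumes "J \<subseteq> GZ" "0 \<in> J" "\<And>m n. m \<in> J \<Longrightarrow> n \<in> J \<Longrightarrow> m - n \<in> J"
    and "\<And>g n. g \<in> GU \<Longrightarrow> n \<in> J \<Longrightarrow> push (gmul g) n \<in> J" and m: "m \<in> GZ" and n: "n \<in> J"
  shows "Lc m \<otimes>\<^bsub>Hh\<^esub> Lc n \<in> Lc ` J"
proof -
  have "Poly_Mapping.keys m \<subseteq> GU" using m by (simp add: GZ_def)
  then show ?thesis
  proof (induction m rule: frag_induction)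
    case zero
    show ?case using assms(2) Lc_simps(1) by (intro image_eqI[of _ _ 0]) (simp_all add: Lc_simps(1))
  next
    case (one g)
    then show ?case using Mon_Lc[OF one, of n] n assms(1,4) by (intro image_eqI[of _ _ "push (gmul g) n"]) (auto simp: Lc_simps)
  next
    case (diff a b)
    then obtain a' b' where e: "a' \<in> J" "b' \<in> J" "Lc a \<otimes>\<^bsub>Hh\<^esub> Lc n = Lc a'" "Lc b \<otimes>\<^bsub>Hh\<^esub> Lc n = Lc b'" by blast
    have "Lc (a - b) \<otimes>\<^bsub>Hh\<^esub> Lc n = Lc (a' - b')"
      unfolding Lc_simps e(3,4)[symmetric] by (simp add: HhS.minus_eq HhS.l_distr HhS.l_minus)
    then show ?case using assms(3)[OF e(1,2)] by (rule image_eqI)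
  qed
qed

lemma Lc_right_mult_closed:
  assumes "J \<subseteq> GZ" "0 \<in> J" "\<And>m n. m \<in> J \<Longrightarrow> n \<in> J \<Longrightarrow> m - n \<in> J"
    and "\<And>g n. g \<in> GU \<Longrightarrow> n \<in> J \<Longrightarrow> push (\<lambda>h. gmul h g) n \<in> J" and m: "m \<in> GZ" and n: "n \<in> J"
  shows "Lc n \<otimes>\<^bsub>Hh\<^esub> Lc m \<in> Lc ` J"
proof -
  have "Poly_Mapping.keys m \<subseteq> GU" using m by (simp add: GZ_def)
  then show ?thesis
  proof (induction m rule: frag_induction)
    case zero
    show ?case using assms(2) by (intro image_eqI[of _ _ 0]) (simp_all add: Lc_simps(1))
  next
    case (one g)
    then show ?case using Lc_Mon[OF one, of n] n assms(1,4) by (intro image_eqI[of _ _ "push (\<lambda>h. gmul h g) n"]) (auto simp: Lc_simps)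
  next
    case (diff a b)
    then obtain a' b' where e: "a' \<in> J" "b' \<in> J" "Lc n \<otimes>\<^bsub>Hh\<^esub> Lc a = Lc a'" "Lc n \<otimes>\<^bsub>Hh\<^esub> Lc b = Lc b'" by blast
    have "Lc n \<otimes>\<^bsub>Hh\<^esub> Lc (a - b) = Lc (a' - b')"
      unfolding Lc_simps e(3,4)[symmetric] by (simp add: HhS.minus_eq HhS.r_distr HhS.r_minus)
    then show ?case using assms(3)[OF e(1,2)] by (rule image_eqI)
  qed
qed

lemma Lc_mult: "m \<in> GZ \<Longrightarrow> n \<in> GZ \<Longrightarrow> Lc m \<otimes>\<^bsub>Hh\<^esub> Lc n \<in> Lc ` GZ"
  by (rule Lc_left_mult_closed) (blast intro: GZ_0 GZ_diff GZ_push gmul_GU)+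

lemma Lc_subring: "subring (Lc ` GZ) Hh"
proof (rule HhS.subringI)
  show "\<one>\<^bsub>Hh\<^esub> \<in> Lc ` GZ"
    by (rule image_eqI[of _ _ "frag_of (0, 0)"]) (simp_all add: Lc_simps Mon_one GZ_frag_of GU_def)
  show "\<ominus>\<^bsub>Hh\<^esub> x \<in> Lc ` GZ" if "x \<in> Lc ` GZ" for x
    using that by (auto simp: Lc_simps(4)[symmetric] intro: GZ_minus)
  show "x \<otimes>\<^bsub>Hh\<^esub> y \<in> Lc ` GZ" if "x \<in> Lc ` GZ" "y \<in> Lc ` GZ" for x y
    using that Lc_mult by blast
  show "x \<oplus>\<^bsub>Hh\<^esub> y \<in> Lc ` GZ" if "x \<in> Lc ` GZ" "y \<in> Lc ` GZ" for x y
    using that by (auto simp: Lc_simps(3)[symmetric] intro: GZ_add)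
qed auto

definition Yu_gens :: "(nat \<Rightarrow> 'a heis) set" where
  "Yu_gens = {Y_tilde C r q i l | i l. True} \<union> {inv\<^bsub>Hh\<^esub> Y_tilde C r q i l | i l. True} \<union>
      {A_tilde C r q i l | i l. True} \<union> {inv\<^bsub>Hh\<^esub> A_tilde C r q i l | i l. True} \<union>
      {t_elem C r q R | R. R \<in> \<UU>}"

lemma Yu_gens_Mon: "x \<in> Yu_gens \<Longrightarrow> \<exists>g\<in>GU. x = Mon g"
proof -
  have GU0: "(0, e) \<in> GU" for e by (simp add: GU_def)
  have A: "\<exists>g\<in>GU. A_tilde C r q i l = Mon g \<and> inv\<^bsub>Hh\<^esub> A_tilde C r q i l = Mon (ginv g)" for i l
    using A_tilde_Mon[of i l] GU0 inv_Mon by metis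
  assume "x \<in> Yu_gens"
  then consider i l where "x = Y_tilde C r q i l" | i l where "x = inv\<^bsub>Hh\<^esub> Y_tilde C r q i l"
    | i l where "x = A_tilde C r q i l" | i l where "x = inv\<^bsub>Hh\<^esub> A_tilde C r q i l" | R where "R \<in> \<UU>" "x = t_elem C r q R"
    unfolding Yu_gens_def by blast
  then show ?thesis
  proof cases
    case 1 then show ?thesis using GU0 Y_tilde_Mon by blast
  next
    case 2 then show ?thesis using GU0 Y_tilde_Mon inv_Mon ginv_GU by metis
  next
    case 3 then show ?thesis using A by blast
  next
    case 4 then show ?thesis using A ginv_GU by metis
  next
    case 5 then show ?thesis using t_elem_Mon by (auto simp: GU_def)
  qed
qed

text \<open>Factors t_R adjust the first component of a label at will, so once every exponent is
  reached, every monomial is, whatever cocycle terms arise on the way.\<close>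

lemma Yu_carrier: "generate_ring Hh Yu_gens = Lc ` GZ"
proof
  have 1: "Yu_gens \<subseteq> carrier Hh" using Yu_gens_Mon by fastforce
  have Mon: "Mon g \<in> Lc ` GZ" if "g \<in> GU" for g
    by (rule image_eqI[of _ _ "frag_of g"]) (simp_all add: Lc_simps GZ_frag_of that)
  then have "Yu_gens \<subseteq> Lc ` GZ" using Yu_gens_Mon by blast
  then show "generate_ring Hh Yu_gens \<subseteq> Lc ` GZ" by (rule HhS.generate_ring_min_subring1[OF 1 Lc_subring])
  let ?Y = "generate_ring Hh Yu_gens"
  have t: "Mon (R, 0) \<in> ?Y" if "R \<in> \<UU>" for R
    unfolding t_elem_Mon[symmetric] using that by (intro generate_ring.incl) (auto simp: Yu_gens_def)
  have shift: "Mon (R, e) \<in> ?Y" if "Mon (S, e) \<in> ?Y" "S \<in> \<UU>" "R \<in> \<UU>" for R S e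
  proof -
    have "Mon (R - S, 0) \<otimes>\<^bsub>Hh\<^esub> Mon (S, e) = Mon (R, e)"
      using that by (subst Mon_mult) (auto simp: GU_def UU_diff)
    then show ?thesis using generate_ring.eng_mult[OF t[of "R - S"] that(1)] that UU_diff by metis
  qed
  have e: "Mon (0, e) \<in> ?Y \<and> Mon (0, - e) \<in> ?Y" for e
    using subset_UNIV
  proof (induction e rule: frag_induction)
    case zero then show ?case using t[of 0] by simp
  next
    case (one p)
    obtain j l where p: "p = (j, l)" by (cases p)
    have "Mon (0, frag_of p) \<in> ?Y" unfolding p Y_tilde_Mon[symmetric] by (rule generate_ring.incl) (auto simp: Yu_gens_def)
    moreover have "Mon (ginv (0, frag_of p)) \<in> ?Y" 
      unfolding p by (subst inv_Mon[symmetric], simp add: GU_def, unfold Y_tilde_Mon[symmetric], rule generate_ring.incl) (auto simp: Yu_gens_def)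
    ultimately show ?case using shift[of _ "- frag_of p" 0] by (auto simp: ginv_def)
  next
    case (diff a b)
    have sub: "Mon (0, x - y) \<in> ?Y" if "Mon (0, x) \<in> ?Y" "Mon (0, - y) \<in> ?Y" for x y
    proof -
      have "Mon (0, x) \<otimes>\<^bsub>Hh\<^esub> Mon (0, - y) = Mon (tw x (- y), x - y)"
        by (subst Mon_mult) (auto simp: GU_def)
      then have "Mon (tw x (- y), x - y) \<in> ?Y" using generate_ring.eng_mult[OF that] by simp
      then show ?thesis by (rule shift) auto
    qed
    have "Mon (0, a - b) \<in> ?Y" using diff by (intro sub) auto
    moreover have "Mon (0, b - a) \<in> ?Y" using diff by (intro sub) auto
    ultimately show ?case by (simp only: minus_diff_eq)
  qed
  have Mon': "Mon g \<in> ?Y" if "g \<in> GU" for g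
    using e[of "snd g"] shift[of 0 "snd g" "fst g"] that by (cases g) (auto simp: GU_def)
  show "Lc ` GZ \<subseteq> ?Y"
  proof
    fix x assume "x \<in> Lc ` GZ"
    then obtain n where n: "x = Lc n" "Poly_Mapping.keys n \<subseteq> GU" by (auto simp: GZ_def)
    from n(2) have "Lc n \<in> ?Y"
    proof (induction n rule: frag_induction)
      case zero then show ?case by (simp add: Lc_simps HhS.zero_in_generate)
    next
      case (one g) then show ?case by (simp add: Lc_simps Mon')
    next
      case (diff a b)
      then show ?case unfolding Lc_simps HhS.minus_eq by (intro generate_ring.eng_add generate_ring.a_inv)
    qed
    then show "x \<in> ?Y" using n(1) by simp
  qed
qed

lemma Yu_eq: "Yu C r q = Hh\<lparr>carrier := Lc ` GZ\<rparr>"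
  unfolding Yu_def Yu_carrier[symmetric] Yu_gens_def ..

lemma Yu_simps: "carrier (Yu C r q) = Lc ` GZ" "x \<otimes>\<^bsub>Yu C r q\<^esub> y = x \<otimes>\<^bsub>Hh\<^esub> y" 
  "x \<oplus>\<^bsub>Yu C r q\<^esub> y = x \<oplus>\<^bsub>Hh\<^esub> y" "\<one>\<^bsub>Yu C r q\<^esub> = \<one>\<^bsub>Hh\<^esub>" "\<zero>\<^bsub>Yu C r q\<^esub> = \<zero>\<^bsub>Hh\<^esub>"
  by (simp_all add: Yu_eq)

sublocale Yu: ring "Yu C r q"
  unfolding Yu_eq by (rule HhS.subring_is_ring[OF Lc_subring])

lemma Yu_diff: 
  assumes "m \<in> GZ" "n \<in> GZ"
  shows "Lc m \<ominus>\<^bsub>Yu C r q\<^esub> Lc n = Lc (m - n)"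
proof -
  have cl: "Lc m \<in> carrier (Yu C r q)" "Lc n \<in> carrier (Yu C r q)" "Lc (m - n) \<in> carrier (Yu C r q)"
    using assms by (auto simp: Yu_simps GZ_diff)
  have "Lc m = Lc (m - n) \<oplus>\<^bsub>Yu C r q\<^esub> Lc n"
    unfolding Yu_simps Lc_simps(3)[symmetric] by simp
  then show ?thesis using cl by (simp add: Yu.minus_eq Yu.a_assoc Yu.r_neg)
qed

section \<open>The quotient by constant terms\<close>

text \<open>What survives of a label in Y_t: the power of t and the exponent.\<close>

definition dg :: "ratfun \<times> 'a expo \<Rightarrow> int \<times> 'a expo" where
  "dg g = (zcoeff 0 (fst g), snd g)"

text \<open>Combinations that cancel after passing to \<open>dg\<close>; their image is an ideal
  bounding the defining ideal of Y_t from above.\<close>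

definition JZ :: "(ratfun \<times> 'a expo \<Rightarrow>\<^sub>0 int) set" where
  "JZ = {n \<in> GZ. push dg n = 0}"

text \<open>The cocycle depends on the exponents alone, so multiplication of labels descends along
  \<open>dg\<close>.\<close>

lemma dg_gmul: "g \<in> GU \<Longrightarrow> h \<in> GU \<Longrightarrow> 
    dg (gmul g h) = (fst (dg g) + fst (dg h) + zcoeff 0 (tw (snd (dg g)) (snd (dg h))), snd (dg g) + snd (dg h))"
  by (cases g; cases h) (auto simp: dg_def GU_def zcoeff_add UU_add)

lemma JZ_GZ: "JZ \<subseteq> GZ" by (auto simp: JZ_def)
lemma JZ_0: "0 \<in> JZ" by (simp add: JZ_def GZ_0)
lemma JZ_diff: "m \<in> JZ \<Longrightarrow> n \<in> JZ \<Longrightarrow> m - n \<in> JZ"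
  by (simp add: JZ_def GZ_diff frag_extend_diff)

lemma JZ_push:
  assumes "n \<in> JZ" "\<And>h. h \<in> GU \<Longrightarrow> p h \<in> GU" "\<And>h. h \<in> GU \<Longrightarrow> dg (p h) = \<rho> (dg h)"
  shows "push p n \<in> JZ"
proof -
  have n: "n \<in> GZ" "push dg n = 0" using assms(1) by (auto simp: JZ_def)
  have "push dg (push p n) = push (\<rho> \<circ> dg) n"
    unfolding push_push using n(1) assms(3) by (intro push_cong[of n GU]) (auto simp: GZ_def)
  also have "\<dots> = 0" unfolding push_push[symmetric] n(2) by simp
  finally show ?thesis using GZ_push[OF n(1) assms(2)] by (simp add: JZ_def)
qed

lemma JZ_gmul: 
  assumes "g \<in> GU" "n \<in> JZ"
  shows "push (gmul g) n \<in> JZ" and "push (\<lambda>h. gmul h g) n \<in> JZ"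
proof -
  show "push (gmul g) n \<in> JZ"
    by (rule JZ_push[where \<rho> = "\<lambda>d. (fst (dg g) + fst d + zcoeff 0 (tw (snd (dg g)) (snd d)), snd (dg g) + snd d)", OF assms(2)])
      (simp_all only: gmul_GU dg_gmul assms(1))
  show "push (\<lambda>h. gmul h g) n \<in> JZ"
    by (rule JZ_push[where \<rho> = "\<lambda>d. (fst d + fst (dg g) + zcoeff 0 (tw (snd d) (snd (dg g))), snd d + snd (dg g))", OF assms(2)])
      (simp_all only: gmul_GU dg_gmul assms(1))
qed

lemma JZ_ideal: "ideal (Lc ` JZ) (Yu C r q)"
proof (rule idealI)
  show "ring (Yu C r q)" by (rule Yu.ring_axioms)
  have closed: "Lc ` JZ \<subseteq> carrier (Yu C r q)" using JZ_GZ by (auto simp: Yu_simps)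
  have diff: "x \<ominus>\<^bsub>Yu C r q\<^esub> y \<in> Lc ` JZ" if "x \<in> Lc ` JZ" "y \<in> Lc ` JZ" for x y
  proof -
    obtain m n where mn: "x = Lc m" "y = Lc n" "m \<in> JZ" "n \<in> JZ" using \<open>x \<in> Lc ` JZ\<close> \<open>y \<in> Lc ` JZ\<close> by blast
    then show ?thesis using Yu_diff[of m n] JZ_GZ JZ_diff by auto
  qed
  have zero: "\<zero>\<^bsub>Yu C r q\<^esub> \<in> Lc ` JZ"
    by (rule image_eqI[OF _ JZ_0]) (simp add: Lc_simps Yu_simps)
  have minus: "\<ominus>\<^bsub>Yu C r q\<^esub> y \<in> Lc ` JZ" if "y \<in> Lc ` JZ" for y
  proof -
    have "y \<in> carrier (Yu C r q)" using that closed by blast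
    then show ?thesis using diff[OF zero that] by (simp add: Yu.minus_eq)
  qed
  have add: "x \<oplus>\<^bsub>Yu C r q\<^esub> y \<in> Lc ` JZ" if "x \<in> Lc ` JZ" "y \<in> Lc ` JZ" for x y
  proof -
    have "y \<in> carrier (Yu C r q)" using that closed by blast
    then show ?thesis using diff[OF that(1) minus[OF that(2)]] by (simp add: Yu.minus_eq)
  qed
  show "subgroup (Lc ` JZ) (add_monoid (Yu C r q))"
  proof (rule Yu.add.subgroupI)
    show "Lc ` JZ \<noteq> {}" using zero by blast
  qed (use closed minus add in \<open>simp_all add: a_inv_def[symmetric]\<close>)
  fix a x assume a: "a \<in> Lc ` JZ" and x: "x \<in> carrier (Yu C r q)"
  then obtain m n where mn: "x = Lc m" "a = Lc n" "m \<in> GZ" "n \<in> JZ" by (auto simp: Yu_simps)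
  show "x \<otimes>\<^bsub>Yu C r q\<^esub> a \<in> Lc ` JZ" unfolding Yu_simps mn(1,2)
    by (rule Lc_left_mult_closed[OF JZ_GZ JZ_0 _ _ mn(3,4)]) (blast intro: JZ_diff JZ_gmul)+
  show "a \<otimes>\<^bsub>Yu C r q\<^esub> x \<in> Lc ` JZ" unfolding Yu_simps mn(1,2)
    by (rule Lc_right_mult_closed[OF JZ_GZ JZ_0 _ _ mn(3,4)]) (blast intro: JZ_diff JZ_gmul)+
qed

abbreviation "Yt_rels \<equiv> {t_elem C r q R \<ominus>\<^bsub>Yu C r q\<^esub> t_elem C r q R' | R R'.
        R \<in> \<UU> \<and> R' \<in> \<UU> \<and> zcoeff 0 R = zcoeff 0 R'}"

lemma Mon_frag: "Mon g = Lc (frag_of g)"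
  by (simp add: Lc_simps)

lemma t_diff:
  assumes "R \<in> \<UU>" "R' \<in> \<UU>"
  shows "t_elem C r q R \<ominus>\<^bsub>Yu C r q\<^esub> t_elem C r q R' = Lc (frag_of (R, 0) - frag_of (R', 0))"
  unfolding t_elem_Mon Mon_frag[of "(R, 0)"] Mon_frag[of "(R', 0)"] using assms by (intro Yu_diff GZ_frag_of) (simp_all add: GU_def)

lemma Yt_rels_JZ: "Yt_rels \<subseteq> Lc ` JZ"
proof
  fix x assume "x \<in> Yt_rels"
  then obtain R R' where R: "x = Lc (frag_of (R, 0) - frag_of (R', 0))" "R \<in> \<UU>" "R' \<in> \<UU>" "zcoeff 0 R = zcoeff 0 R'"
    using t_diff by blast
  have "frag_of (R, 0) - frag_of (R', 0) \<in> JZ"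
    using R by (auto simp: JZ_def frag_extend_diff dg_def GU_def intro!: GZ_diff GZ_frag_of)
  then show "x \<in> Lc ` JZ" using R(1) by blast
qed

sublocale Yti: ideal "Yt_ideal C r q" "Yu C r q"
  unfolding Yt_ideal_def 
  by (rule Yu.genideal_ideal, rule subset_trans[OF Yt_rels_JZ]) (auto simp: Yu_simps JZ_def)

lemma Yt_ideal_JZ: "Yt_ideal C r q \<subseteq> Lc ` JZ"
  unfolding Yt_ideal_def by (rule Yu.genideal_minimal[OF JZ_ideal Yt_rels_JZ])

sublocale Ytc: ring_hom_ring "Yu C r q" "Yt C r q" "Yt_class C r q"
proof -
  have "Yt_class C r q = (+>\<^bsub>Yu C r q\<^esub>) (Yt_ideal C r q)"
    by (rule ext) (simp add: Yt_class_def)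
  then show "ring_hom_ring (Yu C r q) (Yt C r q) (Yt_class C r q)"
    unfolding Yt_def using Yti.rcos_ring_hom_ring by simp
qed

lemma Lc_Yu [simp]: "n \<in> GZ \<Longrightarrow> Lc n \<in> carrier (Yu C r q)"
  by (simp add: Yu_simps)

lemma Mon_Yu [simp]: "g \<in> GU \<Longrightarrow> Mon g \<in> carrier (Yu C r q)"
  unfolding Mon_frag[of g] by (intro Lc_Yu GZ_frag_of)

lemma Yt_zero_iff:
  assumes "x \<in> carrier (Yu C r q)"
  shows "Yt_class C r q x = \<zero>\<^bsub>Yt C r q\<^esub> \<longleftrightarrow> x \<in> Yt_ideal C r q"
proof -
  have "\<zero>\<^bsub>Yt C r q\<^esub> = Yt_ideal C r q" by (simp add: Yt_def FactRing_def)
  then show ?thesis 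
    using assms Yti.rcos_const_imp_mem Yti.a_rcos_const unfolding Yt_class_def by metis
qed

text \<open>Splitting off the factors t_R and t_S reduces the claim to a defining relation of
  \<open>Yt\<close>.\<close>

lemma Yt_class_Mon_eq:
  assumes "g \<in> GU" "h \<in> GU" "dg g = dg h"
  shows "Yt_class C r q (Mon g) = Yt_class C r q (Mon h)"
proof -
  obtain R S e where g: "g = (R, e)" "h = (S, e)" using assms(3) by (cases g; cases h) (auto simp: dg_def)
  have RS: "R \<in> \<UU>" "S \<in> \<UU>" "zcoeff 0 R = zcoeff 0 S" using assms by (auto simp: g GU_def dg_def)
  have t: "Mon (X, 0) \<in> carrier (Yu C r q)" "Mon (0, e) \<in> carrier (Yu C r q)" 
    "Mon (X, e) = Mon (X, 0) \<otimes>\<^bsub>Yu C r q\<^esub> Mon (0, e)" if "X \<in> \<UU>" for X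
    using that by (auto simp: GU_def Yu_simps(2) Mon_mult)
  have "Mon (R, 0) \<ominus>\<^bsub>Yu C r q\<^esub> Mon (S, 0) \<in> Yt_ideal C r q"
    unfolding Yt_ideal_def using RS 
    by (intro set_mp[OF Yu.genideal_self]) (auto simp: t_elem_Mon[symmetric] intro!: subset_trans[OF Yt_rels_JZ] simp: JZ_def)
  then have "Yt_class C r q (Mon (R, 0) \<ominus>\<^bsub>Yu C r q\<^esub> Mon (S, 0)) = \<zero>\<^bsub>Yt C r q\<^esub>"
    using Yt_zero_iff Yti.Icarr by blast
  then have "Yt_class C r q (Mon (R, 0)) \<ominus>\<^bsub>Yt C r q\<^esub> Yt_class C r q (Mon (S, 0)) = \<zero>\<^bsub>Yt C r q\<^esub>"
    using t(1) RS by (simp add: Yu.minus_eq Ytc.S.minus_eq)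
  then have "Yt_class C r q (Mon (R, 0)) = Yt_class C r q (Mon (S, 0))"
    using t(1) RS Ytc.S.r_right_minus_eq Ytc.hom_closed by metis
  then show ?thesis unfolding g t(3)[OF RS(1)] t(3)[OF RS(2)]
    by (simp only: Ytc.hom_mult[OF t(1)[OF RS(1)] t(2)[OF RS(1)]] Ytc.hom_mult[OF t(1)[OF RS(2)] t(2)[OF RS(2)]])
qed

text \<open>Injectivity of \<open>Lc\<close> turns membership in the image of \<open>JZ\<close> into
  a statement about the combination itself.\<close>

lemma Yt_class_Lc_0:
  assumes "n \<in> GZ" "Yt_class C r q (Lc n) = \<zero>\<^bsub>Yt C r q\<^esub>"
  shows "push dg n = 0"
proof -
  have "Lc n \<in> Yt_ideal C r q" by (rule iffD1[OF Yt_zero_iff[OF Lc_Yu[OF assms(1)]] assms(2)])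
  from subsetD[OF Yt_ideal_JZ this] obtain m where m: "Lc n = Lc m" "m \<in> JZ" by (rule imageE)
  have "n = m" by (rule Lc_inj[OF assms(1) subsetD[OF JZ_GZ m(2)] m(1)])
  then show ?thesis using m(2) by (simp add: JZ_def)
qed

end

section \<open>The isomorphism\<close>

context cartan_q
begin

sublocale YP: presentation "UNIV :: 'a yt_letter set" "yt_relations C r"
  by unfold_locales (simp add: mem_free_algebra subsetI)

fun lg :: "'a yt_letter \<Rightarrow> ratfun \<times> 'a expo" where
  "lg (LY i l) = (0, frag_of (i, l))" | "lg (LYinv i l) = ginv (0, frag_of (i, l))"
| "lg LT = (-1, 0)" | "lg LTinv = (1, 0)"

fun gw :: "'a yt_letter list \<Rightarrow> ratfun \<times> 'a expo" where
  "gw [] = (0, 0)" | "gw (g # w) = gmul (lg g) (gw w)"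

lemma lg_GU [simp]: "lg g \<in> GU"
  by (cases g) (simp_all add: GU_def ginv_def UU_minus)

lemma gw_GU [simp]: "gw w \<in> GU"
proof (induction w)
  case Nil then show ?case by (simp add: GU_def)
qed (simp del: gmul.simps)

lemma gmul_assoc: "gmul (gmul x y) z = gmul x (gmul y z)"
  by (cases x; cases y; cases z) (simp add: tw_add algebra_simps)

lemma gmul_0 [simp]: "gmul (0, 0) x = x"
  by (cases x) simp

lemma gmul_central: "gmul (S, 0) x = gmul x (S, 0)"
  by (cases x) (simp add: add.commute)

lemma gw_append: "gw (u @ v) = gmul (gw u) (gw v)"
  by (induction u) (simp_all only: append.simps gw.simps gmul_0 gmul_assoc)

lemma snd_gmul: "snd (gmul x y) = snd x + snd y"
  by (cases x; cases y) simp

lemma snd_gw: "snd (gw w) = ex w"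
proof (induction w)
  case (Cons g w)
  have "snd (lg g) = ex_letter g" by (cases g) (simp_all add: ginv_def)
  then show ?case using Cons by (simp add: snd_gmul del: gmul.simps)
qed simp

lemma gw_T: "T_word \<tau> \<Longrightarrow> gw (\<tau> @ w) = (fst (gw w) - of_int (tdeg \<tau>), snd (gw w))"
proof (induction \<tau>)
  case (Cons g \<tau>)
  then have "g = LT \<or> g = LTinv" "T_word \<tau>" by (auto simp: T_word_def)
  then show ?case using Cons.IH by auto
qed simp

definition wd :: "'a yt_letter word \<Rightarrow> int \<times> 'a expo" where
  "wd w = dg (gw (letters w))"

lemma wd_T: "T_word \<tau> \<Longrightarrow> wd (Word (\<tau> @ w)) = (fst (wd (Word w)) - tdeg \<tau>, snd (wd (Word w)))"
  using gw_GU[of w] zcoeff_of_int[of 0 "tdeg \<tau>"] 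
  by (simp add: wd_def gw_T dg_def zcoeff_diff GU_def mem_Times_iff)

definition hh :: "('a yt_letter word \<Rightarrow>\<^sub>0 int) \<Rightarrow> (ratfun \<times> 'a expo \<Rightarrow>\<^sub>0 int)" where
  "hh = push (gw \<circ> letters)"

lemma hh_GZ [simp]: "hh x \<in> GZ"
  using keys_push[of "gw \<circ> letters" x] by (auto simp: hh_def GZ_def)

lemma push_dg_hh: "push dg (hh x) = push wd x"
  unfolding hh_def push_push by (simp add: wd_def comp_def)

definition hY :: "('a yt_letter word \<Rightarrow>\<^sub>0 int) \<Rightarrow> (nat \<Rightarrow> 'a heis) set" where
  "hY x = Yt_class C r q (Lc (hh x))"

lemma hY_word: "hY (Poly_Mapping.single w 1) = Yt_class C r q (Mon (gw (letters w)))"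
  by (simp add: hY_def hh_def Lc_simps)

lemma hY_closed [simp]: "hY x \<in> carrier (Yt C r q)"
  unfolding hY_def by (intro Ytc.hom_closed Lc_Yu hh_GZ)

lemma hY_add: "hY (x + y) = hY x \<oplus>\<^bsub>Yt C r q\<^esub> hY y"
proof -
  have "Lc (hh (x + y)) = Lc (hh x) \<oplus>\<^bsub>Yu C r q\<^esub> Lc (hh y)"
    by (simp add: hh_def frag_extend_add Lc_simps Yu_simps)
  then show ?thesis unfolding hY_def by (simp only: Ytc.hom_add Lc_Yu hh_GZ)
qed

lemma hY_0: "hY 0 = \<zero>\<^bsub>Yt C r q\<^esub>"
proof -
  have "Lc (hh 0) = \<zero>\<^bsub>Yu C r q\<^esub>" by (simp add: hh_def Lc_simps Yu_simps)
  then show ?thesis unfolding hY_def by (simp only: Ytc.hom_zero)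
qed

lemma hY_minus: "hY (- x) = \<ominus>\<^bsub>Yt C r q\<^esub> hY x"
  by (rule Ytc.S.minus_equality[symmetric]) (simp_all add: hY_add[symmetric] hY_0)

lemma hY_diff: "hY (x - y) = hY x \<ominus>\<^bsub>Yt C r q\<^esub> hY y"
  using hY_add[of x "- y"] by (simp add: hY_minus Ytc.S.minus_eq)

lemma hY_1: "hY 1 = \<one>\<^bsub>Yt C r q\<^esub>"
proof -
  have "hY 1 = hY (Poly_Mapping.single 0 1)" by simp
  also have "\<dots> = Yt_class C r q \<one>\<^bsub>Yu C r q\<^esub>"
    unfolding hY_word by (simp only: zero_word_def word.sel gw.simps Mon_one Yu_simps)
  finally show ?thesis by (simp only: Ytc.hom_one)
qed

lemma hY_mult_word: "hY (Poly_Mapping.single u 1 * Poly_Mapping.single v 1) = hY (Poly_Mapping.single u 1) \<otimes>\<^bsub>Yt C r q\<^esub> hY (Poly_Mapping.single v 1)"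
proof -
  have "letters (u + v) = letters u @ letters v" by (simp add: plus_word_def)
  then have "Mon (gw (letters (u + v))) = Mon (gw (letters u)) \<otimes>\<^bsub>Yu C r q\<^esub> Mon (gw (letters v))"
    by (simp only: gw_append Mon_mult gw_GU Yu_simps)
  then show ?thesis
    by (simp only: mult_single mult_1 hY_word Ytc.hom_mult Mon_Yu gw_GU)
qed

lemma hY_mult: "hY (x * y) = hY x \<otimes>\<^bsub>Yt C r q\<^esub> hY y"
  using subset_UNIV
proof (induction x rule: frag_induction)
  case (one u)
  show ?case using subset_UNIV
  proof (induction y rule: frag_induction)
    case (diff a b)
    then show ?case
      by (simp add: right_diff_distrib hY_diff Ytc.S.minus_eq Ytc.S.r_distr Ytc.S.r_minus)
  qed (simp_all add: hY_mult_word[simplified] hY_0)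
next
  case (diff a b)
  then show ?case
    by (simp add: left_diff_distrib hY_diff Ytc.S.minus_eq Ytc.S.l_distr Ytc.S.l_minus)
qed (simp add: hY_0)

sublocale hY: ring_hom_ring YP.FA "Yt C r q" hY
  by (rule ring_hom_ringI2[OF YP.FA.ring_axioms Ytc.S.ring_axioms], rule ring_hom_memI)
    (simp_all add: free_algebra_simps hY_mult hY_add hY_1)

lemma hY_word_eq: "wd (Word u) = wd (Word v) \<Longrightarrow> hY (Poly_Mapping.single (Word u) 1) = hY (Poly_Mapping.single (Word v) 1)"
  unfolding hY_word by (rule Yt_class_Mon_eq) (simp_all add: wd_def)

lemma hY_eq_0_wd: "hY x = \<zero>\<^bsub>Yt C r q\<^esub> \<Longrightarrow> push wd x = 0"
  unfolding hY_def using Yt_class_Lc_0[OF hh_GZ] by (simp add: push_dg_hh)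

text \<open>By \<open>comm_fun_sym\<close> the two cocycle values differ by (z^(l-k) - z^(k-l))
  times \<open>comm_fun i j\<close>, whose constant term is - \<gamma> by
  \<open>gamma_eq\<close>.\<close>

lemma wd_commute_Y:
  "wd (Word [LY i l, LY j k]) = (\<gamma>', e) \<Longrightarrow> wd (Word [LY j k, LY i l]) = (\<gamma>' + \<gamma> C r i l j k, e)"
proof -
  have "tw (frag_of (i, l)) (frag_of (j, k)) - tw (frag_of (j, k)) (frag_of (i, l)) = 
    (zvar powi (l - k) - zvar powi (k - l)) * comm_fun i j"
    unfolding tw_def by (simp add: comm_fun_sym[of j i] algebra_simps)
  then have "\<gamma> C r i l j k = zcoeff 0 (tw (frag_of (j, k)) (frag_of (i, l))) - zcoeff 0 (tw (frag_of (i, l)) (frag_of (j, k)))"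
    unfolding gamma_eq by (metis minus_diff_eq tw_UU zcoeff_diff)
  then show "wd (Word [LY i l, LY j k]) = (\<gamma>', e) \<Longrightarrow> wd (Word [LY j k, LY i l]) = (\<gamma>' + \<gamma> C r i l j k, e)"
    by (auto simp: wd_def dg_def add.commute)
qed

lemma hY_relation: "x \<in> yt_relations C r \<Longrightarrow> hY x = \<zero>\<^bsub>Yt C r q\<^esub>"
proof -
  have diff0: "hY (Poly_Mapping.single (Word u) 1 - Poly_Mapping.single (Word v) 1) = \<zero>\<^bsub>Yt C r q\<^esub>" if "wd (Word u) = wd (Word v)" for u v
    unfolding hY_diff hY_word_eq[OF that] by (rule Ytc.S.r_right_minus_eq[THEN iffD2]) simp_all
  have one: "(1 :: 'a yt_letter word \<Rightarrow>\<^sub>0 int) = Poly_Mapping.single (Word []) 1" by (simp add: zero_word_def[symmetric])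
  have w2: "letter g * letter h = Poly_Mapping.single (Word [g, h]) (1 :: int)" for g h :: "'a yt_letter"
    by (simp add: letter_def mult_single plus_word_def)
  have inv: "wd (Word [LY i l, LYinv i l]) = wd (Word [])" "wd (Word [LYinv i l, LY i l]) = wd (Word [])" for i l
    by (simp_all add: wd_def ginv_def tw_minus)
  have T: "wd (Word [LT, LTinv]) = wd (Word [])" "wd (Word [LTinv, LT]) = wd (Word [])" by (simp_all add: wd_def)
  have Tc: "wd (Word [LT, g]) = wd (Word [g, LT])" "wd (Word [LTinv, g]) = wd (Word [g, LTinv])" for g
    by (simp_all only: wd_def word.sel gw.simps lg.simps gmul_central[of _ "gmul (lg g) (0, 0)"] gmul_assoc gmul_central[of _ "(0, 0)"])
  assume "x \<in> yt_relations C r"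
  then consider i l where "x = letter (LY i l) * letter (LYinv i l) - 1" | i l where "x = letter (LYinv i l) * letter (LY i l) - 1"
    | "x = letter LT * letter LTinv - 1" | "x = letter LTinv * letter LT - 1"
    | g where "x = letter LT * letter g - letter g * letter LT" | g where "x = letter LTinv * letter g - letter g * letter LTinv"
    | i l j k where "x = letter (LY i l) * letter (LY j k) - LT_power (\<gamma> C r i l j k) * letter (LY j k) * letter (LY i l)"
    unfolding yt_relations_def by blast
  then show ?thesis
  proof cases
    case (7 i l j k)
    define \<tau> :: "'a yt_letter list" where "\<tau> = (if \<gamma> C r i l j k \<ge> 0 then replicate (nat (\<gamma> C r i l j k)) LT else replicate (nat (- \<gamma> C r i l j k)) LTinv)"
    have deg: "tdeg (replicate n LT) = int n" "tdeg (replicate n LTinv) = - int n" for n :: nat by (induction n) auto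
    have \<tau>: "T_word \<tau>" "tdeg \<tau> = \<gamma> C r i l j k" by (auto simp: \<tau>_def T_word_def deg)
    obtain a e where ae: "wd (Word [LY i l, LY j k]) = (a, e)" by (cases "wd (Word [LY i l, LY j k])")
    have "wd (Word [LY i l, LY j k]) = wd (Word (\<tau> @ [LY j k, LY i l]))"
      unfolding wd_T[OF \<tau>(1)] wd_commute_Y[OF ae] by (simp add: ae \<tau>(2))
    then show ?thesis unfolding 7 LT_power_word \<tau>_def[symmetric] mult.assoc w2 
      by (simp only: word_mult_single mult_1 diff0)
  next
    case (1 i l) show ?thesis unfolding 1 w2 one by (rule diff0[OF inv(1)])
  next
    case (2 i l) show ?thesis unfolding 2 w2 one by (rule diff0[OF inv(2)])
  next
    case 3 show ?thesis unfolding 3 w2 one by (rule diff0[OF T(1)])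
  next
    case 4 show ?thesis unfolding 4 w2 one by (rule diff0[OF T(2)])
  next
    case (5 g) show ?thesis unfolding 5 w2 by (rule diff0[OF Tc(1)])
  next
    case (6 g) show ?thesis unfolding 6 w2 by (rule diff0[OF Tc(2)])
  qed
qed

lemma hY_kernel_iff: "x \<in> a_kernel YP.FA (Yt C r q) hY \<longleftrightarrow> hY x = \<zero>\<^bsub>Yt C r q\<^esub>"
  by (simp only: a_kernel_def' mem_Collect_eq FA_UNIV simp_thms)

lemma RI_hY: "x \<in> YP.RI \<Longrightarrow> hY x = \<zero>\<^bsub>Yt C r q\<^esub>"
proof -
  have "yt_relations C r \<subseteq> a_kernel YP.FA (Yt C r q) hY"
    by (rule subsetI) (rule hY_kernel_iff[THEN iffD2, OF hY_relation])
  then have "YP.RI \<subseteq> a_kernel YP.FA (Yt C r q) hY"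
    by (rule YP.FA.genideal_minimal[OF hY.kernel_is_ideal])
  then show "x \<in> YP.RI \<Longrightarrow> hY x = \<zero>\<^bsub>Yt C r q\<^esub>"
    by (rule hY_kernel_iff[THEN iffD1, OF subsetD])
qed

text \<open>\<open>same_exponent_words\<close> leaves an unknown word \<tau> in t. The homomorphism
  \<open>hY\<close> shows that its degree is 0, and then \<tau> represents 1.\<close>

lemma same_wd: 
  assumes "wd u = wd v"
  shows "Poly_Mapping.single u 1 - Poly_Mapping.single v 1 \<in> YP.RI"
proof -
  obtain a b where ab: "u = Word a" "v = Word b" by (metis word.collapse)
  have "ex a = ex b" using assms by (simp add: ab wd_def dg_def snd_gw)
  then obtain \<tau> where \<tau>: "T_word \<tau>" "wc C r a = wc C r (\<tau> @ b)" using same_exponent_words by blast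
  then have "Poly_Mapping.single (Word a) 1 - Poly_Mapping.single (Word (\<tau> @ b)) 1 \<in> YP.RI"
    unfolding wc_def by (subst YP.cls_eq_iff[symmetric]) simp_all
  then have "hY (Poly_Mapping.single (Word a) 1 - Poly_Mapping.single (Word (\<tau> @ b)) 1) = \<zero>\<^bsub>Yt C r q\<^esub>" by (rule RI_hY)
  then have "push wd (frag_of (Word a) - frag_of (Word (\<tau> @ b))) = 0" by (rule hY_eq_0_wd)
  then have "frag_of (wd (Word a)) = frag_of (wd (Word (\<tau> @ b)))" by (simp add: frag_extend_diff)
  then have "wd (Word a) = wd (Word (\<tau> @ b))" by (simp add: frag_of_eq)
  then have "tdeg \<tau> = 0" using assms by (simp add: ab wd_T[OF \<tau>(1)] prod_eq_iff)
  then have "wc C r \<tau> = \<one>\<^bsub>YP.PA\<^esub>" by (rule T_word_degree_0[OF \<tau>(1)])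
  then have "wc C r a = wc C r b" using \<tau>(2) by (simp add: wc_append)
  then show ?thesis unfolding wc_def ab by (subst YP.cls_eq_iff[symmetric]) simp_all
qed

text \<open>Modulo the relations each word may be replaced by a fixed representative of its value
  under \<open>wd\<close>. The result depends only on \<open>push wd x\<close>, which vanishes when
  \<open>hY x\<close> does.\<close>

lemma hY_kernel: "a_kernel YP.FA (Yt C r q) hY = YP.RI"
proof
  show "YP.RI \<subseteq> a_kernel YP.FA (Yt C r q) hY" by (rule subsetI) (rule hY_kernel_iff[THEN iffD2, OF RI_hY])
  show "a_kernel YP.FA (Yt C r q) hY \<subseteq> YP.RI"
  proof
    fix x assume "x \<in> a_kernel YP.FA (Yt C r q) hY"
    then have "hY x = \<zero>\<^bsub>Yt C r q\<^esub>" by (rule hY_kernel_iff[THEN iffD1])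
    then have 0: "push wd x = 0" by (rule hY_eq_0_wd)
    define \<rho> where "\<rho> = (\<lambda>d. SOME w. wd w = d)"
    have \<rho>: "wd (\<rho> (wd w)) = wd w" for w unfolding \<rho>_def by (rule someI[of _ w]) simp
    have "x - push (\<rho> \<circ> wd) x \<in> YP.RI" using subset_UNIV
    proof (induction x rule: frag_induction)
      case zero then show ?case using YP.RI.zero_closed by (simp add: free_algebra_simps)
    next
      case (one w) 
      show ?case using same_wd[OF \<rho>[of w, symmetric]] by simp
    next
      case (diff a b)
      have "a - b - push (\<rho> \<circ> wd) (a - b) = (a - push (\<rho> \<circ> wd) a) + (- 1) * (b - push (\<rho> \<circ> wd) b)"
        by (simp add: frag_extend_diff)
      then show ?case using YP.RI_add[OF diff(1) YP.RI_mult(1)[OF diff(2) FA_UNIV[of "- 1"]]] by (simp only:)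
    qed
    then show "x \<in> YP.RI" unfolding push_push[symmetric] 0 by simp
  qed
qed

text \<open>Some word has the required exponent, and a power of t in front of it corrects the
  constant term.\<close>

lemma hY_surj: "hY ` carrier YP.FA = carrier (Yt C r q)"
proof
  show "hY ` carrier YP.FA \<subseteq> carrier (Yt C r q)" by auto
  show "carrier (Yt C r q) \<subseteq> hY ` carrier YP.FA"
  proof
    fix X assume "X \<in> carrier (Yt C r q)"
    then obtain x where x: "x \<in> carrier (Yu C r q)" "X = Yt_class C r q x"
      unfolding Yt_def FactRing_def A_RCOSETS_def' Yt_class_def by auto
    then obtain n where n: "x = Lc n" "Poly_Mapping.keys n \<subseteq> GU" by (auto simp: Yu_simps GZ_def)
    from n(2) have "n \<in> GZ \<and> (\<exists>y. Yt_class C r q (Lc n) = hY y)"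
    proof (induction n rule: frag_induction)
      case zero
      have "hY 0 = Yt_class C r q (Lc 0)" by (simp add: hY_def hh_def)
      then show ?case using GZ_0 by metis
    next
      case (one g)
      obtain w where w: "ex w = snd g" using exists_word_with_exponent by blast
      \<comment> \<open>By \<open>wd_T\<close> a word in t of degree \<open>d\<close> lowers the
        first component by \<open>d\<close>.\<close>
      define d where "d = fst (wd (Word w)) - fst (dg g)"
      define \<tau> :: "'a yt_letter list" where "\<tau> = (if d \<ge> 0 then replicate (nat d) LT else replicate (nat (- d)) LTinv)"
      have deg: "tdeg (replicate n LT) = int n" "tdeg (replicate n LTinv) = - int n" for n :: nat by (induction n) auto
      have \<tau>: "T_word \<tau>" "tdeg \<tau> = d" by (auto simp: \<tau>_def T_word_def deg)
      have "dg (gw (\<tau> @ w)) = dg g"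
        using wd_T[OF \<tau>(1), of w] by (simp add: \<tau>(2) d_def wd_def w dg_def snd_gw)
      then have "Yt_class C r q (Mon g) = hY (Poly_Mapping.single (Word (\<tau> @ w)) 1)"
        unfolding hY_word using one by (intro Yt_class_Mon_eq) simp_all
      then show ?case using one GZ_frag_of by (auto simp: Lc_simps)
    next
      case (diff a b)
      then obtain y z where yz: "Yt_class C r q (Lc a) = hY y" "Yt_class C r q (Lc b) = hY z" and GZ: "a \<in> GZ" "b \<in> GZ" by blast
      have "Yt_class C r q (Lc (a - b)) = Yt_class C r q (Lc a \<ominus>\<^bsub>Yu C r q\<^esub> Lc b)"
        by (simp only: Yu_diff GZ)
      also have "\<dots> = Yt_class C r q (Lc a) \<ominus>\<^bsub>Yt C r q\<^esub> Yt_class C r q (Lc b)"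
        using GZ by (simp add: Yu.minus_eq Ytc.S.minus_eq)
      also have "\<dots> = hY (y - z)" by (simp only: yz hY_diff)
      finally show ?case using GZ_diff[OF GZ] by blast
    qed
    then show "X \<in> hY ` carrier YP.FA" using x n by auto
  qed
qed

theorem Yt_presentation:
  "\<exists>\<phi> \<in> ring_iso (Yt_presented C r) (Yt C r q).
     (\<forall>i l. \<phi> (Yt_presented_gen C r (LY i l)) = Yt_class C r q (Y_tilde C r q i l)) \<and>
     (\<forall>i l. \<phi> (Yt_presented_gen C r (LYinv i l)) = Yt_class C r q (inv\<^bsub>Hh\<^esub> Y_tilde C r q i l)) \<and>
     \<phi> (Yt_presented_gen C r LT) = inv\<^bsub>Yt C r q\<^esub> Yt_class C r q (t_elem C r q 1) \<and>
     \<phi> (Yt_presented_gen C r LTinv) = Yt_class C r q (t_elem C r q 1)"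
proof -
  define \<phi> where "\<phi> = (\<lambda>X. the_elem (hY ` X))"
  have iso: "\<phi> \<in> ring_iso (Yt_presented C r) (Yt C r q)"
    using hY.FactRing_iso_set[OF hY_surj] unfolding hY_kernel \<phi>_def Yt_presented_def presented_algebra_def .
  have val: "\<phi> (Yt_presented_gen C r g) = Yt_class C r q (Mon (gmul (lg g) (0, 0)))" for g
  proof -
    have "\<phi> (Yt_presented_gen C r g) = hY (letter g)"
      unfolding \<phi>_def Yt_presented_gen_def presented_class_def hY_kernel[symmetric] by (rule hY.the_elem_simp) simp
    then show ?thesis unfolding letter_def hY_word by simp
  qed
  have t: "Mon (1, 0) \<in> carrier (Yu C r q)" "Mon (-1, 0) \<in> carrier (Yu C r q)" by (simp_all add: GU_def UU_minus)
  have tt: "Mon (1, 0) \<otimes>\<^bsub>Yu C r q\<^esub> Mon (-1, 0) = \<one>\<^bsub>Yu C r q\<^esub>" "Mon (-1, 0) \<otimes>\<^bsub>Yu C r q\<^esub> Mon (1, 0) = \<one>\<^bsub>Yu C r q\<^esub>"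
    unfolding Yu_simps by (subst Mon_mult; simp add: GU_def UU_minus Mon_one)+
  have "inv\<^bsub>Yt C r q\<^esub> Yt_class C r q (Mon (1, 0)) = Yt_class C r q (Mon (-1, 0))"
    using t by (intro Ytc.S.inv_char) (simp_all only: Ytc.hom_mult[symmetric] tt Ytc.hom_one Ytc.hom_closed)
  then have T: "\<phi> (Yt_presented_gen C r LT) = inv\<^bsub>Yt C r q\<^esub> Yt_class C r q (t_elem C r q 1)"
    unfolding val t_elem_Mon by simp
  have Y: "\<phi> (Yt_presented_gen C r (LY i l)) = Yt_class C r q (Y_tilde C r q i l)" for i l
    unfolding val Y_tilde_Mon by simp
  have Yinv: "\<phi> (Yt_presented_gen C r (LYinv i l)) = Yt_class C r q (inv\<^bsub>Hh\<^esub> Y_tilde C r q i l)" for i l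
  proof -
    have "inv\<^bsub>Hh\<^esub> Y_tilde C r q i l = Mon (gmul (lg (LYinv i l)) (0, 0))"
      unfolding Y_tilde_Mon by (subst inv_Mon) (simp_all add: GU_def ginv_def)
    then show ?thesis unfolding val by simp
  qed
  show ?thesis using iso T Y Yinv by (intro bexI[of _ \<phi>] conjI allI) (simp_all add: val t_elem_Mon)
qed

end

theorem theorem3p11:
  fixes C :: "int ^ 'n ^ 'n" and r :: "'n \<Rightarrow> nat" and q :: complex
  assumes "finite_type_cartan C"
    and "cartan_symmetrizer C r"
    and "q \<noteq> 0"
    and "\<And>N. N > 0 \<Longrightarrow> q ^ N \<noteq> 1"
  shows "\<exists>\<phi> \<in> ring_iso (Yt_presented C r) (Yt C r q).
     (\<forall>i l. \<phi> (Yt_presented_gen C r (LY i l)) = Yt_class C r q (Y_tilde C r q i l)) \<and>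
     (\<forall>i l. \<phi> (Yt_presented_gen C r (LYinv i l)) =
        Yt_class C r q (inv\<^bsub>Heis_h C r q\<^esub> Y_tilde C r q i l)) \<and>
     \<phi> (Yt_presented_gen C r LT) = inv\<^bsub>Yt C r q\<^esub> Yt_class C r q (t_elem C r q 1) \<and>
     \<phi> (Yt_presented_gen C r LTinv) = Yt_class C r q (t_elem C r q 1)"
proof -
  interpret cartan_q C r q by unfold_locales (use assms in auto)
  show ?thesis by (rule Yt_presentation)
qed

end
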